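(* Let $\mathbb{G}$ be a Carnot group of homogeneous dimension $Q\ge3$ and let $\Omega\subset\mathbb{G}$ be an open set. Let $u\in C(\Omega)$ be such that $|\nabla_{\mathbb{G}}u|^2\in L^1_{\mathrm{loc}}(\Omega)$. For $x_0\in\Omega$ and $r>0$ with $\overline{D(x_0,r)}\subset\Omega$ put $$J^{\mathbb{G}}_{u,x_0}(r):=\frac1{r^4}\int_{D(x_0,r)}|\nabla_{\mathbb{G}}u^+(\xi)|^2\,\Gamma(x_0,\xi)\,d\xi\;\int_{D(x_0,r)}|\nabla_{\mathbb{G}}u^-(\xi)|^2\,\Gamma(x_0,\xi)\,d\xi .$$ (1) For every $x_0\in\partial\{u>0\}\cap\Omega$ and every $r>0$ with $\overline{D(x_0,r)}\subset\Omega$, $$J^{\mathbb{G}}_{u,x_0}(r)=\frac1{Q-2}\int_0^1t\,\mathcal{M}_{tr}\left(\left(\frac{|\nabla_{\mathbb{G}}u^+(x_0\circ\xi)|}{|\nabla_{\mathbb{G}}|\xi||}\right)^2\right)(0)\,dt\;\cdot\;\frac1{Q-2}\int_0^1t\,\mathcal{M}_{tr}\left(\left(\frac{|\nabla_{\mathbb{G}}u^-(x_0\circ\xi)|}{|\nabla_{\mathbb{G}}|\xi||}\right)^2\right)(0)\,dt .$$ Consequently, if both functions $$t\mapsto\mathcal{M}_t\left(\left(\frac{|\nabla_{\mathbb{G}}u^{\pm}(x_0\circ\xi)|}{|\nabla_{\mathbb{G}}|\xi||}\right)^2\right)(0)$$ are monotone increasing almost everywhere, then $J^{\mathbb{G}}_{u,x_0}$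 is monotone increasing in a right neighborhood of $0$. (2) For every $x_0\in\Omega$ and every $r>0$ with $\overline{D(x_0,r)}\subset\Omega$, $$\frac1{r^2}\int_{D(x_0,r)}|\nabla_{\mathbb{G}}u(\xi)|^2\,\Gamma(x_0,\xi)\,d\xi=\frac1{Q-2}\int_0^1t\,\mathcal{M}_{tr}\left(\left(\frac{|\nabla_{\mathbb{G}}u(x_0\circ\xi)|}{|\nabla_{\mathbb{G}}|\xi||}\right)^2\right)(0)\,dt .$$ Thus, if $$t\mapsto\mathcal{M}_t\left(\left(\frac{|\nabla_{\mathbb{G}}u(x_0\circ\xi)|}{|\nabla_{\mathbb{G}}|\xi||}\right)^2\right)(0)$$ is monotone increasing almost everywhere, then $$r\mapsto\frac1{r^2}\int_{D(x_0,r)}|\nabla_{\mathbb{G}}u(\xi)|^2\,\Gamma(x_0,\xi)\,d\xi$$ is monotone increasing in a right neighborhood of $0$.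
   Context: Carnot group: $(\mathbb{G},\circ)$ is a simply connected nilpotent Lie group whose Lie algebra $\mathfrak{g}$ is stratified, $\mathfrak{g}=V_1\oplus\dots\oplus V_\kappa$, $[V_1,V_i]=V_{i+1}$, $V_\kappa\ne\{0\}$, $V_i=\{0\}$ for $i>\kappa$. Via exponential coordinates $\mathbb{G}$ is identified with $\mathbb{R}^N$, $N=\dim\mathfrak{g}$, with unit element $0$, using a basis adapted to the stratification; the dilations are $\delta_\lambda(x_1,\dots,x_N)=(\lambda^{d_1}x_1,\dots,\lambda^{d_N}x_N)$, $\lambda>0$, with $d_j=i$ if the $j$-th basis vector lies in $V_i$. The homogeneous dimension is $Q=\sum_{i=1}^\kappa i\dim V_i$. Haar measure is Lebesgue measure $d\xi$ on $\mathbb{R}^N$. Horizontal gradient and sub-Laplacian: $X_1,\dots,X_m$ ($m=\dim V_1$) is the basis of left-invariant vector fields of $V_1$ with $X_i(0)=e_i$; $\nabla_{\mathbb{G}}f=(X_1f,\dots,X_mf)$ (understood in the weak sense when $f$ is not smooth), $|\nabla_{\mathbb{G}}f|^2=\sum_{j=1}^m(X_jf)^2$, and $\Delta_{\mathbb{G}}=\sum_{j=1}^mX_j^2$. The symbol $\nabla$ denotes the Euclidean gradient in $\mathbb{R}^N$. Fundamental solution and norm: $\Gamma$ is the fundamental solution of $\Delta_{\mathbb{G}}$, i.e. $\int_{\mathbb{R}^N}\Gamma(x,y)\,\Delta_{\mathbb{G}}\varphi(x)\,dx=-\varphi(y)$ for all $\varphi\in C_0^\infty(\mathbb{R}^N)$.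 For $Q\ge 3$ there are a homogeneous norm $|\cdot|$ on $\mathbb{G}$ (homogeneous of degree $1$ with respect to $\delta_\lambda$, smooth away from $0$) and a constant $c_Q>0$ such that $\Gamma(x,y)=c_Q|x^{-1}\circ y|^{2-Q}$; this $|\cdot|$ is the norm used throughout. Write $\Gamma(\xi)=\Gamma(0,\xi)$ and $D(x_0,r)=\{y\in\mathbb{G}:|x_0^{-1}\circ y|<r\}$. Mean value: $$\mathcal{M}_r(w)(x_0):=\int_{\partial D(x_0,r)}w(y)\,\mathcal{K}(x_0^{-1}\circ y)\,d\sigma(y),\qquad \mathcal{K}:=\frac{|\nabla_{\mathbb{G}}\Gamma|^2}{|\nabla\Gamma|},$$ where $\sigma$ is the Euclidean $(N-1)$-dimensional Hausdorff measure. For functions $w$ that are not continuous the same formula is used, and it is understood for almost every $r$. In expressions such as $\mathcal{M}_{t}(w(\xi))(0)$ the variable $\xi$ is the integration variable on $\partial D(0,t)$. Other notation: $u^+=\max\{u,0\}$, $u^-=\max\{-u,0\}$, $\{u>0\}=\{x\in\Omega:u(x)>0\}$. A right neighborhood of $0$ is an interval $(0,\delta)$ with $\delta>0$. "Monotone increasing" means nondecreasing; "monotone increasing almost everywhere" means that, in a right neighborhood $(0,\delta)$ of $0$, the inequality $F(t_1)\le F(t_2)$ holds for $t_1\le t_2$ outside a null set. All integrands are nonnegative, so the integrals are taken with values in $[0,+\infty]$. *)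

theory Defs
  imports "HOL-Analysis.Analysis"
begin

primrec Ck_on :: "nat \<Rightarrow> 'a::real_normed_vector set \<Rightarrow> ('a \<Rightarrow> 'b::real_normed_vector) \<Rightarrow> bool" where
  "Ck_on 0 S f \<longleftrightarrow> continuous_on S f"
| "Ck_on (Suc k) S f \<longleftrightarrow>
     (\<forall>x\<in>S. f differentiable (at x)) \<and> (\<forall>v. Ck_on k S (\<lambda>x. frechet_derivative f (at x) v))"

text \<open>Only used for open \<^term>\<open>S\<close>.\<close>
definition smooth_on :: "'a::real_normed_vector set \<Rightarrow> ('a \<Rightarrow> 'b::real_normed_vector) \<Rightarrow> bool" where
  "smooth_on S f \<longleftrightarrow> (\<forall>k. Ck_on k S f)"

definition test_function :: "'a::euclidean_space set \<Rightarrow> ('a \<Rightarrow> real) \<Rightarrow> bool" where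
  "test_function \<Omega> \<phi> \<longleftrightarrow>
     smooth_on UNIV \<phi> \<and> (\<exists>K. compact K \<and> K \<subseteq> \<Omega> \<and> (\<forall>x. x \<notin> K \<longrightarrow> \<phi> x = 0))"

definition locally_L1 :: "'a::euclidean_space set \<Rightarrow> ('a \<Rightarrow> 'b::euclidean_space) \<Rightarrow> bool" where
  "locally_L1 \<Omega> f \<longleftrightarrow> (\<forall>K. compact K \<and> K \<subseteq> \<Omega> \<longrightarrow> f absolutely_integrable_on K)"

definition egrad :: "(real^'n \<Rightarrow> real) \<Rightarrow> real^'n \<Rightarrow> real^'n" where
  "egrad f x = (\<chi> j. frechet_derivative f (at x) (axis j 1))"

text \<open>
  Normalised so that on an \<open>s\<close>-dimensional Euclidean space it is Lebesgue measure.  It is meant for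
  \<open>s > 0\<close> (in HOL, \<open>0 powr 0 = 0\<close>).  The boundedness requirement is needed because the library's
  \<^const>\<open>diameter\<close> is a real number and is meaningless on unbounded sets.
\<close>
definition hausdorff_premeasure :: "real \<Rightarrow> real \<Rightarrow> 'a::metric_space set \<Rightarrow> ennreal" where
  "hausdorff_premeasure s \<delta> A =
     (INF C \<in> {C :: nat \<Rightarrow> 'a set. A \<subseteq> (\<Union>i. C i) \<and> (\<forall>i. bounded (C i) \<and> diameter (C i) \<le> \<delta>)}.
        \<Sum>i. ennreal (unit_ball_vol s * (diameter (C i) / 2) powr s))"

definition hausdorff_outer :: "real \<Rightarrow> 'a::metric_space set \<Rightarrow> ennreal" where
  "hausdorff_outer s A = (SUP \<delta>\<in>{0<..}. hausdorff_premeasure s \<delta> A)"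

text \<open>The \<sigma>-algebra consists of the Caratheodory-measurable sets of the outer measure.\<close>
definition hausdorff_measure :: "real \<Rightarrow> 'a::metric_space measure" where
  "hausdorff_measure s =
     measure_of UNIV (lambda_system UNIV UNIV (hausdorff_outer s)) (hausdorff_outer s)"

text \<open>
  The group law is an operation \<open>gop\<close> on \<^typ>\<open>real^'n\<close>, and the Lie algebra is identified with the
  tangent space \<^typ>\<open>real^'n\<close> at the unit \<open>0\<close> through \<open>X \<mapsto> X(0)\<close>.  The map
  \<open>deg :: 'n \<Rightarrow> nat\<close> gives the layer \<open>d\<^sub>j\<close> to which the \<open>j\<close>-th basis vector belongs.
\<close>

definition left_inv_field ::
  "(real^'n \<Rightarrow> real^'n \<Rightarrow> real^'n) \<Rightarrow> real^'n \<Rightarrow> real^'n \<Rightarrow> real^'n" where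
  "left_inv_field gop a x = frechet_derivative (gop x) (at 0) a"

text \<open>Commutator of vector fields, in coordinates: \<open>[X,Y] f = X (Y f) - Y (X f)\<close>.\<close>
definition vf_bracket ::
  "(real^'n \<Rightarrow> real^'n) \<Rightarrow> (real^'n \<Rightarrow> real^'n) \<Rightarrow> real^'n \<Rightarrow> real^'n" where
  "vf_bracket X Y x = frechet_derivative Y (at x) (X x) - frechet_derivative X (at x) (Y x)"

definition lie_bracket ::
  "(real^'n \<Rightarrow> real^'n \<Rightarrow> real^'n) \<Rightarrow> real^'n \<Rightarrow> real^'n \<Rightarrow> real^'n" where
  "lie_bracket gop a b = vf_bracket (left_inv_field gop a) (left_inv_field gop b) 0"

definition layer :: "('n::finite \<Rightarrow> nat) \<Rightarrow> nat \<Rightarrow> (real^'n) set" where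
  "layer deg i = span {axis j 1 | j. deg j = i}"

text \<open>
  With the group axioms, the assumption \<open>exp_coords\<close> makes \<open>t \<mapsto> t a\<close> the one-parameter subgroup
  with initial velocity \<open>a\<close>, so the exponential map is the identity; in particular the inverse of
  \<open>x\<close> is \<open>- x\<close>.  Simple connectedness is built into the carrier.  The layers are in direct
  sum by construction, the step is \<open>\<kappa> = Max (range deg)\<close>, and nilpotency follows from \<open>stratified\<close>
  because \<^term>\<open>layer deg i = {0}\<close> for \<open>i > \<kappa>\<close>.
\<close>
locale carnot_group =
  fixes gop :: "real^'n \<Rightarrow> real^'n \<Rightarrow> real^'n" and deg :: "'n \<Rightarrow> nat"
  assumes assoc: "gop (gop x y) z = gop x (gop y z)"
    and left_unit: "gop 0 x = x"
    and right_unit: "gop x 0 = x"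
    and smooth: "smooth_on UNIV (\<lambda>p. gop (fst p) (snd p))"
    and exp_coords: "gop (s *\<^sub>R a) (t *\<^sub>R a) = (s + t) *\<^sub>R a"
    and deg_pos: "deg j \<ge> 1"
    and stratified: "i \<ge> 1 \<Longrightarrow>
      span {lie_bracket gop a b | a b. a \<in> layer deg 1 \<and> b \<in> layer deg i} = layer deg (Suc i)"

definition ginv :: "(real^'n \<Rightarrow> real^'n \<Rightarrow> real^'n) \<Rightarrow> real^'n \<Rightarrow> real^'n" where
  "ginv gop x = (THE y. gop x y = 0 \<and> gop y x = 0)"

definition dilation :: "('n \<Rightarrow> nat) \<Rightarrow> real \<Rightarrow> real^'n \<Rightarrow> real^'n" where
  "dilation deg s x = (\<chi> j. s ^ deg j * x $ j)"

definition hom_dim :: "('n::finite \<Rightarrow> nat) \<Rightarrow> nat" where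
  "hom_dim deg = (\<Sum>i=1..Max (range deg). i * dim (layer deg i))"

definition hderiv ::
  "(real^'n \<Rightarrow> real^'n \<Rightarrow> real^'n) \<Rightarrow> 'n \<Rightarrow> (real^'n \<Rightarrow> real) \<Rightarrow> real^'n \<Rightarrow> real" where
  "hderiv gop j f x = frechet_derivative f (at x) (left_inv_field gop (axis j 1) x)"

text \<open>
  \<open>\<real>\<^sup>m\<close> is embedded in \<open>\<real>\<^sup>N\<close> as the coordinates of degree 1: the horizontal gradient has entry
  \<open>X\<^sub>j f\<close> at \<open>j\<close> if \<open>deg j = 1\<close>, and 0 otherwise.
\<close>
definition hgrad ::
  "(real^'n \<Rightarrow> real^'n \<Rightarrow> real^'n) \<Rightarrow> ('n \<Rightarrow> nat) \<Rightarrow> (real^'n \<Rightarrow> real) \<Rightarrow> real^'n \<Rightarrow> real^'n" where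
  "hgrad gop deg f x = (\<chi> j. if deg j = 1 then hderiv gop j f x else 0)"

definition sub_laplacian ::
  "(real^'n \<Rightarrow> real^'n \<Rightarrow> real^'n) \<Rightarrow> ('n \<Rightarrow> nat) \<Rightarrow> (real^'n \<Rightarrow> real) \<Rightarrow> real^'n \<Rightarrow> real" where
  "sub_laplacian gop deg f x = (\<Sum>j | deg j = 1. hderiv gop j (hderiv gop j f) x)"

text \<open>
  The formal adjoint of \<open>X\<^sub>j\<close> is \<open>- X\<^sub>j\<close>, since Lebesgue measure is invariant under the flow of
  \<open>X\<^sub>j\<close> (a one-parameter group of right translations).
\<close>
definition is_weak_hgrad ::
  "(real^'n \<Rightarrow> real^'n \<Rightarrow> real^'n) \<Rightarrow> ('n \<Rightarrow> nat) \<Rightarrow> (real^'n) set \<Rightarrow>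
   (real^'n \<Rightarrow> real) \<Rightarrow> (real^'n \<Rightarrow> real^'n) \<Rightarrow> bool" where
  "is_weak_hgrad gop deg \<Omega> f g \<longleftrightarrow>
     locally_L1 \<Omega> f \<and> locally_L1 \<Omega> g \<and>
     (\<forall>j x. deg j \<noteq> 1 \<longrightarrow> g x $ j = 0) \<and>
     (\<forall>j \<phi>. deg j = 1 \<longrightarrow> test_function \<Omega> \<phi> \<longrightarrow>
        (LINT x:\<Omega>|lebesgue. f x * hderiv gop j \<phi> x) = - (LINT x:\<Omega>|lebesgue. g x $ j * \<phi> x))"

text \<open>A version of the weak horizontal gradient; versions agree almost everywhere in \<open>\<Omega>\<close>.\<close>
definition weak_hgrad ::
  "(real^'n \<Rightarrow> real^'n \<Rightarrow> real^'n) \<Rightarrow> ('n \<Rightarrow> nat) \<Rightarrow> (real^'n) set \<Rightarrow>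
   (real^'n \<Rightarrow> real) \<Rightarrow> real^'n \<Rightarrow> real^'n" where
  "weak_hgrad gop deg \<Omega> f = (SOME g. is_weak_hgrad gop deg \<Omega> f g)"

definition fundamental_solution ::
  "(real^'n \<Rightarrow> real^'n \<Rightarrow> real^'n) \<Rightarrow> ('n \<Rightarrow> nat) \<Rightarrow> (real^'n \<Rightarrow> real^'n \<Rightarrow> real) \<Rightarrow> bool" where
  "fundamental_solution gop deg \<Gamma> \<longleftrightarrow>
     (\<forall>\<phi> y. test_function UNIV \<phi> \<longrightarrow>
        has_bochner_integral lebesgue (\<lambda>x. \<Gamma> x y * sub_laplacian gop deg \<phi> x) (- \<phi> y))"

definition homogeneous_norm :: "('n \<Rightarrow> nat) \<Rightarrow> (real^'n \<Rightarrow> real) \<Rightarrow> bool" where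
  "homogeneous_norm deg \<rho> \<longleftrightarrow>
     continuous_on UNIV \<rho> \<and> smooth_on (- {0}) \<rho> \<and>
     \<rho> 0 = 0 \<and> (\<forall>x. x \<noteq> 0 \<longrightarrow> \<rho> x > 0) \<and>
     (\<forall>s x. s > 0 \<longrightarrow> \<rho> (dilation deg s x) = s * \<rho> x)"

definition gauge_ball ::
  "(real^'n \<Rightarrow> real^'n \<Rightarrow> real^'n) \<Rightarrow> (real^'n \<Rightarrow> real) \<Rightarrow> real^'n \<Rightarrow> real \<Rightarrow> (real^'n) set" where
  "gauge_ball gop \<rho> x\<^sub>0 r = {y. \<rho> (gop (ginv gop x\<^sub>0) y) < r}"

definition mean_kernel ::
  "(real^'n \<Rightarrow> real^'n \<Rightarrow> real^'n) \<Rightarrow> ('n \<Rightarrow> nat) \<Rightarrow> (real^'n \<Rightarrow> real^'n \<Rightarrow> real) \<Rightarrow>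
   real^'n \<Rightarrow> real" where
  "mean_kernel gop deg \<Gamma> \<xi> = (norm (hgrad gop deg (\<Gamma> 0) \<xi>))\<^sup>2 / norm (egrad (\<Gamma> 0) \<xi>)"

definition mean_value ::
  "(real^'n \<Rightarrow> real^'n \<Rightarrow> real^'n) \<Rightarrow> ('n \<Rightarrow> nat) \<Rightarrow> (real^'n \<Rightarrow> real) \<Rightarrow>
   (real^'n \<Rightarrow> real^'n \<Rightarrow> real) \<Rightarrow> real \<Rightarrow> (real^'n \<Rightarrow> ennreal) \<Rightarrow> real^'n \<Rightarrow> ennreal" where
  "mean_value gop deg \<rho> \<Gamma> r w x\<^sub>0 =
     (\<integral>\<^sup>+y\<in>frontier (gauge_ball gop \<rho> x\<^sub>0 r).
        (w y * ennreal (mean_kernel gop deg \<Gamma> (gop (ginv gop x\<^sub>0) y)))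
      \<partial>hausdorff_measure (real CARD('n) - 1))"

definition energy ::
  "(real^'n \<Rightarrow> real^'n \<Rightarrow> real^'n) \<Rightarrow> ('n \<Rightarrow> nat) \<Rightarrow> (real^'n \<Rightarrow> real) \<Rightarrow>
   (real^'n \<Rightarrow> real^'n \<Rightarrow> real) \<Rightarrow> (real^'n) set \<Rightarrow> (real^'n \<Rightarrow> real) \<Rightarrow> real^'n \<Rightarrow> real \<Rightarrow> ennreal" where
  "energy gop deg \<rho> \<Gamma> \<Omega> w x\<^sub>0 r =
     (\<integral>\<^sup>+\<xi>\<in>gauge_ball gop \<rho> x\<^sub>0 r.
        ennreal ((norm (weak_hgrad gop deg \<Omega> w \<xi>))\<^sup>2 * \<Gamma> x\<^sub>0 \<xi>) \<partial>lebesgue)"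

definition acf_functional ::
  "(real^'n \<Rightarrow> real^'n \<Rightarrow> real^'n) \<Rightarrow> ('n \<Rightarrow> nat) \<Rightarrow> (real^'n \<Rightarrow> real) \<Rightarrow>
   (real^'n \<Rightarrow> real^'n \<Rightarrow> real) \<Rightarrow> (real^'n) set \<Rightarrow> (real^'n \<Rightarrow> real) \<Rightarrow> real^'n \<Rightarrow> real \<Rightarrow> ennreal" where
  "acf_functional gop deg \<rho> \<Gamma> \<Omega> u x\<^sub>0 r =
     ennreal (1 / r ^ 4) *
     energy gop deg \<rho> \<Gamma> \<Omega> (\<lambda>x. max (u x) 0) x\<^sub>0 r *
     energy gop deg \<rho> \<Gamma> \<Omega> (\<lambda>x. max (- u x) 0) x\<^sub>0 r"

text \<open>
  \<open>\<M>\<^sub>t((|\<nabla>\<^sub>G w(x\<^sub>0 \<circ> \<xi>)| / |\<nabla>\<^sub>G|\<xi>||)\<^sup>2)(0)\<close>.  Where \<open>\<nabla>\<^sub>G|\<xi>| = 0\<close> the mean value kernel vanishes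
  too, so the HOL convention \<open>a / 0 = 0\<close> contributes nothing.
\<close>
definition gradient_mean ::
  "(real^'n \<Rightarrow> real^'n \<Rightarrow> real^'n) \<Rightarrow> ('n \<Rightarrow> nat) \<Rightarrow> (real^'n \<Rightarrow> real) \<Rightarrow>
   (real^'n \<Rightarrow> real^'n \<Rightarrow> real) \<Rightarrow> (real^'n) set \<Rightarrow> (real^'n \<Rightarrow> real) \<Rightarrow> real^'n \<Rightarrow> real \<Rightarrow> ennreal" where
  "gradient_mean gop deg \<rho> \<Gamma> \<Omega> w x\<^sub>0 t =
     mean_value gop deg \<rho> \<Gamma> t
       (\<lambda>\<xi>. ennreal ((norm (weak_hgrad gop deg \<Omega> w (gop x\<^sub>0 \<xi>)) / norm (hgrad gop deg \<rho> \<xi>))\<^sup>2)) 0"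

definition increasing_near_0 :: "(real \<Rightarrow> ennreal) \<Rightarrow> bool" where
  "increasing_near_0 F \<longleftrightarrow> (\<exists>\<delta>>0. mono_on {0<..<\<delta>} F)"

definition ae_increasing_near_0 :: "(real \<Rightarrow> ennreal) \<Rightarrow> bool" where
  "ae_increasing_near_0 F \<longleftrightarrow> (\<exists>\<delta>>0. \<exists>Z\<in>null_sets lebesgue. mono_on ({0<..<\<delta>} - Z) F)"

end

theory Submission
  imports Defs
begin

text \<open>
  Write \<open>|\<cdot>|\<close> for the gauge \<open>\<rho>\<close> and \<open>Q\<close> for the homogeneous dimension.  After the left translation
  that moves the centre to the unit element, the weighted energy is the integral of
  \<open>|\<nabla>\<^sub>G w|\<^sup>2 c |\<xi>|\<^bsup>2-Q\<^esup>\<close> over \<open>{|\<xi>| < r}\<close>.  The coarea formula for the gauge turns it into the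
  integral over \<open>0 < s < r\<close> of the surface integrals of \<open>|\<nabla>\<^sub>G w|\<^sup>2 c s\<^bsup>2-Q\<^esup> / |\<nabla>\<rho>|\<close> over the spheres
  \<open>{|\<xi>| = s}\<close>.  Since \<open>\<Gamma> = c \<rho>\<^bsup>2-Q\<^esup>\<close>, the mean value kernel is \<open>c (Q-2) s\<^bsup>1-Q\<^esup> |\<nabla>\<^sub>G \<rho>|\<^sup>2 / |\<nabla>\<rho>|\<close>
  there, so the surface integral is \<open>s / (Q-2)\<close> times the mean value of \<open>(|\<nabla>\<^sub>G w| / |\<nabla>\<^sub>G \<rho>|)\<^sup>2\<close>; the
  factors \<open>|\<nabla>\<^sub>G \<rho>|\<^sup>2\<close> cancel because they vanish on a null set only.  The substitution \<open>s = t r\<close> gives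
  the identity, and its right-hand side makes the monotonicity obvious: for fixed \<open>t\<close> the mean value at
  radius \<open>t r\<close> increases with \<open>r\<close>.

  Four ingredients carry this argument.

  \<^item> The coarea formula \<open>smooth_submersion.coarea\<close> for the Hausdorff measure.  For linear functions it
    says that the \<open>(N-1)\<close>-dimensional Hausdorff measure of a hyperplane is Lebesgue measure with the right
    constant, which is the isodiametric inequality, proved by Steiner symmetrization.  A function
    with nonvanishing continuous gradient is locally linear after a change of variables that is almost an
    isometry, so that the formula holds up to factors arbitrarily close to one.

  \<^item> The invariance of Lebesgue measure under translations of the group (\<open>distr_left\<close>, \<open>distr_right\<close>):
    by the stratification, a left translation adds to each coordinate a function of the coordinates of
    lower degree, and such a map is a composition of shears.

  \<^item> The set \<open>{\<nabla>\<^sub>G \<rho> = 0}\<close> is a null set (\<open>AE_hgrad_nonzero\<close>): the derivatives of a function vanish almost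
    everywhere on its zero set; applied repeatedly, this gives \<open>X\<^sub>a \<rho> = 0\<close> there for all brackets
    \<open>a\<close> of horizontal vectors, hence for all \<open>a\<close>, which Euler's identity for homogeneous functions excludes.

  \<^item> The positive and negative parts of \<open>u\<close> possess weak horizontal gradients
    (\<open>is_weak_hgrad_positive_part\<close>).  Otherwise the choice made by \<^const>\<open>weak_hgrad\<close> would be
    arbitrary and the identity could fail for want of measurability.  The proof is a chain rule for
    mollifications by group convolution.
\<close>

section \<open>Hausdorff measure on Borel sets\<close>

lemma hausdorff_premeasure_le:
  assumes "A \<subseteq> (\<Union>i. C i)" "\<And>i. bounded (C i)" "\<And>i. diameter (C i) \<le> \<delta>"
  shows "hausdorff_premeasure s \<delta> A \<le> (\<Sum>i. ennreal (unit_ball_vol s * (diameter (C i) / 2) powr s))"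
  unfolding hausdorff_premeasure_def by (rule INF_lower) (use assms in auto)

lemma hausdorff_premeasure_mono: "A \<subseteq> B \<Longrightarrow> hausdorff_premeasure s \<delta> A \<le> hausdorff_premeasure s \<delta> B"
  unfolding hausdorff_premeasure_def by (rule INF_superset_mono) auto

lemma hausdorff_premeasure_antimono:
  "\<delta> \<le> \<delta>' \<Longrightarrow> hausdorff_premeasure s \<delta>' A \<le> hausdorff_premeasure s \<delta> A"
  unfolding hausdorff_premeasure_def by (rule INF_superset_mono) (auto intro: order_trans)

lemma hausdorff_premeasure_empty: "\<delta> > 0 \<Longrightarrow> hausdorff_premeasure s \<delta> {} = 0"
  using hausdorff_premeasure_le[of "{}" "\<lambda>_. {}" \<delta> s] by simp

lemma hausdorff_premeasure_cover:
  fixes A :: "'a::metric_space set"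
  assumes "hausdorff_premeasure s \<delta> A < x"
  obtains C :: "nat \<Rightarrow> 'a::metric_space set"
    where "A \<subseteq> (\<Union>i. C i)" "\<And>i. bounded (C i)" "\<And>i. diameter (C i) \<le> \<delta>"
      "(\<Sum>i. ennreal (unit_ball_vol s * (diameter (C i) / 2) powr s)) < x"
  using assms unfolding hausdorff_premeasure_def INF_less_iff by auto

lemma hausdorff_premeasure_Union:
  fixes A :: "nat \<Rightarrow> 'a::metric_space set"
  shows "hausdorff_premeasure s \<delta> (\<Union>n. A n) \<le> (\<Sum>n. hausdorff_premeasure s \<delta> (A n))"
proof (rule ennreal_le_epsilon)
  fix e :: real
  assume fin: "(\<Sum>n. hausdorff_premeasure s \<delta> (A n)) < top" and e: "0 < e"
  let ?w = "\<lambda>C. ennreal (unit_ball_vol s * (diameter C / 2) powr s)"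
  have "hausdorff_premeasure s \<delta> (A n) < hausdorff_premeasure s \<delta> (A n) + ennreal (e * (1/2)^Suc n)" for n
  proof -
    have "hausdorff_premeasure s \<delta> (A n) \<noteq> top"
      using ennreal_suminf_lessD[OF fin] by (auto simp: less_top)
    moreover have "0 < e * (1/2)^Suc n" using e by simp
    ultimately show ?thesis by (cases "hausdorff_premeasure s \<delta> (A n)") (auto simp flip: ennreal_plus simp: ennreal_less_iff)
  qed
  then have lt: "hausdorff_premeasure s \<delta> (A n) < hausdorff_premeasure s \<delta> (A n) + ennreal (e * (1/2)^Suc n)" for n .
  have "\<exists>C. A n \<subseteq> (\<Union>i. C i) \<and> (\<forall>i. bounded (C i)) \<and> (\<forall>i. diameter (C i) \<le> \<delta>) \<and>
      (\<Sum>i. ?w (C i)) < hausdorff_premeasure s \<delta> (A n) + ennreal (e * (1/2)^Suc n)" for n :: nat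
    by (rule hausdorff_premeasure_cover[OF lt[of n]]) blast
  then obtain C :: "nat \<Rightarrow> nat \<Rightarrow> 'a set" where C: "\<And>n. A n \<subseteq> (\<Union>i. C n i)" "\<And>n i. bounded (C n i)"
      "\<And>n i. diameter (C n i) \<le> \<delta>"
      "\<And>n. (\<Sum>i. ?w (C n i)) < hausdorff_premeasure s \<delta> (A n) + ennreal (e * (1/2)^Suc n)"
    by metis
  define D where "D = case_prod C \<circ> prod_decode"
  have "(\<Union>n. A n) \<subseteq> (\<Union>i. D i)"
  proof
    fix x assume "x \<in> (\<Union>n. A n)"
    then obtain n i where "x \<in> C n i" using C(1) by blast
    then have "x \<in> D (prod_encode (n, i))" by (simp add: D_def)
    then show "x \<in> (\<Union>i. D i)" by blast
  qed
  moreover have "bounded (D i)" "diameter (D i) \<le> \<delta>" for i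
    using C by (auto simp: D_def split: prod.split)
  ultimately have "hausdorff_premeasure s \<delta> (\<Union>n. A n) \<le> (\<Sum>i. ?w (D i))"
    by (rule hausdorff_premeasure_le)
  also have "\<dots> = (\<Sum>n. \<Sum>i. ?w (C n i))"
    using suminf_ennreal_2dimen[of "\<lambda>n. \<Sum>i. ?w (C n i)" "\<lambda>(n, i). ?w (C n i)"]
    by (simp add: D_def comp_def case_prod_unfold)
  also have "\<dots> \<le> (\<Sum>n. hausdorff_premeasure s \<delta> (A n) + ennreal (e * (1/2)^Suc n))"
    by (intro suminf_le summableI) (use C(4) in \<open>auto intro: less_imp_le\<close>)
  also have "\<dots> = (\<Sum>n. hausdorff_premeasure s \<delta> (A n)) + (\<Sum>n. ennreal (e * (1/2)^Suc n))"
    by (rule suminf_add[symmetric]) (auto intro: summableI)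
  also have "(\<Sum>n. ennreal (e * (1/2)^Suc n)) = ennreal e"
  proof (rule suminf_ennreal_eq)
    show "(\<lambda>n. e * (1/2)^Suc n) sums e" using sums_mult[OF power_half_series, of e] by simp
  qed (use e in auto)
  finally show "hausdorff_premeasure s \<delta> (\<Union>n. A n) \<le> (\<Sum>n. hausdorff_premeasure s \<delta> (A n)) + ennreal e" .
qed

lemma hausdorff_premeasure_Un:
  assumes "\<delta> > 0"
  shows "hausdorff_premeasure s \<delta> (A \<union> B) \<le> hausdorff_premeasure s \<delta> A + hausdorff_premeasure s \<delta> B"
proof -
  let ?A = "\<lambda>n::nat. if n = 0 then A else if n = 1 then B else {}"
  have "A \<union> B = (\<Union>n. ?A n)" by (auto split: if_splits)
  moreover have "hausdorff_premeasure s \<delta> (\<Union>n. ?A n) \<le> (\<Sum>n. hausdorff_premeasure s \<delta> (?A n))"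
    by (rule hausdorff_premeasure_Union)
  moreover have "(\<Sum>n. hausdorff_premeasure s \<delta> (?A n)) = (\<Sum>n\<in>{0,1}. hausdorff_premeasure s \<delta> (?A n))"
    by (rule suminf_finite) (auto simp: hausdorff_premeasure_empty assms)
  ultimately show ?thesis by simp
qed

lemma hausdorff_outer_ge: "\<delta> > 0 \<Longrightarrow> hausdorff_premeasure s \<delta> A \<le> hausdorff_outer s A"
  unfolding hausdorff_outer_def by (rule SUP_upper) simp

lemma hausdorff_outer_mono: "A \<subseteq> B \<Longrightarrow> hausdorff_outer s A \<le> hausdorff_outer s B"
  unfolding hausdorff_outer_def by (rule SUP_mono) (blast intro: hausdorff_premeasure_mono)

lemma hausdorff_outer_empty [simp]: "hausdorff_outer s {} = 0"
  unfolding hausdorff_outer_def by (auto simp: hausdorff_premeasure_empty intro!: antisym SUP_least)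

lemma hausdorff_outer_Union: "hausdorff_outer s (\<Union>n::nat. A n) \<le> (\<Sum>n. hausdorff_outer s (A n))"
  unfolding hausdorff_outer_def[of s "\<Union>n. A n"]
proof (rule SUP_least)
  fix \<delta> :: real assume "\<delta> \<in> {0<..}"
  then have "(\<Sum>n. hausdorff_premeasure s \<delta> (A n)) \<le> (\<Sum>n. hausdorff_outer s (A n))"
    by (intro suminf_le summableI hausdorff_outer_ge) auto
  with hausdorff_premeasure_Union show "hausdorff_premeasure s \<delta> (\<Union>n. A n) \<le> (\<Sum>n. hausdorff_outer s (A n))"
    by (rule order_trans)
qed

lemma outer_measure_space_hausdorff: "outer_measure_space (Pow UNIV) (hausdorff_outer s)"
  unfolding outer_measure_space_def positive_def increasing_def countably_subadditive_def
  by (auto intro: hausdorff_outer_mono hausdorff_outer_Union)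

lemma hausdorff_outer_Un: "hausdorff_outer s (A \<union> B) \<le> hausdorff_outer s A + hausdorff_outer s B"
  unfolding hausdorff_outer_def[of s "A \<union> B"]
proof (rule SUP_least)
  fix \<delta> :: real assume "\<delta> \<in> {0<..}"
  then show "hausdorff_premeasure s \<delta> (A \<union> B) \<le> hausdorff_outer s A + hausdorff_outer s B"
    by (intro order_trans[OF hausdorff_premeasure_Un] add_mono hausdorff_outer_ge) auto
qed

text \<open>A set of small diameter cannot meet both of two sets at positive distance from each other;
  hence fine covers of \<open>A \<union> B\<close> split into a cover of \<open>A\<close> and one of \<open>B\<close>.\<close>

lemma hausdorff_outer_Un_separated:
  fixes A B :: "'a::metric_space set"
  assumes "\<eta> > 0" and sep: "\<And>x y. x \<in> A \<Longrightarrow> y \<in> B \<Longrightarrow> \<eta> \<le> dist x y"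
  shows "hausdorff_outer s (A \<union> B) = hausdorff_outer s A + hausdorff_outer s B"
proof (rule antisym[OF hausdorff_outer_Un])
  let ?w = "\<lambda>C::'a set. ennreal (unit_ball_vol s * (diameter C / 2) powr s)"
  have key: "hausdorff_premeasure s \<delta> A + hausdorff_premeasure s \<delta> B \<le> hausdorff_premeasure s \<delta> (A \<union> B)"
    if d: "0 < \<delta>" "\<delta> < \<eta>" for \<delta>
  proof (rule dense_ge)
    fix x assume "hausdorff_premeasure s \<delta> (A \<union> B) < x"
    then obtain C where C: "A \<union> B \<subseteq> (\<Union>i. C i)" "\<And>i. bounded (C i)" "\<And>i. diameter (C i) \<le> \<delta>"
      "(\<Sum>i. ?w (C i)) < x" by (rule hausdorff_premeasure_cover) (rule that)
    define CA where "CA i = (if C i \<inter> A = {} then {} else C i)" for i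
    define CB where "CB i = (if C i \<inter> A = {} then C i else {})" for i
    have "C i \<inter> B = {}" if meets: "C i \<inter> A \<noteq> {}" for i
    proof (rule ccontr)
      assume "C i \<inter> B \<noteq> {}"
      then obtain a b where "a \<in> C i" "a \<in> A" "b \<in> C i" "b \<in> B" using meets by fastforce
      then have "\<eta> \<le> dist a b" "dist a b \<le> diameter (C i)"
        using sep diameter_bounded_bound[OF C(2)] by auto
      then show False using C(3)[of i] d by simp
    qed
    then have dis: "C i \<inter> B = {} \<or> C i \<inter> A = {}" for i by blast
    have "A \<subseteq> (\<Union>i. CA i)"
    proof
      fix x assume "x \<in> A"
      then obtain i where "x \<in> C i" using C(1) by blast
      then have "x \<in> CA i" using \<open>x \<in> A\<close> by (auto simp: CA_def)
      then show "x \<in> (\<Union>i. CA i)" by blast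
    qed
    moreover have "B \<subseteq> (\<Union>i. CB i)"
    proof
      fix x assume "x \<in> B"
      then obtain i where "x \<in> C i" using C(1) by blast
      then have "x \<in> CB i" using \<open>x \<in> B\<close> dis[of i] by (auto simp: CB_def)
      then show "x \<in> (\<Union>i. CB i)" by blast
    qed
    moreover have "bounded (CA i)" "bounded (CB i)" "diameter (CA i) \<le> \<delta>" "diameter (CB i) \<le> \<delta>" for i
      using C d by (auto simp: CA_def CB_def)
    ultimately have "hausdorff_premeasure s \<delta> A + hausdorff_premeasure s \<delta> B \<le> (\<Sum>i. ?w (CA i)) + (\<Sum>i. ?w (CB i))"
      by (intro add_mono hausdorff_premeasure_le)
    also have "\<dots> = (\<Sum>i. ?w (CA i) + ?w (CB i))"
      by (rule suminf_add) (auto intro: summableI)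
    also have "(\<lambda>i. ?w (CA i) + ?w (CB i)) = (\<lambda>i. ?w (C i))"
      by (auto simp: CA_def CB_def fun_eq_iff)
    finally show "hausdorff_premeasure s \<delta> A + hausdorff_premeasure s \<delta> B \<le> x"
      using C(4) by simp
  qed
  have "hausdorff_outer s A + hausdorff_outer s B =
      (SUP \<delta>\<in>{0<..}. hausdorff_premeasure s \<delta> A + hausdorff_premeasure s \<delta> B)"
    unfolding hausdorff_outer_def
  proof (rule SUP_add_directed_ennreal[symmetric])
    show "\<exists>k\<in>{0<..}. hausdorff_premeasure s i A + hausdorff_premeasure s j B
        \<le> hausdorff_premeasure s k A + hausdorff_premeasure s k B" if "i \<in> {0<..}" "j \<in> {0<..}" for i j :: real
      using that by (intro bexI[of _ "min i j"] add_mono hausdorff_premeasure_antimono) auto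
  qed
  also have "\<dots> \<le> hausdorff_outer s (A \<union> B)"
  proof (rule SUP_least)
    fix \<delta> :: real assume "\<delta> \<in> {0<..}"
    then have "hausdorff_premeasure s \<delta> A + hausdorff_premeasure s \<delta> B
      \<le> hausdorff_premeasure s (min \<delta> (\<eta>/2)) A + hausdorff_premeasure s (min \<delta> (\<eta>/2)) B"
      by (intro add_mono hausdorff_premeasure_antimono) auto
    also have "\<dots> \<le> hausdorff_premeasure s (min \<delta> (\<eta>/2)) (A \<union> B)"
      using \<open>\<delta> \<in> {0<..}\<close> \<open>\<eta> > 0\<close> by (intro key) auto
    also have "\<dots> \<le> hausdorff_outer s (A \<union> B)"
      using \<open>\<delta> \<in> {0<..}\<close> \<open>\<eta> > 0\<close> by (intro hausdorff_outer_ge) auto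
    finally show "hausdorff_premeasure s \<delta> A + hausdorff_premeasure s \<delta> B \<le> hausdorff_outer s (A \<union> B)" .
  qed
  finally show "hausdorff_outer s A + hausdorff_outer s B \<le> hausdorff_outer s (A \<union> B)" .
qed

text \<open>Caratheodory's criterion.  The part of \<open>A\<close> outside the closed set \<open>F\<close> is exhausted by the sets
  at distance at least \<open>1/(n+1)\<close> from \<open>F\<close>; the remainders are controlled by the shells between
  consecutive distances, every second of which are separated from each other, so that the sum of
  their measures converges.\<close>

lemma hausdorff_outer_closed_split:
  fixes F :: "'a::metric_space set"
  assumes "closed F"
  shows "hausdorff_outer s (A \<inter> F) + hausdorff_outer s (A - F) \<le> hausdorff_outer s A"
proof (cases "hausdorff_outer s A = top \<or> F = {}")
  case True then show ?thesis by (auto simp: top_unique)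
next
  case False
  then have fin: "hausdorff_outer s A < top" and F: "F \<noteq> {}" by (auto simp: less_top)
  let ?H = "hausdorff_outer s"
  define An where "An n = {x\<in>A. 1 / real (Suc n) \<le> infdist x F}" for n
  define D where "D n = {x\<in>A. 1 / real (Suc (Suc n)) \<le> infdist x F \<and> infdist x F < 1 / real (Suc n)}" for n
  have An_sub: "An n \<subseteq> A" "D n \<subseteq> A" for n by (auto simp: An_def D_def)
  have 1: "?H (A \<inter> F) + ?H (An n) \<le> ?H A" for n
  proof -
    have "?H (A \<inter> F) + ?H (An n) = ?H ((A \<inter> F) \<union> An n)"
    proof (rule hausdorff_outer_Un_separated[symmetric])
      show "1 / real (Suc n) \<le> dist x y" if "x \<in> A \<inter> F" "y \<in> An n" for x y
        using that infdist_le[of x F y] by (auto simp: An_def dist_commute)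
    qed simp
    also have "\<dots> \<le> ?H A" using An_sub by (intro hausdorff_outer_mono) auto
    finally show ?thesis .
  qed
  have sepD: "1 / real (Suc (Suc m)) - 1 / real (Suc n) \<le> dist x y" if "x \<in> D m" "y \<in> D n" for x y m n
  proof -
    have "infdist x F \<le> infdist y F + dist x y" by (rule infdist_triangle)
    then show ?thesis using that by (auto simp: D_def)
  qed
  have sumD: "(\<Sum>k<n. ?H (D (2*k + r))) \<le> ?H A" for n r
  proof -
    have "(\<Sum>k<n. ?H (D (2*k + r))) = ?H (\<Union>k<n. D (2*k + r))"
    proof (induction n)
      case (Suc n)
      have "?H ((\<Union>k<n. D (2*k + r)) \<union> D (2*n+r)) = ?H (\<Union>k<n. D (2*k + r)) + ?H (D (2*n+r))"
      proof (rule hausdorff_outer_Un_separated[where \<eta> = "if n = 0 then 1 else 1 / real (2*n + r) - 1 / real (Suc (2*n + r))"])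
        fix x y assume "x \<in> (\<Union>k<n. D (2*k + r))" "y \<in> D (2*n + r)"
        then obtain k where k: "k < n" "x \<in> D (2*k+r)" "y \<in> D (2*n+r)" by auto
        have "1 / real (2*n + r) \<le> 1 / real (Suc (Suc (2*k + r)))"
          using k(1) by (intro divide_left_mono) auto
        then show "(if n = 0 then 1 else 1 / real (2*n + r) - 1 / real (Suc (2*n + r))) \<le> dist x y"
          using sepD[OF k(2,3)] k(1) by simp
      next
        have "1 / real (Suc (2*n + r)) < 1 / real (2*n + r)" if "n \<noteq> 0"
          using that by (intro divide_strict_left_mono) auto
        then show "0 < (if n = 0 then 1 else 1 / real (2*n + r) - 1 / real (Suc (2*n + r)))" by auto
      qed
      then show ?case using Suc by (simp add: lessThan_Suc Un_commute add.commute)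
    qed simp
    also have "\<dots> \<le> ?H A" using An_sub by (intro hausdorff_outer_mono) auto
    finally show ?thesis .
  qed
  have sumD': "(\<Sum>k. ?H (D k)) < top"
  proof -
    have "(\<Sum>k<N. ?H (D k)) \<le> ?H A + ?H A" for N
    proof -
      have "(\<Sum>k<N. ?H (D k)) \<le> (\<Sum>k<2*N. ?H (D k))" by (intro sum_mono2) auto
      also have "\<dots> = (\<Sum>k<N. ?H (D (2*k))) + (\<Sum>k<N. ?H (D (2*k+1)))"
        by (induction N) (auto simp: algebra_simps)
      also have "\<dots> \<le> ?H A + ?H A" using sumD[of 0 N] sumD[of 1 N] by (intro add_mono) auto
      finally show ?thesis .
    qed
    then have "(\<Sum>k. ?H (D k)) \<le> ?H A + ?H A" by (intro suminf_le_const summableI)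
    then show ?thesis by (rule le_less_trans) (use fin in simp)
  qed
  have tail: "?H (A - F) \<le> ?H (An n) + (\<Sum>k. ?H (D (k + n)))" for n
  proof -
    have "A - F \<subseteq> An n \<union> (\<Union>k. D (k + n))"
    proof
      fix x assume x: "x \<in> A - F"
      then have pos: "infdist x F > 0" using in_closed_iff_infdist_zero[OF \<open>closed F\<close> F, of x] infdist_nonneg[of x F] by auto
      show "x \<in> An n \<union> (\<Union>k. D (k + n))"
      proof (cases "x \<in> An n")
        case False
        then have less: "infdist x F < 1 / real (Suc n)" using x by (auto simp: An_def)
        define m where "m = (LEAST m. 1 / real (Suc m) \<le> infdist x F)"
        obtain m0 where "1 / real (Suc m0) \<le> infdist x F"
          using nat_approx_posE[OF pos] by (metis less_imp_le)
        then have m: "1 / real (Suc m) \<le> infdist x F" unfolding m_def by (rule LeastI)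
        have "n < m"
        proof (rule ccontr)
          assume "\<not> n < m"
          then have "1 / real (Suc n) \<le> 1 / real (Suc m)" by (intro divide_left_mono) auto
          then show False using m less by simp
        qed
        then obtain k where k: "m = Suc (k + n)" by (metis add.commute less_iff_Suc_add add_Suc_right)
        have "k + n < m" using k by simp
        then have "\<not> 1 / real (Suc (k+n)) \<le> infdist x F" unfolding m_def by (rule not_less_Least)
        then have "x \<in> D (k + n)" using m x k by (auto simp: D_def)
        then show ?thesis by blast
      qed auto
    qed
    then have "?H (A - F) \<le> ?H (An n \<union> (\<Union>k. D (k + n)))" by (rule hausdorff_outer_mono)
    also have "\<dots> \<le> ?H (An n) + ?H (\<Union>k. D (k + n))" by (rule hausdorff_outer_Un)
    also have "\<dots> \<le> ?H (An n) + (\<Sum>k. ?H (D (k + n)))" by (intro add_left_mono hausdorff_outer_Union)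
    finally show ?thesis .
  qed
  show ?thesis
  proof (rule ennreal_le_epsilon)
    fix e :: real assume "e > 0"
    have "(\<lambda>n. \<Sum>k<n. ?H (D k)) \<longlonglongrightarrow> (\<Sum>k. ?H (D k))" by (intro summable_LIMSEQ summableI)
    moreover have "(\<Sum>k. ?H (D k)) < (\<Sum>k. ?H (D k)) + ennreal e"
      using sumD' \<open>e > 0\<close> by (cases "(\<Sum>k. ?H (D k))") (auto simp flip: ennreal_plus simp: ennreal_less_iff)
    ultimately obtain n where n: "(\<Sum>k. ?H (D k)) < (\<Sum>k<n. ?H (D k)) + ennreal e"
    proof -
      assume lim: "(\<lambda>n. \<Sum>k<n. ?H (D k)) \<longlonglongrightarrow> (\<Sum>k. ?H (D k))"
        and less: "(\<Sum>k. ?H (D k)) < (\<Sum>k. ?H (D k)) + ennreal e"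
        and th: "\<And>n. (\<Sum>k. ?H (D k)) < (\<Sum>k<n. ?H (D k)) + ennreal e \<Longrightarrow> thesis"
      have "(\<lambda>n. (\<Sum>k<n. ?H (D k)) + ennreal e) \<longlonglongrightarrow> (\<Sum>k. ?H (D k)) + ennreal e"
        by (intro tendsto_intros lim)
      from order_tendstoD(1)[OF this less] have "eventually (\<lambda>n. (\<Sum>k. ?H (D k)) < (\<Sum>k<n. ?H (D k)) + ennreal e) sequentially" .
      then show thesis using th by (auto simp: eventually_sequentially)
    qed
    have split: "(\<Sum>k. ?H (D k)) = (\<Sum>k. ?H (D (k + n))) + (\<Sum>k<n. ?H (D k))"
      by (rule suminf_offset) (rule summableI)
    have "(\<Sum>k. ?H (D (k + n))) \<le> ennreal e"
      using n unfolding split by (auto simp: add.commute[of "(\<Sum>k. ?H (D (k + n)))"] intro: less_imp_le)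
    then have "?H (A \<inter> F) + ?H (A - F) \<le> ?H (A \<inter> F) + (?H (An n) + ennreal e)"
      using tail[of n] by (intro add_left_mono) (meson add_left_mono order_trans)
    also have "\<dots> \<le> ?H A + ennreal e" using 1[of n] by (simp add: add_right_mono flip: add.assoc)
    finally show "?H (A \<inter> F) + ?H (A - F) \<le> ?H A + ennreal e" .
  qed
qed

lemma space_hausdorff [simp]: "space (hausdorff_measure s) = UNIV"
  by (simp add: hausdorff_measure_def space_measure_of_conv)

lemma measure_space_hausdorff:
  "measure_space UNIV (lambda_system UNIV UNIV (hausdorff_outer s)) (hausdorff_outer s)"
  using sigma_algebra.caratheodory_lemma[OF sigma_algebra_Pow outer_measure_space_hausdorff] by simp

lemma sets_hausdorff: "sets (hausdorff_measure s) = lambda_system UNIV UNIV (hausdorff_outer s)"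
proof -
  have "sigma_algebra UNIV (lambda_system UNIV UNIV (hausdorff_outer s))"
    using measure_space_hausdorff[of s] by (auto simp: measure_space_def)
  from sigma_algebra.sigma_sets_eq[OF this] show ?thesis
    by (simp add: hausdorff_measure_def sets_measure_of_conv)
qed

lemma borel_sets_hausdorff:
  fixes A :: "'a::metric_space set"
  assumes "A \<in> sets borel"
  shows "A \<in> sets (hausdorff_measure s)"
proof -
  have "sigma_sets UNIV {F::'a set. closed F} \<subseteq> sets (hausdorff_measure s)"
  proof (rule sets.sigma_sets_subset[of _ "hausdorff_measure s", unfolded space_hausdorff])
    show "{F::'a set. closed F} \<subseteq> sets (hausdorff_measure s)"
    proof safe
      fix F :: "'a set" assume F: "closed F"
      show "F \<in> sets (hausdorff_measure s)"
        unfolding sets_hausdorff lambda_system_def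
      proof (safe intro!: antisym)
        fix x :: "'a set"
        show "hausdorff_outer s (F \<inter> x) + hausdorff_outer s ((UNIV - F) \<inter> x) \<le> hausdorff_outer s x"
          using hausdorff_outer_closed_split[OF F, of s x] by (simp add: Int_commute Diff_eq)
        show "hausdorff_outer s x \<le> hausdorff_outer s (F \<inter> x) + hausdorff_outer s ((UNIV - F) \<inter> x)"
          by (rule order_trans[OF hausdorff_outer_mono hausdorff_outer_Un]) auto
      qed auto
    qed
  qed
  then show ?thesis using assms by (auto simp: borel_eq_closed)
qed

lemma emeasure_hausdorff:
  assumes "A \<in> sets (hausdorff_measure s)"
  shows "emeasure (hausdorff_measure s) A = hausdorff_outer s A"
  unfolding hausdorff_measure_def using assms measure_space_hausdorff[of s]
  by (intro emeasure_measure_of_sigma) (auto simp: measure_space_def sets_hausdorff)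

text \<open>A cover of \<open>A\<close> by sets \<open>C\<close> gives a cover of the image by the sets \<open>f (C \<inter> A)\<close>, whose
  diameters are at most \<open>K\<close> times as large.\<close>

lemma hausdorff_outer_Lipschitz_image:
  fixes f :: "'a::metric_space \<Rightarrow> 'b::metric_space"
  assumes K: "K > 0" and s: "s > 0"
    and lip: "\<And>x y. x \<in> A \<Longrightarrow> y \<in> A \<Longrightarrow> dist (f x) (f y) \<le> K * dist x y"
  shows "hausdorff_outer s (f ` A) \<le> ennreal (K powr s) * hausdorff_outer s A"
  unfolding hausdorff_outer_def[of s "f ` A"]
proof (rule SUP_least)
  fix \<delta> :: real assume "\<delta> \<in> {0<..}"
  then have d: "\<delta> > 0" by simp
  have "hausdorff_premeasure s \<delta> (f ` A) \<le> ennreal (K powr s) * hausdorff_premeasure s (\<delta> / K) A"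
  proof -
    let ?w = "\<lambda>d. ennreal (unit_ball_vol s * (d / 2) powr s)"
    have c: "ennreal (1 / K powr s) * ennreal (K powr s) = 1"
      using K by (simp flip: ennreal_mult)
    have "ennreal (1 / K powr s) * hausdorff_premeasure s \<delta> (f ` A) \<le> hausdorff_premeasure s (\<delta> / K) A"
      unfolding hausdorff_premeasure_def[of s "\<delta> / K"]
    proof (rule INF_greatest, safe)
      fix C :: "nat \<Rightarrow> 'a set"
      assume C: "A \<subseteq> (\<Union>i. C i)" "\<forall>i. bounded (C i) \<and> diameter (C i) \<le> \<delta> / K"
      have dist: "dist x y \<le> K * diameter (C i)" if xy: "x \<in> f ` (C i \<inter> A)" "y \<in> f ` (C i \<inter> A)" for x y i
      proof -
        obtain a b where ab: "a \<in> C i" "a \<in> A" "b \<in> C i" "b \<in> A" "x = f a" "y = f b" using xy by auto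
        have "dist x y \<le> K * dist a b" using ab lip by auto
        also have "\<dots> \<le> K * diameter (C i)"
          using ab C(2) K by (intro mult_left_mono diameter_bounded_bound) auto
        finally show ?thesis .
      qed
      have bd: "bounded (f ` (C i \<inter> A))" for i
        unfolding bounded_any_center[where a = undefined] using dist
        by (meson bounded_two_points bounded_any_center)
      have diam: "diameter (f ` (C i \<inter> A)) \<le> K * diameter (C i)" for i

      proof (cases "f ` (C i \<inter> A) = {}")
        case False
        then obtain z where "z \<in> f ` (C i \<inter> A)" by blast
        have "(SUP (x,y)\<in>f ` (C i \<inter> A) \<times> f ` (C i \<inter> A). dist x y) \<le> K * diameter (C i)"
          using \<open>z \<in> f ` (C i \<inter> A)\<close> dist by (intro cSUP_least) auto
        then show ?thesis using False by (simp add: diameter_def)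
      qed (use K C(2) in \<open>simp add: diameter_ge_0\<close>)
      have "hausdorff_premeasure s \<delta> (f ` A) \<le> (\<Sum>i. ?w (diameter (f ` (C i \<inter> A))))"
      proof (rule hausdorff_premeasure_le[OF _ bd])
        show "f ` A \<subseteq> (\<Union>i. f ` (C i \<inter> A))" using C(1) by blast
        show "diameter (f ` (C i \<inter> A)) \<le> \<delta>" for i
          using diam[of i] C(2)[rule_format, of i] K by (auto simp: field_simps intro: order_trans)
      qed
      also have "\<dots> \<le> (\<Sum>i. ?w (K * diameter (C i)))"
        using diam bd s by (intro suminf_le summableI ennreal_leI mult_left_mono powr_mono2)
          (auto simp: diameter_ge_0 divide_right_mono)
      also have "\<dots> = (\<Sum>i. ennreal (K powr s) * ?w (diameter (C i)))"
        using K s C(2) by (intro suminf_cong) (auto simp: diameter_ge_0 powr_mult powr_divide mult_ac simp flip: ennreal_mult)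
      finally have "hausdorff_premeasure s \<delta> (f ` A) \<le> ennreal (K powr s) * (\<Sum>i. ?w (diameter (C i)))"
        by simp
      from mult_left_mono[OF this, of "ennreal (1 / K powr s)"] c
      show "ennreal (1 / K powr s) * hausdorff_premeasure s \<delta> (f ` A) \<le> (\<Sum>i. ?w (diameter (C i)))"
        by (simp flip: mult.assoc)
    qed
    from mult_left_mono[OF this, of "ennreal (K powr s)"] c show ?thesis
      by (simp add: mult.assoc[symmetric] mult.commute[of "ennreal (K powr s)" "ennreal (1 / K powr s)"])
  qed
  also have "\<dots> \<le> ennreal (K powr s) * hausdorff_outer s A"
    using d K by (intro mult_left_mono hausdorff_outer_ge) auto
  finally show "hausdorff_premeasure s \<delta> (f ` A) \<le> ennreal (K powr s) * hausdorff_outer s A" .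
qed

section \<open>Steiner symmetrization and the isodiametric inequality\<close>

text \<open>Both sides are \<open>\<integral>\<integral> 1\<^sub>F(y) 1\<^sub>E(x + y) dx d\<nu>(y)\<close>: translate \<open>x\<close> by \<open>- y\<close> for the left one, \<open>y\<close> by \<open>- x\<close>
  for the right one.  So a translation invariant measure is a multiple of Lebesgue measure.\<close>

lemma translation_invariant_measure_unique:
  fixes \<nu> :: "'a::euclidean_space measure"
  assumes sets: "sets \<nu> = sets borel" and sf: "sigma_finite_measure \<nu>"
    and inv: "\<And>a. distr \<nu> borel (\<lambda>x. x + a) = \<nu>"
    and E[measurable]: "E \<in> sets borel" and F[measurable]: "F \<in> sets borel"
  shows "emeasure \<nu> F * emeasure lborel E = emeasure \<nu> E * emeasure lborel F"
proof -
  interpret sigma_finite_measure \<nu> by (rule sf)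
  interpret pair_sigma_finite \<nu> "lborel::'a measure" ..
  note [measurable_cong] = sets
  have "emeasure \<nu> F * emeasure lborel E = (\<integral>\<^sup>+y. indicator F y * emeasure lborel E \<partial>\<nu>)"
    by (simp add: nn_integral_multc sets)
  also have "\<dots> = (\<integral>\<^sup>+y. (\<integral>\<^sup>+x. indicator F y * indicator E (x + y) \<partial>lborel) \<partial>\<nu>)"
  proof (rule nn_integral_cong)
    fix y
    have "emeasure lborel E = (\<integral>\<^sup>+x. indicator E x \<partial>distr lborel borel ((+) y))"
      by (simp add: lborel_distr_plus)
    also have "\<dots> = (\<integral>\<^sup>+x. indicator E (x + y) \<partial>lborel)"
      by (subst nn_integral_distr) (auto simp: add.commute)
    finally show "indicator F y * emeasure lborel E = (\<integral>\<^sup>+x. indicator F y * indicator E (x + y) \<partial>lborel)"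
      by (simp add: nn_integral_cmult)
  qed
  also have "\<dots> = (\<integral>\<^sup>+x. (\<integral>\<^sup>+y. indicator F y * indicator E (x + y) \<partial>\<nu>) \<partial>lborel)"
    by (rule Fubini'[symmetric]) measurable
  also have "\<dots> = (\<integral>\<^sup>+x. (\<integral>\<^sup>+y. indicator F (y - x) * indicator E y \<partial>\<nu>) \<partial>lborel)"
  proof (rule nn_integral_cong)
    fix x :: 'a
    have "(\<integral>\<^sup>+y. indicator F (y - x) * indicator E y \<partial>\<nu>) = (\<integral>\<^sup>+y. indicator F (y - x) * indicator E y \<partial>distr \<nu> borel (\<lambda>y. y + x))"
      by (simp add: inv)
    also have "\<dots> = (\<integral>\<^sup>+y. indicator F y * indicator E (x + y) \<partial>\<nu>)"
      by (subst nn_integral_distr) (auto simp: add.commute)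
    finally show "(\<integral>\<^sup>+y. indicator F y * indicator E (x + y) \<partial>\<nu>) = (\<integral>\<^sup>+y. indicator F (y - x) * indicator E y \<partial>\<nu>)" ..
  qed
  also have "\<dots> = (\<integral>\<^sup>+y. (\<integral>\<^sup>+x. indicator F (y - x) * indicator E y \<partial>lborel) \<partial>\<nu>)"
    by (rule Fubini') measurable
  also have "\<dots> = (\<integral>\<^sup>+y. indicator E y * emeasure lborel F \<partial>\<nu>)"
  proof (rule nn_integral_cong)
    fix y :: 'a
    have "emeasure lborel F = (\<integral>\<^sup>+x. indicator F x \<partial>lborel)" by simp
    also have "\<dots> = (\<integral>\<^sup>+x. indicator F x \<partial>(density (distr lborel borel (\<lambda>x::'a. y + (-1) *\<^sub>R x)) (\<lambda>_. ennreal (\<bar>-1\<bar>^DIM('a)))))"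
      by (subst lborel_affine[of "-1" y, symmetric]) auto
    also have "\<dots> = (\<integral>\<^sup>+x. indicator F (y - x) \<partial>lborel)"
      by (subst nn_integral_density) (auto simp: nn_integral_distr simp del: nn_integral_indicator)
    finally show "(\<integral>\<^sup>+x. indicator F (y - x) * indicator E y \<partial>lborel) = indicator E y * emeasure lborel F"
      by (subst nn_integral_multc) (auto simp: mult.commute)
  qed
  also have "\<dots> = emeasure \<nu> E * emeasure lborel F"
    by (simp add: nn_integral_multc sets)
  finally show ?thesis .
qed

lemma nn_integral_lborel_shift:
  fixes a :: "'a::euclidean_space"
  assumes [measurable]: "f \<in> borel_measurable borel"
  shows "(\<integral>\<^sup>+x. f (x + a) \<partial>lborel) = (\<integral>\<^sup>+x. f x \<partial>lborel)"
proof -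
  have "(\<integral>\<^sup>+x. f x \<partial>lborel) = (\<integral>\<^sup>+x. f x \<partial>distr lborel borel ((+) a))"
    by (simp add: lborel_distr_plus)
  also have "\<dots> = (\<integral>\<^sup>+x. f (x + a) \<partial>lborel)"
    by (subst nn_integral_distr) (auto simp: add.commute)
  finally show ?thesis ..
qed

text \<open>Integration along the lines in direction \<open>e\<close>.  Every such line meets the slab \<open>0 \<le> x \<bullet> e \<le> 1\<close> in
  a segment of length one, so that integrating the line integrals over the slab counts each line once.
  This avoids splitting the space into a line and its orthogonal complement.\<close>

lemma nn_integral_lines:
  fixes e :: "'a::euclidean_space"
  assumes [measurable]: "f \<in> borel_measurable borel" and e: "norm e = 1"
  shows "(\<integral>\<^sup>+x. f x \<partial>lborel) =
    (\<integral>\<^sup>+x. indicator {0..1} (x \<bullet> e) * (\<integral>\<^sup>+\<tau>. f (x + \<tau> *\<^sub>R e) \<partial>lborel) \<partial>lborel)"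
proof -
  have psf: "pair_sigma_finite (lborel::real measure) (lborel::'a measure)" ..
  have ee: "e \<bullet> e = 1" using e by (simp add: norm_eq_1)
  have "(\<integral>\<^sup>+x. indicator {0..1} (x \<bullet> e) * (\<integral>\<^sup>+\<tau>. f (x + \<tau> *\<^sub>R e) \<partial>lborel) \<partial>lborel)
      = (\<integral>\<^sup>+x. (\<integral>\<^sup>+\<tau>. indicator {0..1} (x \<bullet> e) * f (x + \<tau> *\<^sub>R e) \<partial>lborel) \<partial>lborel)"
    by (simp add: nn_integral_cmult)
  also have "\<dots> = (\<integral>\<^sup>+\<tau>. (\<integral>\<^sup>+x. indicator {0..1} (x \<bullet> e) * f (x + \<tau> *\<^sub>R e) \<partial>lborel) \<partial>lborel)"
    by (rule pair_sigma_finite.Fubini'[OF psf]) measurable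
  also have "\<dots> = (\<integral>\<^sup>+\<tau>. (\<integral>\<^sup>+x. indicator {0..1} (x \<bullet> e - \<tau>) * f x \<partial>lborel) \<partial>lborel)"
  proof (rule nn_integral_cong)
    fix \<tau> :: real
    show "(\<integral>\<^sup>+x. indicator {0..1} (x \<bullet> e) * f (x + \<tau> *\<^sub>R e) \<partial>lborel) = (\<integral>\<^sup>+x. indicator {0..1} (x \<bullet> e - \<tau>) * f x \<partial>lborel)"
      using nn_integral_lborel_shift[of "\<lambda>x. indicator {0..1} (x \<bullet> e - \<tau>) * f x" "\<tau> *\<^sub>R e"]
      by (simp add: inner_add_left ee)
  qed
  also have "\<dots> = (\<integral>\<^sup>+x. (\<integral>\<^sup>+\<tau>. indicator {0..1} (x \<bullet> e - \<tau>) * f x \<partial>lborel) \<partial>lborel)"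
    by (rule pair_sigma_finite.Fubini'[OF psf, symmetric]) measurable
  also have "\<dots> = (\<integral>\<^sup>+x. f x \<partial>lborel)"
  proof (rule nn_integral_cong)
    fix x :: 'a
    have "(\<integral>\<^sup>+\<tau>. indicator {0..1} (x \<bullet> e - \<tau>) \<partial>lborel) = (\<integral>\<^sup>+\<tau>. indicator {x \<bullet> e - 1..x \<bullet> e} \<tau> \<partial>(lborel :: real measure))"
      by (intro nn_integral_cong) (auto simp: indicator_def)
    also have "\<dots> = 1" by simp
    finally show "(\<integral>\<^sup>+\<tau>. indicator {0..1} (x \<bullet> e - \<tau>) * f x \<partial>lborel) = f x"
      by (simp add: nn_integral_multc)
  qed
  finally show ?thesis ..
qed

definition line_measure :: "'a::euclidean_space \<Rightarrow> 'a set \<Rightarrow> 'a \<Rightarrow> ennreal" where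
  "line_measure e S x = emeasure lborel {\<tau>. x + \<tau> *\<^sub>R e \<in> S}"

lemma line_measure_nn_integral:
  "S \<in> sets borel \<Longrightarrow> line_measure e S x = (\<integral>\<^sup>+\<tau>. indicator S (x + \<tau> *\<^sub>R e) \<partial>lborel)"
proof -
  assume [measurable]: "S \<in> sets borel"
  have m: "{\<tau>. x + \<tau> *\<^sub>R e \<in> S} \<in> sets borel" by measurable
  have "(\<integral>\<^sup>+\<tau>. indicator S (x + \<tau> *\<^sub>R e) \<partial>lborel) = (\<integral>\<^sup>+\<tau>. indicator {\<tau>. x + \<tau> *\<^sub>R e \<in> S} \<tau> \<partial>lborel)"
    by (intro nn_integral_cong) (auto simp: indicator_def)
  then show ?thesis using m by (simp add: line_measure_def)
qed

lemma borel_measurable_line_measure [measurable]: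
  assumes [measurable]: "S \<in> sets borel"
  shows "line_measure e S \<in> borel_measurable borel"
proof -
  have "line_measure e S = (\<lambda>x. \<integral>\<^sup>+\<tau>. indicator S (x + \<tau> *\<^sub>R e) \<partial>lborel)"
    by (simp add: fun_eq_iff line_measure_nn_integral)
  then show ?thesis by simp
qed

lemma line_measure_shift:
  assumes [measurable]: "S \<in> sets borel"
  shows "line_measure e S (x + t *\<^sub>R e) = line_measure e S x"
proof -
  have "(\<integral>\<^sup>+\<tau>. indicator S (x + (\<tau> + t) *\<^sub>R e) \<partial>lborel) = (\<integral>\<^sup>+\<tau>. indicator S (x + \<tau> *\<^sub>R e) \<partial>lborel)"
    by (rule nn_integral_lborel_shift[of "\<lambda>\<tau>. indicator S (x + \<tau> *\<^sub>R e)" t]) measurable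
  then show ?thesis by (simp add: line_measure_nn_integral algebra_simps)
qed

lemma emeasure_line_measure:
  fixes e :: "'a::euclidean_space"
  assumes [measurable]: "S \<in> sets borel" and "norm e = 1"
  shows "emeasure lborel S = (\<integral>\<^sup>+x. indicator {0..1} (x \<bullet> e) * line_measure e S x \<partial>lborel)"
  using nn_integral_lines[of "indicator S" e] assms by (simp add: line_measure_nn_integral)

text \<open>Steiner symmetrization: each section in direction \<open>e\<close> is replaced by the open interval of the same
  measure centred on the hyperplane orthogonal to \<open>e\<close>.\<close>

definition steiner :: "'a::euclidean_space \<Rightarrow> 'a set \<Rightarrow> 'a set" where
  "steiner e S = {x. ennreal (2 * \<bar>x \<bullet> e\<bar>) < line_measure e S x}"

lemma steiner_borel [measurable]:
  assumes [measurable]: "S \<in> sets borel"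
  shows "steiner e S \<in> sets borel"
  unfolding steiner_def by measurable

lemma emeasure_centered_interval: "emeasure lborel {\<tau>::real. ennreal (2 * \<bar>\<tau>\<bar>) < l} = l"
proof (cases l)
  case (real r)
  have "{\<tau>. ennreal (2 * \<bar>\<tau>\<bar>) < l} = {- r/2<..<r/2}"
    using real by (auto simp: ennreal_less_iff)
  then show ?thesis using real by simp
next
  case top
  then have "{\<tau>. ennreal (2 * \<bar>\<tau>\<bar>) < l} = UNIV" by (auto simp: less_top)
  then show ?thesis using top by simp
qed

lemma line_measure_steiner:
  fixes e :: "'a::euclidean_space"
  assumes [measurable]: "S \<in> sets borel" and e: "norm e = 1"
  shows "line_measure e (steiner e S) x = line_measure e S x"
proof -
  have ee: "e \<bullet> e = 1" using e by (simp add: norm_eq_1)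
  have "line_measure e (steiner e S) x = line_measure e (steiner e S) (x + (- (x \<bullet> e)) *\<^sub>R e)"
    by (simp only: line_measure_shift steiner_borel assms(1))
  also have "\<dots> = emeasure lborel {\<tau>. ennreal (2 * \<bar>\<tau>\<bar>) < line_measure e S x}"
  proof -
    have eq: "x + (- (x \<bullet> e)) *\<^sub>R e + \<tau> *\<^sub>R e = x + (\<tau> - x \<bullet> e) *\<^sub>R e" for \<tau> by (simp add: algebra_simps)
    have mem: "x + (\<tau> - x \<bullet> e) *\<^sub>R e \<in> steiner e S \<longleftrightarrow> ennreal (2 * \<bar>\<tau>\<bar>) < line_measure e S x" for \<tau>
      by (simp add: steiner_def line_measure_shift inner_add_left ee)
    show ?thesis unfolding line_measure_def[of e "steiner e S"] by (simp only: eq mem)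
  qed
  also have "\<dots> = line_measure e S x" by (rule emeasure_centered_interval)
  finally show ?thesis .
qed

lemma emeasure_steiner:
  fixes e :: "'a::euclidean_space"
  assumes [measurable]: "S \<in> sets borel" and e: "norm e = 1"
  shows "emeasure lborel (steiner e S) = emeasure lborel S"
  by (simp add: emeasure_line_measure[OF _ e] line_measure_steiner e)

lemma line_measure_pos_meets: "0 < line_measure e S x \<Longrightarrow> \<exists>\<tau>. x + \<tau> *\<^sub>R e \<in> S"
  unfolding line_measure_def by (rule ccontr) auto

lemma emeasure_add_le_of_dist_le:
  fixes X Y :: "real set"
  assumes [measurable]: "X \<in> sets borel" "Y \<in> sets borel" and ne: "X \<noteq> {}" "Y \<noteq> {}"
    and D: "\<And>s t. s \<in> X \<Longrightarrow> t \<in> Y \<Longrightarrow> \<bar>s - t\<bar> \<le> D"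
  shows "emeasure lborel X + emeasure lborel Y \<le> ennreal (2 * D)"
proof -
  obtain s0 t0 where st: "s0 \<in> X" "t0 \<in> Y" using ne by auto
  have bX: "bdd_above X" "bdd_below X" and bY: "bdd_above Y" "bdd_below Y"
    by (rule bdd_aboveI[of _ "t0 + D"], use D st in force, rule bdd_belowI[of _ "t0 - D"], use D st in force,
        rule bdd_aboveI[of _ "s0 + D"], use D st in force, rule bdd_belowI[of _ "s0 - D"], use D st in force)
  have le: "Inf X \<le> Sup X" "Inf Y \<le> Sup Y"
    using st bX bY by (meson cInf_lower cSup_upper order_trans)+
  have "Sup X \<le> D + Inf Y"
  proof (rule cSup_least[OF ne(1)])
    fix s assume "s \<in> X"
    have "s - D \<le> Inf Y" by (rule cInf_greatest[OF ne(2)]) (use D[OF \<open>s \<in> X\<close>] in force)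
    then show "s \<le> D + Inf Y" by simp
  qed
  moreover have "Sup Y \<le> D + Inf X"
  proof (rule cSup_least[OF ne(2)])
    fix t assume "t \<in> Y"
    have "t - D \<le> Inf X" by (rule cInf_greatest[OF ne(1)]) (use D[OF _ \<open>t \<in> Y\<close>] in force)
    then show "t \<le> D + Inf X" by simp
  qed
  moreover have "emeasure lborel X \<le> emeasure lborel {Inf X..Sup X}"
    using bX by (intro emeasure_mono) (auto intro: cInf_lower cSup_upper)
  moreover have "emeasure lborel Y \<le> emeasure lborel {Inf Y..Sup Y}"
    using bY by (intro emeasure_mono) (auto intro: cInf_lower cSup_upper)
  ultimately have "emeasure lborel X + emeasure lborel Y \<le> ennreal (Sup X - Inf X) + ennreal (Sup Y - Inf Y)"
    using le by (intro add_mono) auto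
  also have "\<dots> = ennreal ((Sup X - Inf X) + (Sup Y - Inf Y))" using le by (simp flip: ennreal_plus)
  also have "\<dots> \<le> ennreal (2 * D)"
    using \<open>Sup X \<le> D + Inf Y\<close> \<open>Sup Y \<le> D + Inf X\<close> by (intro ennreal_leI) simp
  finally show ?thesis .
qed

lemma steiner_pos: "x \<in> steiner e S \<Longrightarrow> 0 < line_measure e S x"
  unfolding steiner_def mem_Collect_eq by (rule le_less_trans[OF zero_le])

text \<open>Two chords of the set in direction \<open>e\<close> are no farther apart after they have been centred: the
  distances between the ends of the original chords dominate half the sum of their lengths.\<close>

lemma steiner_diameter_le:
  fixes e :: "'a::euclidean_space" and b :: 'a
  defines "p \<equiv> \<lambda>v. v - (v \<bullet> b) *\<^sub>R b"
  assumes [measurable]: "S \<in> sets borel" and e: "norm e = 1" and eb: "e \<bullet> b = 0"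
    and d: "\<And>x y. x \<in> S \<Longrightarrow> y \<in> S \<Longrightarrow> norm (p (x - y)) \<le> d"
    and x: "x \<in> steiner e S" and y: "y \<in> steiner e S"
  shows "norm (p (x - y)) \<le> d"
proof -
  have ee: "e \<bullet> e = 1" using e by (simp add: norm_eq_1)
  define x0 y0 where "x0 = x + (- (x \<bullet> e)) *\<^sub>R e" and "y0 = y + (- (y \<bullet> e)) *\<^sub>R e"
  have lx: "line_measure e S x0 = line_measure e S x" "line_measure e S y0 = line_measure e S y"
    unfolding x0_def y0_def by (simp_all only: line_measure_shift assms(2))
  define X Y where "X = {\<tau>. x0 + \<tau> *\<^sub>R e \<in> S}" and "Y = {\<tau>. y0 + \<tau> *\<^sub>R e \<in> S}"
  have mX: "X \<in> sets borel" "Y \<in> sets borel" unfolding X_def Y_def by measurable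
  have pos: "0 < line_measure e S x0" "0 < line_measure e S y0"
    unfolding lx using x y by (auto intro: steiner_pos)
  then have ne: "X \<noteq> {}" "Y \<noteq> {}"
    using line_measure_pos_meets unfolding X_def Y_def by blast+
  define A where "A = (norm (p (x0 - y0)))\<^sup>2"
  have orth: "p (x0 - y0) \<bullet> e = 0"
    using eb by (simp add: p_def x0_def y0_def inner_simps ee inner_commute)
  have orth': "e \<bullet> p (x0 - y0) = 0" using orth by (simp only: inner_commute)
  have pyth: "(norm (p ((x0 + s *\<^sub>R e) - (y0 + t *\<^sub>R e))))\<^sup>2 = A + (s - t)\<^sup>2" for s t
  proof -
    have "p ((x0 + s *\<^sub>R e) - (y0 + t *\<^sub>R e)) = p (x0 - y0) + (s - t) *\<^sub>R e"
      using eb by (simp add: p_def algebra_simps inner_simps)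
    then have "(norm (p ((x0 + s *\<^sub>R e) - (y0 + t *\<^sub>R e))))\<^sup>2 = (norm (p (x0 - y0) + (s - t) *\<^sub>R e))\<^sup>2"
      by (simp only:)
    also have "\<dots> = A + (s - t)\<^sup>2"
      unfolding A_def power2_norm_eq_inner inner_add_left inner_add_right inner_scaleR_left inner_scaleR_right
        ee orth orth' by (simp add: power2_eq_square)
    finally show ?thesis .
  qed
  have d0: "d \<ge> 0" using d ne unfolding X_def by (auto intro: order_trans[OF norm_ge_zero])
  have AD: "A + (s - t)\<^sup>2 \<le> d\<^sup>2" if "s \<in> X" "t \<in> Y" for s t
    using that power_mono[OF d norm_ge_zero, of "x0 + s *\<^sub>R e" "y0 + t *\<^sub>R e" 2] unfolding pyth
    by (simp add: X_def Y_def)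
  have D: "\<bar>s - t\<bar> \<le> sqrt (d\<^sup>2 - A)" if "s \<in> X" "t \<in> Y" for s t
  proof (rule real_le_rsqrt)
    show "\<bar>s - t\<bar>\<^sup>2 \<le> d\<^sup>2 - A" using AD[OF that] by simp
  qed
  have "emeasure lborel X + emeasure lborel Y \<le> ennreal (2 * sqrt (d\<^sup>2 - A))"
    by (rule emeasure_add_le_of_dist_le[OF mX ne D])
  moreover have "ennreal (2 * \<bar>x \<bullet> e\<bar>) + ennreal (2 * \<bar>y \<bullet> e\<bar>) \<le> emeasure lborel X + emeasure lborel Y"
  proof (rule add_mono)
    have "line_measure e S x0 = emeasure lborel X" "line_measure e S y0 = emeasure lborel Y"
      by (simp_all only: X_def Y_def line_measure_def)
    then have "line_measure e S x = emeasure lborel X" "line_measure e S y = emeasure lborel Y"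
      by (simp_all only: lx)
    then show "ennreal (2 * \<bar>x \<bullet> e\<bar>) \<le> emeasure lborel X" "ennreal (2 * \<bar>y \<bullet> e\<bar>) \<le> emeasure lborel Y"
      using x y by (simp_all add: steiner_def)
  qed
  ultimately have enn: "ennreal (2 * \<bar>x \<bullet> e\<bar> + 2 * \<bar>y \<bullet> e\<bar>) \<le> ennreal (2 * sqrt (d\<^sup>2 - A))"
    by (subst ennreal_plus) (auto intro: order_trans)
  have Ad: "A \<le> d\<^sup>2"
  proof -
    obtain s t where "s \<in> X" "t \<in> Y" using ne by auto
    with AD[of s t] zero_le_power2[of "s - t"] show ?thesis by linarith
  qed
  have "2 * \<bar>x \<bullet> e\<bar> + 2 * \<bar>y \<bullet> e\<bar> \<le> 2 * sqrt (d\<^sup>2 - A)"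
    using enn Ad by (subst (asm) ennreal_le_iff) auto
  then have "\<bar>x \<bullet> e - y \<bullet> e\<bar> \<le> sqrt (d\<^sup>2 - A)" by linarith
  then have "\<bar>x \<bullet> e - y \<bullet> e\<bar>\<^sup>2 \<le> (sqrt (d\<^sup>2 - A))\<^sup>2" by (intro power_mono) auto
  then have "(x \<bullet> e - y \<bullet> e)\<^sup>2 \<le> d\<^sup>2 - A" using Ad by simp
  moreover have "(norm (p (x - y)))\<^sup>2 = A + (x \<bullet> e - y \<bullet> e)\<^sup>2"
    using pyth[of "x \<bullet> e" "y \<bullet> e"] by (simp add: x0_def y0_def)
  ultimately have "(norm (p (x - y)))\<^sup>2 \<le> d\<^sup>2" by simp
  then show ?thesis using d0 by (rule power2_le_imp_le)
qed

lemma steiner_reflect: "S \<in> sets borel \<Longrightarrow> norm e = 1 \<Longrightarrow> x \<in> steiner e S \<Longrightarrow> x - (2 * (x \<bullet> e)) *\<^sub>R e \<in> steiner e S"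
  using line_measure_shift[of S e x "- (2 * (x \<bullet> e))"]
  by (simp add: steiner_def inner_simps norm_eq_1)

text \<open>The reflection in direction \<open>i\<close> permutes the lines in a direction \<open>e\<close> orthogonal to \<open>i\<close>, so the symmetry
  obtained from one coordinate direction survives the symmetrization in the next.\<close>

lemma steiner_keeps_reflection:
  assumes "\<And>x. x \<in> S \<Longrightarrow> x - (2 * (x \<bullet> i)) *\<^sub>R i \<in> S" and i: "norm i = 1" and ei: "e \<bullet> i = 0"
    and x: "x \<in> steiner e S"
  shows "x - (2 * (x \<bullet> i)) *\<^sub>R i \<in> steiner e S"
proof -
  define R where "R x = x - (2 * (x \<bullet> i)) *\<^sub>R i" for x
  have RR: "R (R x) = x" for x using i by (simp add: R_def inner_simps norm_eq_1 algebra_simps)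
  have RS: "R x \<in> S \<longleftrightarrow> x \<in> S" for x using assms(1) RR by (metis R_def)
  have "R x + \<tau> *\<^sub>R e = R (x + \<tau> *\<^sub>R e)" for \<tau> using ei by (simp add: R_def inner_simps)
  then have "line_measure e S (R x) = line_measure e S x" by (simp add: line_measure_def RS)
  moreover have "R x \<bullet> e = x \<bullet> e" using ei by (simp add: R_def inner_simps inner_commute)
  ultimately show ?thesis using x by (simp add: steiner_def R_def)
qed

lemma emeasure_cylinder:
  fixes b :: "'a::euclidean_space"
  assumes b: "b \<in> Basis" and R: "R > 0"
  shows "emeasure lborel {x. norm (x - (x \<bullet> b) *\<^sub>R b) \<le> R \<and> 0 \<le> x \<bullet> b \<and> x \<bullet> b \<le> 1} =
    ennreal (unit_ball_vol (real (DIM('a) - 1)) * R ^ (DIM('a) - 1))"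
proof -
  interpret product_sigma_finite "\<lambda>_. lborel" by standard
  let ?A = "Basis - {b}" and ?I = "Basis :: 'a set"
  let ?C = "{x. norm (x - (x \<bullet> b) *\<^sub>R b) \<le> R \<and> 0 \<le> x \<bullet> b \<and> x \<bullet> b \<le> 1}"
  let ?B = "{f. sqrt (\<Sum>i\<in>?A. (f i)\<^sup>2) \<le> R} \<inter> space (Pi\<^sub>M ?A (\<lambda>_. lborel :: real measure))"
  have I: "insert b ?A = ?I" using b by auto
  have norm_eq: "norm ((\<Sum>i\<in>?I. f i *\<^sub>R i) - ((\<Sum>i\<in>?I. f i *\<^sub>R i) \<bullet> b) *\<^sub>R b) = sqrt (\<Sum>i\<in>?A. (f i)\<^sup>2)" for f
  proof -
    have "(\<Sum>i\<in>?I. f i *\<^sub>R i) - ((\<Sum>i\<in>?I. f i *\<^sub>R i) \<bullet> b) *\<^sub>R b = (\<Sum>i\<in>?A. f i *\<^sub>R i)"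
      using b by (simp add: sum.remove[of Basis b] inner_sum_left inner_Basis sum.neutral algebra_simps inner_simps)
    moreover have "norm (\<Sum>i\<in>?A. f i *\<^sub>R i) = sqrt (\<Sum>i\<in>?A. (f i)\<^sup>2)"
      unfolding norm_eq_sqrt_inner inner_sum_left inner_sum_right
      by (rule arg_cong[where f=sqrt], rule sum.cong) (auto simp: inner_Basis if_distrib[of "\<lambda>x. _ * x"] power2_eq_square cong: if_cong)
    ultimately show ?thesis by simp
  qed
  have C: "?C \<in> sets borel" by measurable
  have "emeasure lborel ?C = (\<integral>\<^sup>+f. indicator ?C (\<Sum>b\<in>Basis. f b *\<^sub>R b) \<partial>(Pi\<^sub>M ?I (\<lambda>_. lborel)))"
    using C by (subst lborel_eq) (simp add: nn_integral_distr flip: nn_integral_indicator)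
  also have "\<dots> = (\<integral>\<^sup>+f. indicator ?C (\<Sum>b\<in>Basis. f b *\<^sub>R b) \<partial>(Pi\<^sub>M (insert b ?A) (\<lambda>_. lborel)))"
    by (simp only: I)
  also have "\<dots> = (\<integral>\<^sup>+y. (\<integral>\<^sup>+f. indicator ?C (\<Sum>i\<in>Basis. (f(b := y)) i *\<^sub>R i) \<partial>(Pi\<^sub>M ?A (\<lambda>_. lborel))) \<partial>lborel)"
    using C by (subst product_nn_integral_insert_rev) (auto simp: I)
  also have "\<dots> = (\<integral>\<^sup>+y. (\<integral>\<^sup>+f. indicator {0..1::real} y * indicator ?B f \<partial>(Pi\<^sub>M ?A (\<lambda>_. lborel))) \<partial>lborel)"
  proof (rule nn_integral_cong, rule nn_integral_cong)
    fix y :: real and f assume f: "f \<in> space (Pi\<^sub>M ?A (\<lambda>_. lborel :: real measure))"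
    have "(\<Sum>i\<in>Basis. (f(b := y)) i *\<^sub>R i) \<bullet> b = y" using b by (subst inner_sum_left_Basis) auto
    moreover have "(\<Sum>i\<in>?A. ((f(b := y)) i)\<^sup>2) = (\<Sum>i\<in>?A. (f i)\<^sup>2)" by (rule sum.cong) auto
    ultimately show "indicator ?C (\<Sum>i\<in>Basis. (f(b := y)) i *\<^sub>R i) = (indicator {0..1} y * indicator ?B f :: ennreal)"
      using f norm_eq[of "f(b := y)"] by (auto simp: indicator_def)
  qed
  also have "\<dots> = (\<integral>\<^sup>+y. indicator {0..1::real} y * emeasure (Pi\<^sub>M ?A (\<lambda>_. lborel)) ?B \<partial>lborel)"
  proof (rule nn_integral_cong)
    fix y :: real assume "y \<in> space lborel"
    have "?B \<in> sets (Pi\<^sub>M ?A (\<lambda>_. lborel))" by measurable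
    then show "(\<integral>\<^sup>+f. indicator {0..1::real} y * indicator ?B f \<partial>(Pi\<^sub>M ?A (\<lambda>_. lborel)))
        = indicator {0..1} y * emeasure (Pi\<^sub>M ?A (\<lambda>_. lborel)) ?B"
      by (simp add: nn_integral_cmult)
  qed
  also have "\<dots> = emeasure (Pi\<^sub>M ?A (\<lambda>_. lborel)) ?B" by (simp add: nn_integral_multc)
  also have "\<dots> = ennreal (unit_ball_vol (real (DIM('a) - 1)) * R ^ (DIM('a) - 1))"
    using b R by (subst emeasure_cball_aux) auto
  finally show ?thesis .
qed

text \<open>The isodiametric inequality in the hyperplane orthogonal to \<open>b\<close>, for cylinders of height one over
  its subsets.  Symmetrizing in all other coordinate directions makes the set invariant under the
  point reflection of the hyperplane, so that it lies in a ball of half its diameter.\<close>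

lemma isodiametric_slab_pos:
  fixes b :: "'a::euclidean_space" and S :: "'a set"
  defines "p \<equiv> \<lambda>v. v - (v \<bullet> b) *\<^sub>R b"
  assumes S: "S \<in> sets borel" and b: "b \<in> Basis" and d: "d > 0"
    and diam: "\<And>x y. x \<in> S \<Longrightarrow> y \<in> S \<Longrightarrow> norm (p (x - y)) \<le> d"
    and slab: "\<And>x. x \<in> S \<Longrightarrow> 0 \<le> x \<bullet> b \<and> x \<bullet> b \<le> 1"
  shows "emeasure lborel S \<le> ennreal (unit_ball_vol (real (DIM('a) - 1)) * (d / 2) ^ (DIM('a) - 1))"
proof -
  have "\<exists>T\<in>sets borel. emeasure lborel T = emeasure lborel S \<and>
      (\<forall>x\<in>T. \<forall>y\<in>T. norm (p (x - y)) \<le> d) \<and> (\<forall>x\<in>T. 0 \<le> x \<bullet> b \<and> x \<bullet> b \<le> 1) \<and>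
      (\<forall>i\<in>I. \<forall>x\<in>T. x - (2 * (x \<bullet> i)) *\<^sub>R i \<in> T)" if "finite I" "I \<subseteq> Basis - {b}" for I
    using that
  proof (induction I)
    case empty
    then show ?case using S diam slab by (intro bexI[of _ S]) auto
  next
    case (insert e I)
    then obtain T where T: "T \<in> sets borel" "emeasure lborel T = emeasure lborel S"
        "\<And>x y. x \<in> T \<Longrightarrow> y \<in> T \<Longrightarrow> norm (p (x - y)) \<le> d"
        "\<And>x. x \<in> T \<Longrightarrow> 0 \<le> x \<bullet> b \<and> x \<bullet> b \<le> 1"
        "\<And>i x. i \<in> I \<Longrightarrow> x \<in> T \<Longrightarrow> x - (2 * (x \<bullet> i)) *\<^sub>R i \<in> T" by auto
    have e: "norm e = 1" "e \<bullet> b = 0" using insert b by (auto simp: inner_Basis)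
    have ei: "norm i = 1" "e \<bullet> i = 0" if "i \<in> I" for i
    proof -
      have "i \<in> Basis" "e \<in> Basis" "e \<noteq> i" using insert that by auto
      then show "norm i = 1" "e \<bullet> i = 0" by (auto simp: inner_Basis)
    qed
    show ?case
    proof (intro bexI[of _ "steiner e T"] conjI ballI)
      show "emeasure lborel (steiner e T) = emeasure lborel S" using T e by (simp add: emeasure_steiner)
      show "norm (p (x - y)) \<le> d" if "x \<in> steiner e T" "y \<in> steiner e T" for x y
        using steiner_diameter_le[OF T(1) e(1,2) _ that, of d] T(3) by (simp add: p_def)
      show "0 \<le> x \<bullet> b" "x \<bullet> b \<le> 1" if x: "x \<in> steiner e T" for x
      proof -
        from line_measure_pos_meets[OF steiner_pos[OF x]] obtain \<tau> where "x + \<tau> *\<^sub>R e \<in> T" ..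
        from T(4)[OF this] show "0 \<le> x \<bullet> b" "x \<bullet> b \<le> 1" using e by (auto simp: inner_simps)
      qed
      show "x - (2 * (x \<bullet> i)) *\<^sub>R i \<in> steiner e T" if "i \<in> insert e I" "x \<in> steiner e T" for i x
        using that steiner_reflect[OF T(1) e(1)] steiner_keeps_reflection[OF T(5)[of i] ei] by blast
    qed (use T in simp)
  qed
  from this[OF finite_Diff[OF finite_Basis] subset_refl] obtain T where "T \<in> sets borel"
      "emeasure lborel T = emeasure lborel S" "\<forall>x\<in>T. \<forall>y\<in>T. norm (p (x - y)) \<le> d"
      "\<forall>x\<in>T. 0 \<le> x \<bullet> b \<and> x \<bullet> b \<le> 1"
      "\<forall>i\<in>Basis - {b}. \<forall>x\<in>T. x - (2 * (x \<bullet> i)) *\<^sub>R i \<in> T" by (elim bexE conjE)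
  then have T: "T \<in> sets borel" "emeasure lborel T = emeasure lborel S"
        "\<And>x y. x \<in> T \<Longrightarrow> y \<in> T \<Longrightarrow> norm (p (x - y)) \<le> d"
        "\<And>x. x \<in> T \<Longrightarrow> 0 \<le> x \<bullet> b \<and> x \<bullet> b \<le> 1"
        "\<And>i x. i \<in> Basis - {b} \<Longrightarrow> x \<in> T \<Longrightarrow> x - (2 * (x \<bullet> i)) *\<^sub>R i \<in> T"
    by blast+
  have refl: "x - (\<Sum>i\<in>I. (2 * (x \<bullet> i)) *\<^sub>R i) \<in> T" if "finite I" "I \<subseteq> Basis - {b}" "x \<in> T" for I x
    using that
  proof (induction I)
    case (insert e I)
    let ?y = "x - (\<Sum>i\<in>I. (2 * (x \<bullet> i)) *\<^sub>R i)"
    have "(\<Sum>i\<in>I. 2 * (x \<bullet> i) * (i \<bullet> e)) = 0"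
      using insert by (intro sum.neutral ballI) (auto simp: inner_Basis subset_iff)
    then have "?y \<bullet> e = x \<bullet> e" by (simp add: inner_diff_left inner_sum_left)
    then show ?case using T(5)[of e ?y] insert by (simp add: algebra_simps)
  qed simp
  have "T \<subseteq> {x. norm (x - (x \<bullet> b) *\<^sub>R b) \<le> d / 2 \<and> 0 \<le> x \<bullet> b \<and> x \<bullet> b \<le> 1}"
  proof
    fix x assume x: "x \<in> T"
    have "x = (\<Sum>i\<in>Basis. (x \<bullet> i) *\<^sub>R i)" by (simp add: euclidean_representation)
    also have "\<dots> = (x \<bullet> b) *\<^sub>R b + (\<Sum>i\<in>Basis - {b}. (x \<bullet> i) *\<^sub>R i)"
      using b by (simp add: sum.remove)
    finally have "(\<Sum>i\<in>Basis - {b}. (x \<bullet> i) *\<^sub>R i) = p x" by (simp add: p_def algebra_simps)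
    moreover have "(\<Sum>i\<in>Basis - {b}. (2 * (x \<bullet> i)) *\<^sub>R i) = 2 *\<^sub>R (\<Sum>i\<in>Basis - {b}. (x \<bullet> i) *\<^sub>R i)"
      by (simp add: scaleR_sum_right)
    ultimately have eq: "(\<Sum>i\<in>Basis - {b}. (2 * (x \<bullet> i)) *\<^sub>R i) = 2 *\<^sub>R p x" by simp
    have "x - 2 *\<^sub>R p x \<in> T" using refl[of "Basis - {b}" x] x unfolding eq by simp
    from T(3)[OF x this] have "norm (p (2 *\<^sub>R p x)) \<le> d" by (simp only: diff_diff_eq2 add_diff_cancel_left')
    moreover have "p (2 *\<^sub>R p x) = 2 *\<^sub>R p x" using b by (simp add: p_def inner_simps algebra_simps)
    ultimately have "norm (p x) \<le> d / 2" by simp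
    then show "x \<in> {x. norm (x - (x \<bullet> b) *\<^sub>R b) \<le> d / 2 \<and> 0 \<le> x \<bullet> b \<and> x \<bullet> b \<le> 1}"
      using T(4)[OF x] by (simp add: p_def)
  qed
  then have "emeasure lborel T \<le> emeasure lborel {x. norm (x - (x \<bullet> b) *\<^sub>R b) \<le> d / 2 \<and> 0 \<le> x \<bullet> b \<and> x \<bullet> b \<le> 1}"
    by (intro emeasure_mono) measurable
  then show ?thesis using T(2) emeasure_cylinder[OF b, of "d/2"] d by simp
qed

text \<open>Degenerate diameters are reached from \<open>d + 1/(k+1)\<close>.\<close>

lemma isodiametric_slab:
  fixes b :: "'a::euclidean_space" and S :: "'a set"
  assumes S: "S \<in> sets borel" and b: "b \<in> Basis" and d: "d \<ge> 0"
    and diam: "\<And>x y. x \<in> S \<Longrightarrow> y \<in> S \<Longrightarrow> norm ((x - y) - ((x - y) \<bullet> b) *\<^sub>R b) \<le> d"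
    and slab: "\<And>x. x \<in> S \<Longrightarrow> 0 \<le> x \<bullet> b \<and> x \<bullet> b \<le> 1"
  shows "emeasure lborel S \<le> ennreal (unit_ball_vol (real (DIM('a) - 1)) * (d / 2) ^ (DIM('a) - 1))"
proof (rule LIMSEQ_le_const)
  have "(\<lambda>k. unit_ball_vol (real (DIM('a) - 1)) * ((d + inverse (real (Suc k))) / 2) ^ (DIM('a) - 1))
      \<longlonglongrightarrow> unit_ball_vol (real (DIM('a) - 1)) * ((d + 0) / 2) ^ (DIM('a) - 1)"
    by (intro tendsto_intros LIMSEQ_inverse_real_of_nat) auto
  then show "(\<lambda>k. ennreal (unit_ball_vol (real (DIM('a) - 1)) * ((d + inverse (real (Suc k))) / 2) ^ (DIM('a) - 1)))
      \<longlonglongrightarrow> ennreal (unit_ball_vol (real (DIM('a) - 1)) * (d / 2) ^ (DIM('a) - 1))"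
    by (intro tendsto_ennrealI) simp
  show "\<exists>N. \<forall>k\<ge>N. emeasure lborel S \<le> ennreal (unit_ball_vol (real (DIM('a) - 1)) * ((d + inverse (real (Suc k))) / 2) ^ (DIM('a) - 1))"
  proof (intro exI allI impI)
    fix k :: nat
    have pos: "0 < inverse (real (Suc k))" by simp
    then have le: "norm ((x - y) - ((x - y) \<bullet> b) *\<^sub>R b) \<le> d + inverse (real (Suc k))" if "x \<in> S" "y \<in> S" for x y
      using diam[OF that] by linarith
    show "emeasure lborel S \<le> ennreal (unit_ball_vol (real (DIM('a) - 1)) * ((d + inverse (real (Suc k))) / 2) ^ (DIM('a) - 1))"
      by (rule isodiametric_slab_pos[OF S b add_nonneg_pos[OF d pos] le slab])
  qed
qed

section \<open>Hausdorff measure on hyperplanes\<close>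

lemma hausdorff_outer_isometry_image:
  fixes f :: "'a::metric_space \<Rightarrow> 'b::metric_space"
  assumes s: "s > 0" and iso: "\<And>x y. x \<in> A \<Longrightarrow> y \<in> A \<Longrightarrow> dist (f x) (f y) = dist x y"
  shows "hausdorff_outer s (f ` A) = hausdorff_outer s A"
proof (rule antisym)
  show "hausdorff_outer s (f ` A) \<le> hausdorff_outer s A"
    using hausdorff_outer_Lipschitz_image[of 1 s A f] s iso by simp
  have inj: "inj_on f A" using iso by (metis dist_eq_0_iff inj_onI)
  have "dist (the_inv_into A f x) (the_inv_into A f y) \<le> 1 * dist x y" if "x \<in> f ` A" "y \<in> f ` A" for x y
    using that iso by (auto simp: the_inv_into_f_f[OF inj])
  from hausdorff_outer_Lipschitz_image[OF zero_less_one s this]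
  have "hausdorff_outer s (the_inv_into A f ` f ` A) \<le> hausdorff_outer s (f ` A)" by simp
  then show "hausdorff_outer s A \<le> hausdorff_outer s (f ` A)"
    using inj by (simp add: image_image the_inv_into_f_f cong: image_cong)
qed

lemma hausdorff_outer_translate:
  fixes a :: "'a::real_normed_vector"
  shows "s > 0 \<Longrightarrow> hausdorff_outer s ((\<lambda>x. x + a) ` A) = hausdorff_outer s A"
  by (rule hausdorff_outer_isometry_image) auto

lemma hausdorff_premeasure_single:
  assumes "bounded A" "diameter A \<le> \<delta>" "0 < \<delta>"
  shows "hausdorff_premeasure s \<delta> A \<le> ennreal (unit_ball_vol s * (diameter A / 2) powr s)"
proof -
  let ?C = "\<lambda>n::nat. if n = 0 then A else {}"
  have "hausdorff_premeasure s \<delta> A \<le> (\<Sum>i. ennreal (unit_ball_vol s * (diameter (?C i) / 2) powr s))"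
    by (rule hausdorff_premeasure_le) (use assms in auto)
  also have "\<dots> = (\<Sum>i\<in>{0}. ennreal (unit_ball_vol s * (diameter (?C i) / 2) powr s))"
    by (rule suminf_finite) auto
  finally show ?thesis by simp
qed

lemma hausdorff_premeasure_UN_finite:
  assumes "finite K" "0 < \<delta>"
  shows "hausdorff_premeasure s \<delta> (\<Union>k\<in>K. A k) \<le> (\<Sum>k\<in>K. hausdorff_premeasure s \<delta> (A k))"
  using assms(1)
proof (induction K)
  case (insert k K)
  have "hausdorff_premeasure s \<delta> (\<Union>k\<in>insert k K. A k)
      \<le> hausdorff_premeasure s \<delta> (A k) + hausdorff_premeasure s \<delta> (\<Union>k\<in>K. A k)"
    using hausdorff_premeasure_Un[OF assms(2)] by simp
  then show ?case using insert by (simp add: add_left_mono order_trans)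
qed (simp add: hausdorff_premeasure_empty assms)

lemma powr_DIM: "DIM('a::euclidean_space) \<ge> 2 \<Longrightarrow> x \<ge> 0 \<Longrightarrow> x powr (real DIM('a) - 1) = x ^ (DIM('a) - 1)"
  by (cases "x = 0") (auto simp: powr_realpow[symmetric] of_nat_diff)

abbreviation surface_outer :: "'a::euclidean_space set \<Rightarrow> ennreal" where
  "surface_outer \<equiv> hausdorff_outer (real DIM('a) - 1)"

abbreviation surface_measure :: "'a::euclidean_space measure" where
  "surface_measure \<equiv> hausdorff_measure (real DIM('a) - 1)"

text \<open>The right cylinder of height one over the part of \<open>A\<close> in the hyperplane orthogonal to \<open>b\<close>.\<close>

definition cyl :: "'a::euclidean_space \<Rightarrow> 'a set \<Rightarrow> 'a set" where
  "cyl b A = {x. 0 \<le> x \<bullet> b \<and> x \<bullet> b \<le> 1 \<and> x - (x \<bullet> b) *\<^sub>R b \<in> A}"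

lemma cyl_borel [measurable]:
  assumes [measurable]: "A \<in> sets borel"
  shows "cyl b A \<in> sets borel"
  unfolding cyl_def by measurable

text \<open>By the isodiametric inequality, the cylinder over a set of diameter \<open>d\<close> has at most the volume that
  the Hausdorff premeasure charges for that set; sum over a cover of \<open>A\<close>.  Closures make the
  covering sets measurable without enlarging their diameters.\<close>

lemma emeasure_cyl_le_surface_outer:
  fixes b :: "'a::euclidean_space"
  assumes dim: "DIM('a) \<ge> 2" and b: "b \<in> Basis" and A: "A \<in> sets borel"
  shows "emeasure lborel (cyl b A) \<le> surface_outer A"
proof -
  let ?s = "real DIM('a) - 1"
  let ?w = "\<lambda>d. ennreal (unit_ball_vol ?s * (d / 2) powr ?s)"
  have "emeasure lborel (cyl b A) \<le> hausdorff_premeasure ?s 1 A"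
  proof (rule dense_ge)
    fix x assume "hausdorff_premeasure ?s 1 A < x"
    then obtain C where C: "A \<subseteq> (\<Union>i. C i)" "\<And>i. bounded (C i)" "\<And>i. diameter (C i) \<le> 1"
      "(\<Sum>i. ?w (diameter (C i))) < x" by (rule hausdorff_premeasure_cover) (rule that)
    have "emeasure lborel (cyl b A) \<le> emeasure lborel (\<Union>i. cyl b (closure (C i)))"
    proof (rule emeasure_mono)
      show "cyl b A \<subseteq> (\<Union>i. cyl b (closure (C i)))"
        unfolding cyl_def using C(1) closure_subset by blast
      show "(\<Union>i. cyl b (closure (C i))) \<in> sets lborel" by measurable
    qed
    also have "\<dots> \<le> (\<Sum>i. emeasure lborel (cyl b (closure (C i))))"
      by (rule emeasure_subadditive_countably) auto
    also have "\<dots> \<le> (\<Sum>i. ?w (diameter (C i)))"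
    proof (intro suminf_le summableI)
      fix i
      have d0: "diameter (C i) \<ge> 0" using C(2) by (rule diameter_ge_0)
      have dist: "norm ((x - y) - ((x - y) \<bullet> b) *\<^sub>R b) \<le> diameter (C i)"
        if "x \<in> cyl b (closure (C i))" "y \<in> cyl b (closure (C i))" for x y
      proof -
        have "dist (x - (x \<bullet> b) *\<^sub>R b) (y - (y \<bullet> b) *\<^sub>R b) \<le> diameter (closure (C i))"
          using that C(2) by (intro diameter_bounded_bound) (auto simp: cyl_def)
        moreover have "(x - (x \<bullet> b) *\<^sub>R b) - (y - (y \<bullet> b) *\<^sub>R b) = (x - y) - ((x - y) \<bullet> b) *\<^sub>R b"
          by (simp add: inner_diff_left algebra_simps)
        ultimately show ?thesis using C(2) by (simp add: dist_norm diameter_closure)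
      qed
      have "emeasure lborel (cyl b (closure (C i))) \<le>
          ennreal (unit_ball_vol (real (DIM('a) - 1)) * (diameter (C i) / 2) ^ (DIM('a) - 1))"
        by (rule isodiametric_slab[OF cyl_borel b d0 dist]) (auto simp: cyl_def)
      also have "\<dots> = ?w (diameter (C i))"
        using dim d0 by (subst powr_DIM) (auto simp: of_nat_diff)
      finally show "emeasure lborel (cyl b (closure (C i))) \<le> ?w (diameter (C i))" .
    qed
    finally show "emeasure lborel (cyl b A) \<le> x" using C(4) by simp
  qed
  also have "\<dots> \<le> surface_outer A" by (rule hausdorff_outer_ge) simp
  finally show ?thesis .
qed

locale coordinate_hyperplane =
  fixes b :: "'a::euclidean_space"
  assumes dim: "DIM('a) \<ge> 2" and b: "b \<in> Basis"
begin

text \<open>\<open>P\<close> is the coordinate hyperplane orthogonal to \<open>b\<close> and \<open>Q\<close> its unit cube, which is the union of the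
  cubes \<open>(1/m) Q + corner m k\<close> for \<open>k \<in> idx m\<close>.\<close>

definition P :: "'a set" where "P = {x. x \<bullet> b = 0}"
definition Q :: "'a set" where "Q = {x\<in>P. \<forall>i\<in>Basis. 0 \<le> x \<bullet> i \<and> x \<bullet> i \<le> 1}"
definition corner :: "nat \<Rightarrow> ('a \<Rightarrow> nat) \<Rightarrow> 'a" where
  "corner m k = (\<Sum>i\<in>Basis - {b}. (real (k i) / real m) *\<^sub>R i)"
definition idx :: "nat \<Rightarrow> ('a \<Rightarrow> nat) set" where "idx m = (Basis - {b}) \<rightarrow>\<^sub>E {..<m}"

lemma spos: "real DIM('a) - 1 > 0" "DIM('a) - 1 > 0" using dim by auto

lemma bb: "b \<bullet> b = 1" using b by simp

lemma P_borel [measurable]: "P \<in> sets borel" unfolding P_def by measurable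
lemma Q_eq: "Q = P \<inter> cbox 0 One"
  by (auto simp: Q_def mem_box)
lemma Q_borel [measurable]: "Q \<in> sets borel" unfolding Q_eq by measurable

lemma card_idx: "card (idx m) = m ^ (DIM('a) - 1)" and finite_idx: "finite (idx m)"
  unfolding idx_def using b by (auto simp: card_PiE intro!: finite_PiE)

lemma corner_inner: "i \<in> Basis \<Longrightarrow> corner m k \<bullet> i = (if i = b then 0 else real (k i) / real m)"
  unfolding corner_def by (simp add: inner_sum_left inner_Basis if_distrib cong: if_cong)

lemma Q_subdivide: "m > 0 \<Longrightarrow> Q \<subseteq> (\<Union>k\<in>idx m. (\<lambda>y. (1 / real m) *\<^sub>R y + corner m k) ` Q)"
proof
  fix y assume m: "m > 0" and y: "y \<in> Q"
  define k where "k = restrict (\<lambda>i. min (nat \<lfloor>real m * (y \<bullet> i)\<rfloor>) (m - 1)) (Basis - {b})"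
  have k: "k \<in> idx m" using m by (auto simp: k_def idx_def)
  let ?z = "real m *\<^sub>R (y - corner m k)"
  have "?z \<in> Q"
    unfolding Q_def P_def
  proof (intro CollectI conjI ballI)
    have yb: "y \<bullet> b = 0" using y by (simp add: Q_def P_def)
    show "?z \<bullet> b = 0" using yb b by (simp add: inner_diff_left corner_inner)
    fix i :: 'a assume i: "i \<in> Basis"
    have zi: "?z \<bullet> i = (if i = b then 0 else real m * (y \<bullet> i) - real (k i))"
      using i m yb by (simp add: inner_diff_left corner_inner field_simps)
    have yi: "0 \<le> y \<bullet> i" "y \<bullet> i \<le> 1" using y i by (auto simp: Q_def)
    have myi: "0 \<le> real m * (y \<bullet> i)" "real m * (y \<bullet> i) \<le> real m" using yi m by (auto intro: mult_left_le)
    show "0 \<le> ?z \<bullet> i"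
    proof (cases "i = b")
      case False
      then have "real (k i) \<le> real (nat \<lfloor>real m * (y \<bullet> i)\<rfloor>)" using i by (simp add: k_def)
      also have "\<dots> \<le> real m * (y \<bullet> i)" using myi by simp
      finally show ?thesis using False unfolding zi by simp
    qed (unfold zi, simp)
    show "?z \<bullet> i \<le> 1"
    proof (cases "i = b")
      case False
      have "real m * (y \<bullet> i) \<le> real (nat \<lfloor>real m * (y \<bullet> i)\<rfloor>) + 1" using myi by linarith
      moreover have "real (k i) = min (real (nat \<lfloor>real m * (y \<bullet> i)\<rfloor>)) (real m - 1)"
        using i False m by (simp add: k_def of_nat_diff of_nat_min)
      moreover have "a \<le> f + 1 \<Longrightarrow> k = min f (m - 1) \<Longrightarrow> a \<le> m \<Longrightarrow> a - k \<le> 1" for a f k m :: real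
        by (simp add: min_def split: if_splits)
      ultimately show ?thesis using myi(2) False unfolding zi by presburger
    qed (unfold zi, simp)
  qed
  moreover have "y = (1 / real m) *\<^sub>R ?z + corner m k" using m by simp
  ultimately show "y \<in> (\<Union>k\<in>idx m. (\<lambda>y. (1 / real m) *\<^sub>R y + corner m k) ` Q)"
    using k by blast
qed

lemma surface_outer_scale_le:
  assumes "c > 0"
  shows "surface_outer ((\<lambda>y. c *\<^sub>R y + v) ` A) \<le> ennreal (c ^ (DIM('a) - 1)) * surface_outer (A :: 'a set)"
proof -
  have "surface_outer ((\<lambda>y. c *\<^sub>R y + v) ` A) \<le> ennreal (c powr (real DIM('a) - 1)) * surface_outer A"
    using assms spos by (intro hausdorff_outer_Lipschitz_image) (auto simp: dist_norm simp flip: scaleR_diff_right)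
  then show ?thesis using assms by (simp add: powr_DIM[OF dim])
qed

lemma diameter_small_cube:
  assumes "m > 0"
  shows "bounded ((\<lambda>y. (1 / real m) *\<^sub>R y + v) ` Q)" "diameter ((\<lambda>y. (1 / real m) *\<^sub>R y + v) ` Q) \<le> real DIM('a) / real m"
proof -
  have bQ: "bounded Q" unfolding Q_eq by (simp add: bounded_Int)
  have *: "(\<lambda>y. (1 / real m) *\<^sub>R y + v) ` Q = (\<lambda>y. v + y) ` ((\<lambda>y. (1 / real m) *\<^sub>R y) ` Q)"
    by (simp add: image_image add.commute)
  show bd: "bounded ((\<lambda>y. (1 / real m) *\<^sub>R y + v) ` Q)"
    unfolding * by (intro bounded_translation bounded_scaling bQ)
  show "diameter ((\<lambda>y. (1 / real m) *\<^sub>R y + v) ` Q) \<le> real DIM('a) / real m"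
  proof (rule diameter_le)
    show "(\<lambda>y. (1 / real m) *\<^sub>R y + v) ` Q \<noteq> {} \<or> 0 \<le> real DIM('a) / real m" by simp
    fix x y assume "x \<in> (\<lambda>y. (1 / real m) *\<^sub>R y + v) ` Q" "y \<in> (\<lambda>y. (1 / real m) *\<^sub>R y + v) ` Q"
    then obtain x' y' where xy: "x' \<in> Q" "y' \<in> Q" "x = (1 / real m) *\<^sub>R x' + v" "y = (1 / real m) *\<^sub>R y' + v" by auto
    have "norm (x' - y') \<le> (\<Sum>i\<in>Basis. \<bar>(x' - y') \<bullet> i\<bar>)" by (rule norm_le_l1)
    also have "\<dots> \<le> (\<Sum>i\<in>(Basis::'a set). 1)"
    proof (rule sum_mono)
      fix i :: 'a assume "i \<in> Basis"
      then have "0 \<le> x' \<bullet> i" "x' \<bullet> i \<le> 1" "0 \<le> y' \<bullet> i" "y' \<bullet> i \<le> 1" using xy by (auto simp: Q_def)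
      then show "\<bar>(x' - y') \<bullet> i\<bar> \<le> 1" by (simp add: inner_diff_left)
    qed
    finally have "norm (x' - y') \<le> real DIM('a)" by simp
    moreover have "x - y = (1 / real m) *\<^sub>R (x' - y')" by (simp add: xy algebra_simps)
    ultimately show "norm (x - y) \<le> real DIM('a) / real m" using assms by (simp add: divide_right_mono)
  qed
qed

lemma surface_outer_Q_finite: "surface_outer Q < top"
proof -
  let ?s = "real DIM('a) - 1"
  let ?W = "unit_ball_vol ?s * (real DIM('a) / 2) ^ (DIM('a) - 1)"
  have "hausdorff_premeasure ?s \<delta> Q \<le> ennreal ?W" if d: "\<delta> > 0" for \<delta>
  proof -
    obtain m :: nat where m: "real DIM('a) / \<delta> < real m" using reals_Archimedean2 by blast
    then have m0: "m > 0" using d dim by (auto intro: gr0I simp: field_simps)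
    have dm: "real DIM('a) / real m \<le> \<delta>" using m d m0 by (simp add: field_simps)
    have "hausdorff_premeasure ?s \<delta> Q \<le> hausdorff_premeasure ?s \<delta> (\<Union>k\<in>idx m. (\<lambda>y. (1 / real m) *\<^sub>R y + corner m k) ` Q)"
      by (intro hausdorff_premeasure_mono Q_subdivide m0)
    also have "\<dots> \<le> (\<Sum>k\<in>idx m. hausdorff_premeasure ?s \<delta> ((\<lambda>y. (1 / real m) *\<^sub>R y + corner m k) ` Q))"
      by (intro hausdorff_premeasure_UN_finite finite_idx d)
    also have "\<dots> \<le> (\<Sum>k\<in>idx m. ennreal (unit_ball_vol ?s * ((real DIM('a) / real m) / 2) powr ?s))"
    proof (rule sum_mono)
      fix k
      have "hausdorff_premeasure ?s \<delta> ((\<lambda>y. (1 / real m) *\<^sub>R y + corner m k) ` Q)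
        \<le> ennreal (unit_ball_vol ?s * (diameter ((\<lambda>y. (1 / real m) *\<^sub>R y + corner m k) ` Q) / 2) powr ?s)"
        using diameter_small_cube[OF m0] dm d by (intro hausdorff_premeasure_single) (auto intro: order_trans)
      also have "\<dots> \<le> ennreal (unit_ball_vol ?s * ((real DIM('a) / real m) / 2) powr ?s)"
        using diameter_small_cube[OF m0, of "corner m k"] spos
        by (intro ennreal_leI mult_left_mono powr_mono2 divide_right_mono) (auto simp: diameter_ge_0)
      finally show "hausdorff_premeasure ?s \<delta> ((\<lambda>y. (1 / real m) *\<^sub>R y + corner m k) ` Q)
        \<le> ennreal (unit_ball_vol ?s * ((real DIM('a) / real m) / 2) powr ?s)" .
    qed
    also have "\<dots> = ennreal (real m ^ (DIM('a) - 1) * (unit_ball_vol ?s * ((real DIM('a) / real m) / 2) ^ (DIM('a) - 1)))"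
      using dim spos m0 by (simp add: card_idx powr_DIM ennreal_mult ennreal_of_nat_eq_real_of_nat flip: of_nat_power)
    also have "real m ^ (DIM('a) - 1) * (unit_ball_vol ?s * ((real DIM('a) / real m) / 2) ^ (DIM('a) - 1)) = ?W"
      using m0 by (simp add: power_divide)
    finally show ?thesis .
  qed
  then have "surface_outer Q \<le> ennreal ?W"
    unfolding hausdorff_outer_def by (intro SUP_least) auto
  then show ?thesis by (rule le_less_trans) simp
qed

text \<open>Hausdorff measure restricted to \<open>P\<close>, as a measure on the Borel sets.\<close>

definition M :: "'a measure" where
  "M = distr (density surface_measure (indicator P)) borel (\<lambda>x. x)"

lemma M_sets [simp, measurable_cong]: "sets M = sets borel" and M_space [simp]: "space M = UNIV"
  by (simp_all add: M_def)

lemma emeasure_M: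
  assumes E: "E \<in> sets borel"
  shows "emeasure M E = surface_outer (E \<inter> P)"
proof -
  have meas: "(\<lambda>x. x) \<in> measurable (density surface_measure (indicator P)) (borel :: 'a measure)"
    by (rule measurableI) (auto intro: borel_sets_hausdorff)
  have EP: "E \<in> sets (surface_measure :: 'a measure)" "P \<in> sets (surface_measure :: 'a measure)"
    by (intro borel_sets_hausdorff E P_borel)+
  have "emeasure M E = emeasure (density surface_measure (indicator P)) E"
    unfolding M_def using E by (subst emeasure_distr[OF meas]) auto
  also have "\<dots> = emeasure surface_measure (P \<inter> E)"
    using EP by (subst emeasure_density) (auto simp flip: indicator_inter_arith intro!: borel_measurable_indicator)
  also have "\<dots> = surface_outer (E \<inter> P)"
    using EP by (subst emeasure_hausdorff) (auto simp: Int_commute)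
  finally show ?thesis .
qed

abbreviation big_box :: "nat \<Rightarrow> 'a set" where
  "big_box j \<equiv> cbox (- real j *\<^sub>R One) (real j *\<^sub>R One)"

lemma UN_big_box: "(\<Union>j. big_box j) = UNIV" and mem_big_box: "\<exists>j. x \<in> big_box j"
proof -
  have *: "\<exists>j. x \<in> big_box j" for x
  proof -
    obtain j :: nat where j: "norm x \<le> real j" using real_arch_simple by blast
    have "- real j \<le> x \<bullet> i \<and> x \<bullet> i \<le> real j" if "i \<in> Basis" for i
      using Basis_le_norm[OF that, of x] j by auto
    then show ?thesis by (auto simp: mem_box)
  qed
  then show "(\<Union>j. big_box j) = UNIV" "\<exists>j. x \<in> big_box j" by blast+
qed

lemma M_big_box_finite: "emeasure M (big_box j) < top"
  proof (cases "j = 0")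
    case True
    have "surface_outer (big_box j \<inter> P) \<le> surface_outer Q"
      using True by (intro hausdorff_outer_mono) (auto simp: Q_eq mem_box)
    then show ?thesis using surface_outer_Q_finite by (simp add: emeasure_M)
  next
    case False
    let ?v = "- real j *\<^sub>R (\<Sum>i\<in>Basis - {b}. i)"
    have vi: "?v \<bullet> i = (if i = b then 0 else - real j)" if "i \<in> Basis" for i
      using that by (simp add: inner_sum_left inner_Basis if_distrib cong: if_cong)
    have "big_box j \<inter> P \<subseteq> (\<lambda>y. (2 * real j) *\<^sub>R y + ?v) ` Q"
    proof
      fix x assume x: "x \<in> big_box j \<inter> P"
      let ?y = "(1 / (2 * real j)) *\<^sub>R (x - ?v)"
      have "?y \<bullet> i \<ge> 0 \<and> ?y \<bullet> i \<le> 1" if i: "i \<in> Basis" for i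
      proof -
        have "- real j \<le> x \<bullet> i" "x \<bullet> i \<le> real j" using x i by (auto simp: mem_box)
        moreover have "i = b \<Longrightarrow> x \<bullet> i = 0" using x by (simp add: P_def)
        moreover have yi: "?y \<bullet> i = (x \<bullet> i - ?v \<bullet> i) / (2 * real j)"
          by (simp only: inner_scaleR_left inner_diff_left) simp
        ultimately show ?thesis using False i unfolding yi vi[OF i] by (auto simp: field_simps)
      qed
      moreover have "?y \<bullet> b = 0" using x b vi[OF b] by (simp only: inner_scaleR_left inner_diff_left) (simp add: P_def)
      ultimately have "?y \<in> Q" by (auto simp: Q_def P_def)
      moreover have "x = (2 * real j) *\<^sub>R ?y + ?v" using False by simp
      ultimately show "x \<in> (\<lambda>y. (2 * real j) *\<^sub>R y + ?v) ` Q" by blast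
    qed
    then have "surface_outer (big_box j \<inter> P) \<le> surface_outer ((\<lambda>y. (2 * real j) *\<^sub>R y + ?v) ` Q)"
      by (rule hausdorff_outer_mono)
    also have "\<dots> \<le> ennreal ((2 * real j) ^ (DIM('a) - 1)) * surface_outer Q"
      using False by (intro surface_outer_scale_le) auto
    also have "\<dots> < top" using surface_outer_Q_finite by (simp add: ennreal_mult_less_top)
    finally show ?thesis by (simp add: emeasure_M)
  qed
lemma sigma_finite_M: "sigma_finite_measure M"
proof
  show "\<exists>A. countable A \<and> A \<subseteq> sets M \<and> \<Union> A = space M \<and> (\<forall>a\<in>A. emeasure M a \<noteq> \<infinity>)"
    using M_big_box_finite UN_big_box by (intro exI[of _ "range big_box"]) (auto simp: less_top)
qed

text \<open>The measure \<open>E \<mapsto> \<integral> H(E \<inter> {x \<bullet> b = s}) ds\<close>, where \<open>H\<close> is Hausdorff measure on the slices.  It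
  is translation invariant, hence a multiple of Lebesgue measure.\<close>

definition N :: "'a measure" where
  "N = distr (lborel \<Otimes>\<^sub>M M) borel (\<lambda>(s, y). y + s *\<^sub>R b)"

lemma N_sets [simp, measurable_cong]: "sets N = sets borel" and N_space [simp]: "space N = UNIV"
  by (simp_all add: N_def)

lemma slice_measurable [measurable]:
  assumes [measurable]: "E \<in> sets borel"
  shows "(\<lambda>s::real. emeasure M {y. y + s *\<^sub>R b \<in> E}) \<in> borel_measurable borel"
proof -
  interpret sigma_finite_measure M by (rule sigma_finite_M)
  have m: "{p. snd p + fst p *\<^sub>R b \<in> E} \<in> sets (borel \<Otimes>\<^sub>M M)"
  proof -
    have "(\<lambda>p. snd p + fst p *\<^sub>R b) \<in> (borel \<Otimes>\<^sub>M M) \<rightarrow>\<^sub>M borel" by measurable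
    from measurable_sets[OF this assms] show ?thesis by (simp add: vimage_def space_pair_measure)
  qed
  from measurable_emeasure_Pair[OF m] show ?thesis by (simp add: vimage_def)
qed

lemma emeasure_N:
  assumes E[measurable]: "E \<in> sets borel"
  shows "emeasure N E = (\<integral>\<^sup>+s. emeasure M {y. y + s *\<^sub>R b \<in> E} \<partial>lborel)"
proof -
  interpret sigma_finite_measure M by (rule sigma_finite_M)
  have m: "(\<lambda>(s, y). y + s *\<^sub>R b) \<in> (lborel \<Otimes>\<^sub>M M) \<rightarrow>\<^sub>M borel" by measurable
  have "emeasure N E = emeasure (lborel \<Otimes>\<^sub>M M) ((\<lambda>(s, y). y + s *\<^sub>R b) -` E \<inter> space (lborel \<Otimes>\<^sub>M M))"
    unfolding N_def using m E by (rule emeasure_distr)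
  also have "\<dots> = (\<integral>\<^sup>+s. emeasure M (Pair s -` ((\<lambda>(s, y). y + s *\<^sub>R b) -` E \<inter> space (lborel \<Otimes>\<^sub>M M))) \<partial>lborel)"
    by (rule emeasure_pair_measure_alt) (use m E in measurable)
  finally show ?thesis by (simp add: space_pair_measure vimage_def)
qed

lemma emeasure_M_slice:
  assumes E[measurable]: "E \<in> sets borel"
  shows "emeasure M {y. y + s *\<^sub>R b \<in> E} = surface_outer (E \<inter> {x. x \<bullet> b = s})"
proof -
  have "{y. y + s *\<^sub>R b \<in> E} \<in> sets borel" by measurable
  then have "emeasure M {y. y + s *\<^sub>R b \<in> E} = surface_outer ({y. y + s *\<^sub>R b \<in> E} \<inter> P)" by (rule emeasure_M)
  also have "\<dots> = surface_outer ((\<lambda>x. x + s *\<^sub>R b) ` ({y. y + s *\<^sub>R b \<in> E} \<inter> P))"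
    using spos by (simp add: hausdorff_outer_translate)
  also have "(\<lambda>x. x + s *\<^sub>R b) ` ({y. y + s *\<^sub>R b \<in> E} \<inter> P) = E \<inter> {x. x \<bullet> b = s}"
  proof safe
    fix x assume "x \<in> E" "s = x \<bullet> b"
    then show "x \<in> (\<lambda>x'. x' + (x \<bullet> b) *\<^sub>R b) ` ({y. y + (x \<bullet> b) *\<^sub>R b \<in> E} \<inter> P)"
      by (intro image_eqI[of _ _ "x - (x \<bullet> b) *\<^sub>R b"]) (auto simp: P_def inner_diff_left bb)
  qed (auto simp: P_def inner_add_left bb)
  finally show ?thesis .
qed

lemma N_translation: "distr N borel (\<lambda>x. x + a) = N"
proof (rule measure_eqI)
  fix E assume "E \<in> sets (distr N borel (\<lambda>x. x + a))"
  then have E[measurable]: "E \<in> sets borel" by simp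
  have E': "{x. x + a \<in> E} \<in> sets borel" by measurable
  have "emeasure (distr N borel (\<lambda>x. x + a)) E = emeasure N {x. x + a \<in> E}"
    by (subst emeasure_distr) (auto simp: vimage_def)
  also have "\<dots> = (\<integral>\<^sup>+s. surface_outer ({x. x + a \<in> E} \<inter> {x. x \<bullet> b = s}) \<partial>lborel)"
    by (simp only: emeasure_N[OF E'] emeasure_M_slice[OF E'])
  also have "\<dots> = (\<integral>\<^sup>+s. emeasure M {y. y + (s + a \<bullet> b) *\<^sub>R b \<in> E} \<partial>lborel)"
  proof (rule nn_integral_cong)
    fix s :: real
    have "(\<lambda>x. x + a) ` ({x. x + a \<in> E} \<inter> {x. x \<bullet> b = s}) = E \<inter> {x. x \<bullet> b = s + a \<bullet> b}"
    proof safe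
      fix x assume "x \<in> E" "x \<bullet> b = s + a \<bullet> b"
      then show "x \<in> (\<lambda>x. x + a) ` ({x. x + a \<in> E} \<inter> {x. x \<bullet> b = s})"
        by (intro image_eqI[of _ _ "x - a"]) (auto simp: inner_diff_left)
    qed (auto simp: inner_add_left)
    then show "surface_outer ({x. x + a \<in> E} \<inter> {x. x \<bullet> b = s}) = emeasure M {y. y + (s + a \<bullet> b) *\<^sub>R b \<in> E}"
      using hausdorff_outer_translate[OF spos(1), of a "{x. x + a \<in> E} \<inter> {x. x \<bullet> b = s}"]
      by (simp add: emeasure_M_slice[OF E])
  qed
  also have "\<dots> = emeasure N E"
    unfolding emeasure_N[OF E] by (rule nn_integral_lborel_shift[of "\<lambda>s. emeasure M {y. y + s *\<^sub>R b \<in> E}"]) measurable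
  finally show "emeasure (distr N borel (\<lambda>x. x + a)) E = emeasure N E" .
qed simp

lemma emeasure_N_cyl:
  assumes A[measurable]: "A \<in> sets borel" and AP: "A \<subseteq> P"
  shows "emeasure N (cyl b A) = surface_outer A"
proof -
  have cylA: "cyl b A \<in> sets borel" by measurable
  have "emeasure N (cyl b A) = (\<integral>\<^sup>+s. surface_outer A * indicator {0..1::real} s \<partial>lborel)"
    unfolding emeasure_N[OF cylA]
  proof (rule nn_integral_cong)
    fix s :: real
    have "{y. y + s *\<^sub>R b \<in> cyl b A} \<in> sets borel" by measurable
    moreover have "{y. y + s *\<^sub>R b \<in> cyl b A} \<inter> P = (if s \<in> {0..1} then A else {})"
      using AP by (auto simp: cyl_def P_def inner_add_left bb)
    ultimately show "emeasure M {y. y + s *\<^sub>R b \<in> cyl b A} = surface_outer A * indicator {0..1} s"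
      by (simp add: emeasure_M)
  qed
  also have "\<dots> = surface_outer A" by (simp add: nn_integral_cmult)
  finally show ?thesis .
qed

lemma sigma_finite_N: "sigma_finite_measure N"
proof
  let ?A = "\<lambda>j::nat. {x. \<bar>x \<bullet> b\<bar> \<le> real j \<and> x - (x \<bullet> b) *\<^sub>R b \<in> big_box j} :: 'a set"
  have A: "?A j \<in> sets borel" for j by measurable
  have "emeasure N (?A j) < top" for j
  proof -
    have "emeasure N (?A j) \<le> (\<integral>\<^sup>+s. emeasure M (big_box j) * indicator {- real j..real j} s \<partial>lborel)"
      unfolding emeasure_N[OF A]
    proof (rule nn_integral_mono)
      fix s :: real
      have m: "{y. y + s *\<^sub>R b \<in> ?A j} \<in> sets borel" by measurable
      have "{y. y + s *\<^sub>R b \<in> ?A j} \<inter> P \<subseteq> (if s \<in> {- real j..real j} then big_box j \<inter> P else {})"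
        by (auto simp: P_def inner_add_left bb)
      then have "surface_outer ({y. y + s *\<^sub>R b \<in> ?A j} \<inter> P) \<le> surface_outer (if s \<in> {- real j..real j} then big_box j \<inter> P else {})"
        by (rule hausdorff_outer_mono)
      then show "emeasure M {y. y + s *\<^sub>R b \<in> ?A j} \<le> emeasure M (big_box j) * indicator {- real j..real j} s"
        unfolding emeasure_M[OF m] by (simp add: emeasure_M split: if_splits)
    qed
    also have "\<dots> = emeasure M (big_box j) * ennreal (2 * real j)"
      by (simp add: nn_integral_cmult)
    also have "\<dots> < top" using M_big_box_finite by (simp add: ennreal_mult_less_top)
    finally show ?thesis .
  qed
  moreover have "(\<Union>j. ?A j) = UNIV"
  proof -
    have "x \<in> (\<Union>j. ?A j)" for x
    proof -
      obtain j1 :: nat where j1: "x - (x \<bullet> b) *\<^sub>R b \<in> big_box j1" using mem_big_box by blast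
      obtain j2 :: nat where j2: "\<bar>x \<bullet> b\<bar> \<le> real j2" using real_arch_simple by blast
      have "big_box j1 \<subseteq> big_box (max j1 j2)" by (simp add: subset_box)
      then have "x \<in> ?A (max j1 j2)" using j1 j2 by (auto simp: le_max_iff_disj)
      then show ?thesis by blast
    qed
    then show ?thesis by blast
  qed
  ultimately show "\<exists>A. countable A \<and> A \<subseteq> sets N \<and> \<Union> A = space N \<and> (\<forall>a\<in>A. emeasure N a \<noteq> \<infinity>)"
    using A by (intro exI[of _ "range ?A"]) (auto simp: less_top)
qed

lemma cyl_Q: "cyl b Q = cbox 0 One"
proof safe
  fix x assume x: "x \<in> cyl b Q"
  show "x \<in> cbox 0 One"
    unfolding mem_box
  proof (intro ballI)
    fix i :: 'a assume i: "i \<in> Basis"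
    show "0 \<bullet> i \<le> x \<bullet> i \<and> x \<bullet> i \<le> One \<bullet> i"
    proof (cases "i = b")
      case False
      then have "(x - (x \<bullet> b) *\<^sub>R b) \<bullet> i = x \<bullet> i" using i b by (simp add: inner_diff_left inner_Basis)
      then show ?thesis using x i by (auto simp: cyl_def Q_def)
    qed (use x b in \<open>auto simp: cyl_def\<close>)
  qed
next
  fix x :: 'a assume x: "x \<in> cbox 0 One"
  have "(x - (x \<bullet> b) *\<^sub>R b) \<bullet> i = (if i = b then 0 else x \<bullet> i)" if "i \<in> Basis" for i
    using that b by (simp add: inner_diff_left inner_Basis)
  then show "x \<in> cyl b Q" using x b by (auto simp: cyl_def Q_def P_def mem_box)
qed

lemma emeasure_N_scaled: "E \<in> sets borel \<Longrightarrow> emeasure N E = surface_outer Q * emeasure lborel E"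
proof -
  assume E: "E \<in> sets borel"
  have "emeasure N (cbox 0 One) = surface_outer Q"
    using cyl_Q emeasure_N_cyl[of Q] by (auto simp: Q_eq)
  moreover have "emeasure lborel (cbox 0 One :: 'a set) = 1"
    by (simp add: emeasure_lborel_cbox)
  ultimately show ?thesis
    using translation_invariant_measure_unique[OF N_sets sigma_finite_N N_translation E, of "cbox 0 One"] by simp
qed

lemma surface_outer_scaled: "A \<in> sets borel \<Longrightarrow> A \<subseteq> P \<Longrightarrow> surface_outer A = surface_outer Q * emeasure lborel (cyl b A)"
  using emeasure_N_cyl[of A] emeasure_N_scaled[of "cyl b A"] by simp

text \<open>The ball inscribed in \<open>Q\<close>.\<close>

definition mid :: 'a where "mid = (1/2) *\<^sub>R (\<Sum>i\<in>Basis - {b}. i)"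
definition B :: "'a set" where "B = cball mid (1/2) \<inter> P"

lemma B_borel [measurable]: "B \<in> sets borel" unfolding B_def by measurable

lemma mid_inner: "i \<in> Basis \<Longrightarrow> mid \<bullet> i = (if i = b then 0 else 1/2)"
  unfolding mid_def by (simp add: inner_sum_left inner_Basis if_distrib cong: if_cong)

lemma B_sub: "B \<subseteq> Q"
proof
  fix x assume x: "x \<in> B"
  have "0 \<le> x \<bullet> i \<and> x \<bullet> i \<le> 1" if i: "i \<in> Basis" for i
  proof (cases "i = b")
    case False
    have "\<bar>(x - mid) \<bullet> i\<bar> \<le> 1/2"
      using x Basis_le_norm[OF i, of "x - mid"]
      by (auto simp: B_def dist_norm norm_minus_commute)
    then have le: "\<bar>x \<bullet> i - 1/2\<bar> \<le> 1/2" using False by (simp only: inner_diff_left mid_inner[OF i]) auto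
    show ?thesis using abs_le_D1[OF le] abs_le_D2[OF le] by auto
  qed (use x in \<open>auto simp: B_def P_def\<close>)
  then show "x \<in> Q" using x by (auto simp: Q_def B_def)
qed

lemma emeasure_cyl_B: "emeasure lborel (cyl b B) = ennreal (unit_ball_vol (real (DIM('a) - 1)) * (1/2) ^ (DIM('a) - 1))"
proof -
  let ?C = "{x::'a. norm (x - (x \<bullet> b) *\<^sub>R b) \<le> 1/2 \<and> 0 \<le> x \<bullet> b \<and> x \<bullet> b \<le> 1}"
  have vb: "mid \<bullet> b = 0" using mid_inner[OF b] by simp
  have [measurable]: "?C \<in> sets borel" by measurable
  have "x - mid \<in> ?C \<longleftrightarrow> x \<in> cyl b B" for x
  proof -
    have "(x - mid) - ((x - mid) \<bullet> b) *\<^sub>R b = (x - (x \<bullet> b) *\<^sub>R b) - mid" "(x - mid) \<bullet> b = x \<bullet> b"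
      unfolding inner_diff_left vb by (simp_all add: algebra_simps)
    then show ?thesis unfolding cyl_def B_def P_def mem_Collect_eq mem_cball Int_iff dist_norm
      by (simp only: norm_minus_commute[of mid]) (auto simp: inner_diff_left bb)
  qed
  then have "emeasure lborel (cyl b B) = (\<integral>\<^sup>+x. indicator ?C (x + - mid) \<partial>lborel)"
  proof -
    assume *: "\<And>x. x - mid \<in> ?C \<longleftrightarrow> x \<in> cyl b B"
    have "emeasure lborel (cyl b B) = (\<integral>\<^sup>+x. indicator (cyl b B) x \<partial>lborel)"
      by (rule nn_integral_indicator[symmetric]) simp
    also have "\<dots> = (\<integral>\<^sup>+x. indicator ?C (x + - mid) \<partial>lborel)"
    proof (rule nn_integral_cong)
      show "indicator (cyl b B) x = (indicator ?C (x + - mid) :: ennreal)" for x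
        unfolding indicator_def using *[of x] by simp
    qed
    finally show ?thesis .
  qed
  also have "\<dots> = (\<integral>\<^sup>+x. indicator ?C x \<partial>lborel)" by (rule nn_integral_lborel_shift) measurable
  also have "\<dots> = ennreal (unit_ball_vol (real (DIM('a) - 1)) * (1/2) ^ (DIM('a) - 1))" using emeasure_cylinder[OF b, of "1/2"] by simp
  finally show ?thesis .
qed

lemma surface_outer_Q_ge: "1 \<le> surface_outer Q"
proof -
  have "emeasure lborel (cyl b Q) \<le> surface_outer Q"
    by (rule emeasure_cyl_le_surface_outer[OF dim b]) measurable
  then show ?thesis by (simp add: cyl_Q emeasure_lborel_cbox)
qed

text \<open>Cut \<open>Q\<close> into small cubes and cover each of them by its inscribed ball, which costs exactly the volume
  of the ball, and by an optimal cover of the rest.  With \<open>c\<close> the measure of \<open>Q\<close> and \<open>|B|\<close> the volume of the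
  inscribed ball, which by \<open>surface_outer_scaled\<close> has measure \<open>c |B|\<close>, this gives
  \<open>c \<le> |B| + c (1 - |B|)\<close> and so \<open>c \<le> 1\<close>.\<close>

lemma surface_outer_Q_le: "surface_outer Q \<le> 1"
proof -
  let ?s = "real DIM('a) - 1"
  define c where "c = enn2real (surface_outer Q)"
  have c: "surface_outer Q = ennreal c" "0 \<le> c"
    using surface_outer_Q_finite by (auto simp: c_def)
  have BP: "B \<subseteq> P" by (auto simp: B_def)
  have HB: "surface_outer B = ennreal (c * (unit_ball_vol (real (DIM('a) - 1)) * (1/2) ^ (DIM('a) - 1)))"
    using surface_outer_scaled[OF B_borel BP] c by (simp add: emeasure_cyl_B ennreal_mult)
  have split: "surface_outer Q = surface_outer B + surface_outer (Q - B)"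
  proof -
    have "emeasure surface_measure (B \<union> (Q - B)) = emeasure surface_measure B + emeasure surface_measure (Q - B)"
      by (rule plus_emeasure[symmetric]) (auto intro!: borel_sets_hausdorff)
    then show ?thesis using B_sub
      by (simp add: emeasure_hausdorff borel_sets_hausdorff Un_absorb1)
  qed
  then obtain h where h: "surface_outer (Q - B) = ennreal h" "0 \<le> h"
    using c by (cases "surface_outer (Q - B)") auto
  \<comment> \<open>here \<open>h\<close> is the measure \<open>c (1 - |B|)\<close> of the part outside the ball\<close>
  have ch: "c = c * (unit_ball_vol (real (DIM('a) - 1)) * (1/2) ^ (DIM('a) - 1)) + h" using split c h HB by (simp flip: ennreal_plus)
  have "hausdorff_premeasure ?s \<delta> Q \<le> ennreal ((unit_ball_vol (real (DIM('a) - 1)) * (1/2) ^ (DIM('a) - 1)) + h)" if d: "\<delta> > 0" for \<delta>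
  proof -
    obtain m :: nat where m: "1 / \<delta> < real m" using reals_Archimedean2 by blast
    then have m0: "m > 0" using d by (auto intro: gr0I simp: field_simps)
    have dm: "1 / real m \<le> \<delta>" using m d m0 by (simp add: field_simps)
    let ?T = "\<lambda>k y. (1 / real m) *\<^sub>R y + corner m k"
    have "hausdorff_premeasure ?s \<delta> Q \<le> hausdorff_premeasure ?s \<delta> (\<Union>k\<in>idx m. ?T k ` Q)"
      by (intro hausdorff_premeasure_mono Q_subdivide m0)
    also have "\<dots> \<le> (\<Sum>k\<in>idx m. hausdorff_premeasure ?s \<delta> (?T k ` Q))"
      by (intro hausdorff_premeasure_UN_finite finite_idx d)
    also have "\<dots> \<le> (\<Sum>k\<in>idx m. ennreal (unit_ball_vol ?s * ((1 / real m) / 2) powr ?s) + ennreal ((1 / real m) ^ (DIM('a) - 1)) * ennreal h)"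
    proof (rule sum_mono)
      fix k
      have "?T k ` B \<subseteq> cball (?T k mid) (1 / real m / 2)"
      proof
        fix z assume "z \<in> ?T k ` B"
        then obtain y where y: "y \<in> B" "z = ?T k y" by blast
        have "?T k mid - z = (1 / real m) *\<^sub>R (mid - y)" by (simp add: y(2) scaleR_diff_right)
        then have "norm (?T k mid - z) = (1 / real m) * norm (mid - y)" by simp
        also have "\<dots> \<le> (1 / real m) * (1 / 2)"
          using y(1) by (intro mult_left_mono) (auto simp: B_def dist_norm)
        finally show "z \<in> cball (?T k mid) (1 / real m / 2)" by (simp add: dist_norm)
      qed
      from bounded_subset[OF bounded_cball this] diameter_subset[OF this bounded_cball]
      have BB: "bounded (?T k ` B)" "diameter (?T k ` B) \<le> 1 / real m"
        using m0 by (auto simp: diameter_cball)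
      have TQ: "?T k ` Q = ?T k ` B \<union> ?T k ` (Q - B)" using B_sub by blast
      have "hausdorff_premeasure ?s \<delta> (?T k ` Q) \<le> hausdorff_premeasure ?s \<delta> (?T k ` B) + hausdorff_premeasure ?s \<delta> (?T k ` (Q - B))"
        by (subst TQ) (rule hausdorff_premeasure_Un[OF d])
      also have "hausdorff_premeasure ?s \<delta> (?T k ` B) \<le> ennreal (unit_ball_vol ?s * (diameter (?T k ` B) / 2) powr ?s)"
        using BB dm d by (intro hausdorff_premeasure_single) auto
      also have "\<dots> \<le> ennreal (unit_ball_vol ?s * ((1 / real m) / 2) powr ?s)"
        using BB spos by (intro ennreal_leI mult_left_mono powr_mono2 divide_right_mono) (auto simp: diameter_ge_0)
      also have "hausdorff_premeasure ?s \<delta> (?T k ` (Q - B)) \<le> surface_outer (?T k ` (Q - B))"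
        using d by (rule hausdorff_outer_ge)
      also have "\<dots> \<le> ennreal ((1 / real m) ^ (DIM('a) - 1)) * ennreal h"
        using m0 h(1) surface_outer_scale_le[of "1 / real m" "corner m k" "Q - B"] by simp
      finally show "hausdorff_premeasure ?s \<delta> (?T k ` Q) \<le>
          ennreal (unit_ball_vol ?s * ((1 / real m) / 2) powr ?s) + ennreal ((1 / real m) ^ (DIM('a) - 1)) * ennreal h"
        by (simp add: add_mono)
    qed
    also have "\<dots> = ennreal (real m ^ (DIM('a) - 1) * (unit_ball_vol ?s * ((1 / real m) / 2) ^ (DIM('a) - 1) + (1 / real m) ^ (DIM('a) - 1) * h))"
    proof -
      have p: "(1 / real m / 2) powr ?s = (1 / real m / 2) ^ (DIM('a) - 1)" by (rule powr_DIM[OF dim]) simp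
      have add: "ennreal X + ennreal Y * ennreal h = ennreal (X + Y * h)" if "X \<ge> 0" "Y \<ge> 0" for X Y
        using that h(2) by (simp add: ennreal_mult)
      have sum: "(\<Sum>k\<in>idx m. ennreal Z) = ennreal (real m ^ (DIM('a) - 1) * Z)" if "Z \<ge> 0" for Z
        using that by (simp add: card_idx ennreal_mult ennreal_of_nat_eq_real_of_nat)
      have u: "0 \<le> unit_ball_vol ?s" using spos by simp
      show ?thesis unfolding p
        by (subst add; (subst sum)?) (use u h(2) in simp_all)
    qed
    also have "real m ^ (DIM('a) - 1) * (unit_ball_vol ?s * ((1 / real m) / 2) ^ (DIM('a) - 1) + (1 / real m) ^ (DIM('a) - 1) * h) = (unit_ball_vol (real (DIM('a) - 1)) * (1/2) ^ (DIM('a) - 1)) + h"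
      using m0 dim by (simp add: power_divide of_nat_diff field_simps)
    finally show ?thesis .
  qed
  then have "surface_outer Q \<le> ennreal ((unit_ball_vol (real (DIM('a) - 1)) * (1/2) ^ (DIM('a) - 1)) + h)"
    unfolding hausdorff_outer_def by (intro SUP_least) auto
  then have "ennreal c \<le> ennreal ((unit_ball_vol (real (DIM('a) - 1)) * (1/2) ^ (DIM('a) - 1)) + h)" by (simp only: c(1))
  then have "c \<le> (unit_ball_vol (real (DIM('a) - 1)) * (1/2) ^ (DIM('a) - 1)) + h"
    by (subst (asm) ennreal_le_iff) (use h(2) in auto)
  with ch have "c * (unit_ball_vol (real (DIM('a) - 1)) * (1/2) ^ (DIM('a) - 1)) + h \<le> (unit_ball_vol (real (DIM('a) - 1)) * (1/2) ^ (DIM('a) - 1)) + h" by metis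
  then have "c * (unit_ball_vol (real (DIM('a) - 1)) * (1/2) ^ (DIM('a) - 1)) \<le> 1 * (unit_ball_vol (real (DIM('a) - 1)) * (1/2) ^ (DIM('a) - 1))" by simp
  then have "c \<le> 1" by (rule mult_right_le_imp_le) simp
  then show ?thesis using c by simp
qed

theorem linear_coarea_coordinate:
  assumes E: "E \<in> sets borel"
  shows "(\<lambda>s. surface_outer (E \<inter> {x. x \<bullet> b = s})) \<in> borel_measurable borel"
    and "(\<integral>\<^sup>+s. surface_outer (E \<inter> {x. x \<bullet> b = s}) \<partial>lborel) = emeasure lborel E"
proof -
  have "surface_outer Q = 1" using surface_outer_Q_le surface_outer_Q_ge by (rule antisym)
  then show "(\<integral>\<^sup>+s. surface_outer (E \<inter> {x. x \<bullet> b = s}) \<partial>lborel) = emeasure lborel E"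
    using emeasure_N[OF E] emeasure_N_scaled[OF E] by (simp add: emeasure_M_slice[OF E])
  show "(\<lambda>s. surface_outer (E \<inter> {x. x \<bullet> b = s})) \<in> borel_measurable borel"
    using slice_measurable[OF E] by (simp only: emeasure_M_slice[OF E])
qed

end

section \<open>Straightening a function near a point\<close>

text \<open>The reflection exchanging the unit vectors \<open>e\<close> and \<open>b\<close> (the identity for \<open>e = b\<close>, because of \<open>x / 0 = 0\<close>).\<close>

definition swap_reflection :: "'a::euclidean_space \<Rightarrow> 'a \<Rightarrow> 'a \<Rightarrow> 'a" where
  "swap_reflection e b x = x - (2 * (x \<bullet> (e - b)) / ((e - b) \<bullet> (e - b))) *\<^sub>R (e - b)"

context
  fixes e b :: "'a::euclidean_space"
  assumes e: "norm e = 1" and b: "norm b = 1"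
begin

lemma ee_bb: "e \<bullet> e = 1" "b \<bullet> b = 1" using e b by (simp_all add: norm_eq_1)

lemma linear_swap_reflection: "linear (swap_reflection e b)"
proof -
  define u where "u = e - b"
  define w where "w = (2 / (u \<bullet> u)) *\<^sub>R u"
  have "swap_reflection e b = (\<lambda>x. x - (x \<bullet> u) *\<^sub>R w)"
    by (simp add: swap_reflection_def u_def[symmetric] w_def fun_eq_iff mult.commute)
  moreover have "linear (\<lambda>x. x - (x \<bullet> u) *\<^sub>R w)"
    by (rule linearI) (simp_all add: inner_add_left scaleR_add_left scaleR_diff_right)
  ultimately show ?thesis by simp
qed

lemma swap_reflection_involution: "swap_reflection e b (swap_reflection e b x) = x"
proof (cases "e = b")
  case False
  define w where "w = e - b"
  have w: "w \<bullet> w \<noteq> 0" using False by (simp add: w_def)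
  define c where "c = 2 * (x \<bullet> w) / (w \<bullet> w)"
  have "(x - c *\<^sub>R w) \<bullet> w = - (x \<bullet> w)" using w by (simp add: inner_diff_left c_def)
  then have "2 * ((x - c *\<^sub>R w) \<bullet> w) / (w \<bullet> w) = - c" by (simp add: c_def)
  then show ?thesis by (simp add: swap_reflection_def w_def[symmetric] c_def[symmetric])
qed (simp add: swap_reflection_def)

lemma norm_swap_reflection: "norm (swap_reflection e b x) = norm x"
proof (cases "e = b")
  case False
  define w where "w = e - b"
  have w: "w \<bullet> w \<noteq> 0" using False by (simp add: w_def)
  define c where "c = 2 * (x \<bullet> w) / (w \<bullet> w)"
  have cw: "c * (w \<bullet> w) = 2 * (x \<bullet> w)" using w by (simp add: c_def)
  have "(x - c *\<^sub>R w) \<bullet> (x - c *\<^sub>R w) = x \<bullet> x - 2 * c * (x \<bullet> w) + c * (c * (w \<bullet> w))"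
    by (simp add: inner_diff_left inner_diff_right inner_commute[of w x] algebra_simps)
  also have "\<dots> = x \<bullet> x" unfolding cw by simp
  finally show ?thesis by (simp add: swap_reflection_def norm_eq_sqrt_inner c_def w_def)
qed (simp add: swap_reflection_def)

lemma dist_swap_reflection: "dist (swap_reflection e b x) (swap_reflection e b y) = dist x y"
  unfolding dist_norm by (metis linear_diff[OF linear_swap_reflection] norm_swap_reflection)

lemma swap_reflection_inner: "swap_reflection e b x \<bullet> b = x \<bullet> e"
proof (cases "e = b")
  case False
  have ww: "(e - b) \<bullet> (e - b) = - 2 * ((e - b) \<bullet> b)"
    by (simp add: inner_diff_left inner_diff_right ee_bb inner_commute)
  moreover have "(e - b) \<bullet> (e - b) \<noteq> 0" using False by simp
  ultimately have "2 * (x \<bullet> (e - b)) / ((e - b) \<bullet> (e - b)) * ((e - b) \<bullet> b) = - (x \<bullet> (e - b))"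
    by (simp add: field_simps)
  then show ?thesis by (simp add: swap_reflection_def inner_diff_left[of x] inner_diff_right)
qed (simp add: swap_reflection_def)

lemma swap_reflection_measurable [measurable]: "swap_reflection e b \<in> borel \<rightarrow>\<^sub>M borel"
  unfolding swap_reflection_def by measurable

lemma swap_reflection_image: "swap_reflection e b ` A = swap_reflection e b -` A"
proof safe
  fix x assume "swap_reflection e b x \<in> A"
  then have "swap_reflection e b (swap_reflection e b x) \<in> swap_reflection e b ` A" by (rule imageI)
  then show "x \<in> swap_reflection e b ` A" by (simp only: swap_reflection_involution)
qed (simp add: swap_reflection_involution)

lemma emeasure_swap_reflection:
  assumes E[measurable]: "E \<in> sets borel"
  shows "emeasure lborel (swap_reflection e b -` E) = emeasure lborel E"
proof -
  let ?R = "swap_reflection e b"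
  let ?\<nu> = "distr lborel borel ?R"
  have em: "emeasure ?\<nu> A = emeasure lborel (?R -` A)" if "A \<in> sets borel" for A
    using that by (subst emeasure_distr) auto
  have ball: "?R -` cball 0 r = cball 0 r" for r by (auto simp: norm_swap_reflection)
  have sf: "sigma_finite_measure ?\<nu>"
  proof
    have "(\<Union>j::nat. cball 0 (real j) :: 'a set) = UNIV"
      using real_arch_simple by auto
    then show "\<exists>A. countable A \<and> A \<subseteq> sets ?\<nu> \<and> \<Union> A = space ?\<nu> \<and> (\<forall>a\<in>A. emeasure ?\<nu> a \<noteq> \<infinity>)"
      by (intro exI[of _ "range (\<lambda>j::nat. cball 0 (real j))"]) (auto simp: em ball emeasure_cball)
  qed
  have inv: "distr ?\<nu> borel (\<lambda>x. x + a) = ?\<nu>" for a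
  proof -
    have "distr ?\<nu> borel (\<lambda>x. x + a) = distr lborel borel (\<lambda>x. ?R x + a)"
      by (subst distr_distr) (auto simp: comp_def)
    also have "(\<lambda>x. ?R x + a) = ?R \<circ> (+) (?R a)"
      by (simp add: fun_eq_iff linear_add[OF linear_swap_reflection] swap_reflection_involution add.commute)
    also have "distr lborel borel (?R \<circ> (+) (?R a)) = distr (distr lborel borel ((+) (?R a))) borel ?R"
      by (subst distr_distr) auto
    also have "\<dots> = ?\<nu>" by (simp add: lborel_distr_plus)
    finally show ?thesis .
  qed
  have "emeasure ?\<nu> (cball 0 1) * emeasure lborel E = emeasure ?\<nu> E * emeasure lborel (cball 0 1 :: 'a set)"
    by (rule translation_invariant_measure_unique[OF _ sf inv]) auto
  then have "emeasure lborel E * emeasure lborel (cball 0 1 :: 'a set) = emeasure lborel (?R -` E) * emeasure lborel (cball 0 1 :: 'a set)"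
    by (simp add: em ball mult.commute)
  moreover have "emeasure lborel (cball 0 1 :: 'a set) \<noteq> 0" "emeasure lborel (cball 0 1 :: 'a set) \<noteq> top"
    using unit_ball_vol_pos[of "real DIM('a)"] by (auto simp: emeasure_cball simp del: unit_ball_vol_pos)
  ultimately show ?thesis
    by (metis ennreal_mult_divide_eq)
qed

end

text \<open>A reflection is an isometry that preserves both measures and carries \<open>e\<close> to a basis vector.\<close>

lemma linear_coarea_unit:
  fixes e :: "'a::euclidean_space"
  assumes dim: "DIM('a) \<ge> 2" and e: "norm e = 1" and E[measurable]: "E \<in> sets borel"
  shows "(\<lambda>s. surface_outer (E \<inter> {x. x \<bullet> e = s})) \<in> borel_measurable borel"
    and "(\<integral>\<^sup>+s. surface_outer (E \<inter> {x. x \<bullet> e = s}) \<partial>lborel) = emeasure lborel E"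
proof -
  obtain b :: 'a where b: "b \<in> Basis" using nonempty_Basis by blast
  then have nb: "norm b = 1" by simp
  interpret coordinate_hyperplane b using dim b by unfold_locales
  let ?R = "swap_reflection e b"
  let ?E = "?R -` E"
  have mE: "?E \<in> sets borel"
    using measurable_sets[OF swap_reflection_measurable[OF e nb] E] by simp
  have "surface_outer (E \<inter> {x. x \<bullet> e = s}) = surface_outer (?E \<inter> {x. x \<bullet> b = s})" for s
  proof -
    have RI: "?R x \<bullet> e = x \<bullet> b" for x
      using swap_reflection_inner[OF e nb, of "?R x"] by (simp add: swap_reflection_involution[OF e nb])
    have "?R ` (E \<inter> {x. x \<bullet> e = s}) = ?E \<inter> {x. x \<bullet> b = s}"
      unfolding swap_reflection_image[OF e nb]
      by (auto simp: RI)
    moreover have "surface_outer (?R ` (E \<inter> {x. x \<bullet> e = s})) = surface_outer (E \<inter> {x. x \<bullet> e = s})"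
      by (rule hausdorff_outer_isometry_image) (use spos dist_swap_reflection[OF e nb] in auto)
    ultimately show ?thesis by simp
  qed
  then show "(\<lambda>s. surface_outer (E \<inter> {x. x \<bullet> e = s})) \<in> borel_measurable borel"
    "(\<integral>\<^sup>+s. surface_outer (E \<inter> {x. x \<bullet> e = s}) \<partial>lborel) = emeasure lborel E"
    using linear_coarea_coordinate[OF mE] emeasure_swap_reflection[OF e nb E] by simp_all
qed

lemma linear_coarea:
  fixes v :: "'a::euclidean_space"
  assumes dim: "DIM('a) \<ge> 2" and v: "v \<noteq> 0" and E[measurable]: "E \<in> sets borel"
  shows "(\<lambda>s. surface_outer (E \<inter> {x. x \<bullet> v = s})) \<in> borel_measurable borel"
    and "(\<integral>\<^sup>+s. surface_outer (E \<inter> {x. x \<bullet> v = s}) \<partial>lborel) = ennreal (norm v) * emeasure lborel E"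
proof -
  let ?e = "(1 / norm v) *\<^sub>R v"
  have e: "norm ?e = 1" using v by simp
  have eq: "{x. x \<bullet> v = s} = {x. x \<bullet> ?e = s / norm v}" for s using v by (auto simp: field_simps)
  have m: "(\<lambda>s. surface_outer (E \<inter> {x. x \<bullet> ?e = s})) \<in> borel_measurable borel"
    by (rule linear_coarea_unit[OF dim e E])
  have "(\<lambda>s. surface_outer (E \<inter> {x. x \<bullet> ?e = s / norm v})) \<in> borel_measurable borel"
    by (rule measurable_compose[OF _ m]) simp
  then show m2: "(\<lambda>s. surface_outer (E \<inter> {x. x \<bullet> v = s})) \<in> borel_measurable borel"
    unfolding eq .
  have "(\<integral>\<^sup>+s. surface_outer (E \<inter> {x. x \<bullet> v = s}) \<partial>lborel)
      = ennreal (norm v) * (\<integral>\<^sup>+s. surface_outer (E \<inter> {x. x \<bullet> v = 0 + norm v * s}) \<partial>lborel)"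
    using v by (subst nn_integral_real_affine[OF m2, of "norm v" 0]) auto
  also have "(\<integral>\<^sup>+s. surface_outer (E \<inter> {x. x \<bullet> v = 0 + norm v * s}) \<partial>lborel) = emeasure lborel E"
    unfolding eq using v linear_coarea_unit(2)[OF dim e E] by simp
  finally show "(\<integral>\<^sup>+s. surface_outer (E \<inter> {x. x \<bullet> v = s}) \<partial>lborel) = ennreal (norm v) * emeasure lborel E" .
qed

text \<open>Near a point where its gradient is \<open>v\<close>, a function \<open>f\<close> becomes the linear functional \<open>v\<close> after the
  change of variables \<open>x \<mapsto> x + (f x - v \<bullet> x) v / |v|\<^sup>2\<close>, which is close to an isometry.\<close>

definition straighten :: "('a::euclidean_space \<Rightarrow> real) \<Rightarrow> 'a \<Rightarrow> 'a \<Rightarrow> 'a" where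
  "straighten f v x = x + ((f x - x \<bullet> v) / (v \<bullet> v)) *\<^sub>R v"

lemma straighten_inner: "v \<noteq> 0 \<Longrightarrow> straighten f v x \<bullet> v = f x"
  by (simp add: straighten_def inner_add_left)

text \<open>\<open>\<epsilon>\<close> measures how far the gradient \<open>g\<close> of \<open>f\<close> deviates from \<open>v\<close> on the ball; all distortion
  factors below tend to one as it tends to zero.\<close>

locale straightening =
  fixes f :: "'a::euclidean_space \<Rightarrow> real" and g :: "'a \<Rightarrow> 'a" and v p :: 'a and \<eta> \<epsilon> :: real
  assumes deriv: "\<And>x. x \<in> cball p \<eta> \<Longrightarrow> (f has_derivative (\<lambda>h. g x \<bullet> h)) (at x)"
    and cont: "continuous_on (cball p \<eta>) g"
    and near: "\<And>x. x \<in> cball p \<eta> \<Longrightarrow> norm (g x - v) \<le> \<epsilon> * norm v"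
    and v: "v \<noteq> 0" and eps: "0 < \<epsilon>" "\<epsilon> < 1"
begin

abbreviation \<psi> where "\<psi> \<equiv> straighten f v"
abbreviation D where "D \<equiv> cball p \<eta>"

lemma vv: "v \<bullet> v = (norm v)\<^sup>2" "norm v > 0" using v by (simp_all add: power2_norm_eq_inner)

lemma straighten_diff:
  assumes "x \<in> D" "y \<in> D"
  shows "norm ((\<psi> x - \<psi> y) - (x - y)) \<le> \<epsilon> * norm (x - y)"
proof -
  have bound: "norm ((f x - x \<bullet> v) - (f y - y \<bullet> v)) \<le> (\<epsilon> * norm v) * norm (x - y)"
  proof (rule differentiable_bound[where f="\<lambda>x. f x - x \<bullet> v" and f'="\<lambda>x h. g x \<bullet> h - h \<bullet> v" and S=D])
    show "convex D" by simp
    fix z assume z: "z \<in> D"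
    show "((\<lambda>x. f x - x \<bullet> v) has_derivative (\<lambda>h. g z \<bullet> h - h \<bullet> v)) (at z within D)"
      by (intro has_derivative_diff has_derivative_at_withinI[OF deriv[OF z]]
          bounded_linear_imp_has_derivative bounded_linear_inner_left)
    show "onorm (\<lambda>h. g z \<bullet> h - h \<bullet> v) \<le> \<epsilon> * norm v"
    proof (rule onorm_bound)
      fix h
      have "g z \<bullet> h - h \<bullet> v = (g z - v) \<bullet> h" by (simp add: inner_diff_left inner_commute[of h])
      then have "norm (g z \<bullet> h - h \<bullet> v) \<le> norm (g z - v) * norm h"
        using Cauchy_Schwarz_ineq2[of "g z - v" h] by simp
      also have "\<dots> \<le> \<epsilon> * norm v * norm h" using near[OF z] by (intro mult_right_mono) auto
      finally show "norm (g z \<bullet> h - h \<bullet> v) \<le> \<epsilon> * norm v * norm h" .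
    qed (use eps in auto)
  qed (use assms in auto)
  have "(\<psi> x - \<psi> y) - (x - y) = (((f x - x \<bullet> v) - (f y - y \<bullet> v)) / (v \<bullet> v)) *\<^sub>R v"
  proof -
    have "(x + a) - (y + b) - (x - y) = a - b" for a b :: 'a by simp
    then show ?thesis unfolding straighten_def by (simp only: diff_divide_distrib[symmetric] scaleR_diff_left[symmetric])
  qed
  moreover have "norm ((c / (v \<bullet> v)) *\<^sub>R v) = \<bar>c\<bar> / norm v" for c :: real
    using vv by (simp add: power2_eq_square)
  ultimately have "norm ((\<psi> x - \<psi> y) - (x - y)) = \<bar>(f x - x \<bullet> v) - (f y - y \<bullet> v)\<bar> / norm v"
    by (simp only:)
  also have "\<dots> \<le> ((\<epsilon> * norm v) * norm (x - y)) / norm v"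
    by (rule divide_right_mono) (use bound in auto)
  finally show ?thesis using vv by simp
qed

lemma straighten_upper: "x \<in> D \<Longrightarrow> y \<in> D \<Longrightarrow> dist (\<psi> x) (\<psi> y) \<le> (1 + \<epsilon>) * dist x y"
  using straighten_diff[of x y] norm_triangle_sub[of "\<psi> x - \<psi> y" "x - y"]
  by (simp add: dist_norm algebra_simps)

lemma straighten_lower: "x \<in> D \<Longrightarrow> y \<in> D \<Longrightarrow> (1 - \<epsilon>) * dist x y \<le> dist (\<psi> x) (\<psi> y)"
  using straighten_diff[of x y] norm_triangle_sub[of "x - y" "\<psi> x - \<psi> y"]
  by (simp add: dist_norm norm_minus_commute algebra_simps)

lemma straighten_inj: "inj_on \<psi> D"
proof (rule inj_onI)
  fix x y assume "x \<in> D" "y \<in> D" "\<psi> x = \<psi> y"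
  then have "(1 - \<epsilon>) * dist x y \<le> 0" using straighten_lower[of x y] by simp
  then show "x = y" using eps by (simp add: mult_le_0_iff)
qed

lemma f_cont: "continuous_on D f"
  using deriv has_derivative_continuous continuous_at_imp_continuous_on by blast

lemma straighten_cont: "continuous_on D \<psi>"
  unfolding straighten_def by (intro continuous_intros f_cont) (use v in auto)

lemma straighten_image_borel:
  assumes E: "E \<in> sets borel" "E \<subseteq> D"
  shows "\<psi> ` E \<in> sets borel"
proof -
  let ?i = "the_inv_into D \<psi>"
  have comp: "compact (\<psi> ` D)" by (intro compact_continuous_image straighten_cont) simp
  have ci: "continuous_on (\<psi> ` D) ?i"
    using straighten_inj by (intro continuous_on_inv straighten_cont) (auto simp: the_inv_into_f_f)
  have eq: "\<psi> ` E = {y \<in> \<psi> ` D. ?i y \<in> E}"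
  proof safe
    fix x assume "x \<in> E"
    then show "\<psi> x \<in> \<psi> ` D" "?i (\<psi> x) \<in> E" using E(2) straighten_inj by (auto simp: the_inv_into_f_f subset_iff)
  next
    fix x assume "x \<in> D" "?i (\<psi> x) \<in> E"
    then show "\<psi> x \<in> \<psi> ` E" using straighten_inj by (simp add: the_inv_into_f_f)
  qed
  have "?i \<in> borel_measurable (restrict_space borel (\<psi> ` D))"
    by (rule borel_measurable_continuous_on_restrict[OF ci])
  from measurable_sets[OF this E(1)] have "{y \<in> \<psi> ` D. ?i y \<in> E} \<in> sets (restrict_space borel (\<psi> ` D))"
    by (simp add: vimage_def Int_def space_restrict_space conj_commute)
  then show ?thesis unfolding eq
    using comp by (subst (asm) sets_restrict_space_iff) (auto simp: compact_imp_closed)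
qed

abbreviation e where "e \<equiv> (1 / norm v) *\<^sub>R v"
text \<open>The Jacobian of \<open>\<psi>\<close>, which is the derivative of \<open>\<psi>\<close> along its own direction of motion \<open>v\<close>.\<close>

definition J where "J x = (if x \<in> D then ennreal ((g x \<bullet> v) / (v \<bullet> v)) else 0)"

lemma J_bounds:
  assumes "x \<in> D"
  shows "1 - \<epsilon> \<le> (g x \<bullet> v) / (v \<bullet> v)" "(g x \<bullet> v) / (v \<bullet> v) \<le> 1 + \<epsilon>"
    "(1 - \<epsilon>) * norm v \<le> norm (g x)" "norm (g x) \<le> (1 + \<epsilon>) * norm v"
proof -
  have "\<bar>(g x - v) \<bullet> v\<bar> \<le> norm (g x - v) * norm v" by (rule Cauchy_Schwarz_ineq2)
  also have "\<dots> \<le> \<epsilon> * (v \<bullet> v)" using near[OF assms] vv by (simp add: power2_eq_square mult.assoc[symmetric] mult_right_mono)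
  finally have "\<bar>g x \<bullet> v - v \<bullet> v\<bar> \<le> \<epsilon> * (v \<bullet> v)" by (simp add: inner_diff_left)
  then show "1 - \<epsilon> \<le> (g x \<bullet> v) / (v \<bullet> v)" "(g x \<bullet> v) / (v \<bullet> v) \<le> 1 + \<epsilon>"
    using v by (auto simp: field_simps abs_le_iff)
  show "(1 - \<epsilon>) * norm v \<le> norm (g x)" "norm (g x) \<le> (1 + \<epsilon>) * norm v"
    using near[OF assms] norm_triangle_sub[of "g x" v] norm_triangle_sub[of v "g x"]
    by (auto simp: algebra_simps norm_minus_commute)
qed

lemma J_measurable [measurable]: "J \<in> borel_measurable borel"
proof -
  have "(\<lambda>x. ennreal (indicator D x *\<^sub>R ((g x \<bullet> v) / (v \<bullet> v)))) \<in> borel_measurable borel"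
    by (rule measurable_compose[OF _ measurable_ennreal], rule borel_measurable_continuous_on_indicator)
      (auto intro!: continuous_intros cont simp: v)
  also have "(\<lambda>x. ennreal (indicator D x *\<^sub>R ((g x \<bullet> v) / (v \<bullet> v)))) = J"
    by (auto simp: J_def indicator_def)
  finally show ?thesis .
qed

text \<open>The change of variables moves points along the lines in direction \<open>v\<close> only, so that the
  one-dimensional substitution rule on each of these lines gives its Jacobian.\<close>

lemma emeasure_straighten_image:
  assumes E[measurable]: "E \<in> sets borel" and ED: "E \<subseteq> D"
  shows "emeasure lborel (\<psi> ` E) = (\<integral>\<^sup>+x. indicator E x * J x \<partial>lborel)"
proof -
  have ne: "norm e = 1" using v by simp
  have \<psi>E[measurable]: "\<psi> ` E \<in> sets borel" by (rule straighten_image_borel[OF E ED])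
  have line: "line_measure e (\<psi> ` E) x = (\<integral>\<^sup>+\<tau>. indicator E (x + \<tau> *\<^sub>R e) * J (x + \<tau> *\<^sub>R e) \<partial>lborel)" for x
  proof -
    define \<sigma> where "\<sigma> \<tau> = \<tau> + (f (x + \<tau> *\<^sub>R e) - (x + \<tau> *\<^sub>R e) \<bullet> v) / norm v" for \<tau>
    define \<sigma>' where "\<sigma>' \<tau> = (g (x + \<tau> *\<^sub>R e) \<bullet> v) / (v \<bullet> v)" for \<tau>
    define I where "I = {\<tau>. x + \<tau> *\<^sub>R e \<in> D}"
    define A where "A = {\<tau>. x + \<tau> *\<^sub>R e \<in> E}"
    have \<psi>\<sigma>: "\<psi> (x + \<tau> *\<^sub>R e) = x + \<sigma> \<tau> *\<^sub>R e" for \<tau>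
      using vv by (simp add: straighten_def \<sigma>_def power2_eq_square algebra_simps add_divide_distrib diff_divide_distrib)
    have AI: "A \<subseteq> I" using ED by (auto simp: A_def I_def)
    have slice: "{\<tau>. x + \<tau> *\<^sub>R e \<in> \<psi> ` E} = \<sigma> ` A"
    proof safe
      fix \<tau> y assume y: "y \<in> E" "x + \<tau> *\<^sub>R e = \<psi> y"
      define t where "t = (f y - y \<bullet> v) / norm v"
      have "\<psi> y = y + t *\<^sub>R e" using vv by (simp add: straighten_def t_def power2_eq_square)
      then have "y = x + \<tau> *\<^sub>R e - t *\<^sub>R e" using y(2) by (metis add_diff_cancel_right')
      then have y_eq: "y = x + (\<tau> - t) *\<^sub>R e" by (simp only: scaleR_diff_left add_diff_eq)
      have "x + \<tau> *\<^sub>R e = x + \<sigma> (\<tau> - t) *\<^sub>R e" using \<psi>\<sigma>[of "\<tau> - t"] y(2) y_eq by simp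
      then have "\<tau> = \<sigma> (\<tau> - t)" using v by simp
      moreover have "\<tau> - t \<in> A" using y y_eq by (simp add: A_def)
      ultimately show "\<tau> \<in> \<sigma> ` A" by blast
    next
      fix \<tau> assume "\<tau> \<in> A"
      then show "x + \<sigma> \<tau> *\<^sub>R e \<in> \<psi> ` E" using \<psi>\<sigma>[of \<tau>] by (auto simp: A_def intro!: image_eqI[of _ _ "x + \<tau> *\<^sub>R e"])
    qed
    have \<sigma>A: "\<sigma> ` A \<in> sets borel" unfolding slice[symmetric] by measurable
    have \<sigma>_inj: "inj_on \<sigma> I"
    proof (rule inj_onI)
      fix a c assume ac: "a \<in> I" "c \<in> I" "\<sigma> a = \<sigma> c"
      then have "\<psi> (x + a *\<^sub>R e) = \<psi> (x + c *\<^sub>R e)" unfolding \<psi>\<sigma> by simp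
      then have "x + a *\<^sub>R e = x + c *\<^sub>R e" using ac straighten_inj by (auto simp: I_def dest: inj_onD)
      then show "a = c" using v by simp
    qed
    have "convex I" "compact I"
    proof -
      have I_eq: "I = (\<lambda>\<tau>. x + \<tau> *\<^sub>R e) -` D" by (auto simp: I_def)
      show "convex I"
      proof (rule convexI)
        fix a c s t :: real assume h: "a \<in> I" "c \<in> I" "0 \<le> s" "0 \<le> t" "s + t = 1"
        have "s *\<^sub>R (x + a *\<^sub>R e) + t *\<^sub>R (x + c *\<^sub>R e) \<in> D"
          using h convexD[OF convex_cball] by (auto simp: I_def)
        moreover have "s *\<^sub>R (x + a *\<^sub>R e) + t *\<^sub>R (x + c *\<^sub>R e) = (s + t) *\<^sub>R x + (s *\<^sub>R a + t *\<^sub>R c) *\<^sub>R e"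
          by (simp add: algebra_simps)
        ultimately show "s *\<^sub>R a + t *\<^sub>R c \<in> I" using h by (simp add: I_def)
      qed
      have "closed I" unfolding I_eq by (intro continuous_closed_vimage) (use v in \<open>auto intro!: continuous_intros\<close>)
      moreover have "bounded I"
      proof -
        have "\<bar>\<tau>\<bar> \<le> norm (p - x) + \<eta>" if "\<tau> \<in> I" for \<tau>
        proof -
          have "\<bar>\<tau>\<bar> = norm (\<tau> *\<^sub>R e)" using v by simp
          also have "\<tau> *\<^sub>R e = (p - x) - (p - (x + \<tau> *\<^sub>R e))" by simp
          also have "norm \<dots> \<le> norm (p - x) + norm (p - (x + \<tau> *\<^sub>R e))" by (rule norm_triangle_ineq4)
          also have "\<dots> \<le> norm (p - x) + \<eta>" using that by (simp add: I_def dist_norm)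
          finally show ?thesis .
        qed
        then show ?thesis by (auto simp: bounded_iff)
      qed
      ultimately show "compact I" by (simp add: compact_eq_bounded_closed)
    qed
    then obtain a c where ac: "I = {a..c}"
      by (metis connected_compact_interval_1 convex_connected)
    have d\<sigma>: "(\<sigma> has_real_derivative \<sigma>' \<tau>) (at \<tau>)" if "\<tau> \<in> {a..c}" for \<tau>
    proof -
      have D: "x + \<tau> *\<^sub>R e \<in> D" using that ac by (auto simp: I_def)
      have "((\<lambda>\<tau>. f (x + \<tau> *\<^sub>R e)) has_derivative (\<lambda>h. g (x + \<tau> *\<^sub>R e) \<bullet> (h *\<^sub>R e))) (at \<tau>)"
        by (rule has_derivative_compose[where f="\<lambda>\<tau>. x + \<tau> *\<^sub>R e" and g=f, OF _ deriv[OF D]])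
           (use v in \<open>auto intro!: derivative_eq_intros\<close>)
      then have "((\<lambda>\<tau>. f (x + \<tau> *\<^sub>R e)) has_real_derivative (g (x + \<tau> *\<^sub>R e) \<bullet> e)) (at \<tau>)"
        by (rule has_derivative_imp_has_field_derivative) (simp add: mult.commute)
      then have "(\<sigma> has_real_derivative 1 + (g (x + \<tau> *\<^sub>R e) \<bullet> e - e \<bullet> v) / norm v) (at \<tau>)"
        unfolding \<sigma>_def inner_add_left inner_scaleR_left
        by (auto intro!: derivative_eq_intros simp: v)
      moreover have "1 + (g (x + \<tau> *\<^sub>R e) \<bullet> e - e \<bullet> v) / norm v = \<sigma>' \<tau>"
        using vv by (simp add: \<sigma>'_def field_simps power2_eq_square)
      ultimately show ?thesis by simp
    qed
    have c\<sigma>': "continuous_on {a..c} \<sigma>'"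
      unfolding \<sigma>'_def using v ac
      by (intro continuous_intros continuous_on_compose2[OF cont]) (auto simp: I_def)
    have \<sigma>'_pos: "0 \<le> \<sigma>' \<tau>" if "\<tau> \<in> {a..c}" for \<tau>
    proof -
      have "x + \<tau> *\<^sub>R e \<in> D" using that ac unfolding I_def by blast
      from J_bounds(1)[OF this] eps show ?thesis unfolding \<sigma>'_def by linarith
    qed
    have "emeasure lborel (\<sigma> ` A) = (\<integral>\<^sup>+\<tau>. indicator A \<tau> * ennreal (\<sigma>' \<tau>) \<partial>lborel)"
    proof (cases "a < c")
      case True
      have mono: "\<sigma> s \<le> \<sigma> t" if "a \<le> s" "s \<le> t" "t \<le> c" for s t
      proof (rule DERIV_nonneg_imp_nondecreasing[OF that(2)])
        fix w assume "s \<le> w" "w \<le> t"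
        then have "w \<in> {a..c}" using that by simp
        then show "\<exists>y. (\<sigma> has_real_derivative y) (at w) \<and> 0 \<le> y" using d\<sigma> \<sigma>'_pos by blast
      qed
      have "emeasure lborel (\<sigma> ` A) = (\<integral>\<^sup>+\<tau>. indicator (\<sigma> ` A) \<tau> * indicator {\<sigma> a..\<sigma> c} \<tau> \<partial>lborel)"
      proof -
        have "indicator (\<sigma> ` A) \<tau> * indicator {\<sigma> a..\<sigma> c} \<tau> = (indicator (\<sigma> ` A) \<tau> :: ennreal)" for \<tau>
          using AI ac mono by (auto simp: indicator_def)
        then show ?thesis using \<sigma>A by simp
      qed
      also have "\<dots> = (\<integral>\<^sup>+\<tau>. indicator (\<sigma> ` A) (\<sigma> \<tau>) * ennreal (\<sigma>' \<tau>) * indicator {a..c} \<tau> \<partial>lborel)"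
        using \<sigma>A by (intro nn_integral_substitution_aux d\<sigma> c\<sigma>' \<sigma>'_pos True) auto
      also have "\<dots> = (\<integral>\<^sup>+\<tau>. indicator A \<tau> * ennreal (\<sigma>' \<tau>) \<partial>lborel)"
      proof (rule nn_integral_cong)
        fix \<tau>
        have "\<sigma> \<tau> \<in> \<sigma> ` A \<longleftrightarrow> \<tau> \<in> A" if "\<tau> \<in> I" using \<sigma>_inj AI that by (auto dest: inj_onD)
        then show "indicator (\<sigma> ` A) (\<sigma> \<tau>) * ennreal (\<sigma>' \<tau>) * indicator {a..c} \<tau> = indicator A \<tau> * ennreal (\<sigma>' \<tau>)"
          using AI unfolding ac[symmetric] by (auto simp: indicator_def)
      qed
      finally show ?thesis .
    next
      case False
      then have "A \<subseteq> {a}" using AI ac by auto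
      then consider "A = {}" | "A = {a}" by blast
      then show ?thesis
      proof cases
        case 2
        have "(\<integral>\<^sup>+\<tau>. indicator {a} \<tau> * ennreal (\<sigma>' \<tau>) \<partial>lborel) = (\<integral>\<^sup>+\<tau>. ennreal (\<sigma>' a) * indicator {a} \<tau> \<partial>lborel)"
          by (intro nn_integral_cong) (auto simp: indicator_def)
        then show ?thesis using 2 by (simp add: nn_integral_cmult)
      qed simp
    qed
    also have "\<dots> = (\<integral>\<^sup>+\<tau>. indicator E (x + \<tau> *\<^sub>R e) * J (x + \<tau> *\<^sub>R e) \<partial>lborel)"
      using ED by (intro nn_integral_cong) (auto simp: A_def J_def \<sigma>'_def indicator_def)
    finally show ?thesis unfolding line_measure_def slice .
  qed
  show ?thesis
    unfolding emeasure_line_measure[OF \<psi>E ne] line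
    by (rule nn_integral_lines[symmetric, OF _ ne]) measurable
qed

text \<open>The coarea formula up to a factor near one, for sets near \<open>p\<close>.  The straightening carries the levels of
  \<open>f\<close> to slices of parallel hyperplanes, where the linear formula applies; it changes surface
  measure and volume by factors between powers of \<open>1 - \<epsilon>\<close> and \<open>1 + \<epsilon>\<close>.  The measure of the straightened slice
  serves as \<open>h\<close>, since the measurability of the original slice function is not known at this stage.\<close>

lemma local_coarea:
  assumes dim: "DIM('a) \<ge> 2" and E[measurable]: "E \<in> sets borel" and ED: "E \<subseteq> D"
    and K: "(1 + \<epsilon>) ^ (DIM('a) - 1) \<le> K" "(1 / (1 - \<epsilon>)) ^ (DIM('a) - 1) \<le> K" "(1 + \<epsilon>) / (1 - \<epsilon>) \<le> K"
  shows "\<exists>h\<in>borel_measurable borel.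
    (\<forall>s. h s \<le> ennreal K * surface_outer (E \<inter> {x. f x = s}) \<and> surface_outer (E \<inter> {x. f x = s}) \<le> ennreal K * h s) \<and>
    (\<integral>\<^sup>+s. h s \<partial>lborel) \<le> ennreal K * (\<integral>\<^sup>+x. indicator E x * ennreal (norm (g x)) \<partial>lborel) \<and>
    (\<integral>\<^sup>+x. indicator E x * ennreal (norm (g x)) \<partial>lborel) \<le> ennreal K * (\<integral>\<^sup>+s. h s \<partial>lborel)"
proof -
  define h where "h s = surface_outer (\<psi> ` E \<inter> {y. y \<bullet> v = s})" for s
  have s: "real DIM('a) - 1 > 0" using dim by simp
  have \<psi>E: "\<psi> ` E \<in> sets borel" by (rule straighten_image_borel[OF E ED])
  have level: "\<psi> ` E \<inter> {y. y \<bullet> v = s} = \<psi> ` (E \<inter> {x. f x = s})" for s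
    using straighten_inner[OF v] by auto
  have h1: "h s \<le> ennreal K * surface_outer (E \<inter> {x. f x = s})" for s
  proof -
    have "h s \<le> ennreal ((1 + \<epsilon>) powr (real DIM('a) - 1)) * surface_outer (E \<inter> {x. f x = s})"
      unfolding h_def level
    proof (rule hausdorff_outer_Lipschitz_image)
      fix x y assume "x \<in> E \<inter> {x. f x = s}" "y \<in> E \<inter> {x. f x = s}"
      then have "x \<in> D" "y \<in> D" using ED by blast+
      then show "dist (\<psi> x) (\<psi> y) \<le> (1 + \<epsilon>) * dist x y" by (rule straighten_upper)
    qed (use eps s in auto)
    also have "\<dots> \<le> ennreal K * surface_outer (E \<inter> {x. f x = s})"
      using K(1) eps by (intro mult_right_mono ennreal_leI) (auto simp: powr_DIM[OF dim])
    finally show ?thesis .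
  qed
  have h2: "surface_outer (E \<inter> {x. f x = s}) \<le> ennreal K * h s" for s
  proof -
    let ?i = "the_inv_into D \<psi>"
    have "surface_outer (?i ` (\<psi> ` E \<inter> {y. y \<bullet> v = s})) \<le> ennreal ((1 / (1 - \<epsilon>)) powr (real DIM('a) - 1)) * h s"
      unfolding h_def
    proof (rule hausdorff_outer_Lipschitz_image)
      fix x y assume "x \<in> \<psi> ` E \<inter> {y. y \<bullet> v = s}" "y \<in> \<psi> ` E \<inter> {y. y \<bullet> v = s}"
      then obtain x' y' where xy: "x' \<in> D" "y' \<in> D" "x = \<psi> x'" "y = \<psi> y'" using ED by blast
      then have "?i x = x'" "?i y = y'" using straighten_inj by (simp_all add: the_inv_into_f_f)
      then show "dist (?i x) (?i y) \<le> 1 / (1 - \<epsilon>) * dist x y"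
        using straighten_lower[OF xy(1,2)] xy eps by (simp add: field_simps)
    qed (use eps s in auto)
    also have "?i ` (\<psi> ` E \<inter> {y. y \<bullet> v = s}) = E \<inter> {x. f x = s}"
    proof -
      have "(\<lambda>x. ?i (\<psi> x)) ` (E \<inter> {x. f x = s}) = (\<lambda>x. x) ` (E \<inter> {x. f x = s})"
      proof (rule image_cong[OF refl])
        fix x assume "x \<in> E \<inter> {x. f x = s}"
        then have "x \<in> D" using ED by blast
        then show "?i (\<psi> x) = x" using straighten_inj by (simp only: the_inv_into_f_f)
      qed
      then show ?thesis unfolding level image_image by simp
    qed
    also have "ennreal ((1 / (1 - \<epsilon>)) powr (real DIM('a) - 1)) * h s \<le> ennreal K * h s"
      using K(2) eps by (intro mult_right_mono ennreal_leI) (simp_all add: powr_DIM[OF dim])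
    finally show ?thesis .
  qed
  have hm: "h \<in> borel_measurable borel" "(\<integral>\<^sup>+s. h s \<partial>lborel) = ennreal (norm v) * emeasure lborel (\<psi> ` E)"
    unfolding h_def using linear_coarea[OF dim v \<psi>E] by simp_all
  have int_h: "(\<integral>\<^sup>+s. h s \<partial>lborel) = (\<integral>\<^sup>+x. indicator E x * (ennreal (norm v) * J x) \<partial>lborel)"
    unfolding hm(2) emeasure_straighten_image[OF E ED] by (subst nn_integral_cmult[symmetric]) (auto simp: mult_ac)
  have gm[measurable]: "(\<lambda>x. indicator E x * ennreal (norm (g x))) \<in> borel_measurable borel"
  proof -
    have "(\<lambda>x. indicator E x * ennreal (indicator D x *\<^sub>R norm (g x))) \<in> borel_measurable borel"
    proof (rule borel_measurable_times_ennreal)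
      show "(\<lambda>x. ennreal (indicator D x *\<^sub>R norm (g x))) \<in> borel_measurable borel"
        by (rule measurable_compose[OF _ measurable_ennreal], rule borel_measurable_continuous_on_indicator)
          (auto intro!: continuous_intros cont)
    qed simp
    also have "(\<lambda>x. indicator E x * ennreal (indicator D x *\<^sub>R norm (g x))) = (\<lambda>x. indicator E x * ennreal (norm (g x)))"
      by (rule ext) (auto simp: indicator_def dest: subsetD[OF ED])
    finally show ?thesis .
  qed
  have K0: "0 \<le> K" using K(1) eps by (meson zero_le_power add_nonneg_nonneg less_imp_le order_trans zero_le_one)
  have ratio: "norm v * ((g x \<bullet> v) / (v \<bullet> v)) \<le> K * norm (g x)" "norm (g x) \<le> K * (norm v * ((g x \<bullet> v) / (v \<bullet> v)))" if "x \<in> D" for x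
  proof -
    note B = J_bounds[OF that]
    have K1: "1 + \<epsilon> \<le> K * (1 - \<epsilon>)" using K(3) eps by (simp add: field_simps)
    have "norm v * ((g x \<bullet> v) / (v \<bullet> v)) \<le> norm v * (1 + \<epsilon>)" using B by (intro mult_left_mono) auto
    also have "\<dots> \<le> norm v * (K * (1 - \<epsilon>))" using K1 by (intro mult_left_mono) auto
    also have "\<dots> = K * ((1 - \<epsilon>) * norm v)" by simp
    also have "\<dots> \<le> K * norm (g x)" using B K0 by (intro mult_left_mono) auto
    finally show "norm v * ((g x \<bullet> v) / (v \<bullet> v)) \<le> K * norm (g x)" .
    have "norm (g x) \<le> (1 + \<epsilon>) * norm v" using B by simp
    also have "\<dots> \<le> (K * (1 - \<epsilon>)) * norm v" using K1 by (intro mult_right_mono) auto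
    also have "\<dots> = K * (norm v * (1 - \<epsilon>))" by simp
    also have "\<dots> \<le> K * (norm v * ((g x \<bullet> v) / (v \<bullet> v)))" using B K0 by (intro mult_left_mono) auto
    finally show "norm (g x) \<le> K * (norm v * ((g x \<bullet> v) / (v \<bullet> v)))" .
  qed
  have pos: "0 \<le> (g x \<bullet> v) / (v \<bullet> v)" if "x \<in> D" for x using J_bounds(1)[OF that] eps by simp
  have "(\<integral>\<^sup>+s. h s \<partial>lborel) \<le> (\<integral>\<^sup>+x. ennreal K * (indicator E x * ennreal (norm (g x))) \<partial>lborel)"
    unfolding int_h
  proof (rule nn_integral_mono)
    fix x
    show "indicator E x * (ennreal (norm v) * J x) \<le> ennreal K * (indicator E x * ennreal (norm (g x)))"

    proof (cases "x \<in> E")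
      case True
      then have D: "x \<in> D" using ED by blast
      have "ennreal (norm v) * ennreal ((g x \<bullet> v) / (v \<bullet> v)) \<le> ennreal K * ennreal (norm (g x))"
        using ratio(1)[OF D] pos[OF D] K0 by (simp only: ennreal_mult[symmetric] norm_ge_zero ennreal_leI)
      then show ?thesis using True D by (simp only: indicator_simps mult_1_left J_def if_True)
    qed simp
  qed
  also have "\<dots> = ennreal K * (\<integral>\<^sup>+x. indicator E x * ennreal (norm (g x)) \<partial>lborel)"
    by (rule nn_integral_cmult) simp
  finally have 1: "(\<integral>\<^sup>+s. h s \<partial>lborel) \<le> ennreal K * (\<integral>\<^sup>+x. indicator E x * ennreal (norm (g x)) \<partial>lborel)" .
  have "(\<integral>\<^sup>+x. indicator E x * ennreal (norm (g x)) \<partial>lborel) \<le> (\<integral>\<^sup>+x. ennreal K * (indicator E x * (ennreal (norm v) * J x)) \<partial>lborel)"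
  proof (rule nn_integral_mono)
    fix x
    show "indicator E x * ennreal (norm (g x)) \<le> ennreal K * (indicator E x * (ennreal (norm v) * J x))"

    proof (cases "x \<in> E")
      case True
      then have D: "x \<in> D" using ED by blast
      have "ennreal (norm (g x)) \<le> ennreal K * (ennreal (norm v) * ennreal ((g x \<bullet> v) / (v \<bullet> v)))"
        using ratio(2)[OF D] pos[OF D] K0
        by (simp only: ennreal_mult[symmetric] norm_ge_zero ennreal_leI mult_nonneg_nonneg)
      then show ?thesis using True D by (simp only: indicator_simps mult_1_left J_def if_True)
    qed simp
  qed
  also have "\<dots> = ennreal K * (\<integral>\<^sup>+s. h s \<partial>lborel)"
    unfolding int_h by (rule nn_integral_cmult) measurable
  finally have "(\<integral>\<^sup>+x. indicator E x * ennreal (norm (g x)) \<partial>lborel) \<le> ennreal K * (\<integral>\<^sup>+s. h s \<partial>lborel)" .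
  with 1 h1 h2 hm(1) show ?thesis by blast
qed

end

section \<open>The coarea formula\<close>

lemma ennreal_le_of_le_mult:
  assumes "\<And>K. 1 < K \<Longrightarrow> a \<le> ennreal K * b"
  shows "a \<le> b"
proof (cases b)
  case (real r)
  have "(\<lambda>n. (1 + inverse (real (Suc n))) * r) \<longlonglongrightarrow> (1 + 0) * r"
    by (intro tendsto_intros LIMSEQ_inverse_real_of_nat)
  then have "(\<lambda>n. ennreal ((1 + inverse (real (Suc n))) * r)) \<longlonglongrightarrow> ennreal r"
    by (intro tendsto_ennrealI) simp
  moreover have "a \<le> ennreal ((1 + inverse (real (Suc n))) * r)" for n
    using assms[of "1 + inverse (real (Suc n))"] real
    by (subst ennreal_mult) (auto simp del: of_nat_Suc)
  ultimately have "a \<le> ennreal r" by (intro LIMSEQ_le_const) auto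
  then show ?thesis using real by simp
qed simp

text \<open>The coarea formula up to the factor \<open>K\<close>, in a form that makes sense before the slice function
  \<open>s \<mapsto> H(E \<inter> {f = s})\<close> is known to be measurable: a Borel function \<open>h\<close> takes its place.\<close>

definition approx_coarea :: "('a::euclidean_space \<Rightarrow> real) \<Rightarrow> ('a \<Rightarrow> 'a) \<Rightarrow> real \<Rightarrow> 'a set \<Rightarrow> bool" where
  "approx_coarea f g K E \<longleftrightarrow> (\<exists>h\<in>borel_measurable borel.
    (\<forall>s. h s \<le> ennreal K * surface_outer (E \<inter> {x. f x = s}) \<and> surface_outer (E \<inter> {x. f x = s}) \<le> ennreal K * h s) \<and>
    (\<integral>\<^sup>+s. h s \<partial>lborel) \<le> ennreal K * (\<integral>\<^sup>+x. indicator E x * ennreal (norm (g x)) \<partial>lborel) \<and>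
    (\<integral>\<^sup>+x. indicator E x * ennreal (norm (g x)) \<partial>lborel) \<le> ennreal K * (\<integral>\<^sup>+s. h s \<partial>lborel))"

locale smooth_submersion =
  fixes f :: "'a::euclidean_space \<Rightarrow> real" and g :: "'a \<Rightarrow> 'a" and U :: "'a set"
  assumes dim: "DIM('a) \<ge> 2" and U: "open U"
    and deriv: "\<And>x. x \<in> U \<Longrightarrow> (f has_derivative (\<lambda>h. g x \<bullet> h)) (at x)"
    and cont: "continuous_on U g"
    and nonzero: "\<And>x. x \<in> U \<Longrightarrow> g x \<noteq> 0"
begin

lemma approx_coarea_near:
  assumes p: "p \<in> U" and K: "K > 1"
  shows "\<exists>\<eta>>0. \<forall>E\<in>sets borel. E \<subseteq> ball p \<eta> \<longrightarrow> approx_coarea f g K E"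
proof -
  have "((\<lambda>\<epsilon>. (1 + \<epsilon>) ^ (DIM('a) - 1)) \<longlongrightarrow> (1 + 0) ^ (DIM('a) - 1)) (at_right (0::real))"
    and "((\<lambda>\<epsilon>. (1 / (1 - \<epsilon>)) ^ (DIM('a) - 1)) \<longlongrightarrow> (1 / (1 - 0)) ^ (DIM('a) - 1)) (at_right (0::real))"
    and "((\<lambda>\<epsilon>. (1 + \<epsilon>) / (1 - \<epsilon>)) \<longlongrightarrow> (1 + 0) / (1 - 0)) (at_right (0::real))"
    by (intro tendsto_intros; simp)+
  then have "eventually (\<lambda>\<epsilon>. (1 + \<epsilon>) ^ (DIM('a) - 1) < K) (at_right (0::real))"
    and "eventually (\<lambda>\<epsilon>. (1 / (1 - \<epsilon>)) ^ (DIM('a) - 1) < K) (at_right (0::real))"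
    and "eventually (\<lambda>\<epsilon>. (1 + \<epsilon>) / (1 - \<epsilon>) < K) (at_right (0::real))"
    using K by (auto dest!: order_tendstoD(2)[of _ _ _ K])
  moreover have "eventually (\<lambda>\<epsilon>. \<epsilon> \<in> {0<..<1}) (at_right (0::real))"
    by (rule eventually_at_right_real) simp
  ultimately have "eventually (\<lambda>\<epsilon>. (1 + \<epsilon>) ^ (DIM('a) - 1) < K \<and> (1 / (1 - \<epsilon>)) ^ (DIM('a) - 1) < K
      \<and> (1 + \<epsilon>) / (1 - \<epsilon>) < K \<and> \<epsilon> \<in> {0<..<1}) (at_right (0::real))"
    by eventually_elim auto
  then obtain \<epsilon> :: real where \<epsilon>: "(1 + \<epsilon>) ^ (DIM('a) - 1) < K" "(1 / (1 - \<epsilon>)) ^ (DIM('a) - 1) < K"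
      "(1 + \<epsilon>) / (1 - \<epsilon>) < K" "0 < \<epsilon>" "\<epsilon> < 1"
    using eventually_happens[of _ "at_right (0::real)"] by force
  obtain r1 where r1: "r1 > 0" "cball p r1 \<subseteq> U" using U p open_contains_cball by blast
  have "0 < \<epsilon> * norm (g p)" using \<epsilon> nonzero[OF p] by simp
  then obtain r2 where r2: "r2 > 0" "\<And>x. x \<in> U \<Longrightarrow> dist x p < r2 \<Longrightarrow> dist (g x) (g p) < \<epsilon> * norm (g p)"
    using cont p unfolding continuous_on_iff by blast
  define \<eta> where "\<eta> = min r1 (r2 / 2)"
  have \<eta>: "\<eta> > 0" "cball p \<eta> \<subseteq> U" using r1 r2(1) by (auto simp: \<eta>_def)
  interpret straightening f g "g p" p \<eta> \<epsilon>
  proof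
    show "(f has_derivative (\<lambda>h. g x \<bullet> h)) (at x)" if "x \<in> cball p \<eta>" for x using deriv \<eta> that by blast
    show "continuous_on (cball p \<eta>) g" using cont \<eta>(2) by (rule continuous_on_subset)
    show "norm (g x - g p) \<le> \<epsilon> * norm (g p)" if "x \<in> cball p \<eta>" for x
    proof -
      have "dist x p \<le> r2 / 2" using that by (simp add: \<eta>_def dist_commute)
      then have "dist x p < r2" using r2(1) by simp
      then have "dist (g x) (g p) < \<epsilon> * norm (g p)" using r2(2) \<eta>(2) that by blast
      then show ?thesis by (simp add: dist_norm)
    qed
  qed (use \<epsilon> nonzero[OF p] in auto)
  have "approx_coarea f g K E" if "E \<in> sets borel" "E \<subseteq> ball p \<eta>" for E
    unfolding approx_coarea_def using \<epsilon> that ball_subset_cball[of p \<eta>]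
    by (intro local_coarea[OF dim]) auto
  then show ?thesis using \<eta>(1) by blast
qed

lemma f_cont: "continuous_on U f"
  using deriv has_derivative_continuous continuous_at_imp_continuous_on by blast

lemma level_borel: "U \<inter> {x. f x = s} \<in> sets borel"
proof -
  have "closedin (top_of_set U) (U \<inter> f -` {s})"
    by (rule continuous_closedin_preimage[OF f_cont]) simp
  then obtain T where "closed T" "U \<inter> f -` {s} = U \<inter> T" by (auto simp: closedin_closed)
  then have "U \<inter> f -` {s} \<in> sets borel" using U by simp
  moreover have "U \<inter> f -` {s} = U \<inter> {x. f x = s}" by auto
  ultimately show ?thesis by simp
qed

lemma sub_level_borel: "E \<in> sets borel \<Longrightarrow> E \<subseteq> U \<Longrightarrow> E \<inter> {x. f x = s} \<in> sets borel"
proof -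
  assume "E \<in> sets borel" "E \<subseteq> U"
  then have "E \<inter> {x. f x = s} = E \<inter> (U \<inter> {x. f x = s})" by auto
  with level_borel \<open>E \<in> sets borel\<close> show ?thesis by simp
qed

lemma g_measurable: "(\<lambda>x. indicator U x * ennreal (norm (g x))) \<in> borel_measurable borel"
proof -
  have "(\<lambda>x. ennreal (indicator U x *\<^sub>R norm (g x))) \<in> borel_measurable borel"
    by (rule measurable_compose[OF _ measurable_ennreal], rule borel_measurable_continuous_on_indicator)
      (use U in \<open>auto intro!: continuous_intros cont\<close>)
  also have "(\<lambda>x. ennreal (indicator U x *\<^sub>R norm (g x))) = (\<lambda>x. indicator U x * ennreal (norm (g x)))"
    by (auto simp: indicator_def)
  finally show ?thesis .
qed

lemma surface_outer_level_sums:
  assumes A: "\<And>i::nat. A i \<in> sets borel" "\<And>i. A i \<subseteq> U" "disjoint_family A"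
  shows "surface_outer ((\<Union>i. A i) \<inter> {x. f x = s}) = (\<Sum>i. surface_outer (A i \<inter> {x. f x = s}))"
proof -
  have m: "A i \<inter> {x. f x = s} \<in> sets surface_measure" for i
    by (intro borel_sets_hausdorff sub_level_borel A)
  have "(\<Sum>i. emeasure surface_measure (A i \<inter> {x. f x = s})) = emeasure surface_measure (\<Union>i. A i \<inter> {x. f x = s})"
    using m A(3) by (intro suminf_emeasure) (auto simp: disjoint_family_on_def)
  moreover have "(\<Union>i. A i \<inter> {x. f x = s}) = (\<Union>i. A i) \<inter> {x. f x = s}" by auto
  moreover have "(\<Union>i. A i) \<inter> {x. f x = s} \<in> sets surface_measure"
    unfolding calculation(2)[symmetric] using m by (intro sets.countable_UN) auto
  ultimately show ?thesis using m by (simp add: emeasure_hausdorff)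
qed

lemma approx_coarea_UN:
  assumes A: "\<And>i::nat. A i \<in> sets borel" "\<And>i. A i \<subseteq> U" "disjoint_family A"
    and ap: "\<And>i. approx_coarea f g K (A i)"
  shows "approx_coarea f g K (\<Union>i. A i)"
proof -
  have "\<forall>i. \<exists>h. h \<in> borel_measurable borel \<and>
    (\<forall>s. h s \<le> ennreal K * surface_outer (A i \<inter> {x. f x = s}) \<and> surface_outer (A i \<inter> {x. f x = s}) \<le> ennreal K * h s) \<and>
    (\<integral>\<^sup>+s. h s \<partial>lborel) \<le> ennreal K * (\<integral>\<^sup>+x. indicator (A i) x * ennreal (norm (g x)) \<partial>lborel) \<and>
    (\<integral>\<^sup>+x. indicator (A i) x * ennreal (norm (g x)) \<partial>lborel) \<le> ennreal K * (\<integral>\<^sup>+s. h s \<partial>lborel)"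
    using ap unfolding approx_coarea_def Bex_def by (rule allI)
  from choice[OF this] obtain h where H: "\<forall>i. h i \<in> borel_measurable borel \<and>
    (\<forall>s. h i s \<le> ennreal K * surface_outer (A i \<inter> {x. f x = s}) \<and> surface_outer (A i \<inter> {x. f x = s}) \<le> ennreal K * h i s) \<and>
    (\<integral>\<^sup>+s. h i s \<partial>lborel) \<le> ennreal K * (\<integral>\<^sup>+x. indicator (A i) x * ennreal (norm (g x)) \<partial>lborel) \<and>
    (\<integral>\<^sup>+x. indicator (A i) x * ennreal (norm (g x)) \<partial>lborel) \<le> ennreal K * (\<integral>\<^sup>+s. h i s \<partial>lborel)" ..
  have h[measurable]: "h i \<in> borel_measurable borel" for i using H by blast
  have h1: "h i s \<le> ennreal K * surface_outer (A i \<inter> {x. f x = s})" for i s using H by blast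
  have h2: "surface_outer (A i \<inter> {x. f x = s}) \<le> ennreal K * h i s" for i s using H by blast
  have h3: "(\<integral>\<^sup>+s. h i s \<partial>lborel) \<le> ennreal K * (\<integral>\<^sup>+x. indicator (A i) x * ennreal (norm (g x)) \<partial>lborel)" for i using H by blast
  have h4: "(\<integral>\<^sup>+x. indicator (A i) x * ennreal (norm (g x)) \<partial>lborel) \<le> ennreal K * (\<integral>\<^sup>+s. h i s \<partial>lborel)" for i using H by blast
  have int: "(\<integral>\<^sup>+x. indicator (\<Union>i. A i) x * ennreal (norm (g x)) \<partial>lborel)
      = (\<Sum>i. \<integral>\<^sup>+x. indicator (A i) x * ennreal (norm (g x)) \<partial>lborel)"
  proof -
    have m: "(\<lambda>x. indicator (A i) x * ennreal (norm (g x))) \<in> borel_measurable lborel" for i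
    proof -
      have "(\<lambda>x. indicator (A i) x * (indicator U x * ennreal (norm (g x)))) \<in> borel_measurable borel"
        by (intro borel_measurable_times_ennreal g_measurable borel_measurable_indicator A)
      also have "(\<lambda>x. indicator (A i) x * (indicator U x * ennreal (norm (g x)))) = (\<lambda>x. indicator (A i) x * ennreal (norm (g x)))"
        by (rule ext) (use A(2)[of i] in \<open>auto simp: indicator_def\<close>)
      finally show ?thesis by simp
    qed
    have "(\<Sum>i. indicator (A i) x * ennreal (norm (g x))) = indicator (\<Union>i. A i) x * ennreal (norm (g x))" for x
      using suminf_indicator[OF A(3), of x] by simp
    then show ?thesis using m by (subst nn_integral_suminf[symmetric]) auto
  qed
  have lev: "surface_outer ((\<Union>i. A i) \<inter> {x. f x = s}) = (\<Sum>i. surface_outer (A i \<inter> {x. f x = s}))" for s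
    by (rule surface_outer_level_sums[OF A])
  show ?thesis
    unfolding approx_coarea_def int lev
  proof (intro bexI[of _ "\<lambda>s. \<Sum>i. h i s"] conjI allI)
    show "(\<Sum>i. h i s) \<le> ennreal K * (\<Sum>i. surface_outer (A i \<inter> {x. f x = s}))" for s
      unfolding ennreal_suminf_cmult[symmetric] by (intro suminf_le summableI h1)
    show "(\<Sum>i. surface_outer (A i \<inter> {x. f x = s})) \<le> ennreal K * (\<Sum>i. h i s)" for s
      unfolding ennreal_suminf_cmult[symmetric] by (intro suminf_le summableI h2)
    have eq: "(\<integral>\<^sup>+s. (\<Sum>i. h i s) \<partial>lborel) = (\<Sum>i. \<integral>\<^sup>+s. h i s \<partial>lborel)"
      by (rule nn_integral_suminf) simp
    show "(\<integral>\<^sup>+s. (\<Sum>i. h i s) \<partial>lborel) \<le> ennreal K * (\<Sum>i. \<integral>\<^sup>+x. indicator (A i) x * ennreal (norm (g x)) \<partial>lborel)"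
      unfolding eq ennreal_suminf_cmult[symmetric] by (intro suminf_le summableI h3)
    show "(\<Sum>i. \<integral>\<^sup>+x. indicator (A i) x * ennreal (norm (g x)) \<partial>lborel) \<le> ennreal K * (\<integral>\<^sup>+s. (\<Sum>i. h i s) \<partial>lborel)"
      unfolding eq ennreal_suminf_cmult[symmetric] by (intro suminf_le summableI h4)
  qed measurable
qed

text \<open>Cover \<open>U\<close> by countably many balls on which the approximate formula holds, and cut \<open>E\<close> into disjoint
  pieces accordingly.\<close>

lemma approx_coarea_all:
  assumes K: "K > 1" and E: "E \<in> sets borel" "E \<subseteq> U"
  shows "approx_coarea f g K E"
proof -
  have "\<exists>\<eta>. \<forall>p\<in>U. \<eta> p > 0 \<and> (\<forall>E\<in>sets borel. E \<subseteq> ball p (\<eta> p) \<longrightarrow> approx_coarea f g K E)"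
    using approx_coarea_near[OF _ K] by (intro bchoice) blast
  then obtain \<eta> where \<eta>: "\<And>p. p \<in> U \<Longrightarrow> \<eta> p > 0"
      "\<And>p E. p \<in> U \<Longrightarrow> E \<in> sets borel \<Longrightarrow> E \<subseteq> ball p (\<eta> p) \<Longrightarrow> approx_coarea f g K E" by blast
  define F where "F = insert {} ((\<lambda>p. ball p (\<eta> p)) ` U)"
  have "\<And>S. S \<in> F \<Longrightarrow> open S" by (auto simp: F_def)
  then obtain F' where F': "F' \<subseteq> F" "countable F'" "\<Union> F' = \<Union> F" by (rule Lindelof)
  define A where "A = from_nat_into (insert {} F')"
  have A: "range A = insert {} F'" unfolding A_def using F'(2) by (intro range_from_nat_into) auto
  have U_sub: "U \<subseteq> (\<Union>n. A n)"
  proof -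
    have "U \<subseteq> \<Union> F" using \<eta>(1) by (auto simp: F_def intro: bexI)
    also have "\<dots> = \<Union> (range A)" unfolding A using F'(3) by simp
    finally show ?thesis .
  qed
  have AF: "A n \<in> F" for n
  proof -
    have "A n \<in> insert {} F'" unfolding A[symmetric] by simp
    then show ?thesis using F'(1) by (auto simp: F_def)
  qed
  have Ab: "A n \<in> sets borel" for n using AF[of n] by (auto simp: F_def)
  define B where "B n = E \<inter> disjointed A n" for n
  have "disjoint_family B"
    using disjoint_family_disjointed[of A] by (auto simp: B_def disjoint_family_on_def)
  moreover have Bb: "B n \<in> sets borel" for n
    using E Ab sets.range_disjointed_sets[of A borel] by (auto simp: B_def)
  moreover have "B n \<subseteq> U" for n using E by (auto simp: B_def)
  moreover have "approx_coarea f g K (B n)" for n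
  proof -
    have BA: "B n \<subseteq> A n" using disjointed_subset[of A n] by (auto simp: B_def)
    show ?thesis
    proof (cases "A n = {}")
      case True
      then have "B n = {}" using BA by simp
      then show ?thesis unfolding approx_coarea_def by (intro bexI[of _ "\<lambda>_. 0"]) auto
    next
      case False
      then obtain p where "p \<in> U" "A n = ball p (\<eta> p)" using AF[of n] by (auto simp: F_def)
      then show ?thesis using \<eta>(2) Bb BA by metis
    qed
  qed
  ultimately have "approx_coarea f g K (\<Union>n. B n)" by (intro approx_coarea_UN)
  moreover have "(\<Union>n. B n) = E"
    using U_sub E(2) UN_disjointed_eq[of A] unfolding B_def by blast
  ultimately show ?thesis by simp
qed

text \<open>Let \<open>K\<close> tend to one: the slice function is then a supremum of Borel functions, and the inequalities
  become an equality.\<close>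

lemma coarea_set:
  assumes E: "E \<in> sets borel" "E \<subseteq> U"
  shows "(\<lambda>s. surface_outer (E \<inter> {x. f x = s})) \<in> borel_measurable borel"
    and "(\<integral>\<^sup>+s. surface_outer (E \<inter> {x. f x = s}) \<partial>lborel) = (\<integral>\<^sup>+x. indicator E x * ennreal (norm (g x)) \<partial>lborel)"
proof -
  let ?F = "\<lambda>s. surface_outer (E \<inter> {x. f x = s})"
  let ?I = "\<integral>\<^sup>+x. indicator E x * ennreal (norm (g x)) \<partial>lborel"
  have ex: "\<exists>h\<in>borel_measurable borel. (\<forall>s. h s \<le> ennreal K * ?F s \<and> ?F s \<le> ennreal K * h s) \<and>
     (\<integral>\<^sup>+s. h s \<partial>lborel) \<le> ennreal K * ?I \<and> ?I \<le> ennreal K * (\<integral>\<^sup>+s. h s \<partial>lborel)" if "K > 1" for K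
    using approx_coarea_all[OF that E] unfolding approx_coarea_def .
  define K where "K n = 1 + inverse (real (Suc n))" for n
  have K1: "K n > 1" for n by (simp add: K_def)
  have "\<forall>n. \<exists>h. h \<in> borel_measurable borel \<and> (\<forall>s. h s \<le> ennreal (K n) * ?F s \<and> ?F s \<le> ennreal (K n) * h s)"
  proof
    fix n show "\<exists>h. h \<in> borel_measurable borel \<and> (\<forall>s. h s \<le> ennreal (K n) * ?F s \<and> ?F s \<le> ennreal (K n) * h s)"
      using ex[OF K1[of n]] by blast
  qed
  from choice[OF this] obtain h where H: "\<forall>n. h n \<in> borel_measurable borel \<and>
      (\<forall>s. h n s \<le> ennreal (K n) * ?F s \<and> ?F s \<le> ennreal (K n) * h n s)" ..
  have h[measurable]: "h n \<in> borel_measurable borel" for n using H by blast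
  have h12: "h n s \<le> ennreal (K n) * ?F s" "?F s \<le> ennreal (K n) * h n s" for n s using H by blast+
  have inv: "ennreal (1 / c) * (ennreal c * x) = x" if "c > 0" for c x
    using that by (simp add: mult.assoc[symmetric] ennreal_mult[symmetric])
  have "?F s = (SUP n. ennreal (1 / K n) * h n s)" for s
  proof (rule antisym)
    show "(SUP n. ennreal (1 / K n) * h n s) \<le> ?F s"
    proof (rule SUP_least)
      fix n
      have "ennreal (1 / K n) * h n s \<le> ennreal (1 / K n) * (ennreal (K n) * ?F s)"
        by (intro mult_left_mono h12) simp
      also have "\<dots> = ?F s" by (rule inv) (use K1[of n] in linarith)
      finally show "ennreal (1 / K n) * h n s \<le> ?F s" .
    qed
    show "?F s \<le> (SUP n. ennreal (1 / K n) * h n s)"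
    proof (rule ennreal_le_of_le_mult)
      fix L :: real assume L: "1 < L"
      have "(\<lambda>n. K n * K n) \<longlonglongrightarrow> (1 + 0) * (1 + 0)"
        unfolding K_def by (intro tendsto_intros LIMSEQ_inverse_real_of_nat)
      then have "eventually (\<lambda>n. K n * K n < L) sequentially" using L by (intro order_tendstoD) auto
      then obtain n where n: "K n * K n < L" by (auto simp: eventually_sequentially)
      have "?F s \<le> ennreal (K n) * h n s" by (rule h12)
      also have "\<dots> = ennreal (K n) * (ennreal (K n) * (ennreal (1 / K n) * h n s))"
        using inv[of "1 / K n"] K1[of n] by simp
      also have "\<dots> = ennreal (K n * K n) * (ennreal (1 / K n) * h n s)"
        using K1[of n] by (simp add: ennreal_mult mult.assoc)
      also have "\<dots> \<le> ennreal L * (SUP n. ennreal (1 / K n) * h n s)"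
        using n by (intro mult_mono ennreal_leI SUP_upper) auto
      finally show "?F s \<le> ennreal L * (SUP n. ennreal (1 / K n) * h n s)" .
    qed
  qed
  then show m[measurable]: "?F \<in> borel_measurable borel" by simp
  have sq: "\<exists>c>1. L = c * c" if "1 < L" for L :: real
    using that by (intro exI[of _ "sqrt L"]) auto
  show "(\<integral>\<^sup>+s. ?F s \<partial>lborel) = ?I"
  proof (rule antisym; rule ennreal_le_of_le_mult)
    fix L :: real assume "1 < L"
    then obtain c where c: "c > 1" "L = c * c" using sq by blast
    obtain h where h[measurable]: "h \<in> borel_measurable borel" and h1: "\<And>s. h s \<le> ennreal c * ?F s"
      and h2: "\<And>s. ?F s \<le> ennreal c * h s" and h3: "(\<integral>\<^sup>+s. h s \<partial>lborel) \<le> ennreal c * ?I"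
      and h4: "?I \<le> ennreal c * (\<integral>\<^sup>+s. h s \<partial>lborel)"
      using ex[OF c(1)] by blast
    have cc: "ennreal c * (ennreal c * x) = ennreal L * x" for x
      using c by (simp add: ennreal_mult mult.assoc)
    have "(\<integral>\<^sup>+s. ?F s \<partial>lborel) \<le> (\<integral>\<^sup>+s. ennreal c * h s \<partial>lborel)" by (intro nn_integral_mono h2)
    also have "\<dots> = ennreal c * (\<integral>\<^sup>+s. h s \<partial>lborel)" by (rule nn_integral_cmult) simp
    also have "\<dots> \<le> ennreal c * (ennreal c * ?I)" by (intro mult_left_mono h3) simp
    finally show "(\<integral>\<^sup>+s. ?F s \<partial>lborel) \<le> ennreal L * ?I" unfolding cc .
    have "?I \<le> ennreal c * (\<integral>\<^sup>+s. h s \<partial>lborel)" by (rule h4)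
    also have "\<dots> \<le> ennreal c * (\<integral>\<^sup>+s. ennreal c * ?F s \<partial>lborel)" by (intro mult_left_mono nn_integral_mono h1) simp
    also have "(\<integral>\<^sup>+s. ennreal c * ?F s \<partial>lborel) = ennreal c * (\<integral>\<^sup>+s. ?F s \<partial>lborel)"
      by (rule nn_integral_cmult) simp
    finally show "?I \<le> ennreal L * (\<integral>\<^sup>+s. ?F s \<partial>lborel)" unfolding cc .
  qed
qed

lemma borel_measurable_surface:
  "W \<in> borel_measurable borel \<Longrightarrow> W \<in> borel_measurable surface_measure" for W :: "'a \<Rightarrow> ennreal"
  by (rule measurableI) (auto intro!: borel_sets_hausdorff dest: measurable_sets)

theorem coarea:
  assumes W: "W \<in> borel_measurable borel"
  shows "(\<lambda>s. \<integral>\<^sup>+x. W x * indicator (U \<inter> {x. f x = s}) x \<partial>surface_measure) \<in> borel_measurable borel"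
    and "(\<integral>\<^sup>+s. (\<integral>\<^sup>+x. W x * indicator (U \<inter> {x. f x = s}) x \<partial>surface_measure) \<partial>lborel)
      = (\<integral>\<^sup>+x. W x * (indicator U x * ennreal (norm (g x))) \<partial>lborel)"
proof -
  let ?L = "\<lambda>W s. \<integral>\<^sup>+x. W x * indicator (U \<inter> {x. f x = s}) x \<partial>surface_measure"
  let ?R = "\<lambda>W. \<integral>\<^sup>+x. W x * (indicator U x * ennreal (norm (g x))) \<partial>lborel"
  have lev[measurable]: "U \<inter> {x. f x = s} \<in> sets surface_measure" for s by (intro borel_sets_hausdorff level_borel)
  note [measurable] = g_measurable
  have "?L W \<in> borel_measurable borel \<and> (\<integral>\<^sup>+s. ?L W s \<partial>lborel) = ?R W"
    using W
  proof (induction rule: borel_measurable_induct)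
    case (cong W W')
    then have "W = W'" by (auto simp: fun_eq_iff)
    then show ?case using cong by simp
  next
    case (set A)
    have eq: "?L (indicator A) s = surface_outer ((A \<inter> U) \<inter> {x. f x = s})" for s
    proof -
      have "?L (indicator A) s = (\<integral>\<^sup>+x. indicator ((A \<inter> U) \<inter> {x. f x = s}) x \<partial>surface_measure)"
        by (intro nn_integral_cong) (auto simp: indicator_def)
      also have "\<dots> = emeasure surface_measure ((A \<inter> U) \<inter> {x. f x = s})"
        using set U by (intro nn_integral_indicator borel_sets_hausdorff sub_level_borel) auto
      finally show ?thesis using set U by (simp add: emeasure_hausdorff borel_sets_hausdorff sub_level_borel)
    qed
    have "?R (indicator A) = (\<integral>\<^sup>+x. indicator (A \<inter> U) x * ennreal (norm (g x)) \<partial>lborel)"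
      by (intro nn_integral_cong) (auto simp: indicator_def)
    then show ?case unfolding eq using coarea_set[of "A \<inter> U"] set U by auto
  next
    case (mult W c)
    have Wb: "W \<in> borel_measurable borel" using mult by blast
    note [measurable] = Wb borel_measurable_surface[OF Wb]
    have eq: "?L (\<lambda>x. c * W x) s = c * ?L W s" for s
      unfolding mult.assoc by (rule nn_integral_cmult) measurable
    have "?R (\<lambda>x. c * W x) = c * ?R W" unfolding mult.assoc by (rule nn_integral_cmult) measurable
    then show ?case unfolding eq using mult by (auto simp: nn_integral_cmult)
  next
    case (add W1 W2)
    have Wb: "W1 \<in> borel_measurable borel" "W2 \<in> borel_measurable borel" using add by blast+
    note [measurable] = Wb Wb[THEN borel_measurable_surface]
    have eq: "?L (\<lambda>x. W2 x + W1 x) s = ?L W2 s + ?L W1 s" for s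
      unfolding distrib_right by (rule nn_integral_add) measurable
    have "?R (\<lambda>x. W2 x + W1 x) = ?R W2 + ?R W1" unfolding distrib_right by (rule nn_integral_add) measurable
    then show ?case unfolding eq using add by (auto simp: nn_integral_add)
  next
    case (seq W')
    have Wb: "W' i \<in> borel_measurable borel" for i using seq by blast
    have incW: "incseq W'" using seq by blast
    have IH: "?L (W' i) \<in> borel_measurable borel" "(\<integral>\<^sup>+s. ?L (W' i) s \<partial>lborel) = ?R (W' i)" for i
      using seq by blast+
    note [measurable] = Wb Wb[THEN borel_measurable_surface]
    have inc: "incseq (\<lambda>i x. W' i x * c x)" for c :: "'a \<Rightarrow> ennreal"
      using incW by (auto simp: incseq_def le_fun_def intro!: mult_right_mono)
    have sup: "(SUP i. W' i) x * c x = (SUP i. W' i x * c x)" for x and c :: "'a \<Rightarrow> ennreal"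
      by (simp add: SUP_mult_right_ennreal image_comp)
    have eq: "?L (SUP i. W' i) s = (SUP i. ?L (W' i) s)" for s
      unfolding sup by (rule nn_integral_monotone_convergence_SUP[OF inc]) measurable
    have eq2: "?R (SUP i. W' i) = (SUP i. ?R (W' i))"
      unfolding sup[of _ "\<lambda>x. indicator U x * ennreal (norm (g x))"]
      by (rule nn_integral_monotone_convergence_SUP[OF inc]) measurable
    have incL: "incseq (\<lambda>i. ?L (W' i))"
      using incW by (auto simp: incseq_def le_fun_def intro!: nn_integral_mono mult_right_mono)
    have "(\<integral>\<^sup>+s. (SUP i. ?L (W' i) s) \<partial>lborel) = (SUP i. \<integral>\<^sup>+s. ?L (W' i) s \<partial>lborel)"
      using IH by (intro nn_integral_monotone_convergence_SUP[OF incL]) auto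
    then show ?case unfolding eq eq2 using IH by auto
  qed
  then show "?L W \<in> borel_measurable borel" "(\<integral>\<^sup>+s. ?L W s \<partial>lborel) = ?R W" by auto
qed

end

section \<open>Calculus of smooth functions\<close>

lemma frechet_derivative_cong_open:
  assumes "open S" "x \<in> S" and eq: "\<And>y. y \<in> S \<Longrightarrow> f y = g y"
  shows "frechet_derivative f (at x) = frechet_derivative g (at x)"
    and "f differentiable (at x) \<longleftrightarrow> g differentiable (at x)"
proof -
  have iff: "(f has_derivative D) (at x) \<longleftrightarrow> (g has_derivative D) (at x)" for D
    using has_derivative_transform_within_open[of f D x UNIV S g] has_derivative_transform_within_open[of g D x UNIV S f]
      assms by auto
  show "frechet_derivative f (at x) = frechet_derivative g (at x)"
    unfolding frechet_derivative_def iff ..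
  show "f differentiable (at x) \<longleftrightarrow> g differentiable (at x)"
    unfolding differentiable_def iff ..
qed

lemma Ck_on_cong:
  assumes S: "open S"
  shows "(\<And>x. x \<in> S \<Longrightarrow> f x = g x) \<Longrightarrow> Ck_on k S f \<longleftrightarrow> Ck_on k S g"
proof (induction k arbitrary: f g)
  case 0
  then show ?case by (simp cong: continuous_on_cong)
next
  case (Suc k)
  have "Ck_on k S (\<lambda>x. frechet_derivative f (at x) v) \<longleftrightarrow> Ck_on k S (\<lambda>x. frechet_derivative g (at x) v)" for v
    by (rule Suc.IH) (simp add: frechet_derivative_cong_open(1)[OF S _ Suc.prems])
  moreover have "f differentiable (at x) \<longleftrightarrow> g differentiable (at x)" if "x \<in> S" for x
    by (rule frechet_derivative_cong_open(2)[OF S that Suc.prems])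
  ultimately show ?case by simp
qed

lemma Ck_on_pred: "Ck_on (Suc k) S f \<Longrightarrow> Ck_on k S f"
proof (induction k arbitrary: f)
  case 0
  then have "\<forall>x\<in>S. isCont f x" using differentiable_imp_continuous_within by auto
  then show ?case by (simp add: continuous_at_imp_continuous_on)
next
  case (Suc k)
  have "Ck_on (Suc k) S (\<lambda>x. frechet_derivative f (at x) v)" for v using Suc.prems by simp
  then have "Ck_on k S (\<lambda>x. frechet_derivative f (at x) v)" for v by (rule Suc.IH)
  then show ?case using Suc.prems by simp
qed

lemma Ck_on_SucI:
  assumes S: "open S" and D: "\<And>x. x \<in> S \<Longrightarrow> (f has_derivative D x) (at x)"
    and Ck: "\<And>v. Ck_on k S (\<lambda>x. D x v)"
  shows "Ck_on (Suc k) S f"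
proof -
  have eq: "frechet_derivative f (at x) v = D x v" if "x \<in> S" for x v
    using frechet_derivative_at[OF D[OF that]] by simp
  have "Ck_on k S (\<lambda>x. frechet_derivative f (at x) v)" for v
    using Ck_on_cong[OF S, of "\<lambda>x. frechet_derivative f (at x) v" "\<lambda>x. D x v" k] eq Ck by simp
  moreover have "f differentiable (at x)" if "x \<in> S" for x
    using D[OF that] by (rule differentiableI)
  ultimately show ?thesis by simp
qed

lemma Ck_on_SucD:
  assumes "Ck_on (Suc k) S f"
  shows "x \<in> S \<Longrightarrow> (f has_derivative frechet_derivative f (at x)) (at x)"
    and "Ck_on k S (\<lambda>x. frechet_derivative f (at x) v)"
  using assms by (auto simp: frechet_derivative_works)

lemma Ck_on_const: "open S \<Longrightarrow> Ck_on k S (\<lambda>_. c)"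
proof (induction k arbitrary: c)
  case (Suc k)
  show ?case by (rule Ck_on_SucI[where D="\<lambda>_ _. 0"]) (use Suc in auto)
qed simp

lemma Ck_on_bounded_linear: "open S \<Longrightarrow> bounded_linear L \<Longrightarrow> Ck_on k S L"
proof (cases k)
  case 0
  assume "bounded_linear L"
  then show ?thesis using 0 by (simp add: linear_continuous_on)
next
  case (Suc m)
  assume S: "open S" and L: "bounded_linear L"
  show ?thesis unfolding Suc
    by (rule Ck_on_SucI[where D="\<lambda>_. L", OF S]) (use S L in \<open>auto intro: bounded_linear_imp_has_derivative Ck_on_const\<close>)
qed

lemma Ck_on_add: "open S \<Longrightarrow> Ck_on k S f \<Longrightarrow> Ck_on k S g \<Longrightarrow> Ck_on k S (\<lambda>x. f x + g x)"
proof (induction k arbitrary: f g)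
  case 0
  then show ?case by (simp add: continuous_on_add)
next
  case (Suc k)
  note f = Ck_on_SucD[OF Suc.prems(2)] and g = Ck_on_SucD[OF Suc.prems(3)]
  show ?case
  proof (rule Ck_on_SucI[OF Suc.prems(1)])
    show "((\<lambda>x. f x + g x) has_derivative (\<lambda>v. frechet_derivative f (at x) v + frechet_derivative g (at x) v)) (at x)"
      if "x \<in> S" for x using f(1)[OF that] g(1)[OF that] by (rule has_derivative_add)
    show "Ck_on k S (\<lambda>x. frechet_derivative f (at x) v + frechet_derivative g (at x) v)" for v
      by (rule Suc.IH[OF Suc.prems(1) f(2) g(2)])
  qed
qed

lemma Ck_on_linear_compose:
  assumes S: "open S" and L: "bounded_linear L"
  shows "Ck_on k S f \<Longrightarrow> Ck_on k S (\<lambda>x. L (f x))"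
proof (induction k arbitrary: f)
  case 0
  then show ?case using bounded_linear.continuous_on[OF L] by simp
next
  case (Suc k)
  note f = Ck_on_SucD[OF Suc.prems]
  show ?case
  proof (rule Ck_on_SucI[OF S])
    show "((\<lambda>x. L (f x)) has_derivative (\<lambda>v. L (frechet_derivative f (at x) v))) (at x)" if "x \<in> S" for x
      by (rule bounded_linear.has_derivative[OF L f(1)[OF that]])
    show "Ck_on k S (\<lambda>x. L (frechet_derivative f (at x) v))" for v
      by (rule Suc.IH[OF f(2)])
  qed
qed

lemma Ck_on_bilinear:
  assumes S: "open S" and B: "bounded_bilinear B"
  shows "Ck_on k S f \<Longrightarrow> Ck_on k S g \<Longrightarrow> Ck_on k S (\<lambda>x. B (f x) (g x))"
proof (induction k arbitrary: f g)
  case 0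
  then show ?case using bounded_bilinear.continuous_on[OF B] by simp
next
  case (Suc k)
  note f = Ck_on_SucD[OF Suc.prems(1)] and g = Ck_on_SucD[OF Suc.prems(2)]
  show ?case
  proof (rule Ck_on_SucI[OF S])
    show "((\<lambda>x. B (f x) (g x)) has_derivative
        (\<lambda>v. B (f x) (frechet_derivative g (at x) v) + B (frechet_derivative f (at x) v) (g x))) (at x)"
      if "x \<in> S" for x by (rule bounded_bilinear.FDERIV[OF B f(1)[OF that] g(1)[OF that]])
    show "Ck_on k S (\<lambda>x. B (f x) (frechet_derivative g (at x) v) + B (frechet_derivative f (at x) v) (g x))" for v
      by (intro Ck_on_add S Suc.IH f(2) g(2) Ck_on_pred[OF Suc.prems(1)] Ck_on_pred[OF Suc.prems(2)])
  qed
qed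

lemma Ck_on_sum: "open S \<Longrightarrow> (\<And>i. i \<in> I \<Longrightarrow> Ck_on k S (f i)) \<Longrightarrow> Ck_on k S (\<lambda>x. \<Sum>i\<in>I. f i x)"
proof (induction I rule: infinite_finite_induct)
  case (insert i I)
  then show ?case by (simp add: Ck_on_add)
qed (simp_all add: Ck_on_const)

text \<open>A derivative in a variable direction is a linear combination of derivatives in fixed directions.  By
  this expansion, statements about \<^const>\<open>Ck_on\<close>, which involves fixed directions only, extend to variable ones.\<close>

lemma linear_euclidean_expand:
  assumes "linear D"
  shows "D v = (\<Sum>b\<in>Basis. (v \<bullet> b) *\<^sub>R D b)"
proof -
  have "D v = D (\<Sum>b\<in>Basis. (v \<bullet> b) *\<^sub>R b)" by (simp add: euclidean_representation)
  then show ?thesis using assms by (simp add: linear_sum linear_scale)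
qed

lemma Ck_on_compose:
  fixes f :: "'b::euclidean_space \<Rightarrow> 'c::real_normed_vector"
  assumes S: "open S"
  shows "Ck_on k T f \<Longrightarrow> Ck_on k S g \<Longrightarrow> g ` S \<subseteq> T \<Longrightarrow> Ck_on k S (\<lambda>x. f (g x))"
proof (induction k arbitrary: f g)
  case 0
  then show ?case using continuous_on_compose2[of T f S g] by simp
next
  case (Suc k)
  note f = Ck_on_SucD[OF Suc.prems(1)] and g = Ck_on_SucD[OF Suc.prems(2)]
  show ?case
  proof (rule Ck_on_SucI[OF S])
    fix x assume x: "x \<in> S"
    then have gx: "g x \<in> T" using Suc.prems(3) by blast
    have lin: "linear (frechet_derivative f (at (g x)))"
      using f(1)[OF gx] by (rule has_derivative_linear)
    have "((\<lambda>x. f (g x)) has_derivative (\<lambda>v. frechet_derivative f (at (g x)) (frechet_derivative g (at x) v))) (at x)"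
      by (rule has_derivative_compose[OF g(1)[OF x] f(1)[OF gx]])
    then show "((\<lambda>x. f (g x)) has_derivative
        (\<lambda>v. \<Sum>b\<in>Basis. (frechet_derivative g (at x) v \<bullet> b) *\<^sub>R frechet_derivative f (at (g x)) b)) (at x)"
      by (subst (asm) linear_euclidean_expand[OF lin])
  next
    fix v
    show "Ck_on k S (\<lambda>x. \<Sum>b\<in>Basis. (frechet_derivative g (at x) v \<bullet> b) *\<^sub>R frechet_derivative f (at (g x)) b)"
    proof (intro Ck_on_sum S)
      fix b :: 'b
      have "Ck_on k S (\<lambda>x. frechet_derivative f (at (g x)) b)"
        by (rule Suc.IH[OF f(2) Ck_on_pred[OF Suc.prems(2)] Suc.prems(3)])
      moreover have "Ck_on k S (\<lambda>x. frechet_derivative g (at x) v \<bullet> b)"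
        by (rule Ck_on_linear_compose[OF S bounded_linear_inner_left g(2)])
      ultimately show "Ck_on k S (\<lambda>x. (frechet_derivative g (at x) v \<bullet> b) *\<^sub>R frechet_derivative f (at (g x)) b)"
        by (intro Ck_on_bilinear[OF S bounded_bilinear_scaleR])
    qed
  qed
qed

lemma smooth_on_has_derivative:
  "smooth_on S f \<Longrightarrow> x \<in> S \<Longrightarrow> (f has_derivative frechet_derivative f (at x)) (at x)"
  using Ck_on_SucD(1)[of 0 S f x] unfolding smooth_on_def by blast

lemma smooth_on_frechet: "smooth_on S f \<Longrightarrow> smooth_on S (\<lambda>x. frechet_derivative f (at x) v)"
  using Ck_on_SucD(2)[of _ S f v] unfolding smooth_on_def by blast

lemma smooth_on_continuous: "smooth_on S f \<Longrightarrow> continuous_on S f"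
  unfolding smooth_on_def using Ck_on.simps(1) by blast

lemma smooth_on_cong: "open S \<Longrightarrow> (\<And>x. x \<in> S \<Longrightarrow> f x = g x) \<Longrightarrow> smooth_on S f \<longleftrightarrow> smooth_on S g"
  unfolding smooth_on_def using Ck_on_cong[of S f g] by auto

lemma smooth_on_subset: "smooth_on T f \<Longrightarrow> S \<subseteq> T \<Longrightarrow> smooth_on S f"
proof -
  have "Ck_on k T f \<Longrightarrow> S \<subseteq> T \<Longrightarrow> Ck_on k S f" for k
  proof (induction k arbitrary: f)
    case 0
    then show ?case using continuous_on_subset[of T f S] by simp
  next
    case (Suc k)
    have "Ck_on k S (\<lambda>x. frechet_derivative f (at x) v)" for v
      using Suc.prems by (intro Suc.IH) auto
    then show ?case using Suc.prems by auto
  qed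
  then show "smooth_on T f \<Longrightarrow> S \<subseteq> T \<Longrightarrow> smooth_on S f" unfolding smooth_on_def by blast
qed

lemma smooth_on_const: "open S \<Longrightarrow> smooth_on S (\<lambda>_. c)"
  unfolding smooth_on_def using Ck_on_const by blast

lemma smooth_on_bounded_linear: "open S \<Longrightarrow> bounded_linear L \<Longrightarrow> smooth_on S L"
  unfolding smooth_on_def using Ck_on_bounded_linear by blast

lemma smooth_on_linear_compose: "open S \<Longrightarrow> bounded_linear L \<Longrightarrow> smooth_on S f \<Longrightarrow> smooth_on S (\<lambda>x. L (f x))"
  unfolding smooth_on_def using Ck_on_linear_compose by blast

lemma smooth_on_add: "open S \<Longrightarrow> smooth_on S f \<Longrightarrow> smooth_on S g \<Longrightarrow> smooth_on S (\<lambda>x. f x + g x)"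
  unfolding smooth_on_def using Ck_on_add by blast

lemma smooth_on_bilinear: "open S \<Longrightarrow> bounded_bilinear B \<Longrightarrow> smooth_on S f \<Longrightarrow> smooth_on S g \<Longrightarrow> smooth_on S (\<lambda>x. B (f x) (g x))"
  unfolding smooth_on_def using Ck_on_bilinear by blast

lemma smooth_on_sum: "open S \<Longrightarrow> (\<And>i. i \<in> I \<Longrightarrow> smooth_on S (f i)) \<Longrightarrow> smooth_on S (\<lambda>x. \<Sum>i\<in>I. f i x)"
  unfolding smooth_on_def by (intro allI Ck_on_sum) blast+

lemma smooth_on_compose:
  fixes f :: "'b::euclidean_space \<Rightarrow> 'c::real_normed_vector"
  shows "open S \<Longrightarrow> smooth_on T f \<Longrightarrow> smooth_on S g \<Longrightarrow> g ` S \<subseteq> T \<Longrightarrow> smooth_on S (\<lambda>x. f (g x))"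
  unfolding smooth_on_def using Ck_on_compose[of S _ T f g] by blast

lemma smooth_on_Pair:
  assumes "open S" "smooth_on S f" "smooth_on S g"
  shows "smooth_on S (\<lambda>x. (f x, g x))"
proof -
  have "smooth_on S (\<lambda>x. (f x, 0) + (0, g x))"
    by (rule smooth_on_add[OF assms(1)])
      (rule smooth_on_linear_compose[OF assms(1), of "\<lambda>y. (y, 0)"] smooth_on_linear_compose[OF assms(1), of "\<lambda>y. (0, y)"],
        auto intro!: bounded_linear_Pair bounded_linear_ident bounded_linear_zero assms)+
  then show ?thesis by simp
qed

text \<open>Both mixed derivatives are the limit of the same second difference quotient.\<close>

lemma mixed_difference_quotient:
  fixes f :: "'a::real_normed_vector \<Rightarrow> real"
  assumes S: "open S" and f: "smooth_on S f" and x: "x \<in> S" and e: "e > 0"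
  shows "eventually (\<lambda>h. \<bar>(f (x + h *\<^sub>R v + h *\<^sub>R w) - f (x + h *\<^sub>R v) - f (x + h *\<^sub>R w) + f x) / h\<^sup>2 -
     frechet_derivative (\<lambda>y. frechet_derivative f (at y) v) (at x) w\<bar> < e) (at_right 0)"
proof -
  define f1 where "f1 y = frechet_derivative f (at y) v" for y
  define f2 where "f2 y = frechet_derivative f1 (at y) w" for y
  have s1: "smooth_on S f1" unfolding f1_def by (rule smooth_on_frechet[OF f])
  then have s2: "smooth_on S f2" unfolding f2_def by (rule smooth_on_frechet)
  obtain r where r: "r > 0" "ball x r \<subseteq> S" using S x open_contains_ball by blast
  have "continuous_on S f2" by (rule smooth_on_continuous[OF s2])
  then obtain r' where r': "r' > 0" "\<And>y. y \<in> S \<Longrightarrow> dist y x < r' \<Longrightarrow> dist (f2 y) (f2 x) < e"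
    using x e unfolding continuous_on_iff by blast
  define R where "R = min r r'"
  have R: "R > 0" using r r' by (simp add: R_def)
  define C where "C = norm v + norm w + 1"
  have C: "C > 0" by (simp add: C_def add_nonneg_pos)
  have near: "x + s *\<^sub>R v + t *\<^sub>R w \<in> S" "\<bar>f2 (x + s *\<^sub>R v + t *\<^sub>R w) - f2 x\<bar> < e"
    if "0 \<le> s" "s \<le> h" "0 \<le> t" "t \<le> h" "0 < h" "h < R / C" for s t h
  proof -
    have "norm (s *\<^sub>R v + t *\<^sub>R w) \<le> s * norm v + t * norm w"
      using that by (intro order_trans[OF norm_triangle_ineq]) auto
    also have "\<dots> \<le> h * norm v + h * norm w"
      using that by (intro add_mono mult_right_mono) auto
    also have "\<dots> \<le> h * C" using that by (simp add: C_def algebra_simps)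
    also have "\<dots> < R" using that C by (simp add: field_simps)
    finally have d: "dist (x + s *\<^sub>R v + t *\<^sub>R w) x < R" by (simp add: dist_norm add.assoc)
    then show "x + s *\<^sub>R v + t *\<^sub>R w \<in> S" using r(2) by (auto simp: R_def dist_commute subset_iff)
    with r'(2)[of "x + s *\<^sub>R v + t *\<^sub>R w"] d show "\<bar>f2 (x + s *\<^sub>R v + t *\<^sub>R w) - f2 x\<bar> < e"
      by (simp add: R_def dist_real_def)
  qed
  have main: "\<bar>(f (x + h *\<^sub>R v + h *\<^sub>R w) - f (x + h *\<^sub>R v) - f (x + h *\<^sub>R w) + f x) / h\<^sup>2 - f2 x\<bar> < e"
    if h: "0 < h" "h < R / C" for h
  proof -
    define \<phi> where "\<phi> s = f (x + s *\<^sub>R v + h *\<^sub>R w) - f (x + s *\<^sub>R v)" for s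
    have d: "((\<lambda>s. f (x + s *\<^sub>R v + t *\<^sub>R w)) has_real_derivative f1 (x + s *\<^sub>R v + t *\<^sub>R w)) (at s)"
      if st: "0 \<le> s" "s \<le> h" "0 \<le> t" "t \<le> h" for s t
    proof -
      have "((\<lambda>s. x + s *\<^sub>R v + t *\<^sub>R w) has_derivative (\<lambda>k. k *\<^sub>R v)) (at s)"
        by (auto intro!: derivative_eq_intros)
      then have "((\<lambda>s. f (x + s *\<^sub>R v + t *\<^sub>R w)) has_derivative
          (\<lambda>k. frechet_derivative f (at (x + s *\<^sub>R v + t *\<^sub>R w)) (k *\<^sub>R v))) (at s)"
        by (rule has_derivative_compose) (rule smooth_on_has_derivative[OF f near(1)[OF st h]])
      then show ?thesis
        by (rule has_derivative_imp_has_field_derivative)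
          (simp add: f1_def linear_scale[OF has_derivative_linear[OF smooth_on_has_derivative[OF f near(1)[OF st h]]]] mult.commute)
    qed
    have d1: "((\<lambda>t. f1 (x + s *\<^sub>R v + t *\<^sub>R w)) has_real_derivative f2 (x + s *\<^sub>R v + t *\<^sub>R w)) (at t)"
      if st: "0 \<le> s" "s \<le> h" "0 \<le> t" "t \<le> h" for s t
    proof -
      have "((\<lambda>t. x + s *\<^sub>R v + t *\<^sub>R w) has_derivative (\<lambda>k. k *\<^sub>R w)) (at t)"
        by (auto intro!: derivative_eq_intros)
      then have "((\<lambda>t. f1 (x + s *\<^sub>R v + t *\<^sub>R w)) has_derivative
          (\<lambda>k. frechet_derivative f1 (at (x + s *\<^sub>R v + t *\<^sub>R w)) (k *\<^sub>R w))) (at t)"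
        by (rule has_derivative_compose) (rule smooth_on_has_derivative[OF s1 near(1)[OF st h]])
      then show ?thesis
        by (rule has_derivative_imp_has_field_derivative)
          (simp add: f2_def linear_scale[OF has_derivative_linear[OF smooth_on_has_derivative[OF s1 near(1)[OF st h]]]] mult.commute)
    qed
    have d\<phi>: "(\<phi> has_real_derivative f1 (x + s *\<^sub>R v + h *\<^sub>R w) - f1 (x + s *\<^sub>R v)) (at s)" if "0 \<le> s" "s \<le> h" for s
      unfolding \<phi>_def using DERIV_diff[OF d[OF that, of h] d[OF that, of 0]] h by simp
    obtain s where s: "0 < s" "s < h" "\<phi> h - \<phi> 0 = (h - 0) * (f1 (x + s *\<^sub>R v + h *\<^sub>R w) - f1 (x + s *\<^sub>R v))"
      using MVT2[OF h(1) d\<phi>] by blast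
    obtain t where t: "0 < t" "t < h" "f1 (x + s *\<^sub>R v + h *\<^sub>R w) - f1 (x + s *\<^sub>R v + 0 *\<^sub>R w) = (h - 0) * f2 (x + s *\<^sub>R v + t *\<^sub>R w)"
      using MVT2[OF h(1) d1[of s]] s by force
    have "f (x + h *\<^sub>R v + h *\<^sub>R w) - f (x + h *\<^sub>R v) - f (x + h *\<^sub>R w) + f x = \<phi> h - \<phi> 0"
      by (simp add: \<phi>_def)
    also have "\<dots> = h\<^sup>2 * f2 (x + s *\<^sub>R v + t *\<^sub>R w)" using s(3) t(3) by (simp add: power2_eq_square)
    finally have "(f (x + h *\<^sub>R v + h *\<^sub>R w) - f (x + h *\<^sub>R v) - f (x + h *\<^sub>R w) + f x) / h\<^sup>2 = f2 (x + s *\<^sub>R v + t *\<^sub>R w)"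
      using h by simp
    then show ?thesis using near(2)[of s h t] s t h by simp
  qed
  have f2x: "frechet_derivative (\<lambda>y. frechet_derivative f (at y) v) (at x) w = f2 x"
    by (simp add: f2_def f1_def[abs_def])
  show ?thesis
    unfolding eventually_at_right_field f2x
    using main R C by (intro exI[of _ "R / C"]) simp
qed

lemma second_derivative_symmetric_real:
  fixes f :: "'a::real_normed_vector \<Rightarrow> real"
  assumes S: "open S" and f: "smooth_on S f" and x: "x \<in> S"
  shows "frechet_derivative (\<lambda>y. frechet_derivative f (at y) v) (at x) w =
    frechet_derivative (\<lambda>y. frechet_derivative f (at y) w) (at x) v" (is "?a = ?b")
proof (rule ccontr)
  assume "?a \<noteq> ?b"
  then have e: "\<bar>?a - ?b\<bar> / 2 > 0" by simp
  have swap: "x + h *\<^sub>R w + h *\<^sub>R v = x + h *\<^sub>R v + h *\<^sub>R w" for h by simp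
  have "eventually (\<lambda>h. \<bar>(f (x + h *\<^sub>R v + h *\<^sub>R w) - f (x + h *\<^sub>R v) - f (x + h *\<^sub>R w) + f x) / h\<^sup>2 - ?a\<bar> < \<bar>?a - ?b\<bar> / 2) (at_right 0)"
    by (rule mixed_difference_quotient[OF S f x e])
  moreover have "eventually (\<lambda>h. \<bar>(f (x + h *\<^sub>R v + h *\<^sub>R w) - f (x + h *\<^sub>R v) - f (x + h *\<^sub>R w) + f x) / h\<^sup>2 - ?b\<bar> < \<bar>?a - ?b\<bar> / 2) (at_right 0)"
    using mixed_difference_quotient[OF S f x e, of w v] unfolding swap
    by (rule eventually_mono) (simp add: algebra_simps)
  ultimately have "eventually (\<lambda>h::real. False) (at_right 0)"
  proof eventually_elim
    case (elim h)
    have "False" if "\<bar>q - a\<bar> < \<bar>a - b\<bar> / 2" "\<bar>q - b\<bar> < \<bar>a - b\<bar> / 2" for q a b :: real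
    proof -
      have "\<bar>a - b\<bar> \<le> \<bar>q - a\<bar> + \<bar>q - b\<bar>"
        using abs_triangle_ineq[of "a - q" "q - b"] by (simp add: abs_minus_commute)
      then show False using that by argo
    qed
    from this[OF elim] show ?case .
  qed
  then show False by simp
qed

lemma second_derivative_symmetric:
  fixes f :: "'a::real_normed_vector \<Rightarrow> 'b::euclidean_space"
  assumes S: "open S" and f: "smooth_on S f" and x: "x \<in> S"
  shows "frechet_derivative (\<lambda>y. frechet_derivative f (at y) v) (at x) w =
    frechet_derivative (\<lambda>y. frechet_derivative f (at y) w) (at x) v"
proof (rule euclidean_eqI)
  fix b :: 'b
  have fr: "frechet_derivative (\<lambda>y. g y \<bullet> b) (at y) u = frechet_derivative g (at y) u \<bullet> b"
    if "smooth_on S g" "y \<in> S" for g :: "'a \<Rightarrow> 'b" and y u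
  proof -
    have "((\<lambda>y. g y \<bullet> b) has_derivative (\<lambda>u. frechet_derivative g (at y) u \<bullet> b)) (at y)"
      by (rule bounded_linear.has_derivative[OF bounded_linear_inner_left smooth_on_has_derivative[OF that]])
    from frechet_derivative_at[OF this] show ?thesis by (simp add: fun_eq_iff)
  qed
  have sm: "smooth_on S (\<lambda>y. f y \<bullet> b)"
    by (rule smooth_on_linear_compose[OF S bounded_linear_inner_left f])
  have "frechet_derivative (\<lambda>y. frechet_derivative f (at y) v) (at x) w \<bullet> b
      = frechet_derivative (\<lambda>y. frechet_derivative (\<lambda>y. f y \<bullet> b) (at y) v) (at x) w" for v w
    unfolding fr[OF smooth_on_frechet[OF f] x, symmetric]
    by (subst frechet_derivative_cong_open(1)[OF S x, of "\<lambda>y. frechet_derivative f (at y) v \<bullet> b"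
          "\<lambda>y. frechet_derivative (\<lambda>y. f y \<bullet> b) (at y) v"]) (simp_all add: fr[OF f])
  then show "frechet_derivative (\<lambda>y. frechet_derivative f (at y) v) (at x) w \<bullet> b =
      frechet_derivative (\<lambda>y. frechet_derivative f (at y) w) (at x) v \<bullet> b"
    using second_derivative_symmetric_real[OF S sm x] by simp
qed

text \<open>The derivative of a derivative whose base point and direction both move.\<close>

lemma has_derivative_frechet_moving:
  fixes f :: "'b::euclidean_space \<Rightarrow> 'c::real_normed_vector"
  assumes T: "open T" and f: "smooth_on T f" and p: "(p has_derivative p') (at x)" and V: "(V has_derivative V') (at x)"
    and px: "p x \<in> T"
  shows "((\<lambda>y. frechet_derivative f (at (p y)) (V y)) has_derivative
    (\<lambda>w. frechet_derivative (\<lambda>q. frechet_derivative f (at q) (V x)) (at (p x)) (p' w)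
        + frechet_derivative f (at (p x)) (V' w))) (at x)"
proof -
  have lin: "linear (frechet_derivative f (at q))" if "q \<in> T" for q
    by (rule has_derivative_linear[OF smooth_on_has_derivative[OF f that]])
  have F: "((\<lambda>q. frechet_derivative f (at q) b) has_derivative frechet_derivative (\<lambda>q. frechet_derivative f (at q) b) (at (p x))) (at (p x))" for b
    by (rule smooth_on_has_derivative[OF smooth_on_frechet[OF f] px])
  have expand: "frechet_derivative (\<lambda>q. frechet_derivative f (at q) v) (at (p x)) w
      = (\<Sum>b\<in>Basis. (v \<bullet> b) *\<^sub>R frechet_derivative (\<lambda>q. frechet_derivative f (at q) b) (at (p x)) w)" for v w
  proof -
    have "((\<lambda>q. \<Sum>b\<in>Basis. (v \<bullet> b) *\<^sub>R frechet_derivative f (at q) b) has_derivative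
      (\<lambda>w. \<Sum>b\<in>Basis. (v \<bullet> b) *\<^sub>R frechet_derivative (\<lambda>q. frechet_derivative f (at q) b) (at (p x)) w)) (at (p x))"
      by (intro has_derivative_sum bounded_linear.has_derivative[OF bounded_linear_scaleR_right F])
    then have "((\<lambda>q. frechet_derivative f (at q) v) has_derivative
      (\<lambda>w. \<Sum>b\<in>Basis. (v \<bullet> b) *\<^sub>R frechet_derivative (\<lambda>q. frechet_derivative f (at q) b) (at (p x)) w)) (at (p x))"
      by (rule has_derivative_transform_within_open[OF _ T px]) (rule linear_euclidean_expand[OF lin, symmetric])
    from frechet_derivative_at[OF this] show ?thesis by (simp add: fun_eq_iff)
  qed
  have pT: "eventually (\<lambda>y. p y \<in> T) (at x)"
    using has_derivative_continuous[OF p] T px by (simp add: continuous_at topological_tendstoD)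
  have "((\<lambda>y. \<Sum>b\<in>Basis. (V y \<bullet> b) *\<^sub>R frechet_derivative f (at (p y)) b) has_derivative
    (\<lambda>w. \<Sum>b\<in>Basis. (V x \<bullet> b) *\<^sub>R frechet_derivative (\<lambda>q. frechet_derivative f (at q) b) (at (p x)) (p' w)
        + (V' w \<bullet> b) *\<^sub>R frechet_derivative f (at (p x)) b)) (at x)"
    by (intro has_derivative_sum has_derivative_scaleR bounded_linear.has_derivative[OF bounded_linear_inner_left V]
        has_derivative_compose[OF p F])
  then have "((\<lambda>y. \<Sum>b\<in>Basis. (V y \<bullet> b) *\<^sub>R frechet_derivative f (at (p y)) b) has_derivative
    (\<lambda>w. frechet_derivative (\<lambda>q. frechet_derivative f (at q) (V x)) (at (p x)) (p' w)
        + frechet_derivative f (at (p x)) (V' w))) (at x)"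
    unfolding sum.distrib expand[symmetric] linear_euclidean_expand[OF lin[OF px], symmetric] .
  then show ?thesis
  proof (rule has_derivative_transform_eventually)
    show "eventually (\<lambda>y. (\<Sum>b\<in>Basis. (V y \<bullet> b) *\<^sub>R frechet_derivative f (at (p y)) b) = frechet_derivative f (at (p y)) (V y)) (at x)"
      using pT by (rule eventually_mono) (rule linear_euclidean_expand[OF lin, symmetric])
    show "(\<Sum>b\<in>Basis. (V x \<bullet> b) *\<^sub>R frechet_derivative f (at (p x)) b) = frechet_derivative f (at (p x)) (V x)"
      by (rule linear_euclidean_expand[OF lin[OF px], symmetric])
  qed simp
qed

text \<open>The family \<open>exp (- 1/x) / x\<^sup>m\<close>, cut off at \<open>0\<close>, is closed under differentiation up to linear
  combinations, so that all its members are smooth.\<close>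

definition flat :: "nat \<Rightarrow> real \<Rightarrow> real" where
  "flat m x = (if x \<le> 0 then 0 else exp (- 1 / x) / x ^ m)"

lemma flat_derivative: "(flat m has_real_derivative flat (m + 2) x - real m * flat (m + 1) x) (at x)"
proof (cases x "0::real" rule: linorder_cases)
  case less
  have "((\<lambda>_. 0) has_real_derivative 0) (at x)" by simp
  then have "(flat m has_real_derivative 0) (at x)"
    by (rule has_field_derivative_transform_within_open[of _ _ _ "{..<0}"]) (use less in \<open>auto simp: flat_def\<close>)
  then show ?thesis using less by (simp add: flat_def)
next
  case greater
  have "((\<lambda>x. exp (- 1 / x) / x ^ m) has_real_derivative
     (exp (- 1 / x) * (1 / x\<^sup>2) * x ^ m - exp (- 1 / x) * (real m * x ^ (m - 1))) / (x ^ m * x ^ m)) (at x)"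
    using greater by (auto intro!: derivative_eq_intros simp: power2_eq_square field_simps)
  also have "(exp (- 1 / x) * (1 / x\<^sup>2) * x ^ m - exp (- 1 / x) * (real m * x ^ (m - 1))) / (x ^ m * x ^ m)
      = flat (m + 2) x - real m * flat (m + 1) x"
    using greater by (cases m) (auto simp: flat_def field_simps power2_eq_square)
  finally show ?thesis
    by (rule has_field_derivative_transform_within_open[of _ _ _ "{0<..}"]) (use greater in \<open>auto simp: flat_def\<close>)
next
  case equal
  have lim: "((\<lambda>y::real. flat m y / y) \<longlongrightarrow> 0) (at 0)"
  proof -
    have "((\<lambda>x::real. x ^ (m + 1) / exp x) \<longlongrightarrow> 0) at_top" by (rule tendsto_power_div_exp_0)
    then have "((\<lambda>y::real. inverse y ^ (m + 1) / exp (inverse y)) \<longlongrightarrow> 0) (at_right 0)"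
      by (rule filterlim_compose[OF _ filterlim_inverse_at_top_right])
    then have "((\<lambda>y::real. flat m y / y) \<longlongrightarrow> 0) (at_right 0)"
    proof (rule Lim_transform_eventually)
      show "eventually (\<lambda>y. inverse y ^ (m + 1) / exp (inverse y) = flat m y / y) (at_right 0)"
        unfolding eventually_at_right_field
        by (intro exI[of _ 1]) (auto simp: flat_def exp_minus field_simps)
    qed
    moreover have "((\<lambda>y::real. flat m y / y) \<longlongrightarrow> 0) (at_left 0)"
    proof (rule Lim_transform_eventually[OF tendsto_const])
      show "eventually (\<lambda>y. 0 = flat m y / y) (at_left 0)"
        unfolding eventually_at_left_field by (intro exI[of _ "-1"]) (auto simp: flat_def)
    qed
    ultimately show ?thesis by (simp add: filterlim_split_at)
  qed
  have "(flat m has_real_derivative 0) (at 0)"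
    unfolding has_field_derivative_iff using lim by (simp add: flat_def)
  then show ?thesis using equal by (simp add: flat_def)
qed

lemma Ck_on_flat: "Ck_on k UNIV (flat m)"
proof (induction k arbitrary: m)
  case 0
  show ?case using flat_derivative by (auto intro!: continuous_at_imp_continuous_on DERIV_isCont)
next
  case (Suc k)
  show ?case
  proof (rule Ck_on_SucI)
    show "(flat m has_derivative (\<lambda>v. v *\<^sub>R (flat (m + 2) x + (- real m) *\<^sub>R flat (m + 1) x))) (at x)" for x
      by (rule has_derivative_eq_rhs[OF flat_derivative[of m x, unfolded has_field_derivative_def]])
        (auto simp: fun_eq_iff)
    show "Ck_on k UNIV (\<lambda>x. v *\<^sub>R (flat (m + 2) x + (- real m) *\<^sub>R flat (m + 1) x))" for v :: real
      by (intro Ck_on_linear_compose[OF open_UNIV bounded_linear_scaleR_right] Ck_on_add open_UNIV Suc)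
  qed simp
qed

text \<open>Positive exactly in the open unit ball.\<close>

definition bump :: "'a::euclidean_space \<Rightarrow> real" where
  "bump x = flat 0 (1 - x \<bullet> x)"

lemma smooth_bump: "smooth_on UNIV bump"
proof -
  have fl: "smooth_on UNIV (flat 0)" unfolding smooth_on_def using Ck_on_flat by blast
  have inn: "smooth_on UNIV (\<lambda>x::'a. 1 + (- 1) *\<^sub>R (x \<bullet> x))"
    by (intro smooth_on_add smooth_on_const open_UNIV smooth_on_linear_compose[OF open_UNIV bounded_linear_scaleR_right]
        smooth_on_bilinear[OF open_UNIV bounded_bilinear_inner] smooth_on_bounded_linear bounded_linear_ident)
  have "smooth_on UNIV (\<lambda>x::'a. flat 0 (1 + (- 1) *\<^sub>R (x \<bullet> x)))"
    by (rule smooth_on_compose[OF open_UNIV fl inn subset_UNIV])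
  moreover have "(\<lambda>x::'a. flat 0 (1 + (- 1) *\<^sub>R (x \<bullet> x))) = bump"
    by (simp add: bump_def fun_eq_iff)
  ultimately show ?thesis by simp
qed

lemma bump_nonneg: "bump x \<ge> 0" by (simp add: bump_def flat_def)

lemma bump_pos: "norm x < 1 \<Longrightarrow> bump x > 0"
proof -
  assume "norm x < 1"
  then have "(norm x)\<^sup>2 < 1" by (simp add: power_less_one_iff)
  then show ?thesis by (simp add: bump_def flat_def power2_norm_eq_inner)
qed

lemma bump_zero: "norm x \<ge> 1 \<Longrightarrow> bump x = 0"
proof -
  assume "norm x \<ge> 1"
  then have "1 \<le> (norm x)\<^sup>2" by (simp add: one_le_power)
  then show ?thesis by (simp add: bump_def flat_def power2_norm_eq_inner)
qed

section \<open>Differential calculus on a Carnot group\<close>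

context carnot_group
begin

lemma gop_minus [simp]: "gop x (- x) = 0" "gop (- x) x = 0"
  using exp_coords[of 1 x "-1"] exp_coords[of "-1" x 1] by simp_all

lemma gop_cancel [simp]: "gop (- x) (gop x y) = y" "gop x (gop (- x) y) = y"
  by (simp_all add: assoc[symmetric] left_unit)

lemma ginv_eq: "ginv gop x = - x"
  unfolding ginv_def
proof (rule the_equality)
  fix y assume "gop x y = 0 \<and> gop y x = 0"
  then have "gop (- x) (gop x y) = gop (- x) 0" by simp
  then show "y = - x" by (simp only: gop_cancel right_unit)
qed simp

lemma minus_gop: "- gop x y = gop (- y) (- x)"
proof -
  have "gop (gop x y) (gop (- y) (- x)) = gop x (gop (gop y (- y)) (- x))" by (simp only: assoc)
  also have "\<dots> = 0" by (simp add: left_unit)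
  finally have "gop (- gop x y) (gop (gop x y) (gop (- y) (- x))) = gop (- gop x y) 0" by simp
  then show ?thesis by (simp only: gop_cancel right_unit)
qed

text \<open>The group law as a function on pairs, so that the usual calculus applies to it.\<close>

abbreviation G :: "(real^'n) \<times> (real^'n) \<Rightarrow> real^'n" where
  "G \<equiv> (\<lambda>p. gop (fst p) (snd p))"

abbreviation dG :: "real^'n \<Rightarrow> real^'n \<Rightarrow> (real^'n) \<times> (real^'n) \<Rightarrow> real^'n" where
  "dG x y \<equiv> frechet_derivative G (at (x, y))"

abbreviation X :: "real^'n \<Rightarrow> real^'n \<Rightarrow> real^'n" where
  "X \<equiv> left_inv_field gop"

lemma G_deriv: "(G has_derivative dG x y) (at (x, y))"
  by (rule smooth_on_has_derivative[OF smooth]) simp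

lemma dG_linear: "linear (dG x y)"
  by (rule has_derivative_linear[OF G_deriv])

lemma gop_has_derivative:
  assumes "(f has_derivative f') (at z)" "(g has_derivative g') (at z)"
  shows "((\<lambda>z. gop (f z) (g z)) has_derivative (\<lambda>v. dG (f z) (g z) (f' v, g' v))) (at z)"
  using has_derivative_compose[OF has_derivative_Pair[OF assms] G_deriv] by simp

lemma smooth_gop:
  fixes f g :: "'z::real_normed_vector \<Rightarrow> real^'n"
  assumes "open S" "smooth_on S f" "smooth_on S g"
  shows "smooth_on S (\<lambda>z. gop (f z) (g z))"
  using smooth_on_compose[OF assms(1) smooth smooth_on_Pair[OF assms] subset_UNIV] by simp

lemma gop_deriv_right: "(gop x has_derivative (\<lambda>v. dG x y (0, v))) (at y)"
  using gop_has_derivative[of "\<lambda>_. x" "\<lambda>_. 0" y "\<lambda>y. y" "\<lambda>v. v"] by simp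

lemma frechet_gop: "frechet_derivative (gop x) (at y) = (\<lambda>v. dG x y (0, v))"
  by (rule frechet_derivative_at[OF gop_deriv_right, symmetric])

lemma X_dG: "X c x = dG x 0 (0, c)"
  by (simp add: left_inv_field_def frechet_gop)

lemma continuous_gop:
  assumes "continuous_on S f" "continuous_on S g"
  shows "continuous_on S (\<lambda>z. gop (f z) (g z))"
proof -
  have "continuous_on UNIV G" by (rule smooth_on_continuous[OF smooth])
  from continuous_on_compose2[OF this continuous_on_Pair[OF assms]] show ?thesis by simp
qed

lemma gop_borel [measurable]:
  assumes [measurable]: "f \<in> borel_measurable M" "g \<in> borel_measurable M"
  shows "(\<lambda>z. gop (f z) (g z)) \<in> borel_measurable M"
proof -
  have "G \<in> borel_measurable borel"
    by (intro borel_measurable_continuous_onI smooth_on_continuous[OF smooth])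
  moreover have "(\<lambda>z. (f z, g z)) \<in> borel_measurable M" by measurable
  ultimately have "(\<lambda>z. G (f z, g z)) \<in> borel_measurable M" by (rule measurable_compose[rotated])
  then show ?thesis by simp
qed

lemma smooth_gop_left: "smooth_on UNIV (gop x)"
  using smooth_gop[OF open_UNIV smooth_on_const[OF open_UNIV] smooth_on_bounded_linear[OF open_UNIV bounded_linear_ident]] .

lemma smooth_X: "smooth_on UNIV (X c)"
proof -
  have "smooth_on UNIV (\<lambda>x. (\<lambda>q. frechet_derivative G (at q) (0, c)) (x, 0))"
    by (rule smooth_on_compose[OF open_UNIV smooth_on_frechet[OF smooth] _ subset_UNIV])
      (intro smooth_on_bounded_linear open_UNIV bounded_linear_Pair bounded_linear_ident bounded_linear_zero)
  then show ?thesis unfolding X_dG[abs_def] by simp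
qed

lemma X_deriv: "(X c has_derivative frechet_derivative (X c) (at x)) (at x)"
  by (rule smooth_on_has_derivative[OF smooth_X]) simp

lemma X_zero: "X c 0 = c"
proof -
  have "gop 0 = (\<lambda>x. x)" by (simp add: fun_eq_iff left_unit)
  then show ?thesis by (simp add: left_inv_field_def frechet_derivative_ident)
qed

lemma linear_X: "linear (\<lambda>c. X c x)"
  unfolding X_dG by (rule linear_compose[OF _ dG_linear, unfolded o_def]) (auto intro!: linearI)

lemma X_push: "X c (gop x y) = dG x y (0, X c y)"
proof -
  have "((\<lambda>z. gop x (gop y z)) has_derivative (\<lambda>v. dG x y (0, dG y 0 (0, v)))) (at 0)"
    using gop_has_derivative[OF has_derivative_const[of x] gop_deriv_right[of y 0]] by (simp add: right_unit)
  then have "(gop (gop x y) has_derivative (\<lambda>v. dG x y (0, dG y 0 (0, v)))) (at 0)"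
    by (simp add: assoc[abs_def] fun_eq_iff[symmetric] assoc)
  from frechet_derivative_at[OF this] have "frechet_derivative (gop (gop x y)) (at 0) c = dG x y (0, dG y 0 (0, c))"
    by (simp add: fun_eq_iff)
  then show ?thesis by (simp add: left_inv_field_def frechet_gop)
qed

text \<open>The mixed second derivative of the group law at the unit; the bracket is its antisymmetric part.\<close>

definition B :: "real^'n \<Rightarrow> real^'n \<Rightarrow> real^'n" where
  "B a c = frechet_derivative (X c) (at 0) a"

lemma lie_bracket_B: "lie_bracket gop a c = B a c - B c a"
  by (simp add: lie_bracket_def vf_bracket_def B_def X_zero)

lemma X_deriv_push:
  "frechet_derivative (X c) (at x) (X a x) =
    frechet_derivative (\<lambda>y. frechet_derivative (gop x) (at y) c) (at 0) a + X (B a c) x"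
proof -
  have 1: "((\<lambda>y. X c (gop x y)) has_derivative (\<lambda>w. frechet_derivative (X c) (at x) (dG x 0 (0, w)))) (at 0)"
    using has_derivative_compose[OF gop_deriv_right[of x 0] X_deriv[of c "gop x 0"]] by (simp add: right_unit)
  have 2: "((\<lambda>y. frechet_derivative (gop x) (at y) (X c y)) has_derivative
      (\<lambda>w. frechet_derivative (\<lambda>y. frechet_derivative (gop x) (at y) (X c 0)) (at 0) w
        + frechet_derivative (gop x) (at 0) (frechet_derivative (X c) (at 0) w))) (at 0)"
    by (rule has_derivative_frechet_moving[OF open_UNIV smooth_gop_left has_derivative_ident X_deriv]) simp
  have 3: "(\<lambda>y. frechet_derivative (gop x) (at y) (X c y)) = (\<lambda>y. X c (gop x y))"
    by (simp add: X_push frechet_gop)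
  have "(\<lambda>w. frechet_derivative (X c) (at x) (dG x 0 (0, w))) =
      (\<lambda>w. frechet_derivative (\<lambda>y. frechet_derivative (gop x) (at y) (X c 0)) (at 0) w
        + frechet_derivative (gop x) (at 0) (frechet_derivative (X c) (at 0) w))"
    by (rule has_derivative_unique[OF 1 2[unfolded 3]])
  from fun_cong[OF this, of a] show ?thesis
    by (simp only: X_zero B_def X_dG[of a x] X_dG[of "frechet_derivative (X c) (at 0) a" x] frechet_gop)
qed

text \<open>Left translations carry left invariant fields to themselves and hence also their brackets; the second
  derivatives of the translation cancel by symmetry.\<close>

lemma vf_bracket_X: "vf_bracket (X a) (X c) x = X (lie_bracket gop a c) x"
proof -
  have "frechet_derivative (\<lambda>y. frechet_derivative (gop x) (at y) c) (at 0) a =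
      frechet_derivative (\<lambda>y. frechet_derivative (gop x) (at y) a) (at 0) c"
    by (rule second_derivative_symmetric[OF open_UNIV smooth_gop_left]) simp
  then have "vf_bracket (X a) (X c) x = X (B a c) x - X (B c a) x"
    by (simp add: vf_bracket_def X_deriv_push)
  also have "\<dots> = X (lie_bracket gop a c) x"
    unfolding lie_bracket_B by (rule linear_diff[OF linear_X, symmetric])
  finally show ?thesis .
qed

text \<open>Left invariant fields as differential operators.\<close>

definition XD :: "real^'n \<Rightarrow> (real^'n \<Rightarrow> real) \<Rightarrow> real^'n \<Rightarrow> real" where
  "XD a f x = frechet_derivative f (at x) (X a x)"

lemma smooth_XD:
  assumes S: "open S" and f: "smooth_on S f"
  shows "smooth_on S (XD a f)"
proof -
  have lin: "linear (frechet_derivative f (at x))" if "x \<in> S" for x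
    by (rule has_derivative_linear[OF smooth_on_has_derivative[OF f that]])
  have Xs: "smooth_on S (X a)" by (rule smooth_on_subset[OF smooth_X subset_UNIV])
  have "smooth_on S (\<lambda>x. \<Sum>b\<in>Basis. (X a x \<bullet> b) *\<^sub>R frechet_derivative f (at x) b)"
    by (intro smooth_on_sum S smooth_on_bilinear[OF S bounded_bilinear_scaleR]
        smooth_on_linear_compose[OF S bounded_linear_inner_left] Xs smooth_on_frechet f)
  then show ?thesis
    using smooth_on_cong[OF S, of "XD a f" "\<lambda>x. \<Sum>b\<in>Basis. (X a x \<bullet> b) *\<^sub>R frechet_derivative f (at x) b"]
      linear_euclidean_expand[OF lin] by (simp add: XD_def)
qed

lemma XD_commutator:
  assumes S: "open S" and f: "smooth_on S f" and x: "x \<in> S"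
  shows "XD a (XD c f) x - XD c (XD a f) x = XD (lie_bracket gop a c) f x"
proof -
  have lin: "linear (frechet_derivative f (at x))"
    by (rule has_derivative_linear[OF smooth_on_has_derivative[OF f x]])
  have D: "XD a (XD c f) x = frechet_derivative (\<lambda>q. frechet_derivative f (at q) (X c x)) (at x) (X a x)
      + frechet_derivative f (at x) (frechet_derivative (X c) (at x) (X a x))" for a c
  proof -
    have "(XD c f has_derivative (\<lambda>w. frechet_derivative (\<lambda>q. frechet_derivative f (at q) (X c x)) (at x) w
        + frechet_derivative f (at x) (frechet_derivative (X c) (at x) w))) (at x)"
      unfolding XD_def[abs_def]
      by (rule has_derivative_frechet_moving[OF S f has_derivative_ident X_deriv x])
    from frechet_derivative_at[OF this] show ?thesis by (simp add: XD_def[of a] fun_eq_iff)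
  qed
  have "frechet_derivative (\<lambda>q. frechet_derivative f (at q) (X c x)) (at x) (X a x)
      = frechet_derivative (\<lambda>q. frechet_derivative f (at q) (X a x)) (at x) (X c x)"
    by (rule second_derivative_symmetric_real[OF S f x])
  then have "XD a (XD c f) x - XD c (XD a f) x = frechet_derivative f (at x) (vf_bracket (X a) (X c) x)"
    unfolding D vf_bracket_def linear_diff[OF lin] by simp
  then show ?thesis by (simp add: vf_bracket_X XD_def)
qed

lemma XD_linear: "(f has_derivative D) (at x) \<Longrightarrow> XD (r *\<^sub>R a + c) f x = r * XD a f x + XD c f x"
proof -
  assume D: "(f has_derivative D) (at x)"
  have "XD a f x = D (X a x)" for a using frechet_derivative_at[OF D] by (simp add: XD_def)
  moreover have "X (r *\<^sub>R a + c) x = r *\<^sub>R X a x + X c x"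
    by (simp only: linear_add[OF linear_X] linear_scale[OF linear_X])
  ultimately show ?thesis
    by (simp add: linear_add[OF has_derivative_linear[OF D]] linear_scale[OF has_derivative_linear[OF D]])
qed

text \<open>Inherited from the commutators of differential operators, evaluated at the unit on linear functions.\<close>

lemma jacobi:
  "lie_bracket gop (lie_bracket gop a b) c =
    lie_bracket gop a (lie_bracket gop b c) - lie_bracket gop b (lie_bracket gop a c)"
proof (rule euclidean_eqI)
  fix e :: "real^'n"
  let ?f = "\<lambda>x. x \<bullet> e"
  have f: "smooth_on UNIV ?f" by (rule smooth_on_bounded_linear[OF open_UNIV bounded_linear_inner_left])
  have val: "XD v ?f 0 = v \<bullet> e" for v
  proof -
    have "(?f has_derivative ?f) (at 0)" by (rule bounded_linear_imp_has_derivative[OF bounded_linear_inner_left])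
    from fun_cong[OF frechet_derivative_at[OF this], of v] show ?thesis by (simp only: XD_def X_zero)
  qed
  have s: "smooth_on UNIV (XD v h)" if "smooth_on UNIV h" for v h
    using smooth_XD[OF open_UNIV that] .
  have com: "XD (lie_bracket gop a b) h x = XD a (XD b h) x - XD b (XD a h) x"
    if "smooth_on UNIV h" for a b h x
    using XD_commutator[OF open_UNIV that] by simp
  have sub: "XD v (\<lambda>x. h1 x - h2 x) x = XD v h1 x - XD v h2 x"
    if "smooth_on UNIV h1" "smooth_on UNIV h2" for v h1 h2 x
  proof -
    have "((\<lambda>x. h1 x - h2 x) has_derivative (\<lambda>w. frechet_derivative h1 (at x) w - frechet_derivative h2 (at x) w)) (at x)"
      using that by (intro has_derivative_diff smooth_on_has_derivative[where S=UNIV]) auto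
    from fun_cong[OF frechet_derivative_at[OF this], of "X v x"] show ?thesis by (simp only: XD_def)
  qed
  have com': "XD v (XD (lie_bracket gop a b) ?f) x = XD v (XD a (XD b ?f)) x - XD v (XD b (XD a ?f)) x" for v a b x
    unfolding com[OF f, abs_def] by (rule sub) (intro s f)+
  show "lie_bracket gop (lie_bracket gop a b) c \<bullet> e =
    (lie_bracket gop a (lie_bracket gop b c) - lie_bracket gop b (lie_bracket gop a c)) \<bullet> e"
  proof -
    have "XD (lie_bracket gop (lie_bracket gop a b) c) ?f 0 =
        XD (lie_bracket gop a (lie_bracket gop b c)) ?f 0 - XD (lie_bracket gop b (lie_bracket gop a c)) ?f 0"
      unfolding com[OF f] com[OF s[OF f]] com' by simp
    then show ?thesis by (simp only: val inner_diff_left)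
  qed
qed

lemma linear_B: "linear (\<lambda>a. B a c)" "linear (\<lambda>c. B a c)"
proof -
  show "linear (\<lambda>a. B a c)" unfolding B_def by (rule has_derivative_linear[OF X_deriv])
  show "linear (\<lambda>c. B a c)"
  proof (rule linearI)
    fix c d
    have "X (c + d) = (\<lambda>x. X c x + X d x)" by (rule ext) (rule linear_add[OF linear_X])
    then have "(X (c + d) has_derivative (\<lambda>w. frechet_derivative (X c) (at 0) w + frechet_derivative (X d) (at 0) w)) (at 0)"
      using has_derivative_add[OF X_deriv X_deriv] by simp
    from frechet_derivative_at[OF this] show "B a (c + d) = B a c + B a d" by (simp add: B_def fun_eq_iff)
  next
    fix r c
    have "X (r *\<^sub>R c) = (\<lambda>x. r *\<^sub>R X c x)" by (rule ext) (rule linear_scale[OF linear_X])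
    then have "(X (r *\<^sub>R c) has_derivative (\<lambda>w. r *\<^sub>R frechet_derivative (X c) (at 0) w)) (at 0)"
      using has_derivative_scaleR_right[OF X_deriv] by simp
    from frechet_derivative_at[OF this] show "B a (r *\<^sub>R c) = r *\<^sub>R B a c" by (simp add: B_def fun_eq_iff)
  qed
qed

lemma linear_lie: "linear (\<lambda>a. lie_bracket gop a c)" "linear (\<lambda>c. lie_bracket gop a c)"
  unfolding lie_bracket_B by (intro linear_compose_sub linear_B)+

lemma mem_layer: "x \<in> layer deg i \<longleftrightarrow> (\<forall>j. deg j \<noteq> i \<longrightarrow> x $ j = 0)"
proof
  assume "x \<in> layer deg i"
  then show "\<forall>j. deg j \<noteq> i \<longrightarrow> x $ j = 0"
    unfolding layer_def
  proof (induction rule: span_induct_alt)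
    case (step c y z)
    then show ?case by (auto simp: axis_def split: if_splits)
  qed simp
next
  assume h: "\<forall>j. deg j \<noteq> i \<longrightarrow> x $ j = 0"
  have "x = (\<Sum>j\<in>UNIV. x $ j *\<^sub>R axis j 1)"
    using basis_expansion[of x] by (simp add: vector_scalar_mult_def scaleR_vec_def scalar_mult_eq_scaleR)
  also have "\<dots> \<in> layer deg i"
    unfolding layer_def
  proof (rule span_sum)
    fix j show "x $ j *\<^sub>R axis j 1 \<in> span {axis j 1 |j. deg j = i}"
    proof (cases "deg j = i")
      case True
      then show ?thesis by (intro span_scale span_base) blast
    next
      case False
      then show ?thesis using h by (simp add: span_zero)
    qed
  qed
  finally show "x \<in> layer deg i" .
qed

lemma subspace_layer: "subspace (layer deg i)"
  unfolding layer_def by (rule subspace_span)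

text \<open>The stratification assumes this for \<open>k = 1\<close> only; the Jacobi identity extends it to brackets of brackets.\<close>

lemma lie_layers: "1 \<le> k \<Longrightarrow> 1 \<le> i \<Longrightarrow> a \<in> layer deg k \<Longrightarrow> c \<in> layer deg i \<Longrightarrow> lie_bracket gop a c \<in> layer deg (k + i)"
proof (induction k arbitrary: i a c rule: nat_induct_at_least)
  case base
  then have "lie_bracket gop a c \<in> span {lie_bracket gop a b | a b. a \<in> layer deg 1 \<and> b \<in> layer deg i}"
    by (intro span_base) blast
  then show ?case using stratified[of i] base by simp
next
  case (Suc k)
  have "a \<in> span {lie_bracket gop a b | a b. a \<in> layer deg 1 \<and> b \<in> layer deg k}"
    using stratified[OF Suc.hyps] Suc.prems by simp
  then show ?case
  proof (induction rule: span_induct_alt)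
    case base
    show ?case using linear_0[OF linear_lie(1)] subspace_0[OF subspace_layer] by simp
  next
    case (step r v w)
    then obtain a1 b1 where ab: "a1 \<in> layer deg 1" "b1 \<in> layer deg k" "v = lie_bracket gop a1 b1" by blast
    have step1: "lie_bracket gop u d \<in> layer deg (Suc j)" if "u \<in> layer deg 1" "d \<in> layer deg j" "1 \<le> j" for u d j
    proof -
      have "lie_bracket gop u d \<in> span {lie_bracket gop a b | a b. a \<in> layer deg 1 \<and> b \<in> layer deg j}"
        using that by (intro span_base) blast
      then show ?thesis using stratified[OF that(3)] by simp
    qed
    have "lie_bracket gop b1 c \<in> layer deg (k + i)" by (rule Suc.IH[OF Suc.prems(1) ab(2) Suc.prems(3)])
    then have 1: "lie_bracket gop a1 (lie_bracket gop b1 c) \<in> layer deg (Suc (k + i))"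
      using Suc.prems(1) by (intro step1[OF ab(1)]) auto
    have "lie_bracket gop a1 c \<in> layer deg (Suc i)" by (rule step1[OF ab(1) Suc.prems(3,1)])
    then have "lie_bracket gop b1 (lie_bracket gop a1 c) \<in> layer deg (k + Suc i)"
      by (intro Suc.IH[OF _ ab(2)]) auto
    then have "lie_bracket gop v c \<in> layer deg (Suc k + i)"
      unfolding ab(3) jacobi using 1 by (intro subspace_diff[OF subspace_layer]) auto
    moreover have "lie_bracket gop (r *\<^sub>R v + w) c = r *\<^sub>R lie_bracket gop v c + lie_bracket gop w c"
      using linear_add[OF linear_lie(1)] linear_scale[OF linear_lie(1)] by simp
    ultimately show ?case using step(2)
      by (simp add: subspace_add[OF subspace_layer] subspace_scale[OF subspace_layer])
  qed
qed

text \<open>By the grading, the component of \<open>[a, c]\<close> in degree \<open>d\<close> only involves components of \<open>c\<close> of degree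
  less than \<open>d\<close>.\<close>

lemma lie_component_zero:
  assumes "\<And>l. deg l < deg k \<Longrightarrow> c $ l = 0"
  shows "lie_bracket gop a c $ k = 0"
proof -
  have basis: "lie_bracket gop (axis j 1) (axis l 1) $ k = 0" if "deg k \<le> deg l" for j l
  proof -
    have "lie_bracket gop (axis j 1) (axis l 1) \<in> layer deg (deg j + deg l)"
      by (intro lie_layers deg_pos) (auto simp: mem_layer axis_def)
    moreover have "deg k \<noteq> deg j + deg l" using that deg_pos[of j] by simp
    ultimately show ?thesis by (simp add: mem_layer)
  qed
  have ex: "v = (\<Sum>j\<in>UNIV. v $ j *\<^sub>R axis j 1)" for v :: "real^'n"
    using basis_expansion[of v] by (simp add: scalar_mult_eq_scaleR)
  have "lie_bracket gop a c = (\<Sum>l\<in>UNIV. \<Sum>j\<in>UNIV. (a $ j * c $ l) *\<^sub>R lie_bracket gop (axis j 1) (axis l 1))"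
    by (subst ex[of a], subst ex[of c])
      (simp add: linear_sum[OF linear_lie(1)] linear_sum[OF linear_lie(2)] linear_scale[OF linear_lie(1)]
        linear_scale[OF linear_lie(2)] scaleR_sum_right mult.commute)
  also have "\<dots> $ k = (\<Sum>l\<in>UNIV. \<Sum>j\<in>UNIV. (a $ j * c $ l) * lie_bracket gop (axis j 1) (axis l 1) $ k)"
    by (simp add: sum_component)
  also have "\<dots> = 0"
  proof (intro sum.neutral ballI)
    fix j l show "(a $ j * c $ l) * lie_bracket gop (axis j 1) (axis l 1) $ k = 0"
      using assms[of l] basis[of l j] by (cases "deg l < deg k") auto
  qed
  finally show ?thesis .
qed

text \<open>The curve \<open>M t = d/ds ((- t a) \<circ> (t (a + s b)))\<close> at \<open>s = 0\<close>, which describes the differential of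
  the exponential map, solves \<open>M' = b - [a, M]\<close>.\<close>

lemma exp_differential_ode:
  fixes a b :: "real^'n"
  defines "M \<equiv> \<lambda>t. dG (- (t *\<^sub>R a)) (t *\<^sub>R a) (0, t *\<^sub>R b)"
  shows "(M has_vector_derivative b - lie_bracket gop a (M t)) (at t)"
proof -
  define m where "m = M t"
  define \<Phi> where "\<Phi> h = dG (- (h *\<^sub>R a)) (h *\<^sub>R a) (X m (- (h *\<^sub>R a)), h *\<^sub>R b)" for h
  have M\<Phi>: "M (t + h) = \<Phi> h" for h
  proof -
    let ?c = "\<lambda>r s. r *\<^sub>R (a + s *\<^sub>R b)"
    have dc: "(?c r has_derivative (\<lambda>s. s *\<^sub>R (r *\<^sub>R b))) (at 0)" for r
      by (auto intro!: derivative_eq_intros simp: mult.commute)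
    have lhs: "((\<lambda>s. gop (- (r *\<^sub>R a)) (?c r s)) has_derivative (\<lambda>s. dG (- (r *\<^sub>R a)) (r *\<^sub>R a) (0, s *\<^sub>R (r *\<^sub>R b)))) (at 0)" for r
      using gop_has_derivative[OF has_derivative_const[of "- (r *\<^sub>R a)"] dc[of r]] by simp
    have "gop (- ((t + h) *\<^sub>R a)) (?c (t + h) s) = gop (gop (- (h *\<^sub>R a)) (gop (- (t *\<^sub>R a)) (?c t s))) (?c h s)" for s
    proof -
      have "- ((t + h) *\<^sub>R a) = gop (- (h *\<^sub>R a)) (- (t *\<^sub>R a))"
        using exp_coords[of "- h" a "- t"] by (simp add: algebra_simps)
      moreover have "?c (t + h) s = gop (?c t s) (?c h s)" by (rule exp_coords[symmetric])
      ultimately show ?thesis by (simp add: assoc)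
    qed
    then have eq: "(\<lambda>s. gop (- ((t + h) *\<^sub>R a)) (?c (t + h) s)) = (\<lambda>s. gop (gop (- (h *\<^sub>R a)) (gop (- (t *\<^sub>R a)) (?c t s))) (?c h s))"
      by (rule ext)
    have zero: "gop (- (t *\<^sub>R a)) (?c t 0) = 0" by simp
    have "((\<lambda>s. gop (gop (- (h *\<^sub>R a)) (gop (- (t *\<^sub>R a)) (?c t s))) (?c h s)) has_derivative
      (\<lambda>s. dG (- (h *\<^sub>R a)) (h *\<^sub>R a) (dG (- (h *\<^sub>R a)) 0 (0, dG (- (t *\<^sub>R a)) (t *\<^sub>R a) (0, s *\<^sub>R (t *\<^sub>R b))), s *\<^sub>R (h *\<^sub>R b)))) (at 0)"
      using gop_has_derivative[OF gop_has_derivative[OF has_derivative_const[of "- (h *\<^sub>R a)"] lhs[of t]] dc[of h]]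
      by (simp add: right_unit)
    from has_derivative_unique[OF this[folded eq] lhs]
    have "dG (- (h *\<^sub>R a)) (h *\<^sub>R a) (dG (- (h *\<^sub>R a)) 0 (0, dG (- (t *\<^sub>R a)) (t *\<^sub>R a) (0, 1 *\<^sub>R (t *\<^sub>R b))), 1 *\<^sub>R (h *\<^sub>R b))
      = dG (- ((t + h) *\<^sub>R a)) ((t + h) *\<^sub>R a) (0, 1 *\<^sub>R ((t + h) *\<^sub>R b))" by (rule fun_cong)
    then show ?thesis by (simp add: M_def \<Phi>_def m_def X_dG)
  qed
  have d1: "((\<lambda>h. (- (h *\<^sub>R a), h *\<^sub>R a)) has_derivative (\<lambda>h. (- (h *\<^sub>R a), h *\<^sub>R a))) (at 0)"
    by (auto intro!: derivative_eq_intros)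
  have "((\<lambda>h. X m (- (h *\<^sub>R a))) has_derivative (\<lambda>h. frechet_derivative (X m) (at (- (0 *\<^sub>R a))) (- (h *\<^sub>R a)))) (at 0)"
    by (rule has_derivative_compose[OF _ X_deriv]) (auto intro!: derivative_eq_intros)
  then have d2: "((\<lambda>h. (X m (- (h *\<^sub>R a)), h *\<^sub>R b)) has_derivative (\<lambda>h. (B (- (h *\<^sub>R a)) m, h *\<^sub>R b))) (at 0)"
    by (auto intro!: derivative_eq_intros simp: B_def)
  let ?H = "\<lambda>u v. frechet_derivative (\<lambda>q. frechet_derivative G (at q) u) (at (0, 0)) v"
  have "(\<Phi> has_derivative (\<lambda>h. ?H (m, 0) (- (h *\<^sub>R a), h *\<^sub>R a) + dG 0 0 (B (- (h *\<^sub>R a)) m, h *\<^sub>R b))) (at 0)"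
    using has_derivative_frechet_moving[OF open_UNIV smooth d1 d2] by (simp add: \<Phi>_def[abs_def] X_zero)
  moreover have "?H (m, 0) (- (h *\<^sub>R a), h *\<^sub>R a) + dG 0 0 (B (- (h *\<^sub>R a)) m, h *\<^sub>R b) = h *\<^sub>R (b - lie_bracket gop a m)" for h
  proof -
    have linH: "linear (?H u)" for u
      by (rule has_derivative_linear[OF smooth_on_has_derivative[OF smooth_on_frechet[OF smooth]]]) simp
    have H2: "?H (m, 0) (0, v) = B m v" for v
    proof -
      have "?H (m, 0) (0, v) = ?H (0, v) (m, 0)"
        by (rule second_derivative_symmetric[OF open_UNIV smooth]) simp
      also have "\<dots> = B m v"
      proof -
        have "((\<lambda>x. (\<lambda>q. frechet_derivative G (at q) (0, v)) (x, 0)) has_derivative (\<lambda>w. ?H (0, v) (w, 0))) (at 0)"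
          by (rule has_derivative_compose[where f="\<lambda>x. (x, 0)"])
            (auto intro!: derivative_eq_intros smooth_on_has_derivative[OF smooth_on_frechet[OF smooth]])
        then have "(X v has_derivative (\<lambda>w. ?H (0, v) (w, 0))) (at 0)" unfolding X_dG[abs_def] by simp
        from frechet_derivative_at[OF this] show ?thesis by (simp add: B_def fun_eq_iff)
      qed
      finally show ?thesis .
    qed
    have right: "dG x 0 (u, 0) = u" for x u
    proof -
      have "((\<lambda>x. gop x 0) has_derivative (\<lambda>u. dG x 0 (u, 0))) (at x)"
        using gop_has_derivative[of "\<lambda>x. x" "\<lambda>u. u" x "\<lambda>_. 0" "\<lambda>_. 0"] by simp
      moreover have "((\<lambda>x. gop x 0) has_derivative (\<lambda>u. u)) (at x)" by (simp add: right_unit)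
      ultimately have "(\<lambda>u. dG x 0 (u, 0)) = (\<lambda>u. u)" by (rule has_derivative_unique)
      then show ?thesis by (rule fun_cong)
    qed
    have H1: "?H (m, 0) (v, 0) = 0" for v
    proof -
      have "((\<lambda>x. (\<lambda>q. frechet_derivative G (at q) (m, 0)) (x, 0)) has_derivative (\<lambda>w. ?H (m, 0) (w, 0))) (at 0)"
        by (rule has_derivative_compose[where f="\<lambda>x. (x, 0)"])
          (auto intro!: derivative_eq_intros smooth_on_has_derivative[OF smooth_on_frechet[OF smooth]])
      then have "((\<lambda>x. m) has_derivative (\<lambda>w. ?H (m, 0) (w, 0))) (at 0)" by (simp add: right)
      from has_derivative_unique[OF this has_derivative_const] show ?thesis by (rule fun_cong)
    qed
    have "?H (m, 0) (- (h *\<^sub>R a), h *\<^sub>R a) = ?H (m, 0) (- (h *\<^sub>R a), 0) + ?H (m, 0) (0, h *\<^sub>R a)"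
      using linear_add[OF linH, of "(m, 0)" "(- (h *\<^sub>R a), 0)" "(0, h *\<^sub>R a)"] by simp
    also have "\<dots> = h *\<^sub>R B m a" unfolding H1 H2 using linear_scale[OF linear_B(2)] by simp
    finally have 1: "?H (m, 0) (- (h *\<^sub>R a), h *\<^sub>R a) = h *\<^sub>R B m a" .
    have "dG 0 0 (B (- (h *\<^sub>R a)) m, h *\<^sub>R b) = dG 0 0 (B (- (h *\<^sub>R a)) m, 0) + dG 0 0 (0, h *\<^sub>R b)"
      using linear_add[OF dG_linear[of 0 0], of "(B (- (h *\<^sub>R a)) m, 0)" "(0, h *\<^sub>R b)"] by simp
    also have "\<dots> = - (h *\<^sub>R B a m) + h *\<^sub>R b"
      unfolding right X_dG[symmetric] X_zero
      using linear_neg[OF linear_B(1)] linear_scale[OF linear_B(1)] by simp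
    finally show ?thesis using 1 by (simp add: lie_bracket_B algebra_simps)
  qed
  ultimately have "(\<Phi> has_vector_derivative (b - lie_bracket gop a m)) (at 0)"
    by (simp add: has_vector_derivative_def)
  then have "(\<Phi> has_derivative (\<lambda>h. h *\<^sub>R (b - lie_bracket gop a m))) (at (t - t))"
    by (simp add: has_vector_derivative_def)
  moreover have "((\<lambda>s. s - t) has_derivative (\<lambda>h. h)) (at t)" by (auto intro!: derivative_eq_intros)
  ultimately have "((\<lambda>s. \<Phi> (s - t)) has_vector_derivative (b - lie_bracket gop a m)) (at t)"
    using has_derivative_compose[of "\<lambda>s. s - t" "\<lambda>h. h" t UNIV \<Phi>] by (simp add: has_vector_derivative_def)
  moreover have "(\<lambda>s. \<Phi> (s - t)) = M" using M\<Phi>[of "_ - t"] by (simp add: fun_eq_iff flip: M\<Phi>)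
  ultimately show ?thesis by (simp add: m_def)
qed

text \<open>Unitriangularity with respect to the degrees, in terms of the action on vectors.\<close>

definition unitri :: "(real^'n \<Rightarrow> real^'n) \<Rightarrow> bool" where
  "unitri D \<longleftrightarrow> (\<forall>v k. (\<forall>l. deg l < deg k \<longrightarrow> v $ l = 0) \<longrightarrow> D v $ k = v $ k)"

text \<open>The \<open>k\<close>-th component of the differential equation \<open>M' = b - [a, M]\<close> reads \<open>M\<^sub>k' = b\<^sub>k\<close> as soon as the
  components of lower degree of \<open>b\<close>, and hence inductively those of \<open>M\<close>, vanish.\<close>

lemma unitri_maurer_cartan: "unitri (\<lambda>v. dG (- a) a (0, v))"
  unfolding unitri_def
proof (intro allI impI)
  fix b :: "real^'n" and k assume b: "\<forall>l. deg l < deg k \<longrightarrow> b $ l = 0"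
  define M where "M t = dG (- (t *\<^sub>R a)) (t *\<^sub>R a) (0, t *\<^sub>R b)" for t
  have M': "(M has_vector_derivative b - lie_bracket gop a (M t)) (at t)" for t
    using exp_differential_ode[of a b t] unfolding M_def[abs_def] .
  have M0: "M 0 = 0" using linear_0[OF dG_linear[of 0 0]] by (simp add: M_def zero_prod_def)
  have "\<forall>l. deg l < deg k \<longrightarrow> b $ l = 0 \<Longrightarrow> \<forall>t. M t $ k = t * b $ k" for k
  proof (induction "deg k" arbitrary: k rule: less_induct)
    case less
    have low: "M t $ l = 0" if "deg l < deg k" for l t
      using less.hyps[of l] less.prems that by (auto dest: less_trans)
    have "((\<lambda>t. M t $ k - t * b $ k) has_real_derivative 0) (at t)" for t
    proof -
      have "((\<lambda>t. M t $ k) has_vector_derivative (b - lie_bracket gop a (M t)) $ k) (at t)"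
        by (rule bounded_linear.has_vector_derivative[OF bounded_linear_vec_nth M'])
      then have "((\<lambda>t. M t $ k) has_real_derivative b $ k) (at t)"
        using lie_component_zero[of k "M t" a] low by (simp add: has_real_derivative_iff_has_vector_derivative)
      then show ?thesis by (auto intro!: derivative_eq_intros)
    qed
    then have "M t $ k - t * b $ k = M 0 $ k - 0 * b $ k" for t
      using DERIV_isconst_all by blast
    then show ?case using M0 by simp
  qed
  from this[OF b] have "M 1 $ k = 1 * b $ k" by blast
  then show "dG (- a) a (0, b) $ k = b $ k" by (simp add: M_def)
qed

lemma unitri_compose: "unitri C \<Longrightarrow> unitri D \<Longrightarrow> unitri (\<lambda>v. C (D v))"
  unfolding unitri_def
proof (intro allI impI)
  fix v :: "real^'n" and k
  assume C: "\<forall>v k. (\<forall>l. deg l < deg k \<longrightarrow> v $ l = 0) \<longrightarrow> C v $ k = v $ k"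
    and D: "\<forall>v k. (\<forall>l. deg l < deg k \<longrightarrow> v $ l = 0) \<longrightarrow> D v $ k = v $ k"
    and v: "\<forall>l. deg l < deg k \<longrightarrow> v $ l = 0"
  have "D v $ l = 0" if "deg l < deg k" for l
    using D[rule_format, of l v] v that by (auto dest: less_trans)
  then have "C (D v) $ k = D v $ k" using C by blast
  also have "\<dots> = v $ k" using D v by blast
  finally show "C (D v) $ k = v $ k" .
qed

lemma unitri_inverse:
  assumes E: "unitri E" and ED: "\<And>v. E (D v) = v"
  shows "unitri D"
  unfolding unitri_def
proof (intro allI)
  fix v k
  show "(\<forall>l. deg l < deg k \<longrightarrow> v $ l = 0) \<longrightarrow> D v $ k = v $ k"
  proof (induction "deg k" arbitrary: k rule: less_induct)
    case less
    show ?case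
    proof
      assume v: "\<forall>l. deg l < deg k \<longrightarrow> v $ l = 0"
      have "D v $ l = 0" if "deg l < deg k" for l
        using less.hyps[OF that] v that by (auto dest: less_trans)
      then have "E (D v) $ k = D v $ k" using E unfolding unitri_def by blast
      then show "D v $ k = v $ k" by (simp add: ED)
    qed
  qed
qed

lemma dG_inverse: "dG (- x) x (0, X c x) = c"
  using X_push[of c "- x" x] by (simp add: X_zero)

lemma unitri_X: "unitri (\<lambda>c. X c x)"
  by (rule unitri_inverse[OF unitri_maurer_cartan dG_inverse])

lemma X_surj: "X (dG (- x) x (0, v)) x = v"
proof -
  have "inj (\<lambda>c. X c x)" by (rule inj_on_inverseI[where g="\<lambda>v. dG (- x) x (0, v)"]) (rule dG_inverse)
  then have "surj (\<lambda>c. X c x)" by (rule linear_inj_imp_surj[OF linear_X])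
  then obtain c where "v = X c x" by blast
  then show ?thesis by (simp add: dG_inverse)
qed

text \<open>A left translation moves left invariant fields to left invariant fields, so its differential
  at \<open>y\<close> is \<open>X(x \<circ> y) X(y)\<^sup>-\<^sup>1\<close>, where \<open>X(x)\<close> is the map \<open>c \<mapsto> X c x\<close>.\<close>

lemma unitri_translation: "unitri (\<lambda>v. dG x y (0, v))"
proof -
  have "dG x y (0, v) = X (dG (- y) y (0, v)) (gop x y)" for v
    by (simp add: X_push X_surj)
  then have "(\<lambda>v. dG x y (0, v)) = (\<lambda>v. X (dG (- y) y (0, v)) (gop x y))" by (rule ext)
  then show ?thesis
    using unitri_compose[OF unitri_X[of "gop x y"] unitri_maurer_cartan[of y]] by simp
qed

text \<open>Integrated along segments: a left translation adds to each coordinate a function of the coordinates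
  of strictly smaller degree.\<close>

lemma gop_triangular:
  assumes "\<And>l. deg l < deg k \<Longrightarrow> y $ l = y' $ l"
  shows "gop x y $ k - y $ k = gop x y' $ k - y' $ k"
proof -
  define w where "w = y' - y"
  have w: "\<forall>l. deg l < deg k \<longrightarrow> w $ l = 0" using assms by (simp add: w_def)
  have "((\<lambda>s. gop x (y + s *\<^sub>R w) $ k - s * w $ k) has_real_derivative 0) (at s)" for s
  proof -
    have "((\<lambda>s. y + s *\<^sub>R w) has_derivative (\<lambda>s. s *\<^sub>R w)) (at s)" by (auto intro!: derivative_eq_intros)
    from has_derivative_compose[OF this gop_deriv_right[of x]]
    have "((\<lambda>s. gop x (y + s *\<^sub>R w)) has_derivative (\<lambda>h. dG x (y + s *\<^sub>R w) (0, h *\<^sub>R w))) (at s)" .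
    from bounded_linear.has_derivative[OF bounded_linear_vec_nth this, of k]
    have "((\<lambda>s. gop x (y + s *\<^sub>R w) $ k) has_derivative (\<lambda>h. dG x (y + s *\<^sub>R w) (0, h *\<^sub>R w) $ k)) (at s)" .
    moreover have "dG x (y + s *\<^sub>R w) (0, h *\<^sub>R w) $ k = w $ k * h" for h
    proof -
      have "\<forall>l. deg l < deg k \<longrightarrow> (h *\<^sub>R w) $ l = 0" using w by simp
      then show ?thesis using unitri_translation[of x "y + s *\<^sub>R w"] unfolding unitri_def by (simp add: mult.commute)
    qed
    ultimately have "((\<lambda>s. gop x (y + s *\<^sub>R w) $ k) has_real_derivative w $ k) (at s)"
      by (simp add: has_field_derivative_def)
    then show ?thesis by (auto intro!: derivative_eq_intros)
  qed
  then have "gop x (y + 1 *\<^sub>R w) $ k - 1 * w $ k = gop x (y + 0 *\<^sub>R w) $ k - 0 * w $ k"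
    using DERIV_isconst_all by blast
  then show ?thesis by (simp add: w_def)
qed

end

section \<open>Invariance of Lebesgue measure and critical points of the gauge\<close>

text \<open>Along the \<open>k\<close>-th coordinate lines the map is a translation, so that all line measures are preserved.\<close>

lemma shear_preserves_lborel:
  fixes p :: "real^'n \<Rightarrow> real" and k :: 'n
  assumes [measurable]: "p \<in> borel_measurable borel"
    and indep: "\<And>x \<tau>. p (x + \<tau> *\<^sub>R axis k 1) = p x"
  shows "distr lborel borel (\<lambda>x. x + p x *\<^sub>R axis k 1) = lborel"
proof (rule measure_eqI)
  let ?e = "axis k 1 :: real^'n"
  let ?S = "\<lambda>x. x + p x *\<^sub>R ?e"
  fix E assume "E \<in> sets (distr lborel borel ?S)"
  then have E[measurable]: "E \<in> sets borel" by simp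
  have SE: "?S -` E \<in> sets borel"
  proof -
    have "?S \<in> borel \<rightarrow>\<^sub>M borel" by measurable
    from measurable_sets[OF this E] show ?thesis by simp
  qed
  have ne: "norm ?e = 1" by simp
  have "line_measure ?e (?S -` E) x = line_measure ?e E x" for x
  proof -
    have "{\<tau>. x + \<tau> *\<^sub>R ?e \<in> ?S -` E} = {\<tau>. (x + p x *\<^sub>R ?e) + \<tau> *\<^sub>R ?e \<in> E}"
      by (simp add: indep algebra_simps)
    then have "line_measure ?e (?S -` E) x = line_measure ?e E (x + p x *\<^sub>R ?e)"
      by (simp only: line_measure_def)
    then show ?thesis by (simp only: line_measure_shift[OF E])
  qed
  then have "emeasure lborel (?S -` E) = emeasure lborel E"
    by (simp only: emeasure_line_measure[OF SE ne] emeasure_line_measure[OF E ne])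
  then show "emeasure (distr lborel borel ?S) E = emeasure lborel E"
    by (subst emeasure_distr) auto
qed simp

text \<open>A map that is triangular with respect to \<open>deg\<close> is a composition of shears: replace the coordinates
  one at a time, those of highest degree first, so that each new coordinate is computed from coordinates
  that are still unchanged.\<close>

lemma triangular_preserves_lborel:
  fixes T :: "real^'n \<Rightarrow> real^'n" and deg :: "'n \<Rightarrow> nat"
  assumes T[measurable]: "T \<in> borel_measurable borel"
    and tri: "\<And>k y y'. (\<And>l. deg l < deg k \<Longrightarrow> y $ l = y' $ l) \<Longrightarrow> T y $ k - y $ k = T y' $ k - y' $ k"
  shows "distr lborel borel T = lborel"
proof -
  define TA where "TA A y = (\<chi> k. if k \<in> A then T y $ k else y $ k)" for A y
  have comp: "TA A y $ k = (if k \<in> A then T y $ k else y $ k)" for A y k by (simp add: TA_def)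
  have "(\<forall>k\<in>A. \<forall>l. deg k < deg l \<longrightarrow> l \<in> A) \<Longrightarrow> TA A \<in> borel_measurable borel \<and> distr lborel borel (TA A) = lborel" for A
  proof (induction "card A" arbitrary: A)
    case 0
    then have "A = {}" by (simp add: card_eq_0_iff)
    then have "TA A = (\<lambda>x. x)" by (simp add: TA_def fun_eq_iff vec_eq_iff)
    then show ?case using distr_id2[of borel "lborel :: (real^'n) measure"] by simp
  next
    case (Suc n)
    then have "A \<noteq> {}" by auto
    then obtain k where k: "k \<in> A" "\<And>l. l \<in> A \<Longrightarrow> deg k \<le> deg l"
      using arg_min_least[of A _ deg] arg_min_if_finite(1)[of A deg] by (metis finite)
    define A' where "A' = A - {k}"
    have up: "\<forall>j\<in>A'. \<forall>l. deg j < deg l \<longrightarrow> l \<in> A'"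
      using Suc.prems k by (fastforce simp: A'_def)
    have "n = card A'" using Suc.hyps(2) k(1) by (simp add: A'_def)
    from Suc.hyps(1)[OF this up] have [measurable]: "TA A' \<in> borel_measurable borel"
      and IH: "distr lborel borel (TA A') = lborel" by auto
    define p where "p z = T z $ k - z $ k" for z
    have [measurable]: "(\<lambda>x. T x $ k) \<in> borel_measurable borel"
      by (rule measurable_compose[OF T]) (intro borel_measurable_continuous_onI continuous_intros)
    have [measurable]: "(\<lambda>x::real^'n. x $ k) \<in> borel_measurable borel"
      by (intro borel_measurable_continuous_onI continuous_intros)
    have p[measurable]: "p \<in> borel_measurable borel" unfolding p_def by measurable
    have pinv: "p (x + \<tau> *\<^sub>R axis k 1) = p x" for x \<tau>
      unfolding p_def by (rule tri) (auto simp: axis_def)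
    define S where "S = (\<lambda>z. z + p z *\<^sub>R axis k 1)"
    have S[measurable]: "S \<in> borel_measurable borel" unfolding S_def by measurable
    have SA: "TA A y = S (TA A' y)" for y
    proof -
      have "p (TA A' y) = p y"
        unfolding p_def
      proof (rule tri)
        fix l assume "deg l < deg k"
        then have "l \<notin> A'" using k(2)[of l] by (auto simp: A'_def)
        then show "TA A' y $ l = y $ l" by (simp add: comp)
      qed
      then show ?thesis using k(1) by (auto simp: vec_eq_iff S_def comp p_def A'_def axis_def)
    qed
    then have TA: "TA A = S \<circ> TA A'" by (simp add: fun_eq_iff)
    have "distr lborel borel (TA A) = distr (distr lborel borel (TA A')) borel S"
      unfolding TA by (subst distr_distr) auto
    also have "\<dots> = lborel" unfolding IH S_def by (rule shear_preserves_lborel[OF p pinv])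
    finally show ?case unfolding TA by (auto intro: measurable_comp)
  qed
  from this[of UNIV] have "distr lborel borel (TA UNIV) = lborel" by auto
  moreover have "TA UNIV = T" by (simp add: TA_def fun_eq_iff vec_eq_iff)
  ultimately show ?thesis by simp
qed

text \<open>For arbitrary \<open>f\<close>, the simple functions below \<open>f\<close> and those below \<open>f \<circ> T\<close>
  correspond to each other.\<close>

lemma nn_integral_measure_preserving:
  fixes f :: "'a \<Rightarrow> ennreal"
  assumes T: "T \<in> M \<rightarrow>\<^sub>M M" "distr M M T = M" and T': "T' \<in> M \<rightarrow>\<^sub>M M"
    and inv: "\<And>x. T' (T x) = x" "\<And>x. T (T' x) = x"
  shows "(\<integral>\<^sup>+x. f (T x) \<partial>M) = (\<integral>\<^sup>+x. f x \<partial>M)"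
proof -
  have le: "(\<integral>\<^sup>+x. f x \<partial>M) \<le> (\<integral>\<^sup>+x. f (S x) \<partial>M)"
    if S: "S \<in> M \<rightarrow>\<^sub>M M" "distr M M S = M" for S and f :: "'a \<Rightarrow> ennreal"
    unfolding nn_integral_def[of M f]
  proof (rule SUP_least, safe)
    fix h assume h: "simple_function M h" "h \<le> f"
    have hm: "h \<in> borel_measurable M" using h(1) by (rule borel_measurable_simple_function)
    have "integral\<^sup>S M h = (\<integral>\<^sup>+x. h x \<partial>M)" using h(1) by (rule nn_integral_eq_simple_integral[symmetric])
    also have "\<dots> = (\<integral>\<^sup>+x. h x \<partial>distr M M S)" by (simp only: S(2))
    also have "\<dots> = (\<integral>\<^sup>+x. h (S x) \<partial>M)" by (subst nn_integral_distr[OF S(1)]) (use hm in auto)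
    also have "\<dots> \<le> (\<integral>\<^sup>+x. f (S x) \<partial>M)" using h(2) by (intro nn_integral_mono) (auto simp: le_fun_def)
    finally show "integral\<^sup>S M h \<le> (\<integral>\<^sup>+x. f (S x) \<partial>M)" .
  qed
  have T'm: "distr M M T' = M"
  proof -
    have "distr M M T' = distr (distr M M T) M T'" by (simp only: T(2))
    also have "\<dots> = distr M M (T' \<circ> T)" by (rule distr_distr[OF T' T(1)])
    also have "\<dots> = distr M M (\<lambda>x. x)" by (simp add: o_def inv)
    finally show ?thesis by (simp add: distr_id2)
  qed
  have "(\<integral>\<^sup>+x. f (T x) \<partial>M) \<le> (\<integral>\<^sup>+x. f (T (T' x)) \<partial>M)" by (rule le[OF T' T'm])
  then show ?thesis using le[OF T, of f] by (simp add: inv antisym)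
qed

text \<open>Balls of half the isolation radius are disjoint, and a disjoint family of open sets is countable.\<close>

lemma countable_isolated_real:
  fixes A :: "real set"
  assumes "\<And>a. a \<in> A \<Longrightarrow> \<exists>d>0. \<forall>x\<in>A. x \<noteq> a \<longrightarrow> d \<le> dist x a"
  shows "countable A"
proof -
  obtain d where d: "\<And>a. a \<in> A \<Longrightarrow> d a > 0" "\<And>a x. a \<in> A \<Longrightarrow> x \<in> A \<Longrightarrow> x \<noteq> a \<Longrightarrow> d a \<le> dist x a"
    using bchoice[of A "\<lambda>a d. d > 0 \<and> (\<forall>x\<in>A. x \<noteq> a \<longrightarrow> d \<le> dist x a)"] assms by blast
  let ?b = "\<lambda>a. ball a (d a / 2)"
  have sep: "?b a \<inter> ?b c = {}" if "a \<in> A" "c \<in> A" "a \<noteq> c" for a c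
  proof (rule ccontr)
    assume "?b a \<inter> ?b c \<noteq> {}"
    then obtain x where x: "dist a x < d a / 2" "dist c x < d c / 2" by auto
    have "dist c a \<le> dist c x + dist a x" by (rule dist_triangle2)
    moreover have "d a \<le> dist c a" by (rule d(2)[OF that(1,2)]) (use that(3) in simp)
    moreover have "d c \<le> dist c a" using d(2)[OF that(2,1,3)] by (simp add: dist_commute)
    ultimately show False using x by simp
  qed
  have inj: "inj_on ?b A"
  proof (rule inj_onI)
    fix a c assume ac: "a \<in> A" "c \<in> A" "?b a = ?b c"
    have "a \<in> ?b a" using d(1)[OF ac(1)] by simp
    then show "a = c" using sep[OF ac(1,2)] ac(3) by blast
  qed
  have "countable (?b ` A)"
    by (rule countable_disjoint_open_subsets) (use sep in \<open>auto simp: pairwise_def disjnt_def\<close>)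
  then show ?thesis using inj by (simp add: countable_image_inj_eq)
qed

text \<open>On the zero set of \<open>f\<close>, the points where \<open>f\<close> has a nonzero derivative in direction \<open>v\<close> are isolated
  on each line in that direction; hence they form a null set.\<close>

lemma AE_zero_set_derivative:
  fixes f :: "'a::euclidean_space \<Rightarrow> real"
  assumes U: "open U" and f: "smooth_on U f"
  shows "AE x in lborel. x \<in> U \<and> f x = 0 \<longrightarrow> frechet_derivative f (at x) v = 0"
proof -
  let ?f' = "\<lambda>x. frechet_derivative f (at x) v"
  define S where "S = {x\<in>U. f x = 0 \<and> ?f' x \<noteq> 0}"
  have cf: "continuous_on U f" and cf': "continuous_on U ?f'"
    by (intro smooth_on_continuous smooth_on_frechet f)+
  have S[measurable]: "S \<in> sets borel"
  proof -
    have "closedin (top_of_set U) (U \<inter> f -` {0})" by (rule continuous_closedin_preimage[OF cf]) simp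
    then obtain C where C: "closed C" "U \<inter> f -` {0} = U \<inter> C" by (auto simp: closedin_closed)
    have "openin (top_of_set U) (U \<inter> ?f' -` (- {0}))" by (rule continuous_openin_preimage_gen[OF cf']) auto
    then have O: "open (U \<inter> ?f' -` (- {0}))" using U by (simp add: openin_open_eq)
    have "S = (U \<inter> C) \<inter> (U \<inter> ?f' -` (- {0}))" unfolding C(2)[symmetric] by (auto simp: S_def)
    then show ?thesis using C O U by simp
  qed
  have ctb: "countable {\<tau>. x + \<tau> *\<^sub>R v \<in> S}" for x
  proof (rule countable_isolated_real)
    fix t assume "t \<in> {\<tau>. x + \<tau> *\<^sub>R v \<in> S}"
    then have t: "x + t *\<^sub>R v \<in> U" "f (x + t *\<^sub>R v) = 0" "?f' (x + t *\<^sub>R v) \<noteq> 0" by (auto simp: S_def)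
    note D = smooth_on_has_derivative[OF f t(1)]
    have "((\<lambda>s. x + s *\<^sub>R v) has_derivative (\<lambda>h. h *\<^sub>R v)) (at t)" by (auto intro!: derivative_eq_intros)
    from has_derivative_compose[OF this D]
    have "((\<lambda>s. f (x + s *\<^sub>R v)) has_derivative (\<lambda>h. h *\<^sub>R ?f' (x + t *\<^sub>R v))) (at t)"
      by (simp add: linear_scale[OF has_derivative_linear[OF D]])
    then have "((\<lambda>s. f (x + s *\<^sub>R v)) has_real_derivative ?f' (x + t *\<^sub>R v)) (at t)"
      by (rule has_derivative_imp_has_field_derivative) simp
    then have "((\<lambda>s. (f (x + s *\<^sub>R v) - f (x + t *\<^sub>R v)) / (s - t)) \<longlongrightarrow> ?f' (x + t *\<^sub>R v)) (at t)"
      by (simp add: has_field_derivative_iff)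
    from tendsto_imp_eventually_ne[OF this t(3)]
    obtain d where d: "d > 0" "\<And>s. s \<noteq> t \<Longrightarrow> dist s t < d \<Longrightarrow> f (x + s *\<^sub>R v) \<noteq> 0"
      unfolding eventually_at using t(2) by auto
    show "\<exists>d>0. \<forall>s\<in>{\<tau>. x + \<tau> *\<^sub>R v \<in> S}. s \<noteq> t \<longrightarrow> d \<le> dist s t"
    proof (intro exI[of _ d] conjI ballI impI)
      fix s assume "s \<in> {\<tau>. x + \<tau> *\<^sub>R v \<in> S}" "s \<noteq> t"
      then show "d \<le> dist s t" using d(2)[of s] by (auto simp: S_def not_less[symmetric])
    qed (rule d)
  qed
  have psf: "pair_sigma_finite (lborel::real measure) (lborel::'a measure)" ..
  have "emeasure lborel S = (\<integral>\<^sup>+\<tau>. indicator {0..1::real} \<tau> * emeasure lborel S \<partial>lborel)"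
    by (simp add: nn_integral_multc)
  also have "\<dots> = (\<integral>\<^sup>+\<tau>. (\<integral>\<^sup>+x. indicator {0..1} \<tau> * indicator S (x + \<tau> *\<^sub>R v) \<partial>lborel) \<partial>lborel)"
  proof (rule nn_integral_cong)
    fix \<tau> :: real
    have "(\<integral>\<^sup>+x. indicator S (x + \<tau> *\<^sub>R v) \<partial>lborel) = emeasure lborel S"
      by (subst nn_integral_lborel_shift) auto
    then show "indicator {0..1} \<tau> * emeasure lborel S = (\<integral>\<^sup>+x. indicator {0..1} \<tau> * indicator S (x + \<tau> *\<^sub>R v) \<partial>lborel)"
      by (subst nn_integral_cmult) auto
  qed
  also have "\<dots> = (\<integral>\<^sup>+x. (\<integral>\<^sup>+\<tau>. indicator {0..1} \<tau> * indicator S (x + \<tau> *\<^sub>R v) \<partial>lborel) \<partial>lborel)"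
    by (rule pair_sigma_finite.Fubini'[OF psf, symmetric]) measurable
  also have "\<dots> = (\<integral>\<^sup>+x. 0 \<partial>(lborel :: 'a measure))"
  proof (rule nn_integral_cong)
    fix x
    have "AE \<tau> in lborel. x + \<tau> *\<^sub>R v \<notin> S"
      using countable_imp_null_set_lborel[OF ctb[of x]] by (auto dest: AE_not_in)
    then have "AE \<tau> in lborel. indicator {0..1} \<tau> * indicator S (x + \<tau> *\<^sub>R v) = (0::ennreal)"
      by eventually_elim simp
    then show "(\<integral>\<^sup>+\<tau>. indicator {0..1} \<tau> * indicator S (x + \<tau> *\<^sub>R v) \<partial>lborel) = 0"
      by (subst nn_integral_0_iff_AE) auto
  qed
  finally have "S \<in> null_sets lborel" using S by (simp add: null_sets_def)
  from AE_not_in[OF this] show ?thesis by eventually_elim (auto simp: S_def)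
qed

context carnot_group
begin

lemma minus_borel: "distr lborel borel uminus = (lborel :: (real^'n) measure)"
  using lborel_affine[of "-1" "0 :: real^'n"] by (simp add: density_1 scaleR_minus_left)

lemma distr_left: "distr lborel borel (gop x) = lborel"
  by (rule triangular_preserves_lborel[where deg=deg]) (measurable, rule gop_triangular)

lemma distr_right: "distr lborel borel (\<lambda>y. gop y x) = lborel"
proof -
  have "(\<lambda>y. gop y x) = uminus \<circ> (gop (- x) \<circ> uminus)"
    by (simp add: fun_eq_iff minus_gop)
  then have "distr lborel borel (\<lambda>y. gop y x) = distr (distr (distr lborel borel uminus) borel (gop (- x))) borel uminus"
    by (simp add: distr_distr comp_assoc)
  then show ?thesis by (simp add: minus_borel distr_left)
qed

lemma nn_integral_left: "(\<integral>\<^sup>+y. f (gop x y) \<partial>lborel) = (\<integral>\<^sup>+y. f y \<partial>lborel)"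
  by (rule nn_integral_measure_preserving[where T'="gop (- x)"])
    (auto simp: distr_left measurable_lborel1 measurable_lborel2 cong: distr_cong)

lemma integral_right:
  fixes f :: "real^'n \<Rightarrow> real"
  assumes "f \<in> borel_measurable borel"
  shows "(\<integral>y. f (gop y x) \<partial>lborel) = (\<integral>y. f y \<partial>lborel)"
  using integral_distr[of "\<lambda>y. gop y x" lborel borel f] assms distr_right[of x] by simp

lemma hderiv_XD: "hderiv gop j f = XD (axis j 1) f"
  by (simp add: fun_eq_iff hderiv_def XD_def)

text \<open>Differentiate \<open>\<rho> (\<delta>\<^sub>s x) = s \<rho> x\<close> at \<open>s = 1\<close>.\<close>

lemma euler_identity:
  assumes \<rho>: "homogeneous_norm deg \<rho>" and x: "x \<noteq> 0"
  shows "frechet_derivative \<rho> (at x) (\<chi> j. real (deg j) * x $ j) = \<rho> x"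
proof -
  have sm: "smooth_on (- {0}) \<rho>" and hom: "\<And>s x. s > 0 \<Longrightarrow> \<rho> (dilation deg s x) = s * \<rho> x"
    using \<rho> by (auto simp: homogeneous_norm_def)
  have d1: "dilation deg 1 x = x" by (simp add: dilation_def vec_eq_iff)
  have "((\<lambda>s. dilation deg s x) has_derivative (\<lambda>h. \<chi> j. h * (real (deg j) * x $ j))) (at 1)"
  proof -
    have "((\<lambda>s. \<Sum>j\<in>UNIV. (s ^ deg j * x $ j) *\<^sub>R axis j 1) has_derivative
        (\<lambda>h. \<Sum>j\<in>UNIV. (h * (real (deg j) * x $ j)) *\<^sub>R axis j (1::real))) (at 1)"
      by (intro has_derivative_sum has_derivative_scaleR_left)
        (auto intro!: derivative_eq_intros simp: mult_ac)
    moreover have "(\<Sum>j\<in>UNIV. c j *\<^sub>R axis j 1) = (\<chi> j. c j)" for c :: "'n \<Rightarrow> real"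
      using basis_expansion[of "\<chi> j. c j"] by (simp add: scalar_mult_eq_scaleR)
    ultimately show ?thesis by (simp add: dilation_def[abs_def])
  qed
  from has_derivative_compose[OF this, of \<rho> "frechet_derivative \<rho> (at x)"]
  have "((\<lambda>s. \<rho> (dilation deg s x)) has_derivative (\<lambda>h. frechet_derivative \<rho> (at x) (\<chi> j. h * (real (deg j) * x $ j)))) (at 1)"
    using smooth_on_has_derivative[OF sm, of x] x by (simp add: d1)
  then have "((\<lambda>s. s * \<rho> x) has_derivative (\<lambda>h. frechet_derivative \<rho> (at x) (\<chi> j. h * (real (deg j) * x $ j)))) (at 1)"
    by (rule has_derivative_transform_within_open[of _ _ _ _ "{0<..}"]) (auto simp: hom)
  moreover have "((\<lambda>s. s * \<rho> x) has_derivative (\<lambda>h. h * \<rho> x)) (at 1)"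
    by (auto intro!: derivative_eq_intros)
  ultimately have "(\<lambda>h. frechet_derivative \<rho> (at x) (\<chi> j. h * (real (deg j) * x $ j))) = (\<lambda>h. h * \<rho> x)"
    by (rule has_derivative_unique)
  from fun_cong[OF this, of 1] show ?thesis by simp
qed

text \<open>Almost everywhere on the zero set of \<open>\<nabla>\<^sub>G \<rho>\<close>, the derivatives \<open>X\<^sub>a \<rho>\<close> for horizontal \<open>a\<close> have vanishing
  gradients themselves, so that the brackets of horizontal fields annihilate \<open>\<rho>\<close> as well.  Repeating this,
  by stratification all left invariant fields do so, which contradicts Euler's identity.\<close>

lemma AE_hgrad_nonzero:
  assumes \<rho>: "homogeneous_norm deg \<rho>"
  shows "AE x in lborel. x \<noteq> 0 \<longrightarrow> hgrad gop deg \<rho> x \<noteq> 0"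
proof -
  let ?U = "- {0} :: (real^'n) set"
  have U: "open ?U" by (rule open_Compl) simp
  have sm: "smooth_on ?U \<rho>" using \<rho> by (simp add: homogeneous_norm_def)
  define Z where "Z = {x\<in>?U. \<forall>j. deg j = 1 \<longrightarrow> XD (axis j 1) \<rho> x = 0}"
  define W where "W a \<longleftrightarrow> (AE x in lborel. x \<in> Z \<longrightarrow> XD a \<rho> x = 0)" for a
  have lin: "XD (r *\<^sub>R a + c) \<rho> x = r * XD a \<rho> x + XD c \<rho> x" if "x \<in> ?U" for r a c x
    by (rule XD_linear[OF smooth_on_has_derivative[OF sm that]])
  have XD0: "XD 0 \<rho> x = 0" if "x \<in> ?U" for x
    using lin[OF that, of "-1" 0 0] by simp
  have W0: "W 0" using XD0 unfolding W_def Z_def by auto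
  have Wlin: "W (r *\<^sub>R a + c)" if "W a" "W c" for r a c
    using that unfolding W_def
  proof eventually_elim
    case (elim x)
    then show ?case using lin[of x r a c] by (auto simp: Z_def)
  qed
  have Wspan: "W a" if "a \<in> span A" "\<And>v. v \<in> A \<Longrightarrow> W v" for a A
    using that(1)
  proof (induction rule: span_induct_alt)
    case (step r v w)
    then show ?case using Wlin that(2) by blast
  qed (rule W0)
  \<comment> \<open>a function that vanishes on \<open>Z\<close> has vanishing derivatives almost everywhere on \<open>Z\<close>\<close>
  have crit: "AE x in lborel. x \<in> Z \<longrightarrow> XD a (XD c \<rho>) x = 0" if c: "W c" for a c
  proof -
    have s: "smooth_on ?U (XD c \<rho>)" by (rule smooth_XD[OF U sm])
    have "AE x in lborel. \<forall>b\<in>Basis. x \<in> ?U \<and> XD c \<rho> x = 0 \<longrightarrow> frechet_derivative (XD c \<rho>) (at x) b = 0"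
      by (intro AE_finite_allI AE_zero_set_derivative[OF U s]) auto
    with c[unfolded W_def] show ?thesis
    proof eventually_elim
      case (elim x)
      show ?case
      proof
        assume x: "x \<in> Z"
        then have xU: "x \<in> ?U" by (simp add: Z_def)
        have b: "frechet_derivative (XD c \<rho>) (at x) b = 0" if "b \<in> Basis" for b
          using elim x xU that by blast
        have "linear (frechet_derivative (XD c \<rho>) (at x))"
          by (rule has_derivative_linear[OF smooth_on_has_derivative[OF s xU]])
        from linear_euclidean_expand[OF this, of "X a x"] b show "XD a (XD c \<rho>) x = 0"
          by (simp add: XD_def)
      qed
    qed
  qed
  have Wlie: "W (lie_bracket gop a c)" if "W a" "W c" for a c
    using crit[OF that(2), of a] crit[OF that(1), of c] unfolding W_def
  proof eventually_elim
    case (elim x)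
    then show ?case using XD_commutator[OF U sm, of x a c] by (auto simp: Z_def)
  qed
  have W1: "W a" if "a \<in> layer deg 1" for a
    using that unfolding layer_def
    by (rule Wspan) (auto simp: W_def Z_def)
  have "W a" if "1 \<le> i" "a \<in> layer deg i" for i a
    using that
  proof (induction i arbitrary: a rule: nat_induct_at_least)
    case (Suc i)
    have "a \<in> span {lie_bracket gop a b | a b. a \<in> layer deg 1 \<and> b \<in> layer deg i}"
      using stratified[OF Suc.hyps] Suc.prems by simp
    then show ?case by (rule Wspan) (use Wlie W1 Suc.IH in blast)
  qed (rule W1)
  then have "W (axis j 1)" for j
    using deg_pos[of j] by (auto simp: mem_layer axis_def)
  then have "AE x in lborel. \<forall>j\<in>UNIV. x \<in> Z \<longrightarrow> XD (axis j 1) \<rho> x = 0"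
    unfolding W_def by (intro AE_finite_allI) auto
  then show ?thesis
  proof eventually_elim
    case (elim x)
    show ?case
    proof (intro impI notI)
      assume x: "x \<noteq> 0" and h: "hgrad gop deg \<rho> x = 0"
      have "XD (axis j 1) \<rho> x = 0" if "deg j = 1" for j
      proof -
        have "hgrad gop deg \<rho> x $ j = 0" using h by simp
        then show ?thesis using that by (simp add: hgrad_def hderiv_XD)
      qed
      then have "x \<in> Z" using x by (simp add: Z_def)
      then have zero: "XD (axis j 1) \<rho> x = 0" for j using elim by blast
      have linD: "linear (frechet_derivative \<rho> (at x))"
        by (rule has_derivative_linear[OF smooth_on_has_derivative[OF sm]]) (use x in simp)
      have "linear (\<lambda>c. XD c \<rho> x)" unfolding XD_def
        using linear_compose[OF linear_X linD] by (simp add: o_def)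
      then have "XD c \<rho> x = 0" for c
      proof -
        assume l: "linear (\<lambda>c. XD c \<rho> x)"
        have "c = (\<Sum>j\<in>UNIV. c $ j *\<^sub>R axis j 1)" using basis_expansion[of c] by (simp add: scalar_mult_eq_scaleR)
        then have "XD c \<rho> x = XD (\<Sum>j\<in>UNIV. c $ j *\<^sub>R axis j 1) \<rho> x" by simp
        also have "\<dots> = (\<Sum>j\<in>UNIV. c $ j *\<^sub>R XD (axis j 1) \<rho> x)"
          by (simp only: linear_sum[OF l] linear_scale[OF l])
        also have "\<dots> = 0" by (simp add: zero)
        finally show ?thesis .
      qed
      then have "XD (dG (- x) x (0, v)) \<rho> x = 0" for v .
      then have "frechet_derivative \<rho> (at x) v = 0" for v by (simp only: XD_def X_surj)
      then have "\<rho> x = 0" using euler_identity[OF \<rho> x] by simp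
      moreover have "\<rho> x > 0" using \<rho> x by (simp add: homogeneous_norm_def)
      ultimately show False by simp
    qed
  qed
qed

end

section \<open>Integration by parts along left invariant fields\<close>

lemma Lipschitz_of_bounded_derivative:
  fixes h :: "real \<Rightarrow> real"
  assumes "\<And>s. s \<in> {- R..R} \<Longrightarrow> (h has_real_derivative h' s) (at s)"
    and "\<And>s. s \<in> {- R..R} \<Longrightarrow> \<bar>h' s\<bar> \<le> L" and "\<bar>t\<bar> \<le> R"
  shows "\<bar>h t - h 0\<bar> \<le> L * \<bar>t\<bar>"
proof -
  have "norm (h t - h 0) \<le> L * norm (t - 0)"
  proof (rule field_differentiable_bound[where S="{- R..R}" and f'=h'])
    show "(h has_field_derivative h' s) (at s within {- R..R})" if "s \<in> {- R..R}" for s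
      using assms(1)[OF that] by (rule has_field_derivative_at_within)
  qed (use assms in auto)
  then show ?thesis by simp
qed

text \<open>Differentiation under the integral sign against a bounded measurable weight of compact support.\<close>

lemma has_derivative_weighted_integral:
  fixes f f' :: "real \<Rightarrow> 'a::euclidean_space \<Rightarrow> real" and w :: "'a \<Rightarrow> real"
  assumes D: "\<And>s z. ((\<lambda>s. f s z) has_real_derivative f' s z) (at s)"
    and f: "\<And>s. continuous_on UNIV (f s)"
    and f': "continuous_on UNIV (\<lambda>(s, z). f' s z)"
    and w[measurable]: "w \<in> borel_measurable borel" and K: "compact K" and w0: "\<And>z. z \<notin> K \<Longrightarrow> w z = 0"
    and wC: "\<And>z. \<bar>w z\<bar> \<le> C"
  shows "((\<lambda>s. \<integral>z. f s z * w z \<partial>lborel) has_real_derivative (\<integral>z. f' 0 z * w z \<partial>lborel)) (at 0)"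
proof -
  have fm[measurable]: "f s \<in> borel_measurable borel" for s
    by (rule borel_measurable_continuous_onI[OF f])
  have "compact ({-1..1::real} \<times> K)" by (intro compact_Times K) simp
  then have "compact ((\<lambda>(s, z). f' s z) ` ({-1..1} \<times> K))"
    by (rule compact_continuous_image[rotated]) (rule continuous_on_subset[OF f'], simp)
  then have "bounded ((\<lambda>(s, z). f' s z) ` ({-1..1} \<times> K))" by (rule compact_imp_bounded)
  then obtain L where L': "\<forall>y\<in>(\<lambda>(s, z). f' s z) ` ({-1..1} \<times> K). norm y \<le> L" unfolding bounded_iff by blast
  have L: "\<bar>f' s z\<bar> \<le> L" if "s \<in> {-1..1}" "z \<in> K" for s z
    using L' that by force
  have Kb: "emeasure lborel K < \<infinity>" by (rule emeasure_compact_finite[OF K])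
  have Ks[measurable]: "K \<in> sets borel" using K by (simp add: compact_imp_closed)
  have int: "integrable lborel (\<lambda>z. f s z * w z)" for s
  proof -
    have "compact (f s ` K)" by (intro compact_continuous_image K continuous_on_subset[OF f]) simp
    then have "bounded (f s ` K)" by (rule compact_imp_bounded)
    then obtain M where M: "\<And>z. z \<in> K \<Longrightarrow> \<bar>f s z\<bar> \<le> M" unfolding bounded_iff by force
    have "integrable lborel (\<lambda>z. (M * C) * indicator K z)"
      using Kb by (intro integrable_mult_right integrable_real_indicator) auto
    then show ?thesis
    proof (rule Bochner_Integration.integrable_bound)
      show "AE z in lborel. norm (f s z * w z) \<le> norm ((M * C) * indicator K z)"
      proof (intro AE_I2)
        fix z
        show "norm (f s z * w z) \<le> norm ((M * C) * indicator K z)"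
        proof (cases "z \<in> K")
          case True
          have "\<bar>f s z * w z\<bar> \<le> M * C" unfolding abs_mult
            using M[OF True] wC[of z] by (intro mult_mono) auto
          then show ?thesis using True by simp
        qed (simp add: w0)
      qed
    qed measurable
  qed
  have "((\<lambda>h. ((\<integral>z. f h z * w z \<partial>lborel) - (\<integral>z. f 0 z * w z \<partial>lborel)) / (h - 0)) \<longlongrightarrow> (\<integral>z. f' 0 z * w z \<partial>lborel)) (at 0)"
    unfolding tendsto_at_iff_sequentially
  proof (intro allI impI)
    fix h :: "nat \<Rightarrow> real" assume hU: "\<forall>i. h i \<in> UNIV - {0}" and hl: "h \<longlonglongrightarrow> 0"
    have h0: "h i \<noteq> 0" for i using hU by simp
    have "eventually (\<lambda>i. dist (h i) 0 < 1) sequentially" using hl by (rule tendstoD) simp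
    then obtain N where N: "\<And>i. i \<ge> N \<Longrightarrow> \<bar>h i\<bar> < 1" by (auto simp: eventually_sequentially)
    have "(\<lambda>i. \<integral>z. ((f (h (i + N)) z - f 0 z) / h (i + N)) * w z \<partial>lborel) \<longlonglongrightarrow> (\<integral>z. f' 0 z * w z \<partial>lborel)"
    proof (rule integral_dominated_convergence[where w="\<lambda>z. (L * C) * indicator K z"])
      have "(\<lambda>z. f' 0 z) \<in> borel_measurable borel"
      proof (rule borel_measurable_continuous_onI)
        have "continuous_on UNIV (\<lambda>z. (\<lambda>(s, z). f' s z) (0, z))"
          by (rule continuous_on_compose2[OF f']) (intro continuous_on_Pair continuous_on_const continuous_on_id, simp)
        then show "continuous_on UNIV (\<lambda>z. f' 0 z)" by simp
      qed
      then show "(\<lambda>z. f' 0 z * w z) \<in> borel_measurable lborel" by simp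
      show "integrable lborel (\<lambda>z. (L * C) * indicator K z)"
        using Kb by (intro integrable_mult_right integrable_real_indicator) auto
      show "AE z in lborel. (\<lambda>i. ((f (h (i + N)) z - f 0 z) / h (i + N)) * w z) \<longlonglongrightarrow> f' 0 z * w z"
      proof (intro AE_I2 tendsto_mult tendsto_const)
        fix z
        have "((\<lambda>h. (f h z - f 0 z) / (h - 0)) \<longlongrightarrow> f' 0 z) (at 0)"
          using D[of z 0] by (simp add: has_field_derivative_iff)
        moreover have "filterlim (\<lambda>i. h (i + N)) (at 0) sequentially"
          using LIMSEQ_ignore_initial_segment[OF hl, of N] h0 by (auto simp: filterlim_at)
        ultimately show "(\<lambda>i. (f (h (i + N)) z - f 0 z) / h (i + N)) \<longlonglongrightarrow> f' 0 z"
          using filterlim_compose by force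
      qed
      show "AE z in lborel. norm (((f (h (i + N)) z - f 0 z) / h (i + N)) * w z) \<le> (L * C) * indicator K z" for i
      proof (intro AE_I2)
        fix z
        show "norm (((f (h (i + N)) z - f 0 z) / h (i + N)) * w z) \<le> (L * C) * indicator K z"
        proof (cases "z \<in> K")
          case True
          have "\<bar>f (h (i + N)) z - f 0 z\<bar> \<le> L * \<bar>h (i + N)\<bar>"
            by (rule Lipschitz_of_bounded_derivative[where R=1 and h'="\<lambda>s. f' s z"])
              (use D L[OF _ True] N[of "i + N"] in auto)
          then have q: "\<bar>(f (h (i + N)) z - f 0 z) / h (i + N)\<bar> \<le> L"
            using h0[of "i + N"] by (simp add: abs_divide pos_divide_le_eq)
          have "\<bar>(f (h (i + N)) z - f 0 z) / h (i + N)\<bar> * \<bar>w z\<bar> \<le> L * C"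
            by (rule mult_mono[OF q wC order_trans[OF abs_ge_zero q] abs_ge_zero])
          then show ?thesis using True by (simp add: abs_mult)
        qed (simp add: w0)
      qed
    qed measurable
    moreover have "(\<integral>z. ((f (h i) z - f 0 z) / h i) * w z \<partial>lborel)
        = ((\<integral>z. f (h i) z * w z \<partial>lborel) - (\<integral>z. f 0 z * w z \<partial>lborel)) / (h i - 0)" for i
    proof -
      have "(\<integral>z. ((f (h i) z - f 0 z) / h i) * w z \<partial>lborel) = (\<integral>z. (f (h i) z * w z - f 0 z * w z) / h i \<partial>lborel)"
        by (rule Bochner_Integration.integral_cong) (auto simp: field_simps)
      also have "\<dots> = (\<integral>z. (f (h i) z * w z - f 0 z * w z) \<partial>lborel) / h i" by simp
      also have "(\<integral>z. (f (h i) z * w z - f 0 z * w z) \<partial>lborel) = (\<integral>z. f (h i) z * w z \<partial>lborel) - (\<integral>z. f 0 z * w z \<partial>lborel)"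
        by (rule Bochner_Integration.integral_diff[OF int int])
      finally show ?thesis by simp
    qed
    ultimately have "(\<lambda>i. ((\<integral>z. f (h (i + N)) z * w z \<partial>lborel) - (\<integral>z. f 0 z * w z \<partial>lborel)) / (h (i + N) - 0)) \<longlonglongrightarrow> (\<integral>z. f' 0 z * w z \<partial>lborel)"
      by (simp only:)
    from LIMSEQ_offset[OF this]
    show "((\<lambda>h. ((\<integral>z. f h z * w z \<partial>lborel) - (\<integral>z. f 0 z * w z \<partial>lborel)) / (h - 0)) \<circ> h) \<longlonglongrightarrow> (\<integral>z. f' 0 z * w z \<partial>lborel)"
      by (simp add: o_def)
  qed
  then show ?thesis by (simp add: has_field_derivative_iff)
qed

lemma continuous_weighted_integral:
  fixes f :: "'b::euclidean_space \<Rightarrow> 'a::euclidean_space \<Rightarrow> real" and w :: "'a \<Rightarrow> real"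
  assumes f: "continuous_on UNIV (\<lambda>(x, z). f x z)"
    and w[measurable]: "w \<in> borel_measurable borel" and K: "compact K" and w0: "\<And>z. z \<notin> K \<Longrightarrow> w z = 0"
    and wC: "\<And>z. \<bar>w z\<bar> \<le> C"
  shows "continuous_on UNIV (\<lambda>x. \<integral>z. f x z * w z \<partial>lborel)"
proof -
  have fz: "continuous_on UNIV (\<lambda>z. f x z)" for x
  proof -
    have "continuous_on UNIV (\<lambda>z. (\<lambda>(x, z). f x z) (x, z))"
      by (rule continuous_on_compose2[OF f]) (intro continuous_on_Pair continuous_on_const continuous_on_id, simp)
    then show ?thesis by simp
  qed
  have fx: "continuous_on UNIV (\<lambda>x. f x z)" for z
  proof -
    have "continuous_on UNIV (\<lambda>x. (\<lambda>(x, z). f x z) (x, z))"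
      by (rule continuous_on_compose2[OF f]) (intro continuous_on_Pair continuous_on_const continuous_on_id, simp)
    then show ?thesis by simp
  qed
  have fm[measurable]: "f x \<in> borel_measurable borel" for x
    by (rule borel_measurable_continuous_onI) (rule fz)
  have Ks[measurable]: "K \<in> sets borel" using K by (simp add: compact_imp_closed)
  have Kb: "emeasure lborel K < \<infinity>" by (rule emeasure_compact_finite[OF K])
  have "isCont (\<lambda>x. \<integral>z. f x z * w z \<partial>lborel) a" for a
    unfolding continuous_at_sequentially
  proof (intro allI impI)
    fix x :: "nat \<Rightarrow> 'b" assume x: "x \<longlonglongrightarrow> a"
    have "bounded (range x)" using x by (rule convergent_imp_bounded)
    then obtain r where r: "\<And>n. x n \<in> cball 0 r" by (auto simp: bounded_iff)
    have "compact (cball (0::'b) r \<times> K)" by (intro compact_Times K) simp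
    then have "compact ((\<lambda>(s, z). f s z) ` (cball 0 r \<times> K))"
      by (rule compact_continuous_image[rotated]) (rule continuous_on_subset[OF f], simp)
    then have "bounded ((\<lambda>(s, z). f s z) ` (cball 0 r \<times> K))" by (rule compact_imp_bounded)
    then obtain L where L: "\<And>s z. s \<in> cball 0 r \<Longrightarrow> z \<in> K \<Longrightarrow> \<bar>f s z\<bar> \<le> L"
      unfolding bounded_iff by force
    have "(\<lambda>n. \<integral>z. f (x n) z * w z \<partial>lborel) \<longlonglongrightarrow> (\<integral>z. f a z * w z \<partial>lborel)"
    proof (rule integral_dominated_convergence[where w="\<lambda>z. (L * C) * indicator K z"])
      show "integrable lborel (\<lambda>z. (L * C) * indicator K z)"
        using Kb by (intro integrable_mult_right integrable_real_indicator) auto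
      show "AE z in lborel. (\<lambda>n. f (x n) z * w z) \<longlonglongrightarrow> f a z * w z"
      proof (intro AE_I2 tendsto_mult tendsto_const)
        fix z
        show "(\<lambda>n. f (x n) z) \<longlonglongrightarrow> f a z"
          using continuous_on_tendsto_compose[OF fx x] by simp
      qed
      show "AE z in lborel. norm (f (x n) z * w z) \<le> (L * C) * indicator K z" for n
      proof (intro AE_I2)
        fix z
        show "norm (f (x n) z * w z) \<le> (L * C) * indicator K z"
        proof (cases "z \<in> K")
          case True
          have "\<bar>f (x n) z\<bar> * \<bar>w z\<bar> \<le> L * C"
            by (rule mult_mono[OF L[OF r True] wC order_trans[OF abs_ge_zero L[OF r True]] abs_ge_zero])
          then show ?thesis using True by (simp add: abs_mult)
        qed (simp add: w0)
      qed
    qed measurable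
    then show "((\<lambda>x. \<integral>z. f x z * w z \<partial>lborel) \<circ> x) \<longlonglongrightarrow> (\<integral>z. f a z * w z \<partial>lborel)" by (simp add: o_def)
  qed
  then show ?thesis by (simp add: continuous_at_imp_continuous_on)
qed

context carnot_group
begin

text \<open>Functions with a continuous derivative along the flow \<open>x \<mapsto> x \<circ> (s e\<^sub>j)\<close> of the field \<open>X\<^sub>j\<close>.  This
  class contains the mollifications below and is closed under products and compositions.\<close>

definition flow_C1 :: "'n \<Rightarrow> (real^'n \<Rightarrow> real) \<Rightarrow> (real^'n \<Rightarrow> real) \<Rightarrow> bool" where
  "flow_C1 j f f' \<longleftrightarrow> continuous_on UNIV f \<and> continuous_on UNIV f' \<and>
     (\<forall>x. ((\<lambda>s. f (gop x (s *\<^sub>R axis j 1))) has_real_derivative f' x) (at 0))"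

lemma flow_C1_derivative:
  assumes "flow_C1 j f f'"
  shows "((\<lambda>s. f (gop x (s *\<^sub>R axis j 1))) has_real_derivative f' (gop x (t *\<^sub>R axis j 1))) (at t)"
proof -
  let ?e = "axis j 1 :: real^'n"
  let ?h = "\<lambda>s. f (gop (gop x (t *\<^sub>R ?e)) (s *\<^sub>R ?e))"
  have "(?h has_real_derivative f' (gop x (t *\<^sub>R ?e))) (at (t + - t))"
    using assms by (simp add: flow_C1_def)
  then have "((\<lambda>s. ?h (s + - t)) has_real_derivative f' (gop x (t *\<^sub>R ?e))) (at t)"
    by (rule DERIV_shift[THEN iffD1])
  moreover have "gop (gop x (t *\<^sub>R ?e)) ((s + - t) *\<^sub>R ?e) = gop x (s *\<^sub>R ?e)" for s
    by (simp only: assoc exp_coords) simp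
  ultimately show ?thesis by (simp only:)
qed

lemma hderiv_flow:
  assumes "f differentiable (at x)"
  shows "((\<lambda>s. f (gop x (s *\<^sub>R axis j 1))) has_real_derivative hderiv gop j f x) (at 0)"
proof -
  let ?e = "axis j 1 :: real^'n"
  have "((\<lambda>s. s *\<^sub>R ?e) has_derivative (\<lambda>s. s *\<^sub>R ?e)) (at (0::real))"
    by (auto intro!: derivative_eq_intros)
  from has_derivative_compose[OF this, of "gop x" "\<lambda>v. dG x 0 (0, v)"]
  have "((\<lambda>s. gop x (s *\<^sub>R ?e)) has_derivative (\<lambda>s. dG x 0 (0, s *\<^sub>R ?e))) (at (0::real))"
    using gop_deriv_right[of x 0] by simp
  from has_derivative_compose[OF this, of f "frechet_derivative f (at x)"]
  have "((\<lambda>s. f (gop x (s *\<^sub>R ?e))) has_derivative (\<lambda>s. frechet_derivative f (at x) (X (s *\<^sub>R ?e) x))) (at 0)"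
    using assms by (simp add: right_unit frechet_derivative_works X_dG)
  moreover have "frechet_derivative f (at x) (X (s *\<^sub>R ?e) x) = hderiv gop j f x * s" for s
    using assms linear_scale[OF linear_X] linear_frechet_derivative[OF assms]
    by (simp add: hderiv_def linear_scale mult.commute)
  ultimately show ?thesis by (simp add: has_field_derivative_def)
qed

lemma flow_C1_smooth:
  assumes "smooth_on UNIV f"
  shows "flow_C1 j f (hderiv gop j f)"
  unfolding flow_C1_def
proof (intro conjI allI)
  show "continuous_on UNIV f" by (rule smooth_on_continuous[OF assms])
  show "continuous_on UNIV (hderiv gop j f)"
    unfolding hderiv_XD by (rule smooth_on_continuous[OF smooth_XD[OF open_UNIV assms]])
  show "((\<lambda>s. f (gop x (s *\<^sub>R axis j 1))) has_real_derivative hderiv gop j f x) (at 0)" for x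
    by (rule hderiv_flow) (use smooth_on_has_derivative[OF assms, of x] in \<open>auto intro: differentiableI\<close>)
qed

lemma flow_C1_mult:
  assumes f: "flow_C1 j f f'" and g: "flow_C1 j g g'"
  shows "flow_C1 j (\<lambda>x. f x * g x) (\<lambda>x. f' x * g x + g' x * f x)"
  unfolding flow_C1_def
proof (intro conjI allI)
  show "continuous_on UNIV (\<lambda>x. f x * g x)" "continuous_on UNIV (\<lambda>x. f' x * g x + g' x * f x)"
    using f g by (auto simp: flow_C1_def intro!: continuous_intros)
  show "((\<lambda>s. f (gop x (s *\<^sub>R axis j 1)) * g (gop x (s *\<^sub>R axis j 1))) has_real_derivative f' x * g x + g' x * f x) (at 0)" for x
    using DERIV_mult[of "\<lambda>s. f (gop x (s *\<^sub>R axis j 1))" "f' x" 0 UNIV "\<lambda>s. g (gop x (s *\<^sub>R axis j 1))" "g' x"] f g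
    by (simp add: flow_C1_def right_unit)
qed

lemma flow_C1_compose:
  assumes f: "flow_C1 j f f'" and F: "\<And>t. (F has_real_derivative F' t) (at t)" "continuous_on UNIV F'"
  shows "flow_C1 j (\<lambda>x. F (f x)) (\<lambda>x. F' (f x) * f' x)"
  unfolding flow_C1_def
proof (intro conjI allI)
  have "continuous_on UNIV F" using F(1) by (auto intro!: continuous_at_imp_continuous_on DERIV_isCont)
  then show "continuous_on UNIV (\<lambda>x. F (f x))" "continuous_on UNIV (\<lambda>x. F' (f x) * f' x)"
    using f F(2) by (auto simp: flow_C1_def intro!: continuous_intros continuous_on_compose2[of UNIV F UNIV f] continuous_on_compose2[of UNIV F' UNIV f])
  show "((\<lambda>s. F (f (gop x (s *\<^sub>R axis j 1)))) has_real_derivative F' (f x) * f' x) (at 0)" for x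
    using DERIV_chain2[of F "F' (f x)" "\<lambda>s. f (gop x (s *\<^sub>R axis j 1))" 0 "f' x"] F(1)[of "f x"] f
    by (simp add: flow_C1_def right_unit)
qed

lemma integrable_continuous_compact:
  fixes f :: "real^'n \<Rightarrow> real"
  assumes f: "continuous_on UNIV f" and K: "compact K" and f0: "\<And>x. x \<notin> K \<Longrightarrow> f x = 0"
  shows "integrable lborel f"
proof -
  have [measurable]: "f \<in> borel_measurable borel" by (rule borel_measurable_continuous_onI[OF f])
  have Ks[measurable]: "K \<in> sets borel" using K by (simp add: compact_imp_closed)
  have "compact (f ` K)" by (intro compact_continuous_image K continuous_on_subset[OF f]) simp
  then have "bounded (f ` K)" by (rule compact_imp_bounded)
  then obtain C where C: "\<And>x. x \<in> K \<Longrightarrow> \<bar>f x\<bar> \<le> C" unfolding bounded_iff by force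
  have "integrable lborel (\<lambda>x. C * indicator K x)"
    using emeasure_compact_finite[OF K] by (intro integrable_mult_right integrable_real_indicator) auto
  then show ?thesis
  proof (rule Bochner_Integration.integrable_bound)
    show "AE x in lborel. norm (f x) \<le> norm (C * indicator K x)"
      using C f0 by (intro AE_I2) (force simp: indicator_def)
  qed simp
qed

lemma flow_C1_support:
  assumes f: "flow_C1 j f f'" and K: "compact K" and f0: "\<And>x. x \<notin> K \<Longrightarrow> f x = 0" and x: "x \<notin> K"
  shows "f' x = 0"
proof -
  have cont: "continuous_on UNIV (\<lambda>s. gop x (s *\<^sub>R axis j 1))" by (intro continuous_gop continuous_intros)
  have "open ((\<lambda>s. gop x (s *\<^sub>R axis j 1)) -` (- K))"
    using K by (intro open_vimage cont) (simp add: compact_imp_closed open_Compl)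
  then have "((\<lambda>s. f (gop x (s *\<^sub>R axis j 1))) has_real_derivative 0) (at 0)"
    by (rule has_field_derivative_transform_within_open[of "\<lambda>_. 0" 0 0, rotated]) (auto simp: f0 right_unit x)
  moreover have "((\<lambda>s. f (gop x (s *\<^sub>R axis j 1))) has_real_derivative f' x) (at 0)"
    using f by (simp add: flow_C1_def)
  ultimately show ?thesis using DERIV_unique by blast
qed

text \<open>The flow consists of right translations, which preserve Lebesgue measure: the integral of \<open>f\<close> along the
  flow is constant, and its derivative is the integral of \<open>f'\<close>.\<close>

lemma integral_flow_derivative:
  assumes f: "flow_C1 j f f'" and K: "compact K" and f0: "\<And>x. x \<notin> K \<Longrightarrow> f x = 0"
  shows "(\<integral>x. f' x \<partial>lborel) = 0"
proof -
  let ?e = "axis j 1 :: real^'n"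
  have cf: "continuous_on UNIV f" "continuous_on UNIV f'" using f by (auto simp: flow_C1_def)
  have if': "integrable lborel f'" by (rule integrable_continuous_compact[OF cf(2) K flow_C1_support[OF f K f0]])
  have ifn: "integrable lborel f" by (rule integrable_continuous_compact[OF cf(1) K f0])
  have [measurable]: "f \<in> borel_measurable borel" "f' \<in> borel_measurable borel"
    by (intro borel_measurable_continuous_onI cf)+
  have shift: "integrable lborel (\<lambda>x. h (gop x y))" if "integrable lborel h" for h :: "real^'n \<Rightarrow> real" and y
    using integrable_distr[of "\<lambda>x. gop x y" lborel borel h] that distr_right[of y] by simp
  have D: "((\<lambda>s. \<integral>x. f (gop x (s *\<^sub>R ?e)) * indicator K2 x \<partial>lborel) has_real_derivative (\<integral>x. f' (gop x (0 *\<^sub>R ?e)) * indicator K2 x \<partial>lborel)) (at 0)"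
    if K2: "compact K2" for K2
  proof (rule has_derivative_weighted_integral[where C=1 and K=K2])
    show "((\<lambda>s. f (gop z (s *\<^sub>R ?e))) has_real_derivative f' (gop z (s *\<^sub>R ?e))) (at s)" for s z
      by (rule flow_C1_derivative[OF f])
    show "continuous_on UNIV (\<lambda>z. f (gop z (s *\<^sub>R ?e)))" for s
      by (rule continuous_on_compose2[OF cf(1)]) (auto intro!: continuous_gop continuous_intros)
    show "continuous_on UNIV (\<lambda>(s, z). f' (gop z (s *\<^sub>R ?e)))"
      unfolding case_prod_unfold
      by (rule continuous_on_compose2[OF cf(2)]) (auto intro!: continuous_gop continuous_intros)
    show "indicator K2 \<in> borel_measurable borel" using K2 by (simp add: compact_imp_closed)
  qed (use K2 in \<open>auto simp: indicator_def\<close>)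
  define K2 where "K2 = (\<lambda>(x, s). gop x (s *\<^sub>R ?e)) ` (K \<times> {-1..1})"
  have K2: "compact K2"
    unfolding K2_def case_prod_unfold
    by (intro compact_continuous_image compact_Times K continuous_gop continuous_intros) simp
  have in2: "x \<in> K2" if "f (gop x (s *\<^sub>R ?e)) \<noteq> 0" "\<bar>s\<bar> < 1" for x s
  proof -
    have "gop x (s *\<^sub>R ?e) \<in> K" using f0 that by blast
    moreover have "x = gop (gop x (s *\<^sub>R ?e)) ((- s) *\<^sub>R ?e)" by (simp add: assoc right_unit)
    ultimately show ?thesis unfolding K2_def using that(2) by (intro image_eqI[of _ _ "(gop x (s *\<^sub>R ?e), - s)"]) auto
  qed
  have "((\<lambda>s. \<integral>x. f (gop x (s *\<^sub>R ?e)) * 1 \<partial>lborel) has_real_derivative (\<integral>x. f' (gop x (0 *\<^sub>R ?e)) * indicator K2 x \<partial>lborel)) (at 0)"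
  proof (rule has_field_derivative_transform_within_open[OF D[OF K2], of "{-1<..<1}"])
    fix s :: real assume "s \<in> {-1<..<1}"
    then have s: "\<bar>s\<bar> < 1" by auto
    show "(\<integral>x. f (gop x (s *\<^sub>R ?e)) * indicator K2 x \<partial>lborel) = (\<integral>x. f (gop x (s *\<^sub>R ?e)) * 1 \<partial>lborel)"
    proof (rule Bochner_Integration.integral_cong[OF refl])
      fix x
      show "f (gop x (s *\<^sub>R ?e)) * indicator K2 x = f (gop x (s *\<^sub>R ?e)) * 1"
      proof (cases "x \<in> K2")
        case False
        then have "f (gop x (s *\<^sub>R ?e)) = 0" using in2[OF _ s] by blast
        then show ?thesis by simp
      qed simp
    qed
  qed auto
  moreover have "((\<lambda>s. \<integral>x. f (gop x (s *\<^sub>R ?e)) * 1 \<partial>lborel) has_real_derivative 0) (at 0)"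
    using integral_right[of f] by simp
  ultimately have "(\<integral>x. f' (gop x (0 *\<^sub>R ?e)) * indicator K2 x \<partial>lborel) = 0" by (rule DERIV_unique)
  moreover have "f' x * indicator K2 x = f' x" for x
  proof (cases "x \<in> K")
    case True
    then have "x \<in> K2" unfolding K2_def by (intro image_eqI[of _ _ "(x, 0)"]) (auto simp: right_unit)
    then show ?thesis by simp
  qed (simp add: flow_C1_support[OF f K f0])
  ultimately show ?thesis by (simp add: right_unit)
qed

end

section \<open>Mollification by group convolution\<close>

definition mollifier :: "real \<Rightarrow> 'a::euclidean_space \<Rightarrow> real" where
  "mollifier \<epsilon> y = bump ((1 / \<epsilon>) *\<^sub>R y) / (\<integral>y. bump ((1 / \<epsilon>) *\<^sub>R y :: 'a) \<partial>lborel)"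

context carnot_group
begin

context
  fixes \<epsilon> :: real
  assumes eps: "\<epsilon> > 0"
begin

lemma smooth_scaled_bump: "smooth_on UNIV (\<lambda>y::real^'n. bump ((1 / \<epsilon>) *\<^sub>R y))"
  by (rule smooth_on_compose[OF open_UNIV smooth_bump _ subset_UNIV])
    (intro smooth_on_bounded_linear open_UNIV bounded_linear_scaleR_right)

lemma scaled_bump_zero: "y \<notin> cball 0 \<epsilon> \<Longrightarrow> bump ((1 / \<epsilon>) *\<^sub>R y :: real^'n) = 0"
  using eps by (intro bump_zero) (simp add: field_simps)

lemma integrable_scaled_bump: "integrable lborel (\<lambda>y::real^'n. bump ((1 / \<epsilon>) *\<^sub>R y))"
  by (rule integrable_continuous_compact[OF smooth_on_continuous[OF smooth_scaled_bump] compact_cball scaled_bump_zero])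

lemma integral_scaled_bump_pos: "(\<integral>y. bump ((1 / \<epsilon>) *\<^sub>R y :: real^'n) \<partial>lborel) > 0"
proof -
  let ?b = "\<lambda>y::real^'n. bump ((1 / \<epsilon>) *\<^sub>R y)"
  have "(\<integral>y. ?b y \<partial>lborel) \<noteq> 0"
  proof
    assume "(\<integral>y. ?b y \<partial>lborel) = 0"
    moreover have "AE y in lborel. 0 \<le> ?b y" by (intro AE_I2 bump_nonneg)
    ultimately have "AE y in lborel. ?b y = 0"
      using integral_nonneg_eq_0_iff_AE[OF integrable_scaled_bump] by blast
    then have "AE y in lborel. y \<notin> cball (0::real^'n) (\<epsilon>/2)"
    proof eventually_elim
      case (elim y)
      show ?case
      proof
        assume "y \<in> cball 0 (\<epsilon>/2)"
        then have "norm ((1 / \<epsilon>) *\<^sub>R y) < 1" using eps by (simp add: field_simps)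
        from bump_pos[OF this] elim show False by simp
      qed
    qed
    then have "emeasure lborel (cball (0::real^'n) (\<epsilon>/2)) = 0"
      by (subst (asm) AE_iff_measurable[of "cball 0 (\<epsilon>/2)"]) auto
    then show False using eps unit_ball_vol_pos[of "real DIM(real^'n)"]
      by (simp add: emeasure_cball del: unit_ball_vol_pos)
  qed
  moreover have "(\<integral>y. ?b y \<partial>lborel) \<ge> 0" by (intro Bochner_Integration.integral_nonneg bump_nonneg)
  ultimately show ?thesis by simp
qed

lemma smooth_mollifier: "smooth_on UNIV (mollifier \<epsilon> :: real^'n \<Rightarrow> real)"
proof -
  have "smooth_on UNIV (\<lambda>y::real^'n. (1 / (\<integral>y. bump ((1 / \<epsilon>) *\<^sub>R y :: real^'n) \<partial>lborel)) *\<^sub>R bump ((1 / \<epsilon>) *\<^sub>R y))"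
    by (rule smooth_on_linear_compose[OF open_UNIV bounded_linear_scaleR_right smooth_scaled_bump])
  then show ?thesis by (simp add: mollifier_def[abs_def])
qed

lemma mollifier_nonneg: "mollifier \<epsilon> (y :: real^'n) \<ge> 0"
  unfolding mollifier_def using integral_scaled_bump_pos by (intro divide_nonneg_pos bump_nonneg)

lemma mollifier_zero: "norm y \<ge> \<epsilon> \<Longrightarrow> mollifier \<epsilon> (y :: real^'n) = 0"
proof -
  assume "norm y \<ge> \<epsilon>"
  then have "norm ((1 / \<epsilon>) *\<^sub>R y) \<ge> 1" using eps by (simp add: field_simps)
  then show ?thesis by (simp add: mollifier_def bump_zero)
qed

lemma integrable_mollifier: "integrable lborel (mollifier \<epsilon> :: real^'n \<Rightarrow> real)"
  unfolding mollifier_def[abs_def] using integrable_scaled_bump by simp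

lemma integral_mollifier: "(\<integral>y. mollifier \<epsilon> (y :: real^'n) \<partial>lborel) = 1"
  unfolding mollifier_def[abs_def] using integral_scaled_bump_pos by simp

text \<open>An average over a small ball differs from \<open>c\<close> by no more than the averaged function does.\<close>

lemma mollifier_average:
  fixes h :: "real^'n \<Rightarrow> real"
  assumes [measurable]: "h \<in> borel_measurable borel" and near: "\<And>y. norm y < \<epsilon> \<Longrightarrow> \<bar>h y - c\<bar> \<le> \<eta>"
  shows "\<bar>(\<integral>y. mollifier \<epsilon> y * h y \<partial>lborel) - c\<bar> \<le> \<eta>"
proof -
  let ?m = "mollifier \<epsilon> :: real^'n \<Rightarrow> real"
  have m[measurable]: "?m \<in> borel_measurable borel"
    by (rule borel_measurable_continuous_onI[OF smooth_on_continuous[OF smooth_mollifier]])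
  have b: "\<bar>?m y * (h y - c)\<bar> \<le> \<eta> * ?m y" for y
  proof (cases "norm y < \<epsilon>")
    case True
    have "\<bar>?m y * (h y - c)\<bar> = ?m y * \<bar>h y - c\<bar>" using mollifier_nonneg[of y] by (simp add: abs_mult)
    also have "\<dots> \<le> ?m y * \<eta>" by (intro mult_left_mono near True mollifier_nonneg)
    finally show ?thesis by (simp add: mult.commute)
  qed (simp add: mollifier_zero)
  have i2: "integrable lborel (\<lambda>y. \<eta> * ?m y)" using integrable_mollifier by simp
  have i1: "integrable lborel (\<lambda>y. ?m y * (h y - c))"
  proof (rule Bochner_Integration.integrable_bound[OF i2])
    show "AE y in lborel. norm (?m y * (h y - c)) \<le> norm (\<eta> * ?m y)"
      using b by (intro AE_I2) (simp add: order_trans[OF _ abs_ge_self])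
  qed measurable
  have i3: "integrable lborel (\<lambda>y. c * ?m y)" using integrable_mollifier by simp
  have "(\<lambda>y. ?m y * h y) = (\<lambda>y. ?m y * (h y - c) + c * ?m y)" by (simp add: algebra_simps)
  then have "(\<integral>y. ?m y * h y \<partial>lborel) = (\<integral>y. ?m y * (h y - c) \<partial>lborel) + (\<integral>y. c * ?m y \<partial>lborel)"
    using Bochner_Integration.integral_add[OF i1 i3] by simp
  then have eq: "(\<integral>y. ?m y * h y \<partial>lborel) - c = (\<integral>y. ?m y * (h y - c) \<partial>lborel)"
    by (simp add: integral_mollifier)
  have "\<bar>\<integral>y. ?m y * (h y - c) \<partial>lborel\<bar> \<le> (\<integral>y. \<bar>?m y * (h y - c)\<bar> \<partial>lborel)"
    by (rule integral_abs_bound)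
  also have "\<dots> \<le> (\<integral>y. \<eta> * ?m y \<partial>lborel)"
    by (intro integral_mono integrable_abs i1 i2 b)
  also have "\<dots> = \<eta>" by (simp add: integral_mollifier)
  finally show ?thesis unfolding eq .
qed

end

lemma integral_minus: "h \<in> borel_measurable borel \<Longrightarrow> (\<integral>y. h (- y) \<partial>lborel) = (\<integral>y. h y \<partial>lborel)"
  for h :: "real^'n \<Rightarrow> real"
  using integral_distr[of uminus lborel borel h] minus_borel by simp

text \<open>The group convolution \<open>\<integral> \<phi>(x \<circ> z\<^sup>-\<^sup>1) w(z) dz\<close>: it averages \<open>w\<close> over left translates, which commute with
  the left invariant fields.\<close>

definition gconv :: "(real^'n \<Rightarrow> real) \<Rightarrow> (real^'n \<Rightarrow> real) \<Rightarrow> real^'n \<Rightarrow> real" where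
  "gconv \<phi> w x = (\<integral>z. \<phi> (gop x (- z)) * w z \<partial>lborel)"

lemma gconv_average:
  assumes [measurable]: "\<phi> \<in> borel_measurable borel" "w \<in> borel_measurable borel"
  shows "gconv \<phi> w x = (\<integral>y. \<phi> y * w (gop (- y) x) \<partial>lborel)"
proof -
  let ?f = "\<lambda>z. \<phi> (gop x (- z)) * w z"
  have "gconv \<phi> w x = (\<integral>y. ?f (gop y x) \<partial>lborel)"
    unfolding gconv_def by (rule integral_right[symmetric]) measurable
  also have "\<dots> = (\<integral>y. ?f (gop (- y) x) \<partial>lborel)"
    by (rule integral_minus[symmetric]) measurable
  also have "\<dots> = (\<integral>y. \<phi> y * w (gop (- y) x) \<partial>lborel)"
    by (simp add: minus_gop)
  finally show ?thesis .
qed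

text \<open>The derivative of the convolution kernel \<open>\<phi>(x \<circ> z\<^sup>-\<^sup>1)\<close> along \<open>X\<^sub>j\<close> in the variable \<open>x\<close>, written so
  that its joint continuity in \<open>(x, z)\<close> is evident.\<close>

definition flow_kernel :: "'n \<Rightarrow> (real^'n \<Rightarrow> real) \<Rightarrow> real^'n \<Rightarrow> real^'n \<Rightarrow> real" where
  "flow_kernel j \<phi> x z = frechet_derivative (\<lambda>p. \<phi> (gop (fst p) (- snd p))) (at (x, z)) (X (axis j 1) x, 0)"

context
  fixes \<phi> :: "real^'n \<Rightarrow> real"
  assumes \<phi>: "smooth_on UNIV \<phi>"
begin

lemma smooth_kernel: "smooth_on UNIV (\<lambda>p. \<phi> (gop (fst p) (- snd p)))"
proof -
  have "smooth_on UNIV (\<lambda>p::(real^'n) \<times> (real^'n). gop (fst p) (- snd p))"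
    by (intro smooth_gop open_UNIV smooth_on_bounded_linear bounded_linear_fst bounded_linear_minus bounded_linear_snd)
  from smooth_on_compose[OF open_UNIV \<phi> this subset_UNIV] show ?thesis .
qed

lemma smooth_kernel_second: "smooth_on UNIV (\<lambda>z. \<phi> (gop x (- z)))"
proof -
  have "smooth_on UNIV (\<lambda>z::real^'n. gop x (- z))"
    by (intro smooth_gop open_UNIV smooth_on_const smooth_on_bounded_linear bounded_linear_minus bounded_linear_ident)
  from smooth_on_compose[OF open_UNIV \<phi> this subset_UNIV] show ?thesis .
qed

lemma kernel_continuous: "continuous_on UNIV (\<lambda>(x, z). \<phi> (gop x (- z)))"
  using smooth_on_continuous[OF smooth_kernel] by (simp add: case_prod_unfold)

lemma flow_kernel_continuous: "continuous_on UNIV (\<lambda>(x, z). flow_kernel j \<phi> x z)"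
proof -
  let ?\<Phi> = "\<lambda>p. \<phi> (gop (fst p) (- snd p))"
  have lin: "linear (frechet_derivative ?\<Phi> (at p))" for p
    by (rule has_derivative_linear[OF smooth_on_has_derivative[OF smooth_kernel]]) simp
  have "continuous_on UNIV (\<lambda>p. \<Sum>b\<in>Basis. ((X (axis j 1) (fst p), 0) \<bullet> b) *\<^sub>R frechet_derivative ?\<Phi> (at p) b)"
    by (intro continuous_intros smooth_on_continuous[OF smooth_on_frechet[OF smooth_kernel]]
        continuous_on_compose2[OF smooth_on_continuous[OF smooth_X]]) auto
  moreover have "(\<lambda>p. \<Sum>b\<in>Basis. ((X (axis j 1) (fst p), 0) \<bullet> b) *\<^sub>R frechet_derivative ?\<Phi> (at p) b)
      = (\<lambda>(x, z). flow_kernel j \<phi> x z)"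
    by (rule ext) (simp only: linear_euclidean_expand[OF lin, symmetric] flow_kernel_def case_prod_unfold prod.collapse)
  ultimately show ?thesis by (simp only:)
qed

lemma flow_C1_kernel: "flow_C1 j (\<lambda>x. \<phi> (gop x (- z))) (\<lambda>x. flow_kernel j \<phi> x z)"
  unfolding flow_C1_def
proof (intro conjI allI)
  have pair: "continuous_on UNIV (\<lambda>x. (x, z))" by (intro continuous_on_Pair continuous_on_const continuous_on_id)
  show "continuous_on UNIV (\<lambda>x. \<phi> (gop x (- z)))"
    using continuous_on_compose2[OF kernel_continuous pair] by simp
  show "continuous_on UNIV (\<lambda>x. flow_kernel j \<phi> x z)"
    using continuous_on_compose2[OF flow_kernel_continuous pair] by simp
  fix x
  have D: "((\<lambda>x. \<phi> (gop x (- z))) has_derivative (\<lambda>v. frechet_derivative (\<lambda>p. \<phi> (gop (fst p) (- snd p))) (at (x, z)) (v, 0))) (at x)"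
  proof -
    have "((\<lambda>x. (x, z)) has_derivative (\<lambda>v. (v, 0))) (at x)" by (auto intro!: derivative_eq_intros)
    from has_derivative_compose[OF this smooth_on_has_derivative[OF smooth_kernel UNIV_I]]
    show ?thesis by simp
  qed
  have "hderiv gop j (\<lambda>x. \<phi> (gop x (- z))) x = flow_kernel j \<phi> x z"
    using fun_cong[OF frechet_derivative_at[OF D], of "X (axis j 1) x"]
    by (simp only: hderiv_def flow_kernel_def)
  then show "((\<lambda>s. \<phi> (gop (gop x (s *\<^sub>R axis j 1)) (- z))) has_real_derivative flow_kernel j \<phi> x z) (at 0)"
    using hderiv_flow[OF differentiableI[OF D], of j] by simp
qed

text \<open>Since \<open>x \<circ> (s e) \<circ> z\<^sup>-\<^sup>1 = x \<circ> (z \<circ> (- s e))\<^sup>-\<^sup>1\<close>, the derivative moves to the variable \<open>z\<close>.\<close>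

lemma flow_kernel_swap: "flow_kernel j \<phi> x z = - hderiv gop j (\<lambda>z. \<phi> (gop x (- z))) z"
proof -
  let ?e = "axis j 1 :: real^'n"
  have "((\<lambda>s. \<phi> (gop x (- gop z (s *\<^sub>R ?e)))) has_real_derivative hderiv gop j (\<lambda>z. \<phi> (gop x (- z))) z) (at 0)"
    using flow_C1_smooth[OF smooth_kernel_second, of j x] by (simp add: flow_C1_def)
  then have "((\<lambda>s. \<phi> (gop x (- gop z (s *\<^sub>R ?e)))) has_real_derivative hderiv gop j (\<lambda>z. \<phi> (gop x (- z))) z) (at (- 0))"
    by simp
  then have "((\<lambda>s. \<phi> (gop x (- gop z ((- s) *\<^sub>R ?e)))) has_real_derivative - hderiv gop j (\<lambda>z. \<phi> (gop x (- z))) z) (at 0)"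
    by (rule DERIV_mirror[THEN iffD1])
  moreover have "gop x (- gop z ((- s) *\<^sub>R ?e)) = gop (gop x (s *\<^sub>R ?e)) (- z)" for s
    by (simp add: minus_gop assoc)
  ultimately have "((\<lambda>s. \<phi> (gop (gop x (s *\<^sub>R ?e)) (- z))) has_real_derivative - hderiv gop j (\<lambda>z. \<phi> (gop x (- z))) z) (at 0)"
    by simp
  moreover have "((\<lambda>s. \<phi> (gop (gop x (s *\<^sub>R ?e)) (- z))) has_real_derivative flow_kernel j \<phi> x z) (at 0)"
    using flow_C1_kernel[of j z] by (simp add: flow_C1_def)
  ultimately show ?thesis by (rule DERIV_unique[symmetric])
qed

lemma flow_C1_gconv:
  assumes w: "w \<in> borel_measurable borel" and K: "compact K" and w0: "\<And>z. z \<notin> K \<Longrightarrow> w z = 0"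
    and wC: "\<And>z. \<bar>w z\<bar> \<le> C"
  shows "flow_C1 j (gconv \<phi> w) (\<lambda>x. \<integral>z. flow_kernel j \<phi> x z * w z \<partial>lborel)"
  unfolding flow_C1_def
proof (intro conjI allI)
  let ?e = "axis j 1 :: real^'n"
  show "continuous_on UNIV (gconv \<phi> w)"
    unfolding gconv_def[abs_def] by (rule continuous_weighted_integral[OF kernel_continuous w K w0 wC])
  show "continuous_on UNIV (\<lambda>x. \<integral>z. flow_kernel j \<phi> x z * w z \<partial>lborel)"
    by (rule continuous_weighted_integral[OF flow_kernel_continuous w K w0 wC])
  fix x
  have "((\<lambda>s. \<integral>z. \<phi> (gop (gop x (s *\<^sub>R ?e)) (- z)) * w z \<partial>lborel) has_real_derivative
      (\<integral>z. flow_kernel j \<phi> (gop x (0 *\<^sub>R ?e)) z * w z \<partial>lborel)) (at 0)"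
  proof (rule has_derivative_weighted_integral[OF _ _ _ w K w0 wC])
    show "((\<lambda>s. \<phi> (gop (gop x (s *\<^sub>R ?e)) (- z))) has_real_derivative flow_kernel j \<phi> (gop x (s *\<^sub>R ?e)) z) (at s)" for s z
      by (rule flow_C1_derivative[OF flow_C1_kernel])
    show "continuous_on UNIV (\<lambda>z. \<phi> (gop (gop x (s *\<^sub>R ?e)) (- z)))" for s
      by (rule smooth_on_continuous[OF smooth_kernel_second])
    have "continuous_on UNIV (\<lambda>p. (gop x (fst p *\<^sub>R ?e), snd p))"
      by (intro continuous_on_Pair continuous_gop continuous_intros)
    from continuous_on_compose2[OF flow_kernel_continuous this]
    show "continuous_on UNIV (\<lambda>(s, z). flow_kernel j \<phi> (gop x (s *\<^sub>R ?e)) z)"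
      by (simp add: case_prod_unfold)
  qed
  then show "((\<lambda>s. gconv \<phi> w (gop x (s *\<^sub>R ?e))) has_real_derivative (\<integral>z. flow_kernel j \<phi> x z * w z \<partial>lborel)) (at 0)"
    by (simp add: gconv_def right_unit)
qed

end

end

section \<open>The chain rule for weak derivatives\<close>

lemma borel_representative:
  fixes f :: "'a::euclidean_space \<Rightarrow> real"
  assumes "integrable lebesgue f"
  obtains f' where "f' \<in> borel_measurable borel" "integrable lborel f'" "AE x in lborel. f x = f' x"
proof -
  have "f \<in> borel_measurable lebesgue" using assms by (rule borel_measurable_integrable)
  then obtain f' where f': "f' \<in> borel_measurable lborel" "AE x in lborel. f x = f' x"
    using completion_ex_borel_measurable_real by blast
  have AE: "AE x in lebesgue. f x = f' x" by (rule AE_completion[OF f'(2)])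
  have "integrable lebesgue f'"
    using assms AE f'(1) by (subst integrable_cong_AE[of f' lebesgue f]) (auto simp: borel_measurable_integrable measurable_completion)
  then have "integrable lborel f'" using f'(1) by (simp add: integrable_completion)
  then show ?thesis using f' that[of f'] by simp
qed

lemma (in pair_sigma_finite) Fubini_product_bound:
  fixes a :: "'a \<Rightarrow> real" and b :: "'b \<Rightarrow> real" and k :: "'a \<Rightarrow> 'b \<Rightarrow> real"
  assumes a: "integrable M1 a" and b: "integrable M2 b"
    and k[measurable]: "(\<lambda>(x, z). k x z) \<in> borel_measurable (M1 \<Otimes>\<^sub>M M2)" and bound: "\<And>x z. \<bar>k x z\<bar> \<le> C"
  shows "(\<integral>x. a x * (\<integral>z. b z * k x z \<partial>M2) \<partial>M1) = (\<integral>z. b z * (\<integral>x. a x * k x z \<partial>M1) \<partial>M2)"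
proof -
  have [measurable]: "a \<in> borel_measurable M1" "b \<in> borel_measurable M2"
    using a b by (auto intro: borel_measurable_integrable)
  have ab: "integrable (M1 \<Otimes>\<^sub>M M2) (\<lambda>(x, z). C * (a x * b z))"
  proof (rule Fubini_integrable)
    have "(\<lambda>x. \<integral>z. norm (case (x, z) of (x, z) \<Rightarrow> C * (a x * b z)) \<partial>M2) = (\<lambda>x. \<bar>C\<bar> * (\<bar>a x\<bar> * (\<integral>z. \<bar>b z\<bar> \<partial>M2)))"
      by (simp add: abs_mult)
    then show "integrable M1 (\<lambda>x. \<integral>z. norm (case (x, z) of (x, z) \<Rightarrow> C * (a x * b z)) \<partial>M2)"
      using a by simp
    show "AE x in M1. integrable M2 (\<lambda>z. case (x, z) of (x, z) \<Rightarrow> C * (a x * b z))"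
      using b by simp
  qed measurable
  have "integrable (M1 \<Otimes>\<^sub>M M2) (\<lambda>(x, z). a x * (b z * k x z))"
  proof (rule Bochner_Integration.integrable_bound[OF ab])
    show "AE p in M1 \<Otimes>\<^sub>M M2. norm (case p of (x, z) \<Rightarrow> a x * (b z * k x z)) \<le> norm (case p of (x, z) \<Rightarrow> C * (a x * b z))"
    proof (intro AE_I2, clarsimp)
      fix x z
      have "\<bar>k x z\<bar> \<le> \<bar>C\<bar>" using bound[of x z] by linarith
      then have "\<bar>a x * b z\<bar> * \<bar>k x z\<bar> \<le> \<bar>a x * b z\<bar> * \<bar>C\<bar>" by (intro mult_left_mono) auto
      then show "\<bar>a x * (b z * k x z)\<bar> \<le> \<bar>C * (a x * b z)\<bar>" by (simp add: abs_mult mult_ac)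
    qed
  qed measurable
  from Fubini_integral[OF this]
  have "(\<integral>z. (\<integral>x. a x * (b z * k x z) \<partial>M1) \<partial>M2) = (\<integral>x. (\<integral>z. a x * (b z * k x z) \<partial>M2) \<partial>M1)" by simp
  moreover have "(\<integral>x. a x * (b z * k x z) \<partial>M1) = b z * (\<integral>x. a x * k x z \<partial>M1)" for z
    by (subst integral_mult_right_zero[symmetric]) (simp add: mult_ac)
  moreover have "(\<integral>z. a x * (b z * k x z) \<partial>M2) = a x * (\<integral>z. b z * k x z \<partial>M2)" for x
    by (rule integral_mult_right_zero)
  ultimately show ?thesis by simp
qed

context carnot_group
begin

text \<open>The chain rule for a continuous function with weak derivative \<open>\<gamma>\<close> along \<open>X\<^sub>j\<close>.  For the group
  convolutions \<open>U n\<close> of \<open>u\<close> with mollifiers it is the classical one, and \<open>X\<^sub>j (U n)\<close> is the convolution of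
  \<open>\<gamma>\<close>.  Convergence of these convolutions in \<open>L\<^sup>1\<close> would require an approximation theorem; instead, Fubini's
  theorem moves the mollifier onto the continuous factor \<open>F' (U n) \<psi>\<close>, whose averages \<open>\<zeta> n\<close> are bounded and
  converge pointwise, so that dominated convergence suffices.\<close>

lemma weak_chain_rule:
  fixes u \<gamma> :: "real^'n \<Rightarrow> real"
  assumes \<Omega>: "open \<Omega>" and u: "continuous_on \<Omega> u"
    and \<gamma>: "\<And>K. compact K \<Longrightarrow> K \<subseteq> \<Omega> \<Longrightarrow> integrable lebesgue (\<lambda>x. indicator K x * \<gamma> x)"
    and weak: "\<And>\<phi>. test_function \<Omega> \<phi> \<Longrightarrow>
        (\<integral>x. indicator \<Omega> x * (u x * hderiv gop j \<phi> x) \<partial>lebesgue) = - (\<integral>x. indicator \<Omega> x * (\<gamma> x * \<phi> x) \<partial>lebesgue)"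
    and F: "\<And>t. (F has_real_derivative F' t) (at t)" and F': "continuous_on UNIV F'" "\<And>t. \<bar>F' t\<bar> \<le> 1"
    and \<psi>: "test_function \<Omega> \<psi>"
  shows "(\<integral>x. indicator \<Omega> x * (F (u x) * hderiv gop j \<psi> x) \<partial>lebesgue) =
    - (\<integral>x. indicator \<Omega> x * (F' (u x) * \<gamma> x * \<psi> x) \<partial>lebesgue)"
proof -
  have smooth\<psi>: "smooth_on UNIV \<psi>" using \<psi> by (simp add: test_function_def)
  obtain K where K: "compact K" "K \<subseteq> \<Omega>" and \<psi>K: "\<And>x. x \<notin> K \<Longrightarrow> \<psi> x = 0"
    using \<psi> unfolding test_function_def by blast
  note c\<psi> = smooth_on_continuous[OF smooth\<psi>]
  note fl\<psi> = flow_C1_smooth[OF smooth\<psi>, of j]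
  have X\<psi>K: "hderiv gop j \<psi> x = 0" if "x \<notin> K" for x
    by (rule flow_C1_support[OF fl\<psi> K(1) \<psi>K that])
  have cX\<psi>: "continuous_on UNIV (hderiv gop j \<psi>)" using fl\<psi> by (simp add: flow_C1_def)
  have [measurable]: "\<psi> \<in> borel_measurable borel" "hderiv gop j \<psi> \<in> borel_measurable borel"
    by (intro borel_measurable_continuous_onI c\<psi> cX\<psi>)+
  have cF: "continuous_on UNIV F" using F by (auto intro!: continuous_at_imp_continuous_on DERIV_isCont)
  have [measurable]: "F \<in> borel_measurable borel" "F' \<in> borel_measurable borel"
    by (intro borel_measurable_continuous_onI cF F')+
  \<comment> \<open>a compact neighbourhood of the support that contains all the translates used below\<close>
  obtain \<epsilon>0 where \<epsilon>0: "\<epsilon>0 > 0" "\<And>x y. x \<in> K \<Longrightarrow> norm y \<le> \<epsilon>0 \<Longrightarrow> gop (- y) x \<in> \<Omega>"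
  proof -
    obtain d where d: "d > 0" "(\<Union>x\<in>K. ball x d) \<subseteq> \<Omega>"
      by (rule compact_subset_open_imp_ball_epsilon_subset[OF K(1) \<Omega> K(2)])
    have "continuous_on (cball 0 1 \<times> K) (\<lambda>p. gop (- fst p) (snd p))"
      by (intro continuous_gop continuous_intros)
    moreover have "compact (cball (0::real^'n) 1 \<times> K)" by (intro compact_Times K) simp
    ultimately have "uniformly_continuous_on (cball 0 1 \<times> K) (\<lambda>p. gop (- fst p) (snd p))"
      by (rule compact_uniformly_continuous)
    then obtain r where r: "r > 0" "\<And>p p'. p \<in> cball 0 1 \<times> K \<Longrightarrow> p' \<in> cball 0 1 \<times> K \<Longrightarrow> dist p' p < r \<Longrightarrow>
        dist (gop (- fst p') (snd p')) (gop (- fst p) (snd p)) < d"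
      using d(1) unfolding uniformly_continuous_on_def by blast
    show ?thesis
    proof (rule that[of "min 1 (r / 2)"])
      fix x y :: "real^'n" assume xy: "x \<in> K" "norm y \<le> min 1 (r / 2)"
      have "dist (gop (- y) x) (gop (- 0) x) < d"
        using r(2)[of "(0, x)" "(y, x)"] r(1) xy by (simp add: dist_Pair_Pair)
      then have "gop (- y) x \<in> ball x d" by (simp add: left_unit dist_commute)
      then show "gop (- y) x \<in> \<Omega>" using d(2) xy(1) by blast
    qed (use r in simp)
  qed
  define K2 where "K2 = (\<lambda>p. gop (- fst p) (snd p)) ` (cball 0 \<epsilon>0 \<times> K)"
  have K2: "compact K2"
    unfolding K2_def by (intro compact_continuous_image compact_Times K continuous_gop continuous_intros) simp
  have K2\<Omega>: "K2 \<subseteq> \<Omega>" using \<epsilon>0(2) by (auto simp: K2_def)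
  have inK2: "gop (- y) x \<in> K2" if "x \<in> K" "norm y \<le> \<epsilon>0" for x y
    unfolding K2_def using that by (intro image_eqI[of _ _ "(y, x)"]) auto
  have KK2: "K \<subseteq> K2" using inK2[of _ 0] \<epsilon>0(1) by (auto simp: left_unit)
  have [measurable]: "K2 \<in> sets borel" using K2 by (simp add: compact_imp_closed)
  \<comment> \<open>truncation makes \<open>u\<close> bounded and Borel measurable without changing the averages over \<open>K\<close>\<close>
  define w where "w x = indicator K2 x *\<^sub>R u x" for x
  have w[measurable]: "w \<in> borel_measurable borel"
    unfolding w_def by (rule borel_measurable_continuous_on_indicator) (auto intro: continuous_on_subset[OF u K2\<Omega>])
  have wK: "w x = u x" if "x \<in> K2" for x using that by (simp add: w_def)
  have w0: "w x = 0" if "x \<notin> K2" for x using that by (simp add: w_def)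
  obtain C where C: "\<And>x. \<bar>w x\<bar> \<le> C" "0 \<le> C"
  proof -
    have "compact (u ` K2)" by (intro compact_continuous_image K2 continuous_on_subset[OF u K2\<Omega>])
    then have "bounded (u ` K2)" by (rule compact_imp_bounded)
    then obtain C where "\<And>x. x \<in> K2 \<Longrightarrow> \<bar>u x\<bar> \<le> C" unfolding bounded_iff by force
    then have "\<bar>w x\<bar> \<le> max C 0" for x using wK[of x] w0[of x] by (cases "x \<in> K2") (auto simp: le_max_iff_disj)
    then show ?thesis by (rule that) simp
  qed
  obtain \<gamma>' where \<gamma>'[measurable]: "\<gamma>' \<in> borel_measurable borel" and i\<gamma>': "integrable lborel \<gamma>'"
    and AE\<gamma>: "AE x in lborel. indicator K2 x * \<gamma> x = \<gamma>' x"
    by (rule borel_representative[OF \<gamma>[OF K2 K2\<Omega>]])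
  have conv\<gamma>: "(\<integral>x. indicator \<Omega> x * (h x * \<gamma> x * \<phi> x) \<partial>lebesgue) = (\<integral>x. \<gamma>' x * (h' x * \<phi> x) \<partial>lborel)"
    if [measurable]: "h' \<in> borel_measurable borel" "\<phi> \<in> borel_measurable borel"
      and h: "\<And>x. x \<in> K2 \<Longrightarrow> h x = h' x" and \<phi>: "\<And>x. x \<notin> K2 \<Longrightarrow> \<phi> x = 0" for h h' \<phi> :: "real^'n \<Rightarrow> real"
  proof -
    have eq: "indicator \<Omega> x * (h x * \<gamma> x * \<phi> x) = (indicator K2 x * \<gamma> x) * (h' x * \<phi> x)" for x
      using h[of x] \<phi>[of x] K2\<Omega> by (cases "x \<in> K2") auto
    have AE: "AE x in lebesgue. (indicator K2 x * \<gamma> x) * (h' x * \<phi> x) = \<gamma>' x * (h' x * \<phi> x)"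
      using AE_completion[OF AE\<gamma>] by eventually_elim simp
    have m: "(\<lambda>x. \<gamma>' x * (h' x * \<phi> x)) \<in> borel_measurable lborel" by measurable
    have "(\<lambda>x. indicator K2 x * \<gamma> x) \<in> borel_measurable lebesgue"
      using \<gamma>[OF K2 K2\<Omega>] by (rule borel_measurable_integrable)
    moreover have "(\<lambda>x. h' x * \<phi> x) \<in> borel_measurable lebesgue" by (rule measurable_completion) measurable
    ultimately have m2: "(\<lambda>x. (indicator K2 x * \<gamma> x) * (h' x * \<phi> x)) \<in> borel_measurable lebesgue"
      by (rule borel_measurable_times)
    have "(\<integral>x. indicator \<Omega> x * (h x * \<gamma> x * \<phi> x) \<partial>lebesgue) = (\<integral>x. \<gamma>' x * (h' x * \<phi> x) \<partial>lebesgue)"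
      unfolding eq by (rule integral_cong_AE[OF m2 measurable_completion[OF m] AE])
    then show ?thesis using integral_completion[OF m] by simp
  qed
  have convu: "(\<integral>x. indicator \<Omega> x * (h x * \<phi> x) \<partial>lebesgue) = (\<integral>x. h' x * \<phi> x \<partial>lborel)"
    if [measurable]: "h' \<in> borel_measurable borel" "\<phi> \<in> borel_measurable borel"
      and h: "\<And>x. x \<in> K2 \<Longrightarrow> h x = h' x" and \<phi>: "\<And>x. x \<notin> K2 \<Longrightarrow> \<phi> x = 0" for h h' \<phi> :: "real^'n \<Rightarrow> real"
  proof -
    have eq: "indicator \<Omega> x * (h x * \<phi> x) = h' x * \<phi> x" for x
      using h[of x] \<phi>[of x] K2\<Omega> by (cases "x \<in> K2") auto
    show ?thesis unfolding eq by (rule integral_completion) measurable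
  qed
  define \<epsilon> where "\<epsilon> n = \<epsilon>0 * inverse (real (Suc n))" for n
  have \<epsilon>: "\<epsilon> n > 0" "\<epsilon> n \<le> \<epsilon>0" for n
    using \<epsilon>0(1) by (auto simp: \<epsilon>_def field_simps)
  have \<epsilon>lim: "\<epsilon> \<longlonglongrightarrow> 0"
    unfolding \<epsilon>_def using tendsto_mult[OF tendsto_const[of \<epsilon>0] LIMSEQ_inverse_real_of_nat] by simp
  define m where "m n = (mollifier (\<epsilon> n) :: real^'n \<Rightarrow> real)" for n
  have sm: "smooth_on UNIV (m n)" for n unfolding m_def by (rule smooth_mollifier[OF \<epsilon>(1)])
  have mm[measurable]: "m n \<in> borel_measurable borel" for n
    by (rule borel_measurable_continuous_onI[OF smooth_on_continuous[OF sm]])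
  define U where "U n = gconv (m n) w" for n
  define XU where "XU n x = (\<integral>z. flow_kernel j (m n) x z * w z \<partial>lborel)" for n x
  have flU: "flow_C1 j (U n) (XU n)" for n
    unfolding U_def XU_def[abs_def] by (rule flow_C1_gconv[OF sm w K2 w0 C(1)])
  have [measurable]: "U n \<in> borel_measurable borel" for n
    using flU[of n] by (intro borel_measurable_continuous_onI) (simp add: flow_C1_def)
  have U_avg: "U n x = (\<integral>y. m n y * w (gop (- y) x) \<partial>lborel)" for n x
    unfolding U_def by (rule gconv_average[OF mm w])
  have U_near: "\<bar>U n x - c\<bar> \<le> \<eta>" if "\<And>y. norm y < \<epsilon> n \<Longrightarrow> \<bar>w (gop (- y) x) - c\<bar> \<le> \<eta>" for n x c \<eta>
    unfolding U_avg m_def by (rule mollifier_average[OF \<epsilon>(1) _ that]) measurable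
  have U_bound: "\<bar>U n x\<bar> \<le> C" for n x using U_near[of n x 0 C] C(1) by simp
  \<comment> \<open>the weak identity, tested with the convolution kernel \<open>z \<mapsto> m n (x \<circ> z\<^sup>-\<^sup>1)\<close>\<close>
  have XU_conv: "XU n x = (\<integral>z. \<gamma>' z * m n (gop x (- z)) \<partial>lborel)" if x: "x \<in> K" for n x
  proof -
    let ?\<eta> = "\<lambda>z. m n (gop x (- z))"
    have s\<eta>: "smooth_on UNIV ?\<eta>" by (rule smooth_kernel_second[OF sm])
    have supp: "?\<eta> z = 0" if "z \<notin> K2" for z
    proof (rule ccontr)
      assume "?\<eta> z \<noteq> 0"
      then have "norm (gop x (- z)) < \<epsilon> n"
        unfolding m_def using mollifier_zero[OF \<epsilon>(1)[of n], of "gop x (- z)"] by (meson not_le)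
      then have "gop (- gop x (- z)) x \<in> K2" using \<epsilon>(2)[of n] by (intro inK2 x) simp
      then show False using that by (simp add: minus_gop assoc right_unit)
    qed
    have test: "test_function \<Omega> ?\<eta>"
      unfolding test_function_def using s\<eta> K2 K2\<Omega> supp by blast
    have cX: "continuous_on UNIV (hderiv gop j ?\<eta>)" using flow_C1_smooth[OF s\<eta>, of j] by (simp add: flow_C1_def)
    have [measurable]: "?\<eta> \<in> borel_measurable borel" "hderiv gop j ?\<eta> \<in> borel_measurable borel"
      by (intro borel_measurable_continuous_onI smooth_on_continuous[OF s\<eta>] cX)+
    have "XU n x = (\<integral>z. - (w z * hderiv gop j ?\<eta> z) \<partial>lborel)"
      unfolding XU_def by (simp add: flow_kernel_swap[OF sm] mult.commute)
    also have "\<dots> = - (\<integral>z. w z * hderiv gop j ?\<eta> z \<partial>lborel)" by simp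
    also have "(\<integral>z. w z * hderiv gop j ?\<eta> z \<partial>lborel) = (\<integral>z. indicator \<Omega> z * (u z * hderiv gop j ?\<eta> z) \<partial>lebesgue)"
      by (rule convu[symmetric])
        (use wK flow_C1_support[OF flow_C1_smooth[OF s\<eta>, of j] K2 supp] in auto)
    also have "- \<dots> = (\<integral>z. indicator \<Omega> z * (\<gamma> z * ?\<eta> z) \<partial>lebesgue)" using weak[OF test] by simp
    also have "\<dots> = (\<integral>z. indicator \<Omega> z * (1 * \<gamma> z * ?\<eta> z) \<partial>lebesgue)" by simp
    also have "\<dots> = (\<integral>z. \<gamma>' z * (1 * ?\<eta> z) \<partial>lborel)"
      by (rule conv\<gamma>) (use supp in auto)
    finally show ?thesis by simp
  qed
  define A where "A n x = F' (U n x) * \<psi> x" for n x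
  have cA: "continuous_on UNIV (A n)" for n
    unfolding A_def using flU[of n] by (intro continuous_intros c\<psi> continuous_on_compose2[OF F'(1)]) (auto simp: flow_C1_def)
  have Am[measurable]: "A n \<in> borel_measurable borel" for n by (rule borel_measurable_continuous_onI[OF cA])
  have iA: "integrable lborel (A n)" for n
    by (rule integrable_continuous_compact[OF cA K(1)]) (simp add: A_def \<psi>K)
  obtain C\<psi> where C\<psi>: "\<And>x. \<bar>\<psi> x\<bar> \<le> C\<psi>" "0 \<le> C\<psi>"
  proof -
    have "compact (\<psi> ` K)" by (intro compact_continuous_image K continuous_on_subset[OF c\<psi>]) simp
    then have "bounded (\<psi> ` K)" by (rule compact_imp_bounded)
    then obtain c where "\<And>x. x \<in> K \<Longrightarrow> \<bar>\<psi> x\<bar> \<le> c" unfolding bounded_iff by force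
    then have "\<bar>\<psi> x\<bar> \<le> max c 0" for x using \<psi>K[of x] by (cases "x \<in> K") (auto simp: le_max_iff_disj)
    then show ?thesis by (rule that) simp
  qed
  have A_bound: "\<bar>A n x\<bar> \<le> C\<psi>" for n x
    using mult_mono[OF F'(2)[of "U n x"] C\<psi>(1)[of x]] by (simp add: A_def abs_mult)
  define \<zeta> where "\<zeta> n z = (\<integral>x. A n x * m n (gop x (- z)) \<partial>lborel)" for n z
  have parts: "(\<integral>x. F (U n x) * hderiv gop j \<psi> x \<partial>lborel) = - (\<integral>z. \<gamma>' z * \<zeta> n z \<partial>lborel)" for n
  proof -
    have fl: "flow_C1 j (\<lambda>x. F (U n x) * \<psi> x) (\<lambda>x. (F' (U n x) * XU n x) * \<psi> x + hderiv gop j \<psi> x * F (U n x))"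
      by (rule flow_C1_mult[OF flow_C1_compose[OF flU F F'(1)] fl\<psi>])
    have "(\<integral>x. (F' (U n x) * XU n x) * \<psi> x + hderiv gop j \<psi> x * F (U n x) \<partial>lborel) = 0"
      by (rule integral_flow_derivative[OF fl K(1)]) (simp add: \<psi>K)
    moreover have cU: "continuous_on UNIV (U n)" "continuous_on UNIV (XU n)" using flU[of n] by (auto simp: flow_C1_def)
    have i1: "integrable lborel (\<lambda>x. (F' (U n x) * XU n x) * \<psi> x)"
    proof (rule integrable_continuous_compact[OF _ K(1)])
      show "continuous_on UNIV (\<lambda>x. (F' (U n x) * XU n x) * \<psi> x)"
        by (intro continuous_on_mult c\<psi> cU continuous_on_compose2[OF F'(1) cU(1)]) simp
    qed (simp add: \<psi>K)
    have i2: "integrable lborel (\<lambda>x. hderiv gop j \<psi> x * F (U n x))"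
    proof (rule integrable_continuous_compact[OF _ K(1)])
      show "continuous_on UNIV (\<lambda>x. hderiv gop j \<psi> x * F (U n x))"
        by (intro continuous_on_mult cX\<psi> continuous_on_compose2[OF cF cU(1)]) simp
    qed (simp add: X\<psi>K)
    ultimately have sum0: "(\<integral>x. (F' (U n x) * XU n x) * \<psi> x \<partial>lborel) + (\<integral>x. hderiv gop j \<psi> x * F (U n x) \<partial>lborel) = 0"
      using Bochner_Integration.integral_add[OF i1 i2] by simp
    have "(\<integral>x. (F' (U n x) * XU n x) * \<psi> x \<partial>lborel) = (\<integral>x. A n x * (\<integral>z. \<gamma>' z * m n (gop x (- z)) \<partial>lborel) \<partial>lborel)"
    proof (rule Bochner_Integration.integral_cong[OF refl])
      fix x show "(F' (U n x) * XU n x) * \<psi> x = A n x * (\<integral>z. \<gamma>' z * m n (gop x (- z)) \<partial>lborel)"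
        using XU_conv[of x n] \<psi>K[of x] by (cases "x \<in> K") (auto simp: A_def)
    qed
    also have "\<dots> = (\<integral>z. \<gamma>' z * (\<integral>x. A n x * m n (gop x (- z)) \<partial>lborel) \<partial>lborel)"
    proof -
      have psf: "pair_sigma_finite (lborel :: (real^'n) measure) (lborel :: (real^'n) measure)" ..
      have cm: "continuous_on UNIV (m n)" by (rule smooth_on_continuous[OF sm])
      have "compact (m n ` cball 0 (\<epsilon> n))" by (intro compact_continuous_image continuous_on_subset[OF cm]) auto
      then have "bounded (m n ` cball 0 (\<epsilon> n))" by (rule compact_imp_bounded)
      then obtain c where c: "\<And>y. y \<in> cball 0 (\<epsilon> n) \<Longrightarrow> \<bar>m n y\<bar> \<le> c" unfolding bounded_iff by force
      have mb: "\<bar>m n y\<bar> \<le> \<bar>c\<bar>" for y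
      proof (cases "norm y \<le> \<epsilon> n")
        case True
        then show ?thesis using c[of y] by simp
      next
        case False
        then have "m n y = 0" unfolding m_def by (intro mollifier_zero \<epsilon>) simp
        then show ?thesis by simp
      qed
      have "(\<lambda>(x, z). m n (gop x (- z))) \<in> borel_measurable (borel :: ((real^'n) \<times> (real^'n)) measure)"
        by (rule borel_measurable_continuous_onI[OF kernel_continuous[OF sm]])
      then have meas: "(\<lambda>(x, z). m n (gop x (- z))) \<in> borel_measurable (lborel \<Otimes>\<^sub>M lborel)"
        by (simp add: lborel_prod)
      show ?thesis
        by (rule pair_sigma_finite.Fubini_product_bound[OF psf iA i\<gamma>' meas mb])
    qed
    finally show ?thesis using sum0 by (simp add: \<zeta>_def mult.commute)
  qed
  have \<zeta>_avg: "\<zeta> n z = (\<integral>y. m n y * A n (gop y z) \<partial>lborel)" for n z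
  proof -
    let ?f = "\<lambda>x. A n x * m n (gop x (- z))"
    have "\<zeta> n z = (\<integral>y. ?f (gop y z) \<partial>lborel)" unfolding \<zeta>_def by (rule integral_right[symmetric]) measurable
    then show ?thesis by (simp add: assoc right_unit mult.commute)
  qed
  have \<zeta>_near: "\<bar>\<zeta> n z - c\<bar> \<le> \<eta>" if "\<And>y. norm y < \<epsilon> n \<Longrightarrow> \<bar>A n (gop y z) - c\<bar> \<le> \<eta>" for n z c \<eta>
    unfolding \<zeta>_avg m_def by (rule mollifier_average[OF \<epsilon>(1) _ that]) measurable
  have \<zeta>_bound: "\<bar>\<zeta> n z\<bar> \<le> C\<psi>" for n z using \<zeta>_near[of n z 0 C\<psi>] A_bound by simp
  have \<zeta>m[measurable]: "\<zeta> n \<in> borel_measurable borel" for n unfolding \<zeta>_avg[abs_def] by measurable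
  \<comment> \<open>near a point of the domain, \<open>u\<close> varies little over small translates\<close>
  have u_near: "\<exists>r>0. \<forall>y y'. norm y < r \<longrightarrow> norm y' < r \<longrightarrow> \<bar>u (gop (- y') (gop y z)) - u z\<bar> \<le> \<eta>"
    if z: "z \<in> \<Omega>" and \<eta>: "\<eta> > 0" for z \<eta>
  proof -
    have "isCont u z" using u \<Omega> z continuous_on_eq_continuous_at by blast
    then obtain d where d: "d > 0" "\<And>x. dist x z < d \<Longrightarrow> dist (u x) (u z) < \<eta>"
      using \<eta> unfolding continuous_at_eps_delta by blast
    have "continuous_on UNIV (\<lambda>p. gop (- snd p) (gop (fst p) z))" by (intro continuous_gop continuous_intros)
    then have "isCont (\<lambda>p. gop (- snd p) (gop (fst p) z)) (0, 0)" using continuous_on_eq_continuous_at[OF open_UNIV] by blast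
    then obtain r where r: "r > 0" "\<And>p. dist p (0, 0) < r \<Longrightarrow> dist (gop (- snd p) (gop (fst p) z)) (gop (- 0) (gop 0 z)) < d"
      using d(1) unfolding continuous_at_eps_delta by (metis fst_conv snd_conv)
    show ?thesis
    proof (intro exI[of _ "r / 2"] conjI allI impI)
      fix y y' :: "real^'n" assume "norm y < r / 2" "norm y' < r / 2"
      then have "norm y + norm y' < r" by simp
      moreover have "dist (y, y') (0, 0) \<le> norm y + norm y'"
        unfolding dist_Pair_Pair by (simp add: sqrt_sum_squares_le_sum)
      ultimately have "dist (gop (- y') (gop y z)) z < d" using r(2)[of "(y, y')"] by (simp add: left_unit)
      from d(2)[OF this] show "\<bar>u (gop (- y') (gop y z)) - u z\<bar> \<le> \<eta>" by (simp add: dist_real_def)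
    qed (use r in simp)
  qed
  have U_lim: "(\<lambda>n. U n x) \<longlonglongrightarrow> w x" if x: "x \<in> K" for x
  proof (rule LIMSEQ_I)
    fix \<eta> :: real assume \<eta>: "\<eta> > 0"
    have x\<Omega>: "x \<in> \<Omega>" using x K by blast
    obtain r where r: "r > 0" "\<And>y y'. norm y < r \<Longrightarrow> norm y' < r \<Longrightarrow> \<bar>u (gop (- y') (gop y x)) - u x\<bar> \<le> \<eta> / 2"
      using u_near[OF x\<Omega>, of "\<eta> / 2"] \<eta> by auto
    have "eventually (\<lambda>n. \<epsilon> n < r) sequentially" using \<epsilon>lim r(1) by (rule order_tendstoD)
    then obtain N where N: "\<And>n. n \<ge> N \<Longrightarrow> \<epsilon> n < r" by (auto simp: eventually_sequentially)
    have "norm (U n x - w x) < \<eta>" if "n \<ge> N" for n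
    proof -
      have "\<bar>U n x - w x\<bar> \<le> \<eta> / 2"
      proof (rule U_near)
        fix y :: "real^'n" assume y: "norm y < \<epsilon> n"
        have "w (gop (- y) x) = u (gop (- y) x)" using \<epsilon>(2)[of n] y by (intro wK inK2 x) simp
        moreover have "w x = u x" using x KK2 by (intro wK) blast
        ultimately show "\<bar>w (gop (- y) x) - w x\<bar> \<le> \<eta> / 2"
          using r(2)[of 0 y] r(1) N[OF that] y by (simp add: left_unit)
      qed
      then show ?thesis using \<eta> by simp
    qed
    then show "\<exists>N. \<forall>n\<ge>N. norm (U n x - w x) < \<eta>" by blast
  qed
  have \<zeta>_lim: "(\<lambda>n. \<zeta> n z) \<longlonglongrightarrow> F' (w z) * \<psi> z" if zK: "z \<in> K2" for z
  proof (rule LIMSEQ_I)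
    fix \<eta> :: real assume \<eta>: "\<eta> > 0"
    have z: "z \<in> \<Omega>" using zK K2\<Omega> by blast
    define e where "e = \<eta> / (2 * (C\<psi> + 1))"
    have e: "e > 0" using \<eta> C\<psi>(2) by (simp add: e_def)
    have "isCont F' (u z)" using F'(1) continuous_on_eq_continuous_at[OF open_UNIV] by blast
    then obtain d where d: "d > 0" "\<And>a. dist a (u z) < d \<Longrightarrow> dist (F' a) (F' (u z)) < e"
      using e unfolding continuous_at_eps_delta by blast
    obtain r where r: "r > 0" "\<And>y y'. norm y < r \<Longrightarrow> norm y' < r \<Longrightarrow> \<bar>u (gop (- y') (gop y z)) - u z\<bar> \<le> d / 2"
      using u_near[OF z, of "d / 2"] d by auto
    have "continuous_on UNIV (\<lambda>y. \<psi> (gop y z))"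
      by (rule continuous_on_compose2[OF c\<psi>]) (auto intro!: continuous_gop continuous_intros)
    then have "isCont (\<lambda>y. \<psi> (gop y z)) 0" using continuous_on_eq_continuous_at[OF open_UNIV] by blast
    then obtain r' where r': "r' > 0" "\<And>y. dist y 0 < r' \<Longrightarrow> dist (\<psi> (gop y z)) (\<psi> (gop 0 z)) < e"
      using e unfolding continuous_at_eps_delta by blast
    have "eventually (\<lambda>n. \<epsilon> n < min r r') sequentially" using \<epsilon>lim r(1) r'(1) by (intro order_tendstoD) auto
    then obtain N where N: "\<And>n. n \<ge> N \<Longrightarrow> \<epsilon> n < min r r'" by (auto simp: eventually_sequentially)
    have "norm (\<zeta> n z - F' (w z) * \<psi> z) < \<eta>" if nN: "n \<ge> N" for n
    proof -
      have "\<bar>\<zeta> n z - F' (w z) * \<psi> z\<bar> \<le> e * C\<psi> + e"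
      proof (rule \<zeta>_near)
        fix y :: "real^'n" assume y: "norm y < \<epsilon> n"
        then have yr: "norm y < r" "norm y < r'" using N[OF nN] by auto
        have \<psi>d: "\<bar>\<psi> (gop y z) - \<psi> z\<bar> \<le> e" using r'(2)[of y] yr by (simp add: left_unit dist_real_def)
        have Fd: "\<bar>F' (U n (gop y z)) - F' (u z)\<bar> * \<bar>\<psi> (gop y z)\<bar> \<le> e * C\<psi>"
        proof (cases "gop y z \<in> K")
          case True
          have "\<bar>U n (gop y z) - u z\<bar> \<le> d / 2"
          proof (rule U_near)
            fix y' :: "real^'n" assume y': "norm y' < \<epsilon> n"
            have "w (gop (- y') (gop y z)) = u (gop (- y') (gop y z))"
              using \<epsilon>(2)[of n] y' by (intro wK inK2 True) simp
            then show "\<bar>w (gop (- y') (gop y z)) - u z\<bar> \<le> d / 2"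
              using r(2)[of y y'] yr y' N[OF nN] by simp
          qed
          then have "dist (U n (gop y z)) (u z) < d" using d(1) by (simp add: dist_real_def)
          from d(2)[OF this] have "\<bar>F' (U n (gop y z)) - F' (u z)\<bar> \<le> e" by (simp add: dist_real_def)
          then show ?thesis using C\<psi> e by (intro mult_mono) auto
        next
          case False
          then have "\<psi> (gop y z) = 0" by (rule \<psi>K)
          then show ?thesis using e C\<psi> by simp
        qed
        have "A n (gop y z) - F' (w z) * \<psi> z =
            (F' (U n (gop y z)) - F' (u z)) * \<psi> (gop y z) + F' (u z) * (\<psi> (gop y z) - \<psi> z)"
          by (simp add: A_def wK[OF zK] algebra_simps)
        also have "\<bar>\<dots>\<bar> \<le> \<bar>F' (U n (gop y z)) - F' (u z)\<bar> * \<bar>\<psi> (gop y z)\<bar> + \<bar>F' (u z)\<bar> * \<bar>\<psi> (gop y z) - \<psi> z\<bar>"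
          unfolding abs_mult[symmetric] by (rule abs_triangle_ineq)
        also have "\<dots> \<le> e * C\<psi> + 1 * e"
          using e by (intro add_mono Fd mult_mono F'(2) \<psi>d) auto
        finally show "\<bar>A n (gop y z) - F' (w z) * \<psi> z\<bar> \<le> e * C\<psi> + e" by simp
      qed
      also have "e * C\<psi> + e = \<eta> / 2"
      proof -
        have "e * C\<psi> + e = e * (C\<psi> + 1)" by (simp add: algebra_simps)
        also have "\<dots> = \<eta> / 2" using C\<psi>(2) by (simp add: e_def field_simps)
        finally show ?thesis .
      qed
      finally show ?thesis using \<eta> by simp
    qed
    then show "\<exists>N. \<forall>n\<ge>N. norm (\<zeta> n z - F' (w z) * \<psi> z) < \<eta>" by blast
  qed
  have lhs: "(\<lambda>n. \<integral>x. F (U n x) * hderiv gop j \<psi> x \<partial>lborel) \<longlonglongrightarrow> (\<integral>x. F (w x) * hderiv gop j \<psi> x \<partial>lborel)"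
  proof -
    have "compact (F ` cball 0 C)" by (intro compact_continuous_image continuous_on_subset[OF cF]) auto
    then have "bounded (F ` cball 0 C)" by (rule compact_imp_bounded)
    then obtain c where c: "\<And>t. t \<in> cball 0 C \<Longrightarrow> \<bar>F t\<bar> \<le> c" unfolding bounded_iff by force
    show ?thesis
    proof (rule integral_dominated_convergence[where w="\<lambda>x. c * \<bar>hderiv gop j \<psi> x\<bar>"])
      show "integrable lborel (\<lambda>x. c * \<bar>hderiv gop j \<psi> x\<bar>)"
        using integrable_continuous_compact[OF cX\<psi> K(1) X\<psi>K] by simp
      show "AE x in lborel. (\<lambda>n. F (U n x) * hderiv gop j \<psi> x) \<longlonglongrightarrow> F (w x) * hderiv gop j \<psi> x"
      proof (intro AE_I2)
        fix x
        show "(\<lambda>n. F (U n x) * hderiv gop j \<psi> x) \<longlonglongrightarrow> F (w x) * hderiv gop j \<psi> x"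
        proof (cases "x \<in> K")
          case True
          have "isCont F (w x)" by (rule DERIV_isCont[OF F])
          from isCont_tendsto_compose[OF this U_lim[OF True]] show ?thesis by (rule tendsto_mult_right)
        qed (simp add: X\<psi>K)
      qed
      show "AE x in lborel. norm (F (U n x) * hderiv gop j \<psi> x) \<le> c * \<bar>hderiv gop j \<psi> x\<bar>" for n
        using c U_bound by (intro AE_I2) (simp add: abs_mult mult_right_mono)
    qed measurable
  qed
  have rhs: "(\<lambda>n. \<integral>z. \<gamma>' z * \<zeta> n z \<partial>lborel) \<longlonglongrightarrow> (\<integral>z. \<gamma>' z * (F' (w z) * \<psi> z) \<partial>lborel)"
  proof (rule integral_dominated_convergence[where w="\<lambda>z. \<bar>\<gamma>' z\<bar> * C\<psi>"])
    show "integrable lborel (\<lambda>z. \<bar>\<gamma>' z\<bar> * C\<psi>)" using i\<gamma>' by simp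
    show "AE z in lborel. (\<lambda>n. \<gamma>' z * \<zeta> n z) \<longlonglongrightarrow> \<gamma>' z * (F' (w z) * \<psi> z)"
      using AE\<gamma>
    proof eventually_elim
      case (elim z)
      show ?case
      proof (cases "z \<in> K2")
        case True
        from \<zeta>_lim[OF this] show ?thesis by (rule tendsto_mult_left)
      next
        case False
        then have "\<gamma>' z = 0" using elim by simp
        then show ?thesis by simp
      qed
    qed
    show "AE z in lborel. norm (\<gamma>' z * \<zeta> n z) \<le> \<bar>\<gamma>' z\<bar> * C\<psi>" for n
      using \<zeta>_bound by (intro AE_I2) (simp add: abs_mult mult_left_mono)
  qed measurable
  have "(\<integral>x. F (w x) * hderiv gop j \<psi> x \<partial>lborel) = - (\<integral>z. \<gamma>' z * (F' (w z) * \<psi> z) \<partial>lborel)"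
    using lhs[unfolded parts] tendsto_minus[OF rhs] by (rule LIMSEQ_unique)
  moreover have "(\<integral>x. indicator \<Omega> x * (F (u x) * hderiv gop j \<psi> x) \<partial>lebesgue) = (\<integral>x. F (w x) * hderiv gop j \<psi> x \<partial>lborel)"
    by (rule convu) (use wK X\<psi>K KK2 in auto)
  moreover have "(\<integral>x. indicator \<Omega> x * (F' (u x) * \<gamma> x * \<psi> x) \<partial>lebesgue) = (\<integral>z. \<gamma>' z * (F' (w z) * \<psi> z) \<partial>lborel)"
    by (rule conv\<gamma>) (use wK \<psi>K KK2 in auto)
  ultimately show ?thesis by simp
qed

end

section \<open>Weak gradients of the positive and negative parts\<close>

text \<open>A \<open>C\<^sup>1\<close> approximation of the positive part: \<open>s\<^sup>2 / (s + \<delta>) = s - \<delta> + \<delta>\<^sup>2 / (s + \<delta>)\<close> for \<open>s \<ge> 0\<close>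
  vanishes to second order at \<open>0\<close> and has a slope between \<open>0\<close> and \<open>1\<close>.\<close>

definition smooth_pos :: "real \<Rightarrow> real \<Rightarrow> real" where
  "smooth_pos \<delta> s = (max s 0)\<^sup>2 / (max s 0 + \<delta>)"

definition smooth_pos_deriv :: "real \<Rightarrow> real \<Rightarrow> real" where
  "smooth_pos_deriv \<delta> s = 1 - (\<delta> / (max s 0 + \<delta>))\<^sup>2"

lemma smooth_pos_has_derivative:
  assumes \<delta>: "\<delta> > 0"
  shows "(smooth_pos \<delta> has_real_derivative smooth_pos_deriv \<delta> s) (at s)"
proof -
  consider "s > 0" | "s < 0" | "s = 0" by linarith
  then show ?thesis
  proof cases
    case 1
    have D: "((\<lambda>s. s\<^sup>2 / (s + \<delta>)) has_real_derivative smooth_pos_deriv \<delta> s) (at s)"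
      using 1 \<delta> by (auto intro!: derivative_eq_intros simp: smooth_pos_deriv_def divide_simps power2_eq_square)
        (simp add: algebra_simps)
    have "eventually (\<lambda>x. smooth_pos \<delta> x = x\<^sup>2 / (x + \<delta>)) (nhds s)"
      using eventually_nhds_in_open[of "{0<..}" s] 1 by (auto elim!: eventually_mono simp: smooth_pos_def)
    from DERIV_cong_ev[OF refl this refl] D show ?thesis by (rule iffD2)
  next
    case 2
    have D: "((\<lambda>s. 0) has_real_derivative smooth_pos_deriv \<delta> s) (at s)"
      using 2 \<delta> by (simp add: smooth_pos_deriv_def)
    have "eventually (\<lambda>x. smooth_pos \<delta> x = 0) (nhds s)"
      using eventually_nhds_in_open[of "{..<0}" s] 2 by (auto elim!: eventually_mono simp: smooth_pos_def)
    from DERIV_cong_ev[OF refl this refl] D show ?thesis by (rule iffD2)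
  next
    case 3
    have "((\<lambda>h. (smooth_pos \<delta> (0 + h) - smooth_pos \<delta> 0) / h) \<longlongrightarrow> 0) (at 0)"
    proof (rule Lim_null_comparison)
      have "norm ((smooth_pos \<delta> (0 + h) - smooth_pos \<delta> 0) / h) \<le> \<bar>h\<bar> / \<delta>" if "h \<noteq> 0" for h
      proof (cases "h > 0")
        case True
        then have "norm ((smooth_pos \<delta> (0 + h) - smooth_pos \<delta> 0) / h) = h / (h + \<delta>)"
          using \<delta> by (simp add: smooth_pos_def power2_eq_square)
        also have "\<dots> \<le> h / \<delta>" using True \<delta> by (intro divide_left_mono) auto
        finally show ?thesis using True by simp
      next
        case False
        then show ?thesis using \<delta> by (simp add: smooth_pos_def divide_nonpos_pos)
      qed
      then show "eventually (\<lambda>h. norm ((smooth_pos \<delta> (0 + h) - smooth_pos \<delta> 0) / h) \<le> \<bar>h\<bar> / \<delta>) (at 0)"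
        by (simp add: eventually_at_filter)
      show "((\<lambda>h. \<bar>h\<bar> / \<delta>) \<longlongrightarrow> 0) (at 0)"
        by (rule tendsto_eq_intros | use \<delta> in simp)+
    qed
    then show ?thesis using 3 \<delta> by (simp add: DERIV_def smooth_pos_deriv_def)
  qed
qed

lemma smooth_pos_deriv_bounds:
  assumes \<delta>: "\<delta> > 0"
  shows "\<bar>smooth_pos_deriv \<delta> s\<bar> \<le> 1"
proof -
  have "\<delta> / (max s 0 + \<delta>) \<le> 1" "0 \<le> \<delta> / (max s 0 + \<delta>)" using \<delta> by auto
  then have "0 \<le> (\<delta> / (max s 0 + \<delta>))\<^sup>2" "(\<delta> / (max s 0 + \<delta>))\<^sup>2 \<le> 1" by (auto simp: power_le_one)
  then show ?thesis by (simp add: smooth_pos_deriv_def)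
qed

lemma smooth_pos_deriv_continuous:
  assumes \<delta>: "\<delta> > 0"
  shows "continuous_on UNIV (smooth_pos_deriv \<delta>)"
proof -
  have "max s 0 + \<delta> \<noteq> 0" for s using \<delta> by (simp add: max_def)
  then show ?thesis unfolding smooth_pos_deriv_def[abs_def] by (intro continuous_intros) auto
qed

lemma smooth_pos_bound:
  assumes \<delta>: "\<delta> > 0"
  shows "\<bar>smooth_pos \<delta> s\<bar> \<le> \<bar>s\<bar>"
proof -
  have "smooth_pos \<delta> s = max s 0 * (max s 0 / (max s 0 + \<delta>))" by (simp add: smooth_pos_def power2_eq_square)
  moreover have "0 \<le> max s 0 / (max s 0 + \<delta>)" "max s 0 / (max s 0 + \<delta>) \<le> 1" using \<delta> by (auto simp: divide_le_eq)
  moreover have "max s 0 * (max s 0 / (max s 0 + \<delta>)) \<le> max s 0" "0 \<le> max s 0 * (max s 0 / (max s 0 + \<delta>))"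
    using calculation(2,3) by (auto intro: mult_left_le mult_nonneg_nonneg simp del: times_divide_eq_right)
  ultimately show ?thesis by linarith
qed

lemma smooth_pos_limits:
  "(\<lambda>n. smooth_pos (inverse (real (Suc n))) s) \<longlonglongrightarrow> max s 0"
  "(\<lambda>n. smooth_pos_deriv (inverse (real (Suc n))) s) \<longlonglongrightarrow> (if s > 0 then 1 else 0)"
proof -
  have l: "(\<lambda>n. inverse (real (Suc n))) \<longlonglongrightarrow> 0" by (rule LIMSEQ_inverse_real_of_nat)
  have "(\<lambda>n. smooth_pos (inverse (real (Suc n))) s) \<longlonglongrightarrow> max s 0 \<and>
    (\<lambda>n. smooth_pos_deriv (inverse (real (Suc n))) s) \<longlonglongrightarrow> (if s > 0 then 1 else 0)"
  proof (cases "s > 0")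
    case True
    have "(\<lambda>n. s\<^sup>2 / (s + inverse (real (Suc n)))) \<longlonglongrightarrow> s\<^sup>2 / (s + 0)" using True by (intro tendsto_intros l) simp
    moreover have "(\<lambda>n. 1 - (inverse (real (Suc n)) / (s + inverse (real (Suc n))))\<^sup>2) \<longlonglongrightarrow> 1 - (0 / (s + 0))\<^sup>2"
      using True by (intro tendsto_intros l) simp
    ultimately show ?thesis using True by (simp add: smooth_pos_def smooth_pos_deriv_def power2_eq_square)
  next
    case False
    then have "max s 0 = 0" by simp
    moreover from this have "smooth_pos (inverse (real (Suc n))) s = 0" "smooth_pos_deriv (inverse (real (Suc n))) s = 0" for n
      by (simp_all add: smooth_pos_def smooth_pos_deriv_def del: of_nat_Suc)
    ultimately show ?thesis using False by simp
  qed
  then show "(\<lambda>n. smooth_pos (inverse (real (Suc n))) s) \<longlonglongrightarrow> max s 0"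
    "(\<lambda>n. smooth_pos_deriv (inverse (real (Suc n))) s) \<longlonglongrightarrow> (if s > 0 then 1 else 0)" by auto
qed

lemma locally_L1_continuous:
  fixes f :: "'a::euclidean_space \<Rightarrow> real"
  assumes "continuous_on \<Omega> f"
  shows "locally_L1 \<Omega> f"
  unfolding locally_L1_def set_integrable_def
proof (intro allI impI)
  fix K assume K: "compact K \<and> K \<subseteq> \<Omega>"
  have c: "continuous_on K f" using continuous_on_subset[OF assms] K by blast
  have b: "K \<in> sets borel" using K by (simp add: compact_imp_closed)
  have "(\<lambda>x. indicator K x *\<^sub>R f x) \<in> borel_measurable borel"
    by (rule borel_measurable_continuous_on_indicator[OF b c])
  moreover have "integrable lborel (\<lambda>x. indicator K x *\<^sub>R f x)" using K c by (intro borel_integrable_compact) auto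
  ultimately show "integrable lebesgue (\<lambda>x. indicator K x *\<^sub>R f x)" by (simp add: integrable_completion)
qed

context carnot_group
begin

text \<open>Letting \<open>\<delta> \<rightarrow> 0\<close> in the chain rule for \<^const>\<open>smooth_pos\<close>.\<close>

lemma is_weak_hgrad_positive_part:
  assumes \<Omega>: "open \<Omega>" and u: "continuous_on \<Omega> u" and g: "is_weak_hgrad gop deg \<Omega> u g"
  shows "is_weak_hgrad gop deg \<Omega> (\<lambda>x. max (u x) 0) (\<lambda>x. if u x > 0 then g x else 0)"
  unfolding is_weak_hgrad_def
proof (intro conjI allI impI)
  have trunc: "(\<lambda>x. indicator K x *\<^sub>R u x) \<in> borel_measurable borel" if "compact K" "K \<subseteq> \<Omega>" for K
    using that by (intro borel_measurable_continuous_on_indicator continuous_on_subset[OF u]) (auto simp: compact_imp_closed)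
  have gK: "integrable lebesgue (\<lambda>x. indicator K x *\<^sub>R g x)" if "compact K" "K \<subseteq> \<Omega>" for K
    using g that by (auto simp: is_weak_hgrad_def locally_L1_def set_integrable_def)
  show "locally_L1 \<Omega> (\<lambda>x. max (u x) 0)" by (intro locally_L1_continuous continuous_intros u)
  show "locally_L1 \<Omega> (\<lambda>x. if u x > 0 then g x else 0)"
    unfolding locally_L1_def set_integrable_def
  proof (intro allI impI)
    fix K assume "compact K \<and> K \<subseteq> \<Omega>"
    then have K: "compact K" "K \<subseteq> \<Omega>" by auto
    note [measurable] = trunc[OF K]
    have "{x. indicator K x *\<^sub>R u x > 0} \<in> sets borel" by measurable
    then have "{x. indicator K x *\<^sub>R u x > 0} \<in> sets lebesgue" by simp
    from integrable_mult_indicator[OF this gK[OF K]]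
    have "integrable lebesgue (\<lambda>x. indicator {x. indicator K x *\<^sub>R u x > 0} x *\<^sub>R (indicator K x *\<^sub>R g x))" .
    also have "(\<lambda>x. indicator {x. indicator K x *\<^sub>R u x > 0} x *\<^sub>R (indicator K x *\<^sub>R g x)) =
        (\<lambda>x. indicator K x *\<^sub>R (if u x > 0 then g x else 0))"
      by (auto simp: fun_eq_iff indicator_def)
    finally show "integrable lebesgue (\<lambda>x. indicator K x *\<^sub>R (if u x > 0 then g x else 0))" .
  qed
  show "(if u x > 0 then g x else 0) $ j = 0" if "deg j \<noteq> 1" for j x
    using g that by (auto simp: is_weak_hgrad_def)
  fix j \<psi> assume j: "deg j = 1" and \<psi>: "test_function \<Omega> \<psi>"
  have smooth\<psi>: "smooth_on UNIV \<psi>" using \<psi> by (simp add: test_function_def)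
  obtain K where K: "compact K" "K \<subseteq> \<Omega>" and \<psi>K: "\<And>x. x \<notin> K \<Longrightarrow> \<psi> x = 0"
    using \<psi> unfolding test_function_def by blast
  note c\<psi> = smooth_on_continuous[OF smooth\<psi>]
  note fl\<psi> = flow_C1_smooth[OF smooth\<psi>, of j]
  have X\<psi>K: "hderiv gop j \<psi> x = 0" if "x \<notin> K" for x
    by (rule flow_C1_support[OF fl\<psi> K(1) \<psi>K that])
  have cX\<psi>: "continuous_on UNIV (hderiv gop j \<psi>)" using fl\<psi> by (simp add: flow_C1_def)
  have [measurable]: "\<psi> \<in> borel_measurable borel" "hderiv gop j \<psi> \<in> borel_measurable borel"
    by (intro borel_measurable_continuous_onI c\<psi> cX\<psi>)+
  define w where "w x = indicator K x *\<^sub>R u x" for x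
  have w[measurable]: "w \<in> borel_measurable borel" unfolding w_def by (rule trunc[OF K])
  define \<gamma> where "\<gamma> x = indicator K x * g x $ j" for x
  have i\<gamma>: "integrable lebesgue (\<lambda>x. indicator A x * g x $ j)" if "compact A" "A \<subseteq> \<Omega>" for A
    using integrable_bounded_linear[OF bounded_linear_vec_nth gK[OF that], of j] by simp
  have i\<gamma>': "integrable lebesgue \<gamma>" unfolding \<gamma>_def by (rule i\<gamma>[OF K])
  then have [measurable]: "\<gamma> \<in> borel_measurable lebesgue" by (rule borel_measurable_integrable)
  have lm: "f \<in> borel_measurable lebesgue" if "f \<in> borel_measurable borel" for f :: "real^'n \<Rightarrow> real"
    using that by (intro measurable_completion) simp
  define \<delta> where "\<delta> n = inverse (real (Suc n))" for n
  have \<delta>: "\<delta> n > 0" for n by (simp add: \<delta>_def)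
  let ?F = "\<lambda>n. smooth_pos (\<delta> n)" and ?F' = "\<lambda>n. smooth_pos_deriv (\<delta> n)"
  have [measurable]: "?F n \<in> borel_measurable borel" "?F' n \<in> borel_measurable borel" for n
    using smooth_pos_has_derivative[OF \<delta>, of n] smooth_pos_deriv_continuous[OF \<delta>, of n]
    by (auto intro!: borel_measurable_continuous_onI continuous_at_imp_continuous_on DERIV_isCont)
  have approx: "(\<integral>x. ?F n (w x) * hderiv gop j \<psi> x \<partial>lebesgue) = - (\<integral>x. ?F' n (w x) * \<gamma> x * \<psi> x \<partial>lebesgue)" for n
  proof -
    have "(\<integral>x. indicator \<Omega> x * (?F n (u x) * hderiv gop j \<psi> x) \<partial>lebesgue) =
        - (\<integral>x. indicator \<Omega> x * (?F' n (u x) * g x $ j * \<psi> x) \<partial>lebesgue)"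
    proof (rule weak_chain_rule[OF \<Omega> u i\<gamma> _ smooth_pos_has_derivative[OF \<delta>] smooth_pos_deriv_continuous[OF \<delta>]
          smooth_pos_deriv_bounds[OF \<delta>] \<psi>])
      fix \<phi> :: "real^'n \<Rightarrow> real" assume "test_function \<Omega> \<phi>"
      then show "(\<integral>x. indicator \<Omega> x * (u x * hderiv gop j \<phi> x) \<partial>lebesgue) = - (\<integral>x. indicator \<Omega> x * (g x $ j * \<phi> x) \<partial>lebesgue)"
        using g j by (simp add: is_weak_hgrad_def set_lebesgue_integral_def)
    qed
    moreover have e1: "indicator \<Omega> x * (?F n (u x) * hderiv gop j \<psi> x) = ?F n (w x) * hderiv gop j \<psi> x" for x
      using X\<psi>K[of x] K(2) by (cases "x \<in> K") (auto simp: w_def)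
    moreover have e2: "indicator \<Omega> x * (?F' n (u x) * g x $ j * \<psi> x) = ?F' n (w x) * \<gamma> x * \<psi> x" for x
      using \<psi>K[of x] K(2) by (cases "x \<in> K") (auto simp: w_def \<gamma>_def)
    ultimately show ?thesis unfolding e1 e2 by blast
  qed
  have lhs: "(\<lambda>n. \<integral>x. ?F n (w x) * hderiv gop j \<psi> x \<partial>lebesgue) \<longlonglongrightarrow> (\<integral>x. max (w x) 0 * hderiv gop j \<psi> x \<partial>lebesgue)"
  proof (rule integral_dominated_convergence[where w="\<lambda>x. \<bar>w x * hderiv gop j \<psi> x\<bar>"])
    have "continuous_on K (\<lambda>x. u x * hderiv gop j \<psi> x)"
      by (intro continuous_on_mult continuous_on_subset[OF u K(2)] continuous_on_subset[OF cX\<psi>]) simp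
    from borel_integrable_compact[OF K(1) this]
    have "integrable lborel (\<lambda>x. w x * hderiv gop j \<psi> x)" by (simp add: w_def mult.assoc)
    then have "integrable lebesgue (\<lambda>x. w x * hderiv gop j \<psi> x)" by (simp add: integrable_completion)
    then show "integrable lebesgue (\<lambda>x. \<bar>w x * hderiv gop j \<psi> x\<bar>)" by (rule integrable_abs)
    show "AE x in lebesgue. (\<lambda>n. ?F n (w x) * hderiv gop j \<psi> x) \<longlonglongrightarrow> max (w x) 0 * hderiv gop j \<psi> x"
      unfolding \<delta>_def by (intro AE_I2 tendsto_mult_right smooth_pos_limits)
    show "AE x in lebesgue. norm (?F n (w x) * hderiv gop j \<psi> x) \<le> \<bar>w x * hderiv gop j \<psi> x\<bar>" for n
      using smooth_pos_bound[OF \<delta>] by (intro AE_I2) (simp add: abs_mult mult_right_mono)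
    show "(\<lambda>x. max (w x) 0 * hderiv gop j \<psi> x) \<in> borel_measurable lebesgue" by (rule lm) measurable
    show "(\<lambda>x. ?F n (w x) * hderiv gop j \<psi> x) \<in> borel_measurable lebesgue" for n by (rule lm) measurable
  qed
  have rhs: "(\<lambda>n. \<integral>x. ?F' n (w x) * \<gamma> x * \<psi> x \<partial>lebesgue) \<longlonglongrightarrow> (\<integral>x. (if w x > 0 then 1 else 0) * \<gamma> x * \<psi> x \<partial>lebesgue)"
  proof -
    have "compact (\<psi> ` K)" by (intro compact_continuous_image K continuous_on_subset[OF c\<psi>]) simp
    then have "bounded (\<psi> ` K)" by (rule compact_imp_bounded)
    then obtain c where c: "\<And>x. x \<in> K \<Longrightarrow> \<bar>\<psi> x\<bar> \<le> c" unfolding bounded_iff by force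
    have lw: "(\<lambda>x. h (w x)) \<in> borel_measurable lebesgue" if [measurable]: "h \<in> borel_measurable borel" for h :: "real \<Rightarrow> real"
      by (rule lm) measurable
    have l\<psi>: "\<psi> \<in> borel_measurable lebesgue" by (rule lm) measurable
    show ?thesis
    proof (rule integral_dominated_convergence[where w="\<lambda>x. \<bar>\<gamma> x\<bar> * c"])
      show "integrable lebesgue (\<lambda>x. \<bar>\<gamma> x\<bar> * c)" using i\<gamma>' by simp
      show "(\<lambda>x. (if w x > 0 then 1 else 0) * \<gamma> x * \<psi> x) \<in> borel_measurable lebesgue"
        by (intro borel_measurable_times l\<psi> lw[of "\<lambda>s. if s > 0 then 1 else 0"]) measurable
      show "(\<lambda>x. ?F' n (w x) * \<gamma> x * \<psi> x) \<in> borel_measurable lebesgue" for n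
        by (intro borel_measurable_times l\<psi> lw) measurable
      show "AE x in lebesgue. (\<lambda>n. ?F' n (w x) * \<gamma> x * \<psi> x) \<longlonglongrightarrow> (if w x > 0 then 1 else 0) * \<gamma> x * \<psi> x"
        unfolding \<delta>_def by (intro AE_I2 tendsto_mult_right smooth_pos_limits)
      show "AE x in lebesgue. norm (?F' n (w x) * \<gamma> x * \<psi> x) \<le> \<bar>\<gamma> x\<bar> * c" for n
      proof (intro AE_I2)
        fix x
        show "norm (?F' n (w x) * \<gamma> x * \<psi> x) \<le> \<bar>\<gamma> x\<bar> * c"
        proof (cases "x \<in> K")
          case True
          have "\<bar>?F' n (w x)\<bar> * \<bar>\<gamma> x\<bar> * \<bar>\<psi> x\<bar> \<le> 1 * \<bar>\<gamma> x\<bar> * c"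
            by (intro mult_mono smooth_pos_deriv_bounds[OF \<delta>] c[OF True]) auto
          then show ?thesis by (simp add: abs_mult)
        qed (simp add: \<gamma>_def)
      qed
    qed
  qed
  have "(\<integral>x. max (w x) 0 * hderiv gop j \<psi> x \<partial>lebesgue) = - (\<integral>x. (if w x > 0 then 1 else 0) * \<gamma> x * \<psi> x \<partial>lebesgue)"
    using lhs[unfolded approx] tendsto_minus[OF rhs] by (rule LIMSEQ_unique)
  moreover have e1: "indicator \<Omega> x *\<^sub>R (max (u x) 0 * hderiv gop j \<psi> x) = max (w x) 0 * hderiv gop j \<psi> x" for x
    using X\<psi>K[of x] K(2) by (cases "x \<in> K") (auto simp: w_def)
  moreover have e2: "indicator \<Omega> x *\<^sub>R ((if u x > 0 then g x else 0) $ j * \<psi> x) = (if w x > 0 then 1 else 0) * \<gamma> x * \<psi> x" for x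
    using \<psi>K[of x] K(2) by (cases "x \<in> K") (auto simp: w_def \<gamma>_def)
  ultimately show "(LINT x:\<Omega>|lebesgue. max (u x) 0 * hderiv gop j \<psi> x) =
      - (LINT x:\<Omega>|lebesgue. (if u x > 0 then g x else 0) $ j * \<psi> x)"
    unfolding set_lebesgue_integral_def e1 e2 by simp
qed

lemma is_weak_hgrad_uminus:
  assumes "is_weak_hgrad gop deg \<Omega> u g"
  shows "is_weak_hgrad gop deg \<Omega> (\<lambda>x. - u x) (\<lambda>x. - g x)"
  using assms by (auto simp: is_weak_hgrad_def locally_L1_def set_integrable_def set_lebesgue_integral_def)

lemma weak_hgrad:
  assumes "\<exists>g. is_weak_hgrad gop deg \<Omega> u g"
  shows "is_weak_hgrad gop deg \<Omega> u (weak_hgrad gop deg \<Omega> u)"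
  unfolding weak_hgrad_def using assms by (rule someI_ex)

end

section \<open>Gauge balls and the mean value kernel\<close>

context carnot_group
begin

text \<open>In dimension one the stratification leaves a single layer of degree one, and then \<open>Q = 1\<close>.  The
  coarea formula needs at least two dimensions.\<close>

lemma two_le_dimension:
  assumes Q: "hom_dim deg \<ge> 3"
  shows "2 \<le> CARD('n)"
proof (rule ccontr)
  assume "\<not> 2 \<le> CARD('n)"
  then have "CARD('n) = Suc 0" using zero_less_card_finite[where 'a='n] by linarith
  then obtain k :: 'n where "(UNIV :: 'n set) = {k}" unfolding card_1_singleton_iff by blast
  then have one: "j = k" for j :: 'n by blast
  have "deg k = 1"
  proof (rule ccontr)
    assume "deg k \<noteq> 1"
    then have dk: "deg k \<ge> 2" using deg_pos[of k] by linarith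
    have z: "a = 0" if "a \<in> layer deg 1" for a
    proof (rule vec_eq_iff[THEN iffD2], rule allI)
      fix j show "a $ j = 0 $ j"
        using that \<open>deg k \<noteq> 1\<close> one[of j] by (simp add: mem_layer)
    qed
    have "span {lie_bracket gop a b | a b. a \<in> layer deg 1 \<and> b \<in> layer deg (deg k - 1)} \<subseteq> span {0}"
    proof (rule span_mono, clarify)
      fix a b assume "a \<in> layer deg 1"
      then have "a = 0" by (rule z)
      then show "lie_bracket gop a b = 0" using linear_0[OF linear_lie(1)] by simp
    qed
    then have "layer deg (deg k) \<subseteq> {0}" using stratified[of "deg k - 1"] dk by simp
    moreover have "axis k 1 \<in> layer deg (deg k)" by (auto simp: mem_layer axis_def)
    ultimately have "axis k (1::real) = 0" by blast
    then show False by (simp add: axis_eq_0_iff)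
  qed
  then have "range deg = {1}" using one by (metis full_SetCompr_eq image_cong image_constant UNIV_I)
  then have "hom_dim deg = dim (layer deg 1)" by (simp add: hom_dim_def)
  also have "\<dots> \<le> DIM(real^'n)" by (rule dim_subset_UNIV)
  finally show False using Q \<open>CARD('n) = Suc 0\<close> by simp
qed

end

locale gauged_group = carnot_group gop deg
  for gop :: "real^'n \<Rightarrow> real^'n \<Rightarrow> real^'n" and deg :: "'n \<Rightarrow> nat" +
  fixes \<rho> :: "real^'n \<Rightarrow> real" and \<Gamma> :: "real^'n \<Rightarrow> real^'n \<Rightarrow> real" and c :: real
  assumes gauge: "homogeneous_norm deg \<rho>" and Q3: "hom_dim deg \<ge> 3" and c: "c > 0"
    and \<Gamma>: "x \<noteq> y \<Longrightarrow> \<Gamma> x y = c * \<rho> (gop (ginv gop x) y) powr (2 - real (hom_dim deg))"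
begin

abbreviation Q :: real where "Q \<equiv> real (hom_dim deg)"

lemma Q: "Q > 2" using Q3 by simp

lemma dim2: "2 \<le> CARD('n)" by (rule two_le_dimension[OF Q3])

lemma gauge_continuous: "continuous_on S \<rho>"
  using gauge continuous_on_subset by (auto simp: homogeneous_norm_def)

lemma gauge_borel [measurable]: "\<rho> \<in> borel_measurable borel"
  by (rule borel_measurable_continuous_onI[OF gauge_continuous])

lemma gauge_smooth: "smooth_on (- {0}) \<rho>"
  using gauge by (simp add: homogeneous_norm_def)

lemma gauge_zero: "\<rho> x = 0 \<longleftrightarrow> x = 0" and gauge_nonneg: "0 \<le> \<rho> x" and gauge_pos: "x \<noteq> 0 \<Longrightarrow> 0 < \<rho> x"
  using gauge unfolding homogeneous_norm_def by (metis less_irrefl, metis less_imp_le order_refl, blast)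

lemma gauge_dilation: "s > 0 \<Longrightarrow> \<rho> (dilation deg s x) = s * \<rho> x"
  using gauge by (simp add: homogeneous_norm_def)

lemma dilation_dilation: "dilation deg s (dilation deg t x) = dilation deg (s * t) x"
  by (simp add: dilation_def vec_eq_iff power_mult_distrib mult_ac)

lemma dilation_one [simp]: "dilation deg 1 x = x"
  by (simp add: dilation_def vec_eq_iff)

lemma dilation_zero: "dilation deg 0 x = 0"
proof -
  have "(0::real) ^ deg j = 0" for j using deg_pos[of j] by simp
  then show ?thesis by (simp add: dilation_def vec_eq_iff)
qed

lemma dilation_continuous: "continuous_on S (\<lambda>s. dilation deg s x)"
  unfolding dilation_def by (intro continuous_intros)

lemma linear_dilation: "linear (dilation deg s)"
  by (rule linearI) (simp_all add: dilation_def vec_eq_iff algebra_simps)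

text \<open>The dilations pull a point outside the Euclidean unit ball back to the unit sphere, where the gauge
  has a positive minimum, and they decrease the gauge.\<close>

lemma gauge_ball_in_unit_ball:
  obtains m where "m > 0" "\<And>x. \<rho> x < m \<Longrightarrow> norm x \<le> 1"
proof -
  have "sphere (0::real^'n) 1 \<noteq> {}" by simp
  then obtain y where y: "y \<in> sphere 0 1" "\<And>z. z \<in> sphere 0 1 \<Longrightarrow> \<rho> y \<le> \<rho> z"
    using continuous_attains_inf[OF compact_sphere _ gauge_continuous] by blast
  have "y \<noteq> 0" using y(1) by auto
  then have m: "\<rho> y > 0" by (rule gauge_pos)
  have "norm x \<le> 1" if x: "\<rho> x < \<rho> y" for x
  proof (rule ccontr)
    assume n: "\<not> norm x \<le> 1"
    have "\<exists>s. 0 \<le> s \<and> s \<le> 1 \<and> norm (dilation deg s x) = 1"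
    proof (rule IVT')
      show "norm (dilation deg 0 x) \<le> 1" by (simp add: dilation_zero)
      show "1 \<le> norm (dilation deg 1 x)" using n by simp
      show "continuous_on {0..1} (\<lambda>s. norm (dilation deg s x))" by (intro continuous_intros dilation_continuous)
    qed simp
    then obtain s where s: "0 \<le> s" "s \<le> 1" "norm (dilation deg s x) = 1" by blast
    have "s \<noteq> 0" using s(3) by (auto simp: dilation_zero)
    then have s0: "s > 0" using s by simp
    have "\<rho> y \<le> \<rho> (dilation deg s x)" using s by (intro y(2)) simp
    also have "\<dots> = s * \<rho> x" by (rule gauge_dilation[OF s0])
    also have "\<dots> \<le> 1 * \<rho> x" using s gauge_nonneg by (intro mult_right_mono)
    finally show False using x by simp
  qed
  then show ?thesis using m that by blast
qed

text \<open>Every gauge ball is a dilate of one inside the Euclidean unit ball.\<close>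

lemma gauge_bounded: "bounded {x. \<rho> x < r}"
proof -
  obtain m where m: "m > 0" "\<And>x. \<rho> x < m \<Longrightarrow> norm x \<le> 1" by (rule gauge_ball_in_unit_ball) blast
  define t where "t = max r 1 / m"
  have t: "t > 0" using m by (simp add: t_def)
  have "{x. \<rho> x < r} \<subseteq> dilation deg t ` cball 0 1"
  proof
    fix x assume "x \<in> {x. \<rho> x < r}"
    then have "\<rho> (dilation deg (1 / t) x) < m"
      using t m by (simp add: gauge_dilation t_def field_simps)
    then have "dilation deg (1 / t) x \<in> cball 0 1" using m by simp
    moreover have "x = dilation deg t (dilation deg (1 / t) x)" using t by (simp add: dilation_dilation)
    ultimately show "x \<in> dilation deg t ` cball 0 1" by blast
  qed
  then show ?thesis
    using bounded_linear_image[OF bounded_cball linear_conv_bounded_linear[THEN iffD1, OF linear_dilation]]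
    by (rule bounded_subset[rotated])
qed

text \<open>For \<open>t \<le> 1\<close> the dilation by \<open>t\<close> shrinks Euclidean norms at least by the factor \<open>t\<close>, since all degrees
  are positive.\<close>

lemma gauge_small:
  assumes \<epsilon>: "\<epsilon> > 0"
  obtains r where "r > 0" "{x. \<rho> x < r} \<subseteq> cball 0 \<epsilon>"
proof -
  obtain m where m: "m > 0" "\<And>x. \<rho> x < m \<Longrightarrow> norm x \<le> 1" by (rule gauge_ball_in_unit_ball) blast
  define t where "t = min \<epsilon> 1"
  have t: "0 < t" "t \<le> 1" "t \<le> \<epsilon>" using \<epsilon> by (auto simp: t_def)
  show ?thesis
  proof (rule that)
    show "t * m > 0" using t m by simp
    show "{x. \<rho> x < t * m} \<subseteq> cball 0 \<epsilon>"
    proof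
      fix x assume "x \<in> {x. \<rho> x < t * m}"
      then have "\<rho> (dilation deg (1 / t) x) < m" using t by (simp add: gauge_dilation field_simps)
      then have n: "norm (dilation deg (1 / t) x) \<le> 1" by (rule m)
      let ?y = "dilation deg (1 / t) x"
      have "norm x = norm (dilation deg t ?y)" using t by (simp add: dilation_dilation)
      also have "\<dots> \<le> norm (t *\<^sub>R ?y)"
      proof (rule norm_le_componentwise_cart)
        fix j
        have "t ^ deg j \<le> t ^ 1" using t deg_pos by (intro power_decreasing) auto
        then have "t ^ deg j * \<bar>?y $ j\<bar> \<le> t * \<bar>?y $ j\<bar>" by (intro mult_right_mono) auto
        moreover have "dilation deg t ?y $ j = t ^ deg j * ?y $ j" by (simp add: dilation_def)
        ultimately show "norm (dilation deg t ?y $ j) \<le> norm ((t *\<^sub>R ?y) $ j)" using t by (simp add: abs_mult)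
      qed
      also have "\<dots> \<le> t * 1" using t n by (simp add: mult_left_le)
      finally show "x \<in> cball 0 \<epsilon>" using t by simp
    qed
  qed
qed

lemma gauge_ball_eq: "gauge_ball gop \<rho> x r = gop x ` {y. \<rho> y < r}"
  unfolding gauge_ball_def ginv_eq by (auto simp: image_iff) (metis gop_cancel(2))

lemma gauge_ball_zero: "gauge_ball gop \<rho> 0 r = {y. \<rho> y < r}"
  by (simp add: gauge_ball_eq left_unit)

lemma gop_compact: "compact K \<Longrightarrow> compact (gop x ` K)"
  by (intro compact_continuous_image continuous_gop continuous_intros)

lemma gauge_ball_compact_closure: "compact (closure (gauge_ball gop \<rho> x r))"
proof -
  have "compact (gop x ` closure {y. \<rho> y < r})" using gauge_bounded by (intro gop_compact) simp
  moreover have "gauge_ball gop \<rho> x r \<subseteq> gop x ` closure {y. \<rho> y < r}"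
    unfolding gauge_ball_eq by (intro image_mono closure_subset)
  ultimately have "bounded (gauge_ball gop \<rho> x r)" using compact_imp_bounded bounded_subset by blast
  then show ?thesis by simp
qed

lemma gauge_ball_shrinks:
  assumes \<Omega>: "open \<Omega>" "x \<in> \<Omega>"
  obtains R where "R > 0" "\<And>r. r < R \<Longrightarrow> closure (gauge_ball gop \<rho> x r) \<subseteq> \<Omega>"
proof -
  have c: "continuous_on UNIV (gop x)" by (intro continuous_gop continuous_intros)
  have "open (gop x -` \<Omega>)" by (rule open_vimage[OF \<Omega>(1) c])
  moreover have "0 \<in> gop x -` \<Omega>" using \<Omega> by (simp add: right_unit)
  ultimately obtain e where e: "e > 0" "cball 0 e \<subseteq> gop x -` \<Omega>" using open_contains_cball by metis
  obtain R where R: "R > 0" "{y. \<rho> y < R} \<subseteq> cball 0 e" by (rule gauge_small[OF e(1)])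
  show ?thesis
  proof (rule that[OF R(1)])
    fix r assume r: "r < R"
    have "gauge_ball gop \<rho> x r \<subseteq> gop x ` cball 0 e"
      unfolding gauge_ball_eq using R(2) r by (intro image_mono) auto
    moreover have "closed (gop x ` cball 0 e)" by (intro compact_imp_closed gop_compact) simp
    ultimately have "closure (gauge_ball gop \<rho> x r) \<subseteq> gop x ` cball 0 e" by (rule closure_minimal)
    then show "closure (gauge_ball gop \<rho> x r) \<subseteq> \<Omega>" using e(2) by blast
  qed
qed

text \<open>A point of the gauge sphere is the limit of its dilates by factors less than one.\<close>

lemma frontier_gauge_ball:
  assumes t: "t > 0"
  shows "frontier (gauge_ball gop \<rho> 0 t) = {y. \<rho> y = t}"
proof -
  have op: "open {y. \<rho> y < t}" by (intro open_Collect_less gauge_continuous continuous_on_const)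
  have "closure {y. \<rho> y < t} = {y. \<rho> y \<le> t}"
  proof
    show "closure {y. \<rho> y < t} \<subseteq> {y. \<rho> y \<le> t}"
      by (intro closure_minimal closed_Collect_le gauge_continuous continuous_on_const) auto
    show "{y. \<rho> y \<le> t} \<subseteq> closure {y. \<rho> y < t}"
    proof
      fix y assume "y \<in> {y. \<rho> y \<le> t}"
      then have y: "\<rho> y \<le> t" by simp
      let ?s = "\<lambda>n. 1 - inverse (real (Suc (Suc n)))"
      have "?s \<longlonglongrightarrow> 1 - 0" by (intro tendsto_intros LIMSEQ_Suc[OF LIMSEQ_inverse_real_of_nat])
      then have "?s \<longlonglongrightarrow> 1" by simp
      moreover have "isCont (\<lambda>s. dilation deg s y) 1"
        using dilation_continuous[of UNIV y] by (simp add: continuous_on_eq_continuous_at)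
      ultimately have lim: "(\<lambda>n. dilation deg (?s n) y) \<longlonglongrightarrow> dilation deg 1 y"
        by (rule isCont_tendsto_compose[rotated])
      have "\<rho> (dilation deg (?s n) y) < t" for n
      proof -
        have s: "0 < ?s n" "?s n < 1" by (auto simp: field_simps)
        have "?s n * \<rho> y \<le> ?s n * t" using s y by (intro mult_left_mono) auto
        also have "\<dots> < 1 * t" using s t by (intro mult_strict_right_mono)
        finally show ?thesis by (simp only: gauge_dilation[OF s(1)] mult_1)
      qed
      with lim show "y \<in> closure {y. \<rho> y < t}" unfolding closure_sequential dilation_one
        by (intro exI[of _ "\<lambda>n. dilation deg (?s n) y"]) simp
    qed
  qed
  then show ?thesis unfolding frontier_def gauge_ball_zero interior_open[OF op] by auto
qed

lemma gauge_gradient: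
  assumes "x \<noteq> 0"
  shows "(\<rho> has_derivative (\<lambda>h. egrad \<rho> x \<bullet> h)) (at x)"
proof -
  have D: "(\<rho> has_derivative frechet_derivative \<rho> (at x)) (at x)"
    using smooth_on_has_derivative[OF gauge_smooth] assms by simp
  have "frechet_derivative \<rho> (at x) h = egrad \<rho> x \<bullet> h" for h
  proof -
    have "frechet_derivative \<rho> (at x) h = frechet_derivative \<rho> (at x) (\<Sum>j\<in>UNIV. h $ j *\<^sub>R axis j 1)"
      by (simp add: basis_expansion scalar_mult_eq_scaleR[symmetric])
    also have "\<dots> = (\<Sum>j\<in>UNIV. h $ j * frechet_derivative \<rho> (at x) (axis j 1))"
      using has_derivative_linear[OF D] by (simp add: linear_sum linear_scale)
    finally show ?thesis by (simp add: egrad_def inner_vec_def mult.commute)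
  qed
  then show ?thesis using D by (metis (no_types, lifting) ext)
qed

text \<open>By Euler's identity, the derivative of \<open>\<rho>\<close> in direction of the dilations is \<open>\<rho>\<close> and hence does not vanish.\<close>

lemma gauge_submersion: "smooth_submersion \<rho> (egrad \<rho>) (- {0})"
proof
  show "DIM(real^'n) \<ge> 2" using dim2 by simp
  show "open (- {0::real^'n})" by (rule open_Compl) simp
  show "continuous_on (- {0}) (egrad \<rho>)"
    unfolding egrad_def[abs_def]
    by (intro continuous_on_vec_lambda smooth_on_continuous smooth_on_frechet gauge_smooth)
  fix x :: "real^'n" assume "x \<in> - {0}"
  then have x: "x \<noteq> 0" by simp
  show "(\<rho> has_derivative (\<lambda>h. egrad \<rho> x \<bullet> h)) (at x)" by (rule gauge_gradient[OF x])
  have "\<rho> x = egrad \<rho> x \<bullet> (\<chi> j. real (deg j) * x $ j)"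
    using euler_identity[OF gauge x] fun_cong[OF frechet_derivative_at[OF gauge_gradient[OF x]], of "\<chi> j. real (deg j) * x $ j"] by simp
  then show "egrad \<rho> x \<noteq> 0" using gauge_pos[OF x] by auto
qed

text \<open>Both gradients of \<open>\<Gamma> = c \<rho>\<^bsup>2-Q\<^esup>\<close> are those of \<open>\<rho>\<close> times \<open>k = - c (Q-2) \<rho>\<^bsup>1-Q\<^esup>\<close>.\<close>

lemma mean_kernel_gauge:
  assumes x: "x \<noteq> 0"
  shows "mean_kernel gop deg \<Gamma> x = c * (Q - 2) * \<rho> x powr (1 - Q) * (norm (hgrad gop deg \<rho> x))\<^sup>2 / norm (egrad \<rho> x)"
proof -
  define k where "k = - (c * (Q - 2) * \<rho> x powr (1 - Q))"
  have \<rho>x: "\<rho> x > 0" by (rule gauge_pos[OF x])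
  have "((\<lambda>y. c * \<rho> y powr (2 - Q)) has_derivative (\<lambda>h. k * frechet_derivative \<rho> (at x) h)) (at x)"
  proof -
    have "((\<lambda>s. c * s powr (2 - Q)) has_real_derivative k) (at (\<rho> x))"
      using \<rho>x by (auto intro!: derivative_eq_intros simp: k_def algebra_simps)
    moreover have "(\<rho> has_derivative frechet_derivative \<rho> (at x)) (at x)"
      using smooth_on_has_derivative[OF gauge_smooth] x by simp
    ultimately show ?thesis using has_derivative_compose[of \<rho> _ x UNIV "\<lambda>s. c * s powr (2 - Q)" "(*) k"]
      by (simp add: has_field_derivative_def)
  qed
  then have "(\<Gamma> 0 has_derivative (\<lambda>h. k * frechet_derivative \<rho> (at x) h)) (at x)"
  proof (rule has_derivative_transform_within_open)
    show "open (- {0::real^'n})" by (rule open_Compl) simp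
    show "c * \<rho> y powr (2 - Q) = \<Gamma> 0 y" if "y \<in> - {0}" for y
      using \<Gamma>[of 0 y] that by (simp add: ginv_eq left_unit)
  qed (use x in simp)
  then have F: "frechet_derivative (\<Gamma> 0) (at x) = (\<lambda>h. k * frechet_derivative \<rho> (at x) h)"
    by (rule frechet_derivative_at[symmetric])
  have h: "hgrad gop deg (\<Gamma> 0) x = k *\<^sub>R hgrad gop deg \<rho> x"
    by (simp add: hgrad_def hderiv_def F vec_eq_iff)
  have e: "egrad (\<Gamma> 0) x = k *\<^sub>R egrad \<rho> x"
    by (simp add: egrad_def F vec_eq_iff)
  have cancel: "s\<^sup>2 * a / (s * b) = s * a / b" if "s \<noteq> 0" for s a b :: real
    using that by (simp add: power2_eq_square)
  have k: "\<bar>k\<bar> = c * (Q - 2) * \<rho> x powr (1 - Q)" and k0: "k \<noteq> 0" using c Q \<rho>x by (auto simp: k_def abs_mult)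
  have "mean_kernel gop deg \<Gamma> x = \<bar>k\<bar>\<^sup>2 * (norm (hgrad gop deg \<rho> x))\<^sup>2 / (\<bar>k\<bar> * norm (egrad \<rho> x))"
    by (simp add: mean_kernel_def h e power_mult_distrib)
  also have "\<dots> = \<bar>k\<bar> * (norm (hgrad gop deg \<rho> x))\<^sup>2 / norm (egrad \<rho> x)"
    by (rule cancel) (use k0 in simp)
  finally show ?thesis unfolding k .
qed

lemma hgrad_nonzero_borel: "{x. x \<noteq> 0 \<and> hgrad gop deg \<rho> x \<noteq> 0} \<in> sets borel"
proof -
  have U: "open (- {0::real^'n})" by (rule open_Compl) simp
  have [measurable]: "(\<lambda>x. indicator (- {0}) x *\<^sub>R hderiv gop j \<rho> x) \<in> borel_measurable borel" for j
    unfolding hderiv_XD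
    by (intro borel_measurable_continuous_on_indicator smooth_on_continuous smooth_XD U gauge_smooth) (use U in simp)
  have "{x. x \<noteq> 0 \<and> hgrad gop deg \<rho> x \<noteq> 0} = {x. \<exists>j\<in>{j. deg j = 1}. indicator (- {0}) x *\<^sub>R hderiv gop j \<rho> x \<noteq> 0}"
    by (auto simp: hgrad_def vec_eq_iff indicator_def)
  also have "\<dots> \<in> sets borel" by measurable
  finally show ?thesis .
qed

end

section \<open>The energy as an integral of mean values\<close>

context gauged_group
begin

text \<open>The energy identity at the unit element for a density \<open>h\<close> that is only known to agree almost everywhere with
  a Borel function.  With \<open>I s\<close> the slice integrals given by the coarea formula, the mean value
  at radius \<open>s\<close> is \<open>(Q-2) I s / s\<close> for almost every \<open>s\<close>; so \<open>t M(t r)\<close> is \<open>(Q-2) I(t r) / r\<close>.\<close>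

lemma gauge_energy:
  fixes h h' :: "real^'n \<Rightarrow> ennreal" and r :: real
  assumes r: "r > 0" and h'[measurable]: "h' \<in> borel_measurable borel"
    and h: "AE x in lborel. \<rho> x < r \<longrightarrow> h x = h' x"
  defines "M \<equiv> \<lambda>t. \<integral>\<^sup>+y. h y * ennreal (1 / (norm (hgrad gop deg \<rho> y))\<^sup>2) * ennreal (mean_kernel gop deg \<Gamma> y)
      * indicator {y. \<rho> y = t} y \<partial>surface_measure"
  shows "ennreal (1 / r\<^sup>2) * (\<integral>\<^sup>+x. h x * ennreal (c * \<rho> x powr (2 - Q)) * indicator {x. \<rho> x < r} x \<partial>lborel)
    = ennreal (1 / (Q - 2)) * (\<integral>\<^sup>+t. ennreal t * M (t * r) * indicator {0..1} t \<partial>lborel)"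
proof -
  interpret S: smooth_submersion \<rho> "egrad \<rho>" "- {0}" by (rule gauge_submersion)
  define U where "U = - {0::real^'n}"
  define Z where "Z = {x. x \<noteq> 0 \<and> hgrad gop deg \<rho> x \<noteq> 0}"
  have [measurable]: "Z \<in> sets borel" unfolding Z_def by (rule hgrad_nonzero_borel)
  define k where "k x = indicator U x *\<^sub>R (c * \<rho> x powr (2 - Q) / norm (egrad \<rho> x))" for x
  have [measurable]: "k \<in> borel_measurable borel"
    unfolding k_def U_def
  proof (rule borel_measurable_continuous_on_indicator)
    show "- {0::real^'n} \<in> sets borel" using S.U by simp
    show "continuous_on (- {0::real^'n}) (\<lambda>x. c * \<rho> x powr (2 - Q) / norm (egrad \<rho> x))"
      by (intro continuous_intros gauge_continuous S.cont) (auto simp: gauge_zero S.nonzero)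
  qed
  have k: "k x = c * \<rho> x powr (2 - Q) / norm (egrad \<rho> x)" if "x \<noteq> 0" for x using that by (simp add: k_def U_def)
  have k0: "0 \<le> k x" for x using c by (simp add: k_def indicator_def)
  \<comment> \<open>dividing by \<open>|\<nabla>\<rho>|\<close> in \<open>k\<close> compensates for the factor in the coarea formula; the critical points of \<open>\<rho>\<close>, where the mean value drops the density, are removed\<close>
  define W where "W x = h' x * (ennreal (k x) * indicator (Z \<inter> {x. \<rho> x < r}) x)" for x
  have W[measurable]: "W \<in> borel_measurable borel" unfolding W_def[abs_def] by measurable
  define I where "I s = (\<integral>\<^sup>+x. W x * indicator (U \<inter> {x. \<rho> x = s}) x \<partial>surface_measure)" for s
  have [measurable]: "I \<in> borel_measurable borel" unfolding I_def[abs_def] U_def by (rule S.coarea(1)[OF W])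
  have I0: "I s = 0" if "s \<le> 0 \<or> r \<le> s" for s
  proof -
    have zero: "W x * indicator (U \<inter> {x. \<rho> x = s}) x = 0" for x
      using that gauge_pos[of x] by (auto simp: W_def U_def indicator_def)
    show ?thesis unfolding I_def zero by simp
  qed
  \<comment> \<open>the solid integral by slices\<close>
  have total: "(\<integral>\<^sup>+s. I s \<partial>lborel) = (\<integral>\<^sup>+x. h x * ennreal (c * \<rho> x powr (2 - Q)) * indicator {x. \<rho> x < r} x \<partial>lborel)"
  proof -
    have "(\<integral>\<^sup>+s. I s \<partial>lborel) = (\<integral>\<^sup>+x. W x * (indicator U x * ennreal (norm (egrad \<rho> x))) \<partial>lborel)"
      unfolding I_def U_def by (rule S.coarea(2)[OF W])
    also have "\<dots> = (\<integral>\<^sup>+x. h x * ennreal (c * \<rho> x powr (2 - Q)) * indicator {x. \<rho> x < r} x \<partial>lborel)"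
    proof (rule nn_integral_cong_AE)
      show "AE x in lborel. W x * (indicator U x * ennreal (norm (egrad \<rho> x)))
          = h x * ennreal (c * \<rho> x powr (2 - Q)) * indicator {x. \<rho> x < r} x"
        using h AE_hgrad_nonzero[OF gauge] AE_lborel_singleton[of 0]
      proof eventually_elim
        case (elim x)
        show ?case
        proof (cases "\<rho> x < r")
          case True
          have e: "norm (egrad \<rho> x) \<noteq> 0" using elim S.nonzero[of x] by simp
          have "ennreal (k x) * ennreal (norm (egrad \<rho> x)) = ennreal (k x * norm (egrad \<rho> x))"
            using k0 by (simp add: ennreal_mult)
          also have "k x * norm (egrad \<rho> x) = c * \<rho> x powr (2 - Q)" using e elim by (simp add: k)
          finally show ?thesis using True elim by (simp add: W_def Z_def U_def mult.assoc)
        qed (simp add: W_def)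
      qed
    qed
    finally show ?thesis .
  qed
  \<comment> \<open>almost every slice misses the exceptional null set up to surface measure zero\<close>
  obtain N where N: "{x. \<not> (\<rho> x < r \<longrightarrow> h x = h' x)} \<subseteq> N" "emeasure lborel N = 0" "N \<in> sets borel"
    using AE_E[OF h] by auto
  define J where "J s = (\<integral>\<^sup>+x. indicator N x * indicator (U \<inter> {x. \<rho> x = s}) x \<partial>surface_measure)" for s
  have indN: "(indicator N :: real^'n \<Rightarrow> ennreal) \<in> borel_measurable borel" using N(3) by simp
  have [measurable]: "J \<in> borel_measurable borel" unfolding J_def[abs_def] U_def by (rule S.coarea(1)[OF indN])
  have "(\<integral>\<^sup>+s. J s \<partial>lborel) = (\<integral>\<^sup>+x. indicator N x * (indicator U x * ennreal (norm (egrad \<rho> x))) \<partial>lborel)"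
    unfolding J_def U_def by (rule S.coarea(2)[OF indN])
  also have "\<dots> = (\<integral>\<^sup>+x. 0 \<partial>(lborel :: (real^'n) measure))"
  proof (rule nn_integral_cong_AE)
    have "AE x in lborel. x \<notin> N" using N by (intro AE_not_in) (simp add: null_sets_def)
    then show "AE x in lborel. indicator N x * (indicator U x * ennreal (norm (egrad \<rho> x))) = 0" by eventually_elim simp
  qed
  finally have "AE s in lborel. J s = 0" by (simp add: nn_integral_0_iff_AE)
  then have slices: "AE s in lborel. 0 < s \<and> s < r \<longrightarrow> M s = ennreal ((Q - 2) / s) * I s"
  proof eventually_elim
    case (elim s)
    show ?case
    proof
      assume s: "0 < s \<and> s < r"
      have lev: "U \<inter> {x. \<rho> x = s} \<in> sets surface_measure" unfolding U_def by (intro borel_sets_hausdorff S.level_borel)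
      note [measurable] = lev S.borel_measurable_surface[OF indN] S.borel_measurable_surface[OF W]
      have "AE x in surface_measure. indicator N x * indicator (U \<inter> {x. \<rho> x = s}) x = (0::ennreal)"
        using elim unfolding J_def by (subst (asm) nn_integral_0_iff_AE) measurable
      then have "AE x in surface_measure. h x * ennreal (1 / (norm (hgrad gop deg \<rho> x))\<^sup>2) * ennreal (mean_kernel gop deg \<Gamma> x)
          * indicator {y. \<rho> y = s} x = ennreal ((Q - 2) / s) * (W x * indicator (U \<inter> {x. \<rho> x = s}) x)"
      proof eventually_elim
        case (elim x)
        show ?case
        proof (cases "\<rho> x = s")
          case True
          then have x: "x \<noteq> 0" using s gauge_zero[of x] by auto
          then have "x \<notin> N" using elim True by (auto simp: U_def indicator_def)
          then have hx: "h x = h' x" using N(1) True s by auto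
          show ?thesis
          proof (cases "hgrad gop deg \<rho> x = 0")
            case True
            then show ?thesis by (simp add: W_def Z_def)
          next
            case False
            have "1 / (norm (hgrad gop deg \<rho> x))\<^sup>2 * mean_kernel gop deg \<Gamma> x = c * (Q - 2) * s powr (1 - Q) / norm (egrad \<rho> x)"
              unfolding mean_kernel_gauge[OF x] using False True by simp
            also have "s powr (1 - Q) = s powr (2 - Q) / s"
              using s powr_mult_base[of s "1 - Q"] by (simp add: field_simps)
            also have "c * (Q - 2) * (s powr (2 - Q) / s) / norm (egrad \<rho> x) = (Q - 2) / s * k x"
              using x True by (simp add: k mult_ac)
            finally have "ennreal (1 / (norm (hgrad gop deg \<rho> x))\<^sup>2) * ennreal (mean_kernel gop deg \<Gamma> x) =
                ennreal ((Q - 2) / s) * ennreal (k x)"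
              using s Q k0[of x] by (simp add: ennreal_mult'[symmetric])
            then show ?thesis using True x False s by (simp add: W_def Z_def U_def hx mult.assoc mult.left_commute)
          qed
        qed simp
      qed
      then have "M s = (\<integral>\<^sup>+x. ennreal ((Q - 2) / s) * (W x * indicator (U \<inter> {x. \<rho> x = s}) x) \<partial>surface_measure)"
        unfolding M_def by (rule nn_integral_cong_AE)
      also have "\<dots> = ennreal ((Q - 2) / s) * I s"
        unfolding I_def by (rule nn_integral_cmult) measurable
      finally show "M s = ennreal ((Q - 2) / s) * I s" .
    qed
  qed
  \<comment> \<open>rescaling the radius to the unit interval\<close>
  obtain N' where N': "{s. \<not> (0 < s \<and> s < r \<longrightarrow> M s = ennreal ((Q - 2) / s) * I s)} \<subseteq> N'"
      "emeasure lborel N' = 0" "N' \<in> sets borel"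
    using AE_E[OF slices] by auto
  have "AE s in lborel. s \<notin> N'" using N' by (intro AE_not_in) (simp add: null_sets_def)
  then have "AE t in lborel. 0 + r * t \<notin> N'"
    using r N'(3) by (intro AE_borel_affine) auto
  then have "AE t in lborel. ennreal t * M (t * r) * indicator {0..1} t = ennreal ((Q - 2) / r) * I (0 + r * t)"
    using AE_lborel_singleton[of 0] AE_lborel_singleton[of 1]
  proof eventually_elim
    case (elim t)
    show ?case
    proof (cases "0 < t \<and> t < 1")
      case True
      then have "0 < t * r \<and> t * r < r" using r by simp
      then have "M (t * r) = ennreal ((Q - 2) / (t * r)) * I (t * r)"
        using N'(1) elim by (auto simp: mult.commute)
      then have "ennreal t * M (t * r) = (ennreal t * ennreal ((Q - 2) / (t * r))) * I (t * r)" by (simp add: mult.assoc)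
      also have "ennreal t * ennreal ((Q - 2) / (t * r)) = ennreal ((Q - 2) / r)"
        using True Q r by (simp add: ennreal_mult[symmetric])
      finally show ?thesis using True by (simp add: mult.commute)
    next
      case False
      then have t: "t < 0 \<or> 1 < t" using elim by auto
      then have "r * t \<le> 0 \<or> r \<le> r * t" using r by (auto simp: mult_le_0_iff)
      then show ?thesis using t by (auto simp: I0)
    qed
  qed
  then have "(\<integral>\<^sup>+t. ennreal t * M (t * r) * indicator {0..1} t \<partial>lborel) = (\<integral>\<^sup>+t. ennreal ((Q - 2) / r) * I (0 + r * t) \<partial>lborel)"
    by (rule nn_integral_cong_AE)
  also have "\<dots> = ennreal ((Q - 2) / r) * (\<integral>\<^sup>+t. I (0 + r * t) \<partial>lborel)" by (rule nn_integral_cmult) measurable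
  finally have right: "(\<integral>\<^sup>+t. ennreal t * M (t * r) * indicator {0..1} t \<partial>lborel) = ennreal ((Q - 2) / r) * (\<integral>\<^sup>+t. I (0 + r * t) \<partial>lborel)" .
  have "(\<integral>\<^sup>+s. I s \<partial>lborel) = ennreal r * (\<integral>\<^sup>+t. I (0 + r * t) \<partial>lborel)"
    using nn_integral_real_affine[of I r 0] r by simp
  then have "ennreal (1 / r\<^sup>2) * (\<integral>\<^sup>+s. I s \<partial>lborel) = (ennreal (1 / r\<^sup>2) * ennreal r) * (\<integral>\<^sup>+t. I (0 + r * t) \<partial>lborel)"
    by (simp add: mult.assoc)
  also have "ennreal (1 / r\<^sup>2) * ennreal r = ennreal (1 / (Q - 2)) * ennreal ((Q - 2) / r)"
    using r Q by (simp add: ennreal_mult[symmetric] power2_eq_square)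
  finally show ?thesis unfolding total right by (simp add: mult.assoc)
qed

lemma gradient_mean_gauge:
  assumes t: "t > 0"
  shows "gradient_mean gop deg \<rho> \<Gamma> \<Omega> w x0 t =
    (\<integral>\<^sup>+y. ennreal ((norm (weak_hgrad gop deg \<Omega> w (gop x0 y)))\<^sup>2) * ennreal (1 / (norm (hgrad gop deg \<rho> y))\<^sup>2)
      * ennreal (mean_kernel gop deg \<Gamma> y) * indicator {y. \<rho> y = t} y \<partial>surface_measure)"
proof -
  have "ennreal ((a / b)\<^sup>2) = ennreal (a\<^sup>2) * ennreal (1 / b\<^sup>2)" for a b :: real
    by (simp add: ennreal_mult[symmetric] power_divide)
  then show ?thesis
    unfolding gradient_mean_def mean_value_def frontier_gauge_ball[OF t] ginv_eq by (simp add: left_unit)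
qed

text \<open>The closure of the ball is a compact subset of the domain, on which the weak gradient is integrable; this
  provides the Borel function that \<open>gauge_energy\<close> asks for.\<close>

lemma energy_mean_identity:
  assumes w: "locally_L1 \<Omega> (weak_hgrad gop deg \<Omega> w)" and r: "r > 0" and sub: "closure (gauge_ball gop \<rho> x0 r) \<subseteq> \<Omega>"
  shows "ennreal (1 / r\<^sup>2) * energy gop deg \<rho> \<Gamma> \<Omega> w x0 r
    = ennreal (1 / (Q - 2)) * (\<integral>\<^sup>+t\<in>{0..1}. (ennreal t * gradient_mean gop deg \<rho> \<Gamma> \<Omega> w x0 (t * r)) \<partial>lebesgue)"
proof -
  let ?g = "weak_hgrad gop deg \<Omega> w"
  define K where "K = closure (gauge_ball gop \<rho> x0 r)"
  have K: "compact K" "K \<subseteq> \<Omega>" using sub gauge_ball_compact_closure by (auto simp: K_def)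
  have inK: "gop x0 y \<in> K" if "\<rho> y < r" for y
    unfolding K_def gauge_ball_eq using that by (intro subsetD[OF closure_subset] imageI) simp
  have "integrable lebesgue (\<lambda>x. indicator K x *\<^sub>R ?g x)"
    using w K by (simp add: locally_L1_def set_integrable_def)
  then have "(\<lambda>x. indicator K x *\<^sub>R ?g x) \<in> borel_measurable lebesgue" by (rule borel_measurable_integrable)
  then have "(\<lambda>x. (norm (indicator K x *\<^sub>R ?g x))\<^sup>2) \<in> borel_measurable lebesgue" by measurable
  then obtain f where f: "f \<in> borel_measurable lborel" "AE x in lborel. (norm (indicator K x *\<^sub>R ?g x))\<^sup>2 = f x"
    using completion_ex_borel_measurable_real by blast
  have [measurable]: "f \<in> borel_measurable borel" using f(1) by simp
  have [measurable]: "gop x0 \<in> borel_measurable borel"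
    using gop_borel[OF measurable_const[of x0 borel borel] measurable_ident_sets[OF refl]] by simp
  define h where "h y = ennreal ((norm (?g (gop x0 y)))\<^sup>2)" for y
  have h'm: "(\<lambda>y. ennreal (f (gop x0 y))) \<in> borel_measurable borel" by measurable
  have "AE x in distr lborel borel (gop x0). (norm (indicator K x *\<^sub>R ?g x))\<^sup>2 = f x" using f(2) by (simp only: distr_left)
  then have "AE y in lborel. (norm (indicator K (gop x0 y) *\<^sub>R ?g (gop x0 y)))\<^sup>2 = f (gop x0 y)"
    by (rule AE_distrD[rotated]) simp
  then have hh': "AE y in lborel. \<rho> y < r \<longrightarrow> h y = ennreal (f (gop x0 y))"
    by eventually_elim (auto simp: h_def inK)
  \<comment> \<open>left translation moves the centre to the unit element\<close>
  have "energy gop deg \<rho> \<Gamma> \<Omega> w x0 r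
      = (\<integral>\<^sup>+x. ennreal ((norm (?g x))\<^sup>2 * \<Gamma> x0 x) * indicator (gauge_ball gop \<rho> x0 r) x \<partial>lborel)"
    unfolding energy_def by (rule nn_integral_completion)
  also have "\<dots> = (\<integral>\<^sup>+y. ennreal ((norm (?g (gop x0 y)))\<^sup>2 * \<Gamma> x0 (gop x0 y)) * indicator (gauge_ball gop \<rho> x0 r) (gop x0 y) \<partial>lborel)"
    by (rule nn_integral_left[symmetric])
  also have "\<dots> = (\<integral>\<^sup>+y. h y * ennreal (c * \<rho> y powr (2 - Q)) * indicator {y. \<rho> y < r} y \<partial>lborel)"
  proof (rule nn_integral_cong_AE)
    show "AE y in lborel. ennreal ((norm (?g (gop x0 y)))\<^sup>2 * \<Gamma> x0 (gop x0 y)) * indicator (gauge_ball gop \<rho> x0 r) (gop x0 y) =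
        h y * ennreal (c * \<rho> y powr (2 - Q)) * indicator {y. \<rho> y < r} y"
      using AE_lborel_singleton[of 0]
    proof eventually_elim
      case (elim y)
      have ne: "x0 \<noteq> gop x0 y"
      proof
        assume "x0 = gop x0 y"
        then have "gop (- x0) x0 = gop (- x0) (gop x0 y)" by simp
        then show False using elim by simp
      qed
      have "\<Gamma> x0 (gop x0 y) = c * \<rho> y powr (2 - Q)" using \<Gamma>[OF ne] by (simp add: ginv_eq)
      moreover have "indicator (gauge_ball gop \<rho> x0 r) (gop x0 y) = (indicator {y. \<rho> y < r} y :: ennreal)"
        by (simp add: gauge_ball_def ginv_eq indicator_def)
      ultimately show ?case by (simp add: h_def ennreal_mult')
    qed
  qed
  finally have E: "energy gop deg \<rho> \<Gamma> \<Omega> w x0 r = (\<integral>\<^sup>+y. h y * ennreal (c * \<rho> y powr (2 - Q)) * indicator {y. \<rho> y < r} y \<partial>lborel)" .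
  have "(\<integral>\<^sup>+t\<in>{0..1}. (ennreal t * gradient_mean gop deg \<rho> \<Gamma> \<Omega> w x0 (t * r)) \<partial>lebesgue)
      = (\<integral>\<^sup>+t. ennreal t * gradient_mean gop deg \<rho> \<Gamma> \<Omega> w x0 (t * r) * indicator {0..1} t \<partial>lborel)"
    by (rule nn_integral_completion)
  also have "\<dots> = (\<integral>\<^sup>+t. ennreal t * (\<integral>\<^sup>+y. h y * ennreal (1 / (norm (hgrad gop deg \<rho> y))\<^sup>2) * ennreal (mean_kernel gop deg \<Gamma> y)
      * indicator {y. \<rho> y = t * r} y \<partial>surface_measure) * indicator {0..1} t \<partial>lborel)"
  proof (rule nn_integral_cong)
    fix t :: real
    consider "t < 0" | "t = 0" | "t > 0" by linarith
    then show "ennreal t * gradient_mean gop deg \<rho> \<Gamma> \<Omega> w x0 (t * r) * indicator {0..1} t = ennreal t * (\<integral>\<^sup>+y. h y * ennreal (1 / (norm (hgrad gop deg \<rho> y))\<^sup>2) * ennreal (mean_kernel gop deg \<Gamma> y)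
      * indicator {y. \<rho> y = t * r} y \<partial>surface_measure) * indicator {0..1} t"
    proof cases
      case 3
      then have "t * r > 0" using r by simp
      from gradient_mean_gauge[OF this] show ?thesis by (simp only: h_def)
    qed simp_all
  qed
  finally show ?thesis unfolding E using gauge_energy[OF r h'm hh'] by simp
qed

end

text \<open>For fixed \<open>t\<close>, the integrand at radius \<open>t r\<close> grows with \<open>r\<close> unless \<open>t r\<close> lies in the exceptional null set.\<close>

lemma increasing_near_0_average:
  assumes M: "ae_increasing_near_0 M" and R: "R > 0"
    and A: "\<And>r. 0 < r \<Longrightarrow> r < R \<Longrightarrow> A r = C * (\<integral>\<^sup>+t\<in>{0..1}. (ennreal t * M (t * r)) \<partial>lebesgue)"
  shows "increasing_near_0 A"
proof -
  obtain \<delta> Z where \<delta>: "\<delta> > 0" and Z: "Z \<in> null_sets lebesgue" and mono: "mono_on ({0<..<\<delta>} - Z) M"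
    using M unfolding ae_increasing_near_0_def by blast
  have null: "AE t in lebesgue. t * r \<notin> Z" if "r > 0" for r
  proof -
    have "negligible ((*\<^sub>R) (1 / r) ` Z)"
      using Z by (intro negligible_differentiable_image_negligible linear_imp_differentiable_on linear_scaleR)
        (auto simp: negligible_iff_null_sets)
    moreover have "{t. t * r \<in> Z} \<subseteq> (*\<^sub>R) (1 / r) ` Z"
    proof
      fix t assume "t \<in> {t. t * r \<in> Z}"
      then show "t \<in> (*\<^sub>R) (1 / r) ` Z" using that by (intro image_eqI[of _ _ "t * r"]) auto
    qed
    ultimately have "{t. t * r \<in> Z} \<in> null_sets lebesgue" using negligible_subset negligible_iff_null_sets by blast
    from AE_not_in[OF this] show ?thesis by simp
  qed
  have "mono_on {0<..<min \<delta> R} A"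
  proof (rule mono_onI)
    fix r s assume rs: "r \<in> {0<..<min \<delta> R}" "s \<in> {0<..<min \<delta> R}" "r \<le> s"
    have "(\<integral>\<^sup>+t\<in>{0..1}. (ennreal t * M (t * r)) \<partial>lebesgue) \<le> (\<integral>\<^sup>+t\<in>{0..1}. (ennreal t * M (t * s)) \<partial>lebesgue)"
    proof (rule nn_integral_mono_AE)
      have "AE t in lebesgue. t * r \<notin> Z" "AE t in lebesgue. t * s \<notin> Z" using rs by (auto intro: null)
      then show "AE t in lebesgue. ennreal t * M (t * r) * indicator {0..1} t \<le> ennreal t * M (t * s) * indicator {0..1} t"
      proof eventually_elim
        case (elim t)
        show ?case
        proof (cases "0 < t \<and> t \<le> 1")
          case True
          have "t * r \<le> t * s" using True rs by (intro mult_left_mono) auto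
          moreover have "t * s \<le> s" using True rs by (simp add: mult_left_le_one_le)
          moreover have "0 < t * r" using True rs by simp
          moreover have "s < \<delta>" using rs by simp
          ultimately have "t * r \<in> {0<..<\<delta>} - Z" "t * s \<in> {0<..<\<delta>} - Z" "t * r \<le> t * s"
            using elim by simp_all
          then have "M (t * r) \<le> M (t * s)" by (rule mono_onD[OF mono])
          then show ?thesis by (intro mult_mono) auto
        next
          case False
          then show ?thesis by (cases "t = 0") (auto simp: indicator_def)
        qed
      qed
    qed
    then show "A r \<le> A s" using rs by (auto simp: A intro: mult_left_mono)
  qed
  then show ?thesis using \<delta> R unfolding increasing_near_0_def by (intro exI[of _ "min \<delta> R"]) simp
qed

lemma increasing_near_0_times:
  assumes "increasing_near_0 F" "increasing_near_0 H"
  shows "increasing_near_0 (\<lambda>r. F r * H r)"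
proof -
  obtain a b where ab: "a > 0" "b > 0" and m: "mono_on {0<..<a} F" "mono_on {0<..<b} H"
    using assms unfolding increasing_near_0_def by blast
  have "mono_on {0<..<min a b} (\<lambda>r. F r * H r)"
    by (intro mono_onI mult_mono mono_onD[OF m(1)] mono_onD[OF m(2)]) auto
  then show ?thesis using ab unfolding increasing_near_0_def by (intro exI[of _ "min a b"]) simp
qed

theorem theorem4p1:
  fixes gop :: "real^'n \<Rightarrow> real^'n \<Rightarrow> real^'n" and deg :: "'n \<Rightarrow> nat"
    and \<rho> :: "real^'n \<Rightarrow> real" and \<Gamma> :: "real^'n \<Rightarrow> real^'n \<Rightarrow> real" and c\<^sub>Q :: real
    and \<Omega> :: "(real^'n) set" and u :: "real^'n \<Rightarrow> real"
  assumes "carnot_group gop deg"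
    and "hom_dim deg \<ge> 3"
    and "fundamental_solution gop deg \<Gamma>"
    and "homogeneous_norm deg \<rho>"
    and "c\<^sub>Q > 0"
    and "\<And>x y. x \<noteq> y \<Longrightarrow> \<Gamma> x y = c\<^sub>Q * \<rho> (gop (ginv gop x) y) powr (2 - real (hom_dim deg))"
    and "open \<Omega>"
    and "continuous_on \<Omega> u"
    and "\<exists>g. is_weak_hgrad gop deg \<Omega> u g"
    and "locally_L1 \<Omega> (\<lambda>x. (norm (weak_hgrad gop deg \<Omega> u x))\<^sup>2)"
  shows
    "(\<forall>x\<^sub>0 \<in> frontier {x \<in> \<Omega>. u x > 0} \<inter> \<Omega>.
        (\<forall>r>0. closure (gauge_ball gop \<rho> x\<^sub>0 r) \<subseteq> \<Omega> \<longrightarrow>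
           acf_functional gop deg \<rho> \<Gamma> \<Omega> u x\<^sub>0 r =
             (ennreal (1 / (real (hom_dim deg) - 2)) *
               (\<integral>\<^sup>+t\<in>{0..1}. (ennreal t *
                  gradient_mean gop deg \<rho> \<Gamma> \<Omega> (\<lambda>x. max (u x) 0) x\<^sub>0 (t * r)) \<partial>lebesgue)) *
             (ennreal (1 / (real (hom_dim deg) - 2)) *
               (\<integral>\<^sup>+t\<in>{0..1}. (ennreal t *
                  gradient_mean gop deg \<rho> \<Gamma> \<Omega> (\<lambda>x. max (- u x) 0) x\<^sub>0 (t * r)) \<partial>lebesgue))) \<and>
        (ae_increasing_near_0 (gradient_mean gop deg \<rho> \<Gamma> \<Omega> (\<lambda>x. max (u x) 0) x\<^sub>0) \<and>
         ae_increasing_near_0 (gradient_mean gop deg \<rho> \<Gamma> \<Omega> (\<lambda>x. max (- u x) 0) x\<^sub>0) \<longrightarrow>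
         increasing_near_0 (acf_functional gop deg \<rho> \<Gamma> \<Omega> u x\<^sub>0))) \<and>
     (\<forall>x\<^sub>0 \<in> \<Omega>.
        (\<forall>r>0. closure (gauge_ball gop \<rho> x\<^sub>0 r) \<subseteq> \<Omega> \<longrightarrow>
           ennreal (1 / r\<^sup>2) * energy gop deg \<rho> \<Gamma> \<Omega> u x\<^sub>0 r =
             ennreal (1 / (real (hom_dim deg) - 2)) *
               (\<integral>\<^sup>+t\<in>{0..1}. (ennreal t *
                  gradient_mean gop deg \<rho> \<Gamma> \<Omega> u x\<^sub>0 (t * r)) \<partial>lebesgue)) \<and>
        (ae_increasing_near_0 (gradient_mean gop deg \<rho> \<Gamma> \<Omega> u x\<^sub>0) \<longrightarrow>
         increasing_near_0 (\<lambda>r. ennreal (1 / r\<^sup>2) * energy gop deg \<rho> \<Gamma> \<Omega> u x\<^sub>0 r)))"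
proof -
  interpret carnot_group gop deg by fact
  interpret gauged_group gop deg \<rho> \<Gamma> c\<^sub>Q
    by unfold_locales (fact assms(4), fact assms(2), fact assms(5), rule assms(6))
  have L1: "locally_L1 \<Omega> (weak_hgrad gop deg \<Omega> w)" if "\<exists>g. is_weak_hgrad gop deg \<Omega> w g" for w
    using weak_hgrad[OF that] by (simp add: is_weak_hgrad_def)
  let ?up = "\<lambda>x. max (u x) 0" and ?um = "\<lambda>x. max (- u x) 0"
  obtain g where g: "is_weak_hgrad gop deg \<Omega> u g" using assms(9) by blast
  have ex: "\<exists>g. is_weak_hgrad gop deg \<Omega> ?up g" "\<exists>g. is_weak_hgrad gop deg \<Omega> ?um g"
    using is_weak_hgrad_positive_part[OF assms(7,8) g]
      is_weak_hgrad_positive_part[OF assms(7) continuous_on_minus[OF assms(8)] is_weak_hgrad_uminus[OF g]] by blast+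
  note identity = energy_mean_identity[OF L1]
  note id_u = identity[OF assms(9)] and id_p = identity[OF ex(1)] and id_m = identity[OF ex(2)]
  \<comment> \<open>distribute \<open>1 / r\<^sup>4\<close> over the two energies\<close>
  have split: "acf_functional gop deg \<rho> \<Gamma> \<Omega> u x0 r =
      (ennreal (1 / r\<^sup>2) * energy gop deg \<rho> \<Gamma> \<Omega> ?up x0 r) * (ennreal (1 / r\<^sup>2) * energy gop deg \<rho> \<Gamma> \<Omega> ?um x0 r)" for x0 r
  proof -
    have "ennreal (1 / r ^ 4) = ennreal (1 / r\<^sup>2) * ennreal (1 / r\<^sup>2)"
      by (simp add: ennreal_mult[symmetric] power4_eq_xxxx power2_eq_square mult.assoc)
    then show ?thesis by (simp add: acf_functional_def mult_ac)
  qed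
  have incr: "increasing_near_0 (\<lambda>r. ennreal (1 / r\<^sup>2) * energy gop deg \<rho> \<Gamma> \<Omega> w x0 r)"
    if x0: "x0 \<in> \<Omega>" and w: "\<exists>g. is_weak_hgrad gop deg \<Omega> w g"
      and M: "ae_increasing_near_0 (gradient_mean gop deg \<rho> \<Gamma> \<Omega> w x0)" for x0 w
  proof -
    obtain R where R: "R > 0" "\<And>r. r < R \<Longrightarrow> closure (gauge_ball gop \<rho> x0 r) \<subseteq> \<Omega>"
      by (rule gauge_ball_shrinks[OF assms(7) x0]) blast
    show ?thesis
      by (rule increasing_near_0_average[OF M R(1)]) (rule identity[OF w _ R(2)])
  qed
  show ?thesis
  proof (intro conjI ballI allI impI)
    fix x0 r assume "(0::real) < r" "closure (gauge_ball gop \<rho> x0 r) \<subseteq> \<Omega>"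
    then show "acf_functional gop deg \<rho> \<Gamma> \<Omega> u x0 r =
             (ennreal (1 / (real (hom_dim deg) - 2)) *
               (\<integral>\<^sup>+t\<in>{0..1}. (ennreal t * gradient_mean gop deg \<rho> \<Gamma> \<Omega> ?up x0 (t * r)) \<partial>lebesgue)) *
             (ennreal (1 / (real (hom_dim deg) - 2)) *
               (\<integral>\<^sup>+t\<in>{0..1}. (ennreal t * gradient_mean gop deg \<rho> \<Gamma> \<Omega> ?um x0 (t * r)) \<partial>lebesgue))"
      unfolding split by (intro arg_cong2[of _ _ _ _ "(*)"] id_p id_m)
  next
    fix x0 assume x0: "x0 \<in> frontier {x \<in> \<Omega>. u x > 0} \<inter> \<Omega>"
      and M: "ae_increasing_near_0 (gradient_mean gop deg \<rho> \<Gamma> \<Omega> ?up x0) \<and>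
         ae_increasing_near_0 (gradient_mean gop deg \<rho> \<Gamma> \<Omega> ?um x0)"
    show "increasing_near_0 (acf_functional gop deg \<rho> \<Gamma> \<Omega> u x0)"
      unfolding split[abs_def] using x0 M by (intro increasing_near_0_times incr ex) auto
  next
    fix x0 r assume "(0::real) < r" "closure (gauge_ball gop \<rho> x0 r) \<subseteq> \<Omega>"
    then show "ennreal (1 / r\<^sup>2) * energy gop deg \<rho> \<Gamma> \<Omega> u x0 r =
             ennreal (1 / (real (hom_dim deg) - 2)) *
               (\<integral>\<^sup>+t\<in>{0..1}. (ennreal t * gradient_mean gop deg \<rho> \<Gamma> \<Omega> u x0 (t * r)) \<partial>lebesgue)"
      by (rule id_u)
  next
    fix x0 assume "x0 \<in> \<Omega>" "ae_increasing_near_0 (gradient_mean gop deg \<rho> \<Gamma> \<Omega> u x0)"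
    then show "increasing_near_0 (\<lambda>r. ennreal (1 / r\<^sup>2) * energy gop deg \<rho> \<Gamma> \<Omega> u x0 r)"
      using assms(9) by (intro incr) auto
  qed
qed

end
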